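(* Let $\mathcal C$ be a strict monoidal category such that $\underline 1$ is a left $\otimes$-generator for $\mathcal C$. For a cowreath $(A,X,\psi)$ in $\mathcal C$, the following statements are equivalent: (i) the forgetful functor $F:\mathcal C(\psi)_A^X\to\mathcal C_A$ is separable; (ii) $(X,\psi)$ is a coseparable coalgebra in $\mathcal T_A^\#$. If $\mathcal C$ has coequalizers and $A$ and $X$ are left coflat in $\mathcal C$, these statements are also equivalent to (iii) $AX$ is a coseparable $A$-coring in $\mathcal C$, that is, a coseparable coalgebra in the monoidal category ${}_A^{\,!}\mathcal C_A$; (iv) the forgetful functor $U:\mathcal C^{AX}\to\mathcal C_A$ is separable.
   Context: Conventions: $\mathcal C$ is a strict monoidal category with unit object $\underline 1$; the tensor product is written by juxtaposition, and the identity morphism of $X$ is written $X$ (so $fA=f\otimes \mathrm{Id}_A$). $(A,m,\eta)$ is an algebra in $\mathcal C$; $\mathcal C_A$ is the category of right $A$-modules. Right (left) actions are denoted $\mu$ ($\nu$). Separable functor: $F:\mathcal D\to\mathcal E$ is separable if the natural transformation $\mathcal D(-,-)\to\mathcal E(F-,F-)$ given by $F$ has a natural left inverse. If $F$ has a right adjoint $G$, this holds iff the unit $\mathrm{Id}\to GF$ has a natural left inverse $GF\to\mathrm{Id}$. Left $\otimes$-generator: $P\in\mathcal C$ is a left $\otimes$-generator if for all $f,g:YZ\to W$: $f\circ hZ=g\circ hZ$ for all $h:P\to Y$ implies $f=g$. $\mathcal T_A^\#$: objects $(X,\psi)$, $\psi:XA\to AX$ with $\psi\circ Xm=mX\circ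 A\psi\circ\psi A$, $\psi\circ X\eta=\eta X$. Morphisms $(X,\psi_X)\to(Y,\psi_Y)$: $f:X\to AY$ in $\mathcal C$ with $mY\circ Af\circ\psi_X=mY\circ A\psi_Y\circ fA$; composition $g\bullet f=mZ\circ Ag\circ f$, identity $\eta X$; tensor product of objects $(XY,\psi_XY\circ X\psi_Y)$, of morphisms $f:X\to AX'$, $g:Y\to AY'$: $mX'Y'\circ A\psi_{X'}Y'\circ fg$; unit $(\underline 1,A)$. Cowreath: $(A,X,\psi)$ with $(X,\psi)$ a coalgebra in $\mathcal T_A^\#$; explicitly there are $\delta:X\to AXX$, $\epsilon:X\to A$ with $mXX\circ A\psi X\circ AX\psi\circ\delta A=mXX\circ A\delta\circ\psi$; $mXXX\circ A\delta X\circ\delta=mXXX\circ A\psi XX\circ AX\delta\circ\delta$; $m\circ A\epsilon\circ\psi=m\circ\epsilon A$; $mX\circ A\epsilon X\circ\delta=\eta X=mX\circ A\psi\circ AX\epsilon\circ\delta$. Entwined modules: objects of $\mathcal C(\psi)_A^X$ are $(M,\mu,\rho)$ with $(M,\mu)\in\mathcal C_A$, $\rho:M\to MX$, $\rho\circ\mu=\mu X\circ M\psi\circ\rho A$, $\rho X\circ\rho=\mu XX\circ M\delta\circ\rho$, $\mu\circ M\epsilon\circ\rho=M$; morphisms are right $A$-linear $f$ with $fX\circ\rho=\rho\circ f$. Coseparable coalgebra: a coalgebra $(C,\Delta,\varepsilon)$ in a monoidal category $\mathcal M$ is coseparable if it is a relative injective $C$-bicomodule: whenever $i:M\to N$ in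 ${}^C\mathcal M^C$ has a left inverse in $\mathcal M$, every $f:M\to C$ in ${}^C\mathcal M^C$ is of the form $g\circ i$ with $g:N\to C$ in ${}^C\mathcal M^C$. (Equivalently, $\Delta$ has a $C$-bicolinear left inverse.) Bimodules: $X$ is left coflat if $-\otimes X$ preserves coequalizers. For $X\in\mathcal C_A$, $Y\in{}_A\mathcal C$, $q:XY\to X\otimes_AY$ is the coequalizer of $\mu Y,X\nu:XAY\to XY$. $Y\in{}_A\mathcal C$ is robust if $Mq$ is the coequalizer of $M\mu Y,MX\nu:MXAY\to MXY$ for all $M\in\mathcal C$, $X\in\mathcal C_A$. For $A$ left coflat, ${}_A^{\,!}\mathcal C_A$ is the full subcategory of ${}_A\mathcal C_A$ of bimodules that are left coflat in $\mathcal C$ and robust as left $A$-modules; it is monoidal with tensor product $\otimes_A$ and unit $A$, and acts on the right on $\mathcal C_A$ via $\otimes_A$. An $A$-coring is a coalgebra in ${}_A^{\,!}\mathcal C_A$; for an $A$-coring $\mathfrak C$, $\mathcal C^{\mathfrak C}$ is the category of right $\mathfrak C$-comodules in $\mathcal C_A$. The coring $AX$: left action $mX$, right action $\mu_{AX}=mX\circ A\psi$; $AX\otimes_AAX$ is identified with $AXX$ via the coequalizer map $\mu_{AX}X:AXAX\to AXX$; comultiplication $mXX\circ A\delta:AX\to AXX$, counit $m\circ A\epsilon:AX\to A$. *)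

theory Defs
  imports Main
begin

text \<open>Every arrow has a unique domain and codomain. Categories whose
  morphisms are morphisms of another category (modules, comodules, ...) therefore have
  triples (source, underlying morphism, target) as arrows.\<close>

record ('o, 'a) category =
  Obj :: "'o set"
  Arr :: "'a set"
  Dom :: "'a \<Rightarrow> 'o"
  Cod :: "'a \<Rightarrow> 'o"
  Ident :: "'o \<Rightarrow> 'a"
  Comp :: "'a \<Rightarrow> 'a \<Rightarrow> 'a"  (infixl "\<cdot>\<index>" 60)

definition hom :: "('o, 'a, 'z) category_scheme \<Rightarrow> 'o \<Rightarrow> 'o \<Rightarrow> 'a set" where
  "hom C X Y = {f \<in> Arr C. Dom C f = X \<and> Cod C f = Y}"

definition is_category :: "('o, 'a, 'z) category_scheme \<Rightarrow> bool" where
  "is_category C \<longleftrightarrow>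
     (\<forall>f \<in> Arr C. Dom C f \<in> Obj C \<and> Cod C f \<in> Obj C) \<and>
     (\<forall>X \<in> Obj C. Ident C X \<in> hom C X X) \<and>
     (\<forall>f \<in> Arr C. \<forall>g \<in> Arr C. Cod C f = Dom C g \<longrightarrow> g \<cdot>\<^bsub>C\<^esub> f \<in> hom C (Dom C f) (Cod C g)) \<and>
     (\<forall>f \<in> Arr C. f \<cdot>\<^bsub>C\<^esub> Ident C (Dom C f) = f \<and> Ident C (Cod C f) \<cdot>\<^bsub>C\<^esub> f = f) \<and>
     (\<forall>f \<in> Arr C. \<forall>g \<in> Arr C. \<forall>h \<in> Arr C. Cod C f = Dom C g \<longrightarrow> Cod C g = Dom C h \<longrightarrow>
        h \<cdot>\<^bsub>C\<^esub> g \<cdot>\<^bsub>C\<^esub> f = h \<cdot>\<^bsub>C\<^esub> (g \<cdot>\<^bsub>C\<^esub> f))"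

definition is_functor ::
  "('o, 'a, 'z) category_scheme \<Rightarrow> ('p, 'b, 'w) category_scheme \<Rightarrow> ('o \<Rightarrow> 'p) \<Rightarrow> ('a \<Rightarrow> 'b) \<Rightarrow> bool" where
  "is_functor D E Fo Fa \<longleftrightarrow>
     (\<forall>X \<in> Obj D. Fo X \<in> Obj E \<and> Fa (Ident D X) = Ident E (Fo X)) \<and>
     (\<forall>f \<in> Arr D. Fa f \<in> hom E (Fo (Dom D f)) (Fo (Cod D f))) \<and>
     (\<forall>f \<in> Arr D. \<forall>g \<in> Arr D. Cod D f = Dom D g \<longrightarrow> Fa (g \<cdot>\<^bsub>D\<^esub> f) = Fa g \<cdot>\<^bsub>E\<^esub> Fa f)"

definition separable_functor ::
  "('o, 'a, 'z) category_scheme \<Rightarrow> ('p, 'b, 'w) category_scheme \<Rightarrow> ('o \<Rightarrow> 'p) \<Rightarrow> ('a \<Rightarrow> 'b) \<Rightarrow> bool" where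
  "separable_functor D E Fo Fa \<longleftrightarrow> is_functor D E Fo Fa \<and>
     (\<exists>\<phi>. (\<forall>X \<in> Obj D. \<forall>Y \<in> Obj D. \<forall>g \<in> hom E (Fo X) (Fo Y). \<phi> X Y g \<in> hom D X Y) \<and>
          (\<forall>X \<in> Obj D. \<forall>Y \<in> Obj D. \<forall>f \<in> hom D X Y. \<phi> X Y (Fa f) = f) \<and>
          (\<forall>X \<in> Obj D. \<forall>X' \<in> Obj D. \<forall>Y \<in> Obj D. \<forall>Y' \<in> Obj D.
             \<forall>u \<in> hom D X' X. \<forall>v \<in> hom D Y Y'. \<forall>g \<in> hom E (Fo X) (Fo Y).
               \<phi> X' Y' (Fa v \<cdot>\<^bsub>E\<^esub> g \<cdot>\<^bsub>E\<^esub> Fa u) = v \<cdot>\<^bsub>D\<^esub> \<phi> X Y g \<cdot>\<^bsub>D\<^esub> u))"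

definition is_coequalizer :: "('o, 'a, 'z) category_scheme \<Rightarrow> 'a \<Rightarrow> 'a \<Rightarrow> 'a \<Rightarrow> bool" where
  "is_coequalizer C f g q \<longleftrightarrow>
     f \<in> Arr C \<and> g \<in> hom C (Dom C f) (Cod C f) \<and> q \<in> Arr C \<and> Dom C q = Cod C f \<and>
     q \<cdot>\<^bsub>C\<^esub> f = q \<cdot>\<^bsub>C\<^esub> g \<and>
     (\<forall>k \<in> Arr C. Dom C k = Cod C f \<longrightarrow> k \<cdot>\<^bsub>C\<^esub> f = k \<cdot>\<^bsub>C\<^esub> g \<longrightarrow>
        (\<exists>!h. h \<in> hom C (Cod C q) (Cod C k) \<and> h \<cdot>\<^bsub>C\<^esub> q = k))"

definition has_coequalizers :: "('o, 'a, 'z) category_scheme \<Rightarrow> bool" where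
  "has_coequalizers C \<longleftrightarrow>
     (\<forall>f \<in> Arr C. \<forall>g \<in> hom C (Dom C f) (Cod C f). \<exists>q. is_coequalizer C f g q)"

definition coeq :: "('o, 'a, 'z) category_scheme \<Rightarrow> 'a \<Rightarrow> 'a \<Rightarrow> 'a" where
  "coeq C f g = (SOME q. is_coequalizer C f g q)"

text \<open>The arrow h with h q = k; meaningful only when q is an epimorphism through which k factors.\<close>

definition factor :: "('o, 'a, 'z) category_scheme \<Rightarrow> 'a \<Rightarrow> 'a \<Rightarrow> 'a" where
  "factor C q k = (THE h. h \<in> hom C (Cod C q) (Cod C k) \<and> h \<cdot>\<^bsub>C\<^esub> q = k)"

text \<open>In assoc, lunit and runit: (XY)Z to X(YZ), 1X to X and X1 to X.\<close>

record ('o, 'a) moncat = "('o, 'a) category" +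
  tensO :: "'o \<Rightarrow> 'o \<Rightarrow> 'o"  (infixl "\<otimes>\<index>" 75)
  tensA :: "'a \<Rightarrow> 'a \<Rightarrow> 'a"  (infixl "\<boxtimes>\<index>" 75)
  tunit :: "'o"
  assoc :: "'o \<Rightarrow> 'o \<Rightarrow> 'o \<Rightarrow> 'a"
  lunit :: "'o \<Rightarrow> 'a"
  runit :: "'o \<Rightarrow> 'a"

definition whiskL :: "('o, 'a) moncat \<Rightarrow> 'o \<Rightarrow> 'a \<Rightarrow> 'a"  (infixr "\<lhd>\<index>" 70) where
  "X \<lhd>\<^bsub>C\<^esub> f = Ident C X \<boxtimes>\<^bsub>C\<^esub> f"

definition whiskR :: "('o, 'a) moncat \<Rightarrow> 'a \<Rightarrow> 'o \<Rightarrow> 'a"  (infixl "\<rhd>\<index>" 72) where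
  "f \<rhd>\<^bsub>C\<^esub> X = f \<boxtimes>\<^bsub>C\<^esub> Ident C X"

definition strict_monoidal :: "('o, 'a) moncat \<Rightarrow> bool" where
  "strict_monoidal C \<longleftrightarrow> is_category C \<and>
     tunit C \<in> Obj C \<and>
     (\<forall>X \<in> Obj C. \<forall>Y \<in> Obj C. X \<otimes>\<^bsub>C\<^esub> Y \<in> Obj C \<and>
        Ident C X \<boxtimes>\<^bsub>C\<^esub> Ident C Y = Ident C (X \<otimes>\<^bsub>C\<^esub> Y)) \<and>
     (\<forall>f \<in> Arr C. \<forall>g \<in> Arr C.
        f \<boxtimes>\<^bsub>C\<^esub> g \<in> hom C (Dom C f \<otimes>\<^bsub>C\<^esub> Dom C g) (Cod C f \<otimes>\<^bsub>C\<^esub> Cod C g)) \<and>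
     (\<forall>f \<in> Arr C. \<forall>f' \<in> Arr C. \<forall>g \<in> Arr C. \<forall>g' \<in> Arr C.
        Cod C f = Dom C f' \<longrightarrow> Cod C g = Dom C g' \<longrightarrow>
        (f' \<cdot>\<^bsub>C\<^esub> f) \<boxtimes>\<^bsub>C\<^esub> (g' \<cdot>\<^bsub>C\<^esub> g) = (f' \<boxtimes>\<^bsub>C\<^esub> g') \<cdot>\<^bsub>C\<^esub> (f \<boxtimes>\<^bsub>C\<^esub> g)) \<and>
     (\<forall>X \<in> Obj C. \<forall>Y \<in> Obj C. \<forall>Z \<in> Obj C. X \<otimes>\<^bsub>C\<^esub> Y \<otimes>\<^bsub>C\<^esub> Z = X \<otimes>\<^bsub>C\<^esub> (Y \<otimes>\<^bsub>C\<^esub> Z) \<and>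
        assoc C X Y Z = Ident C (X \<otimes>\<^bsub>C\<^esub> Y \<otimes>\<^bsub>C\<^esub> Z)) \<and>
     (\<forall>X \<in> Obj C. tunit C \<otimes>\<^bsub>C\<^esub> X = X \<and> X \<otimes>\<^bsub>C\<^esub> tunit C = X \<and>
        lunit C X = Ident C X \<and> runit C X = Ident C X) \<and>
     (\<forall>f \<in> Arr C. \<forall>g \<in> Arr C. \<forall>h \<in> Arr C.
        f \<boxtimes>\<^bsub>C\<^esub> g \<boxtimes>\<^bsub>C\<^esub> h = f \<boxtimes>\<^bsub>C\<^esub> (g \<boxtimes>\<^bsub>C\<^esub> h)) \<and>
     (\<forall>f \<in> Arr C. Ident C (tunit C) \<boxtimes>\<^bsub>C\<^esub> f = f \<and> f \<boxtimes>\<^bsub>C\<^esub> Ident C (tunit C) = f)"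

context
  fixes C :: "('o, 'a) moncat" (structure)
begin

definition left_tensor_generator :: "'o \<Rightarrow> bool" where
  "left_tensor_generator P \<longleftrightarrow> P \<in> Obj C \<and>
     (\<forall>Y \<in> Obj C. \<forall>Z \<in> Obj C. \<forall>W \<in> Obj C. \<forall>f \<in> hom C (Y \<otimes> Z) W. \<forall>g \<in> hom C (Y \<otimes> Z) W.
        (\<forall>h \<in> hom C P Y. f \<cdot> (h \<rhd> Z) = g \<cdot> (h \<rhd> Z)) \<longrightarrow> f = g)"

definition left_coflat :: "'o \<Rightarrow> bool" where
  "left_coflat X \<longleftrightarrow> X \<in> Obj C \<and>
     (\<forall>f g q. is_coequalizer C f g q \<longrightarrow> is_coequalizer C (f \<rhd> X) (g \<rhd> X) (q \<rhd> X))"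

end

context
  fixes V :: "('o, 'a) moncat" (structure)
begin

definition coalgebra :: "'o \<Rightarrow> 'a \<Rightarrow> 'a \<Rightarrow> bool" where
  "coalgebra K \<Delta> e \<longleftrightarrow> K \<in> Obj V \<and> \<Delta> \<in> hom V K (K \<otimes> K) \<and> e \<in> hom V K (tunit V) \<and>
     assoc V K K K \<cdot> (\<Delta> \<rhd> K) \<cdot> \<Delta> = (K \<lhd> \<Delta>) \<cdot> \<Delta> \<and>
     lunit V K \<cdot> (e \<rhd> K) \<cdot> \<Delta> = Ident V K \<and>
     runit V K \<cdot> (K \<lhd> e) \<cdot> \<Delta> = Ident V K"

definition bicomodule :: "'o \<Rightarrow> 'a \<Rightarrow> 'a \<Rightarrow> 'o \<Rightarrow> 'a \<Rightarrow> 'a \<Rightarrow> bool" where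
  "bicomodule K \<Delta> e N l r \<longleftrightarrow> N \<in> Obj V \<and> l \<in> hom V N (K \<otimes> N) \<and> r \<in> hom V N (N \<otimes> K) \<and>
     assoc V K K N \<cdot> (\<Delta> \<rhd> N) \<cdot> l = (K \<lhd> l) \<cdot> l \<and>
     lunit V N \<cdot> (e \<rhd> N) \<cdot> l = Ident V N \<and>
     assoc V N K K \<cdot> (r \<rhd> K) \<cdot> r = (N \<lhd> \<Delta>) \<cdot> r \<and>
     runit V N \<cdot> (N \<lhd> e) \<cdot> r = Ident V N \<and>
     assoc V K N K \<cdot> (l \<rhd> K) \<cdot> r = (K \<lhd> r) \<cdot> l"

definition bicolinear :: "'o \<Rightarrow> 'o \<Rightarrow> 'a \<Rightarrow> 'a \<Rightarrow> 'o \<Rightarrow> 'a \<Rightarrow> 'a \<Rightarrow> 'a \<Rightarrow> bool" where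
  "bicolinear K M lM rM N lN rN f \<longleftrightarrow> f \<in> hom V M N \<and>
     lN \<cdot> f = (K \<lhd> f) \<cdot> lM \<and> rN \<cdot> f = (f \<rhd> K) \<cdot> rM"

definition coseparable_coalgebra :: "'o \<Rightarrow> 'a \<Rightarrow> 'a \<Rightarrow> bool" where
  "coseparable_coalgebra K \<Delta> e \<longleftrightarrow> coalgebra K \<Delta> e \<and>
     (\<forall>M lM rM N lN rN i f.
        bicomodule K \<Delta> e M lM rM \<longrightarrow> bicomodule K \<Delta> e N lN rN \<longrightarrow>
        bicolinear K M lM rM N lN rN i \<longrightarrow>
        (\<exists>p \<in> hom V N M. p \<cdot> i = Ident V M) \<longrightarrow>
        bicolinear K M lM rM K \<Delta> \<Delta> f \<longrightarrow>
        (\<exists>g. bicolinear K N lN rN K \<Delta> \<Delta> g \<and> f = g \<cdot> i))"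

end

context
  fixes C :: "('o, 'a) moncat" (structure)
begin

definition algebra :: "'o \<Rightarrow> 'a \<Rightarrow> 'a \<Rightarrow> bool" where
  "algebra A m \<eta> \<longleftrightarrow> A \<in> Obj C \<and> m \<in> hom C (A \<otimes> A) A \<and> \<eta> \<in> hom C (tunit C) A \<and>
     m \<cdot> (m \<rhd> A) = m \<cdot> (A \<lhd> m) \<and>
     m \<cdot> (\<eta> \<rhd> A) = Ident C A \<and> m \<cdot> (A \<lhd> \<eta>) = Ident C A"

end

context
  fixes C :: "('o, 'a) moncat" (structure)
    and A :: 'o and m \<eta> :: 'a
begin

definition right_module :: "'o \<Rightarrow> 'a \<Rightarrow> bool" where
  "right_module M \<mu> \<longleftrightarrow> M \<in> Obj C \<and> \<mu> \<in> hom C (M \<otimes> A) M \<and>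
     \<mu> \<cdot> (\<mu> \<rhd> A) = \<mu> \<cdot> (M \<lhd> m) \<and> \<mu> \<cdot> (M \<lhd> \<eta>) = Ident C M"

definition left_module :: "'o \<Rightarrow> 'a \<Rightarrow> bool" where
  "left_module M \<nu> \<longleftrightarrow> M \<in> Obj C \<and> \<nu> \<in> hom C (A \<otimes> M) M \<and>
     \<nu> \<cdot> (A \<lhd> \<nu>) = \<nu> \<cdot> (m \<rhd> M) \<and> \<nu> \<cdot> (\<eta> \<rhd> M) = Ident C M"

definition right_linear :: "'o \<Rightarrow> 'a \<Rightarrow> 'o \<Rightarrow> 'a \<Rightarrow> 'a \<Rightarrow> bool" where
  "right_linear M \<mu> N \<mu>' f \<longleftrightarrow> f \<in> hom C M N \<and> f \<cdot> \<mu> = \<mu>' \<cdot> (f \<rhd> A)"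

definition left_linear :: "'o \<Rightarrow> 'a \<Rightarrow> 'o \<Rightarrow> 'a \<Rightarrow> 'a \<Rightarrow> bool" where
  "left_linear M \<nu> N \<nu>' f \<longleftrightarrow> f \<in> hom C M N \<and> f \<cdot> \<nu> = \<nu>' \<cdot> (A \<lhd> f)"

definition right_modules :: "('o \<times> 'a, ('o \<times> 'a) \<times> 'a \<times> ('o \<times> 'a)) category" where
  "right_modules = \<lparr>
     Obj = {(M, \<mu>). right_module M \<mu>},
     Arr = {((M, \<mu>), f, (N, \<mu>')). right_module M \<mu> \<and> right_module N \<mu>' \<and> right_linear M \<mu> N \<mu>' f},
     Dom = (\<lambda>(M, f, N). M),
     Cod = (\<lambda>(M, f, N). N),
     Ident = (\<lambda>M. (M, Ident C (fst M), M)),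
     Comp = (\<lambda>(_, g, P) (M, f, _). (M, g \<cdot> f, P)) \<rparr>"

text \<open>An arrow from (X, psi) to (Y, psi') is a morphism from X to AY. The resulting monoidal
  category is strict, so its associator and unitors are identities; the identity of (X, psi)
  is eta X.\<close>

definition transfer :: "'o \<Rightarrow> 'a \<Rightarrow> bool" where
  "transfer X \<psi> \<longleftrightarrow> X \<in> Obj C \<and> \<psi> \<in> hom C (X \<otimes> A) (A \<otimes> X) \<and>
     \<psi> \<cdot> (X \<lhd> m) = (m \<rhd> X) \<cdot> (A \<lhd> \<psi>) \<cdot> (\<psi> \<rhd> A) \<and>
     \<psi> \<cdot> (X \<lhd> \<eta>) = \<eta> \<rhd> X"

definition transfer_tensor :: "'o \<times> 'a \<Rightarrow> 'o \<times> 'a \<Rightarrow> 'o \<times> 'a" where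
  "transfer_tensor = (\<lambda>(X, \<psi>) (Y, \<psi>'). (X \<otimes> Y, (\<psi> \<rhd> Y) \<cdot> (X \<lhd> \<psi>')))"

definition Tsharp :: "('o \<times> 'a, ('o \<times> 'a) \<times> 'a \<times> ('o \<times> 'a)) moncat" where
  "Tsharp = (let one = (\<lambda>(X, \<psi>). ((X, \<psi>), \<eta> \<rhd> X, (X, \<psi>))) in \<lparr>
     Obj = {(X, \<psi>). transfer X \<psi>},
     Arr = {((X, \<psi>), f, (Y, \<psi>')). transfer X \<psi> \<and> transfer Y \<psi>' \<and> f \<in> hom C X (A \<otimes> Y) \<and>
              (m \<rhd> Y) \<cdot> (A \<lhd> f) \<cdot> \<psi> = (m \<rhd> Y) \<cdot> (A \<lhd> \<psi>') \<cdot> (f \<rhd> A)},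
     Dom = (\<lambda>(X, f, Y). X),
     Cod = (\<lambda>(X, f, Y). Y),
     Ident = one,
     Comp = (\<lambda>(_, g, Z) (X, f, _). (X, (m \<rhd> fst Z) \<cdot> (A \<lhd> g) \<cdot> f, Z)),
     tensO = transfer_tensor,
     tensA = (\<lambda>(X, f, (X', \<psi>')) (Y, g, (Y', \<phi>')).
        (transfer_tensor X Y,
         (m \<rhd> X' \<otimes> Y') \<cdot> (A \<lhd> \<psi>' \<rhd> Y') \<cdot> (f \<boxtimes> g),
         transfer_tensor (X', \<psi>') (Y', \<phi>'))),
     tunit = (tunit C, Ident C A),
     assoc = (\<lambda>X Y Z. one (transfer_tensor (transfer_tensor X Y) Z)),
     lunit = one,
     runit = one \<rparr>)"

definition cowreath_comult :: "'o \<Rightarrow> 'a \<Rightarrow> 'a \<Rightarrow> ('o \<times> 'a) \<times> 'a \<times> ('o \<times> 'a)" where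
  "cowreath_comult X \<psi> \<delta> = ((X, \<psi>), \<delta>, transfer_tensor (X, \<psi>) (X, \<psi>))"

definition cowreath_counit :: "'o \<Rightarrow> 'a \<Rightarrow> 'a \<Rightarrow> ('o \<times> 'a) \<times> 'a \<times> ('o \<times> 'a)" where
  "cowreath_counit X \<psi> \<epsilon> = ((X, \<psi>), \<epsilon>, (tunit C, Ident C A))"

definition cowreath :: "'o \<Rightarrow> 'a \<Rightarrow> 'a \<Rightarrow> 'a \<Rightarrow> bool" where
  "cowreath X \<psi> \<delta> \<epsilon> \<longleftrightarrow> algebra C A m \<eta> \<and>
     coalgebra Tsharp (X, \<psi>) (cowreath_comult X \<psi> \<delta>) (cowreath_counit X \<psi> \<epsilon>)"

definition entwined_module :: "'o \<Rightarrow> 'a \<Rightarrow> 'a \<Rightarrow> 'a \<Rightarrow> 'o \<Rightarrow> 'a \<Rightarrow> 'a \<Rightarrow> bool" where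
  "entwined_module X \<psi> \<delta> \<epsilon> M \<mu> \<rho> \<longleftrightarrow> right_module M \<mu> \<and> \<rho> \<in> hom C M (M \<otimes> X) \<and>
     \<rho> \<cdot> \<mu> = (\<mu> \<rhd> X) \<cdot> (M \<lhd> \<psi>) \<cdot> (\<rho> \<rhd> A) \<and>
     (\<rho> \<rhd> X) \<cdot> \<rho> = (\<mu> \<rhd> X \<otimes> X) \<cdot> (M \<lhd> \<delta>) \<cdot> \<rho> \<and>
     \<mu> \<cdot> (M \<lhd> \<epsilon>) \<cdot> \<rho> = Ident C M"

definition entwined_modules ::
  "'o \<Rightarrow> 'a \<Rightarrow> 'a \<Rightarrow> 'a \<Rightarrow> ('o \<times> 'a \<times> 'a, ('o \<times> 'a \<times> 'a) \<times> 'a \<times> ('o \<times> 'a \<times> 'a)) category" where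
  "entwined_modules X \<psi> \<delta> \<epsilon> = \<lparr>
     Obj = {(M, \<mu>, \<rho>). entwined_module X \<psi> \<delta> \<epsilon> M \<mu> \<rho>},
     Arr = {((M, \<mu>, \<rho>), f, (N, \<mu>', \<rho>')).
              entwined_module X \<psi> \<delta> \<epsilon> M \<mu> \<rho> \<and> entwined_module X \<psi> \<delta> \<epsilon> N \<mu>' \<rho>' \<and>
              right_linear M \<mu> N \<mu>' f \<and> (f \<rhd> X) \<cdot> \<rho> = \<rho>' \<cdot> f},
     Dom = (\<lambda>(M, f, N). M),
     Cod = (\<lambda>(M, f, N). N),
     Ident = (\<lambda>M. (M, Ident C (fst M), M)),
     Comp = (\<lambda>(_, g, P) (M, f, _). (M, g \<cdot> f, P)) \<rparr>"

end

text \<open>Both forgetful functors to right A-modules drop the coaction.\<close>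

definition forget_obj :: "'o \<times> 'a \<times> 'a \<Rightarrow> 'o \<times> 'a" where
  "forget_obj = (\<lambda>(M, \<mu>, \<rho>). (M, \<mu>))"

definition forget_arr ::
  "('o \<times> 'a \<times> 'a) \<times> 'a \<times> ('o \<times> 'a \<times> 'a) \<Rightarrow> ('o \<times> 'a) \<times> 'a \<times> ('o \<times> 'a)" where
  "forget_arr = (\<lambda>(M, f, N). (forget_obj M, f, forget_obj N))"

context
  fixes C :: "('o, 'a) moncat" (structure)
    and A :: 'o and m \<eta> :: 'a
begin

text \<open>A right module is a pair (M, mu), a left module a pair (N, nu), a bimodule a triple
  (N, nu, mu). The coequalizer M N -> M \<otimes>_A N is fixed by choice; everything derived from it
  is determined by its universal property.\<close>

definition tq :: "'o \<times> 'a \<Rightarrow> 'o \<times> 'a \<Rightarrow> 'a" where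
  "tq = (\<lambda>(M, \<mu>) (N, \<nu>). coeq C (\<mu> \<rhd> N) (M \<lhd> \<nu>))"

definition robust :: "'o \<Rightarrow> 'a \<Rightarrow> bool" where
  "robust Y \<nu> \<longleftrightarrow> left_module C A m \<eta> Y \<nu> \<and>
     (\<forall>M \<in> Obj C. \<forall>X \<mu>. right_module C A m \<eta> X \<mu> \<longrightarrow>
        is_coequalizer C (M \<lhd> \<mu> \<rhd> Y) (M \<lhd> X \<lhd> \<nu>) (M \<lhd> tq (X, \<mu>) (Y, \<nu>)))"

definition bimodule :: "'o \<times> 'a \<times> 'a \<Rightarrow> bool" where
  "bimodule = (\<lambda>(M, \<nu>, \<mu>). left_module C A m \<eta> M \<nu> \<and> right_module C A m \<eta> M \<mu> \<and>
     \<mu> \<cdot> (\<nu> \<rhd> A) = \<nu> \<cdot> (A \<lhd> \<mu>))"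

text \<open>cr: left coflat in C and robust as a left A-module.\<close>

definition cr_bimodule :: "'o \<times> 'a \<times> 'a \<Rightarrow> bool" where
  "cr_bimodule = (\<lambda>(M, \<nu>, \<mu>). bimodule (M, \<nu>, \<mu>) \<and> left_coflat C M \<and> robust M \<nu>)"

abbreviation lpart :: "'o \<times> 'a \<times> 'a \<Rightarrow> 'o \<times> 'a" where
  "lpart N \<equiv> (fst N, fst (snd N))"

abbreviation rpart :: "'o \<times> 'a \<times> 'a \<Rightarrow> 'o \<times> 'a" where
  "rpart N \<equiv> (fst N, snd (snd N))"

text \<open>The right A-module (M, mu) \<otimes>_A N for a bimodule N.\<close>

definition act_obj :: "'o \<times> 'a \<Rightarrow> 'o \<times> 'a \<times> 'a \<Rightarrow> 'o \<times> 'a" where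
  "act_obj M N = (let q = tq M (lpart N) in
     (Cod C q, factor C (q \<rhd> A) (q \<cdot> (fst M \<lhd> snd (snd N)))))"

text \<open>The underlying morphism of f \<otimes>_A g, for f from M to M' and g from N to N'.\<close>

definition act_arr ::
  "'o \<times> 'a \<Rightarrow> 'o \<times> 'a \<Rightarrow> 'o \<times> 'a \<times> 'a \<Rightarrow> 'o \<times> 'a \<times> 'a \<Rightarrow> 'a \<Rightarrow> 'a \<Rightarrow> 'a" where
  "act_arr M M' N N' f g = factor C (tq M (lpart N)) (tq M' (lpart N') \<cdot> (f \<boxtimes> g))"

definition bim_tensor :: "'o \<times> 'a \<times> 'a \<Rightarrow> 'o \<times> 'a \<times> 'a \<Rightarrow> 'o \<times> 'a \<times> 'a" where
  "bim_tensor M N = (let q = tq (rpart M) (lpart N); (T, \<mu>) = act_obj (rpart M) N in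
     (T, factor C (A \<lhd> q) (q \<cdot> (fst (snd M) \<rhd> fst N)), \<mu>))"

text \<open>From (M \<otimes>_A N) \<otimes>_A P to M \<otimes>_A (N \<otimes>_A P), for a right module M and bimodules N, P.\<close>

definition act_assoc :: "'o \<times> 'a \<Rightarrow> 'o \<times> 'a \<times> 'a \<Rightarrow> 'o \<times> 'a \<times> 'a \<Rightarrow> 'a" where
  "act_assoc M N P = factor C
     (tq (act_obj M N) (lpart P) \<cdot> (tq M (lpart N) \<rhd> fst P))
     (tq M (lpart (bim_tensor N P)) \<cdot> (fst M \<lhd> tq (rpart N) (lpart P)))"

definition act_runit :: "'o \<times> 'a \<Rightarrow> 'a" where
  "act_runit M = factor C (tq M (A, m)) (snd M)"

definition cr_bimodules ::
  "('o \<times> 'a \<times> 'a, ('o \<times> 'a \<times> 'a) \<times> 'a \<times> ('o \<times> 'a \<times> 'a)) moncat" where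
  "cr_bimodules = \<lparr>
     Obj = {M. cr_bimodule M},
     Arr = {((M, \<nu>, \<mu>), f, (N, \<nu>', \<mu>')).
              cr_bimodule (M, \<nu>, \<mu>) \<and> cr_bimodule (N, \<nu>', \<mu>') \<and>
              left_linear C A M \<nu> N \<nu>' f \<and> right_linear C A M \<mu> N \<mu>' f},
     Dom = (\<lambda>(M, f, N). M),
     Cod = (\<lambda>(M, f, N). N),
     Ident = (\<lambda>M. (M, Ident C (fst M), M)),
     Comp = (\<lambda>(_, g, P) (M, f, _). (M, g \<cdot> f, P)),
     tensO = bim_tensor,
     tensA = (\<lambda>(M, f, M') (N, g, N').
        (bim_tensor M N, act_arr (rpart M) (rpart M') N N' f g, bim_tensor M' N')),
     tunit = (A, m, m),
     assoc = (\<lambda>M N P. (bim_tensor (bim_tensor M N) P, act_assoc (rpart M) N P,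
                          bim_tensor M (bim_tensor N P))),
     lunit = (\<lambda>M. (bim_tensor (A, m, m) M, factor C (tq (A, m) (lpart M)) (fst (snd M)), M)),
     runit = (\<lambda>M. (bim_tensor M (A, m, m), act_runit (rpart M), M)) \<rparr>"

text \<open>The coring is given by a bimodule K and the underlying morphisms of its comultiplication
  and counit.\<close>

definition comodule :: "'o \<times> 'a \<times> 'a \<Rightarrow> 'a \<Rightarrow> 'a \<Rightarrow> 'o \<Rightarrow> 'a \<Rightarrow> 'a \<Rightarrow> bool" where
  "comodule K \<Delta> e M \<mu> \<rho> \<longleftrightarrow> right_module C A m \<eta> M \<mu> \<and>
     (let MK = act_obj (M, \<mu>) K in
        right_linear C A M \<mu> (fst MK) (snd MK) \<rho> \<and>
        act_assoc (M, \<mu>) K K \<cdot> act_arr (M, \<mu>) MK K K \<rho> (Ident C (fst K)) \<cdot> \<rho>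
          = act_arr (M, \<mu>) (M, \<mu>) K (bim_tensor K K) (Ident C M) \<Delta> \<cdot> \<rho> \<and>
        act_runit (M, \<mu>) \<cdot> act_arr (M, \<mu>) (M, \<mu>) K (A, m, m) (Ident C M) e \<cdot> \<rho> = Ident C M)"

definition comodules ::
  "'o \<times> 'a \<times> 'a \<Rightarrow> 'a \<Rightarrow> 'a \<Rightarrow> ('o \<times> 'a \<times> 'a, ('o \<times> 'a \<times> 'a) \<times> 'a \<times> ('o \<times> 'a \<times> 'a)) category" where
  "comodules K \<Delta> e = \<lparr>
     Obj = {(M, \<mu>, \<rho>). comodule K \<Delta> e M \<mu> \<rho>},
     Arr = {((M, \<mu>, \<rho>), f, (N, \<mu>', \<rho>')).
              comodule K \<Delta> e M \<mu> \<rho> \<and> comodule K \<Delta> e N \<mu>' \<rho>' \<and> right_linear C A M \<mu> N \<mu>' f \<and>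
              act_arr (M, \<mu>) (N, \<mu>') K K f (Ident C (fst K)) \<cdot> \<rho> = \<rho>' \<cdot> f},
     Dom = (\<lambda>(M, f, N). M),
     Cod = (\<lambda>(M, f, N). N),
     Ident = (\<lambda>M. (M, Ident C (fst M), M)),
     Comp = (\<lambda>(_, g, P) (M, f, _). (M, g \<cdot> f, P)) \<rparr>"

definition AX_bim :: "'o \<Rightarrow> 'a \<Rightarrow> 'o \<times> 'a \<times> 'a" where
  "AX_bim X \<psi> = (A \<otimes> X, m \<rhd> X, (m \<rhd> X) \<cdot> (A \<lhd> \<psi>))"

text \<open>The first factor is the identification of AXX with the chosen tensor product of AX with
  itself: both are targets of coequalizers of the same pair, namely of mu_{AX} X and of tq.\<close>

definition AX_comult :: "'o \<Rightarrow> 'a \<Rightarrow> 'a \<Rightarrow> 'a" where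
  "AX_comult X \<psi> \<delta> =
     factor C (snd (snd (AX_bim X \<psi>)) \<rhd> X) (tq (rpart (AX_bim X \<psi>)) (lpart (AX_bim X \<psi>)))
       \<cdot> ((m \<rhd> X \<otimes> X) \<cdot> (A \<lhd> \<delta>))"

definition AX_counit :: "'a \<Rightarrow> 'a" where
  "AX_counit \<epsilon> = m \<cdot> (A \<lhd> \<epsilon>)"

definition coseparable_coring :: "'o \<times> 'a \<times> 'a \<Rightarrow> 'a \<Rightarrow> 'a \<Rightarrow> bool" where
  "coseparable_coring K \<Delta> e \<longleftrightarrow>
     coseparable_coalgebra cr_bimodules K (K, \<Delta>, bim_tensor K K) (K, e, (A, m, m))"

end

end

theory Submission
  imports Defs
begin

text \<open>All four conditions are equivalent to the existence of a normalized Casimir morphism,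
  a morphism \<^term>\<open>B\<close> from XX to A that is a morphism from the square of \<^term>\<open>(X, \<psi>)\<close> to the
  unit of the transfer category, intertwines the two ways of coming down from XX to AX through the
  comultiplication, and satisfies m (A B) \<delta> = \<epsilon>. In any monoidal category such a morphism is
  the same as a bicolinear retraction of the comultiplication.

  A Casimir morphism averages A-linear maps between entwined modules to colinear ones, which
  splits the forgetful functor. Conversely, the values of a splitting on the counits of the adjunction
  with the cofree entwined modules MX are natural retractions z of the coactions. Because the unit object is
  a left tensor generator, naturality against morphisms from the unit object makes z on a free
  module YA equal to Y z, hence z on A left A-linear, and B = m (A \<epsilon>) z (\<eta> XX) is Casimir.

  For the coring, the coequalizer defining M \<otimes> AX over A is split with quotient MX, so comodules over AX
  are entwined modules; the same identification turns a coseparability retraction of AX \<otimes> AX into such a map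
  z from AXX to AX, and a Casimir morphism averages bicomodule maps, once for each of the two coactions.\<close>

section \<open>String diagrams in strict monoidal categories\<close>

named_theorems typing "sources and targets of arrows, used to read off string diagrams"

datatype ('o, 'a) diagram =
    Box "'o list" 'a "'o list"
  | Wires "'o list"
  | Seq "('o, 'a) diagram" "('o, 'a) diagram"
  | Par "('o, 'a) diagram" "('o, 'a) diagram"

text \<open>A layer (n, d, f, c) is a box f from the word d to the word c with n wires to its left. Lists of layers
  are read in the order of application, whereas Seq s t is s after t, like composition.\<close>

type_synonym ('o, 'a) layer = "nat \<times> 'o list \<times> 'a \<times> 'o list"

fun src :: "('o, 'a) diagram \<Rightarrow> 'o list" where
  "src (Box d f c) = d"
| "src (Wires w) = w"
| "src (Seq s t) = src t"
| "src (Par s t) = src s @ src t"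

fun tgt :: "('o, 'a) diagram \<Rightarrow> 'o list" where
  "tgt (Box d f c) = c"
| "tgt (Wires w) = w"
| "tgt (Seq s t) = tgt s"
| "tgt (Par s t) = tgt s @ tgt t"

fun well_typed :: "('o, 'a) diagram \<Rightarrow> bool" where
  "well_typed (Box d f c) = True"
| "well_typed (Wires w) = True"
| "well_typed (Seq s t) = (well_typed s \<and> well_typed t \<and> tgt t = src s)"
| "well_typed (Par s t) = (well_typed s \<and> well_typed t)"

fun layers :: "nat \<Rightarrow> ('o, 'a) diagram \<Rightarrow> ('o, 'a) layer list" where
  "layers n (Box d f c) = [(n, d, f, c)]"
| "layers n (Wires w) = []"
| "layers n (Seq s t) = layers n t @ layers n s"
| "layers n (Par s t) = layers n s @ layers (n + length (tgt s)) t"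

fun word_after :: "'o list \<Rightarrow> ('o, 'a) layer list \<Rightarrow> 'o list" where
  "word_after w [] = w"
| "word_after w ((n, d, f, c) # p) = word_after (take n w @ c @ drop (n + length d) w) p"

fun swap_head :: "('o, 'a) layer list \<Rightarrow> ('o, 'a) layer list" where
  "swap_head ((n, d, f, c) # (n', d', f', c') # p) =
     (if n + length c \<le> n' then (n' - length c + length d, d', f', c') # (n, d, f, c) # p
      else if n' + length d' \<le> n then (n', d', f', c') # (n - length d' + length c', d, f, c) # p
      else (n, d, f, c) # (n', d', f', c') # p)"
| "swap_head p = p"

fun swap_at :: "nat \<Rightarrow> ('o, 'a) layer list \<Rightarrow> ('o, 'a) layer list" where
  "swap_at 0 p = swap_head p"
| "swap_at (Suc k) p = (case p of [] \<Rightarrow> [] | l # p' \<Rightarrow> l # swap_at k p')"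

fun lift :: "nat \<Rightarrow> nat \<Rightarrow> ('o, 'a) layer list \<Rightarrow> ('o, 'a) layer list" where
  "lift i 0 p = p"
| "lift i (Suc j) p = lift (i - 1) j (swap_at (i - 1) p)"

definition replace ::
  "'o list \<Rightarrow> nat \<Rightarrow> nat \<Rightarrow> ('o, 'a) diagram \<Rightarrow> ('o, 'a) diagram \<Rightarrow>
   ('o, 'a) layer list \<Rightarrow> ('o, 'a) layer list" where
  "replace w k n s t p =
     (let w' = word_after w (take k p); l = layers n s in
      if take (length l) (drop k p) = l \<and> n + length (src s) \<le> length w' \<and>
         take (length (src s)) (drop n w') = src s
      then take k p @ layers n t @ drop (k + length l) p else p)"

text \<open>Up i j exchanges layer i with the j layers before it, by the interchange law; Rw e k n rewrites with
  equation e from left to right at layer k and n wires from the left, and Rv e k n from right to left.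
  A step that does not apply leaves the layers unchanged, so any list of steps is sound. The lists in
  the proofs below were found by a search.\<close>

datatype step = Up nat nat | Rw nat nat nat | Rv nat nat nat

fun exec :: "(('o, 'a) diagram \<times> ('o, 'a) diagram) list \<Rightarrow> 'o list \<Rightarrow> step list \<Rightarrow>
    ('o, 'a) layer list \<Rightarrow> ('o, 'a) layer list" where
  "exec es w [] p = p"
| "exec es w (Up i j # c) p = exec es w c (lift i j p)"
| "exec es w (Rw e k n # c) p = exec es w c (replace w k n (fst (es ! e)) (snd (es ! e)) p)"
| "exec es w (Rv e k n # c) p = exec es w c (replace w k n (snd (es ! e)) (fst (es ! e)) p)"

definition parallel :: "('o, 'a) diagram \<Rightarrow> ('o, 'a) diagram \<Rightarrow> bool" where
  "parallel s t \<longleftrightarrow> well_typed s \<and> well_typed t \<and> src s = src t \<and> tgt s = tgt t"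

definition derivable ::
  "(('o, 'a) diagram \<times> ('o, 'a) diagram) list \<Rightarrow> step list \<Rightarrow>
   ('o, 'a) diagram \<Rightarrow> ('o, 'a) diagram \<Rightarrow> bool" where
  "derivable es c s t \<longleftrightarrow> (\<forall>(s, t) \<in> set es. parallel s t) \<and> parallel s t \<and>
     (\<forall>x \<in> set c. case x of Up i j \<Rightarrow> True | Rw e k n \<Rightarrow> e < length es | Rv e k n \<Rightarrow> e < length es) \<and>
     exec es (src s) c (layers 0 s) = layers 0 t"

fun ob :: "('o, 'a) moncat \<Rightarrow> 'o list \<Rightarrow> 'o" where
  "ob C [] = tunit C"
| "ob C (X # w) = X \<otimes>\<^bsub>C\<^esub> ob C w"

fun arrow :: "('o, 'a) moncat \<Rightarrow> ('o, 'a) diagram \<Rightarrow> 'a" where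
  "arrow C (Box d f c) = f"
| "arrow C (Wires w) = Ident C (ob C w)"
| "arrow C (Seq s t) = arrow C s \<cdot>\<^bsub>C\<^esub> arrow C t"
| "arrow C (Par s t) = arrow C s \<boxtimes>\<^bsub>C\<^esub> arrow C t"

fun interpretable :: "('o, 'a) moncat \<Rightarrow> ('o, 'a) diagram \<Rightarrow> bool" where
  "interpretable C (Box d f c) =
     (set d \<subseteq> Obj C \<and> set c \<subseteq> Obj C \<and> f \<in> hom C (ob C d) (ob C c))"
| "interpretable C (Wires w) = (set w \<subseteq> Obj C)"
| "interpretable C (Seq s t) = (interpretable C s \<and> interpretable C t)"
| "interpretable C (Par s t) = (interpretable C s \<and> interpretable C t)"

definition layer_arrow :: "('o, 'a) moncat \<Rightarrow> 'o list \<Rightarrow> 'a \<Rightarrow> 'o list \<Rightarrow> 'a" where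
  "layer_arrow C P f Q = Ident C (ob C P) \<boxtimes>\<^bsub>C\<^esub> f \<boxtimes>\<^bsub>C\<^esub> Ident C (ob C Q)"

fun layers_arrow :: "('o, 'a) moncat \<Rightarrow> 'o list \<Rightarrow> ('o, 'a) layer list \<Rightarrow> 'a" where
  "layers_arrow C w [] = Ident C (ob C w)"
| "layers_arrow C w ((n, d, f, c) # p) =
     layers_arrow C (take n w @ c @ drop (n + length d) w) p
       \<cdot>\<^bsub>C\<^esub> layer_arrow C (take n w) f (drop (n + length d) w)"

fun fits :: "('o, 'a) moncat \<Rightarrow> 'o list \<Rightarrow> ('o, 'a) layer list \<Rightarrow> bool" where
  "fits C w [] = (set w \<subseteq> Obj C)"
| "fits C w ((n, d, f, c) # p) \<longleftrightarrow>
     set w \<subseteq> Obj C \<and> interpretable C (Box d f c) \<and>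
     n + length d \<le> length w \<and> take (length d) (drop n w) = d \<and>
     fits C (take n w @ c @ drop (n + length d) w) p"

definition depicts :: "('o, 'a) moncat \<Rightarrow> 'a \<Rightarrow> ('o, 'a) diagram \<Rightarrow> bool" where
  "depicts C f t \<longleftrightarrow> f = arrow C t \<and> interpretable C t"

definition depicts_obj :: "('o, 'a) moncat \<Rightarrow> 'o \<Rightarrow> 'o list \<Rightarrow> bool" where
  "depicts_obj C X w \<longleftrightarrow> X = ob C w \<and> set w \<subseteq> Obj C"

locale strict_moncat =
  fixes C :: "('o, 'a) moncat" (structure)
  assumes strict: "strict_monoidal C"
begin

lemma category: "is_category C"
  using strict by (simp add: strict_monoidal_def)

lemma comp_in: "f \<in> hom C X Y \<Longrightarrow> g \<in> hom C Y Z \<Longrightarrow> g \<cdot> f \<in> hom C X Z"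
  using category[unfolded is_category_def, THEN conjunct2, THEN conjunct2, THEN conjunct1]
  by (simp add: hom_def)

lemma comp_assoc:
  "f \<in> hom C X Y \<Longrightarrow> g \<in> hom C Y Z \<Longrightarrow> h \<in> hom C Z W \<Longrightarrow> h \<cdot> g \<cdot> f = h \<cdot> (g \<cdot> f)"
  using category[unfolded is_category_def, THEN conjunct2, THEN conjunct2, THEN conjunct2, THEN conjunct2]
  by (simp add: hom_def)

lemma comp_id [simp]: "f \<in> hom C X Y \<Longrightarrow> f \<cdot> Ident C X = f"
  and id_comp [simp]: "f \<in> hom C X Y \<Longrightarrow> Ident C Y \<cdot> f = f"
  using category[unfolded is_category_def, THEN conjunct2, THEN conjunct2, THEN conjunct2, THEN conjunct1]
  by (auto simp: hom_def)

lemma id_in [intro, simp]: "X \<in> Obj C \<Longrightarrow> Ident C X \<in> hom C X X"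
  using category[unfolded is_category_def, THEN conjunct2, THEN conjunct1] by simp

lemma hom_objs: assumes "f \<in> hom C X Y" shows "X \<in> Obj C" "Y \<in> Obj C"
  using category[unfolded is_category_def, THEN conjunct1] assms by (auto simp: hom_def)

lemma unit_obj [intro, simp]: "tunit C \<in> Obj C"
  using strict by (simp add: strict_monoidal_def)

lemma tens_obj [intro, simp]: "X \<in> Obj C \<Longrightarrow> Y \<in> Obj C \<Longrightarrow> X \<otimes> Y \<in> Obj C"
  using strict by (simp add: strict_monoidal_def)

lemma tens_obj_assoc:
  "X \<in> Obj C \<Longrightarrow> Y \<in> Obj C \<Longrightarrow> Z \<in> Obj C \<Longrightarrow> X \<otimes> Y \<otimes> Z = X \<otimes> (Y \<otimes> Z)"
  using strict by (simp add: strict_monoidal_def)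

lemma tens_obj_unit [simp]: "X \<in> Obj C \<Longrightarrow> X \<otimes> tunit C = X" "X \<in> Obj C \<Longrightarrow> tunit C \<otimes> X = X"
  using strict by (simp_all add: strict_monoidal_def)

lemma tens_in:
  assumes "f \<in> hom C X Y" "g \<in> hom C X' Y'"
  shows "f \<boxtimes> g \<in> hom C (X \<otimes> X') (Y \<otimes> Y')"
proof -
  have "\<forall>f \<in> Arr C. \<forall>g \<in> Arr C. f \<boxtimes> g \<in> hom C (Dom C f \<otimes> Dom C g) (Cod C f \<otimes> Cod C g)"
    using strict unfolding strict_monoidal_def by (elim conjE)
  then show ?thesis using assms by (simp add: hom_def)
qed

lemma tens_id: "X \<in> Obj C \<Longrightarrow> Y \<in> Obj C \<Longrightarrow> Ident C X \<boxtimes> Ident C Y = Ident C (X \<otimes> Y)"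
  using strict by (simp add: strict_monoidal_def)

lemma interchange:
  assumes "f \<in> hom C X Y" "f' \<in> hom C Y Z" "g \<in> hom C X' Y'" "g' \<in> hom C Y' Z'"
  shows "(f' \<cdot> f) \<boxtimes> (g' \<cdot> g) = (f' \<boxtimes> g') \<cdot> (f \<boxtimes> g)"
proof -
  have "\<forall>f \<in> Arr C. \<forall>f' \<in> Arr C. \<forall>g \<in> Arr C. \<forall>g' \<in> Arr C.
        Cod C f = Dom C f' \<longrightarrow> Cod C g = Dom C g' \<longrightarrow>
        (f' \<cdot> f) \<boxtimes> (g' \<cdot> g) = (f' \<boxtimes> g') \<cdot> (f \<boxtimes> g)"
    using strict unfolding strict_monoidal_def by (elim conjE)
  then show ?thesis using assms by (simp add: hom_def)
qed

lemma tens_assoc: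
  "f \<in> hom C X Y \<Longrightarrow> g \<in> hom C X' Y' \<Longrightarrow> h \<in> hom C X'' Y'' \<Longrightarrow> f \<boxtimes> g \<boxtimes> h = f \<boxtimes> (g \<boxtimes> h)"
  using strict by (simp add: strict_monoidal_def hom_def)

lemma tens_unit [simp]:
  "f \<in> hom C X Y \<Longrightarrow> Ident C (tunit C) \<boxtimes> f = f" "f \<in> hom C X Y \<Longrightarrow> f \<boxtimes> Ident C (tunit C) = f"
  using strict by (simp_all add: strict_monoidal_def hom_def)

lemma ob_obj [intro, simp]: "set w \<subseteq> Obj C \<Longrightarrow> ob C w \<in> Obj C"
  by (induction w) auto

lemma ob_append: "set v \<subseteq> Obj C \<Longrightarrow> set w \<subseteq> Obj C \<Longrightarrow> ob C (v @ w) = ob C v \<otimes> ob C w"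
  by (induction v) (auto simp: tens_obj_assoc)

lemma layer_in:
  assumes "interpretable C (Box d f c)" "set P \<subseteq> Obj C" "set Q \<subseteq> Obj C"
  shows "layer_arrow C P f Q \<in> hom C (ob C (P @ d @ Q)) (ob C (P @ c @ Q))"
proof -
  have "layer_arrow C P f Q \<in> hom C (ob C P \<otimes> ob C d \<otimes> ob C Q) (ob C P \<otimes> ob C c \<otimes> ob C Q)"
    unfolding layer_arrow_def using assms by (intro tens_in) auto
  then show ?thesis using assms by (auto simp: ob_append tens_obj_assoc)
qed

lemma fits_obj: "fits C w p \<Longrightarrow> set w \<subseteq> Obj C"
  by (cases "(C, w, p)" rule: fits.cases) auto

lemma fits_split:
  assumes "fits C w ((n, d, f, c) # p)"
  obtains P Q where "w = P @ d @ Q" "n = length P" "set P \<subseteq> Obj C" "set Q \<subseteq> Obj C"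
    "interpretable C (Box d f c)" "fits C (P @ c @ Q) p"
proof -
  have a: "n + length d \<le> length w" "take (length d) (drop n w) = d" "set w \<subseteq> Obj C"
    using assms by auto
  have "w = take n w @ d @ drop (n + length d) w"
    by (metis a(2) add.commute append_take_drop_id drop_drop)
  then show ?thesis
    using that[of "take n w" "drop (n + length d) w"] assms a
    by (auto dest: in_set_takeD in_set_dropD)
qed

lemma layers_arrow_box:
  "layers_arrow C (P @ d @ Q) ((length P, d, f, c) # p)
   = layers_arrow C (P @ c @ Q) p \<cdot> layer_arrow C P f Q"
  by simp

lemma layers_arrow_in:
  "fits C w p \<Longrightarrow> layers_arrow C w p \<in> hom C (ob C w) (ob C (word_after w p)) \<and>
     set (word_after w p) \<subseteq> Obj C"
proof (induction p arbitrary: w)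
  case Nil
  then show ?case by simp
next
  case (Cons l p)
  obtain n d f c where l: "l = (n, d, f, c)" by (cases l) auto
  from Cons.prems[unfolded l] obtain P Q where
    *: "w = P @ d @ Q" "n = length P" "set P \<subseteq> Obj C" "set Q \<subseteq> Obj C"
    "interpretable C (Box d f c)" "fits C (P @ c @ Q) p" by (rule fits_split)
  show ?case using Cons.IH[OF *(6)] layer_in[OF *(5,3,4)]
    unfolding l * layers_arrow_box by (auto intro: comp_in)
qed

lemma fits_append:
  "fits C w (p @ q) \<longleftrightarrow> fits C w p \<and> fits C (word_after w p) q"
proof (induction p arbitrary: w)
  case Nil
  then show ?case using fits_obj by auto
next
  case (Cons l p)
  then show ?case by (cases l) auto
qed

lemma word_after_append: "word_after w (p @ q) = word_after (word_after w p) q"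
  by (induction w p rule: word_after.induct) auto

lemma layers_arrow_append:
  "fits C w (p @ q) \<Longrightarrow>
   layers_arrow C w (p @ q) = layers_arrow C (word_after w p) q \<cdot> layers_arrow C w p"
proof (induction p arbitrary: w)
  case Nil
  then show ?case using layers_arrow_in[of w q] comp_id by auto
next
  case (Cons l p)
  obtain n d f c where l: "l = (n, d, f, c)" by (cases l) auto
  from Cons.prems[unfolded l append_Cons] obtain P Q where
    *: "w = P @ d @ Q" "n = length P" "set P \<subseteq> Obj C" "set Q \<subseteq> Obj C"
    "interpretable C (Box d f c)" "fits C (P @ c @ Q) (p @ q)" by (rule fits_split)
  have p: "fits C (P @ c @ Q) p" "fits C (word_after (P @ c @ Q) p) q"
    using *(6) by (auto simp: fits_append)
  show ?case
    using Cons.IH[OF *(6)] comp_assoc[OF layer_in[OF *(5,3,4)]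
        layers_arrow_in[OF p(1), THEN conjunct1] layers_arrow_in[OF p(2), THEN conjunct1]]
    unfolding l * append_Cons layers_arrow_box by simp
qed

lemma arrow_in:
  "well_typed t \<Longrightarrow> interpretable C t \<Longrightarrow>
   arrow C t \<in> hom C (ob C (src t)) (ob C (tgt t)) \<and> set (src t) \<subseteq> Obj C \<and> set (tgt t) \<subseteq> Obj C"
  by (induction t) (auto simp: ob_append intro: comp_in tens_in)

lemma layer_comp:
  assumes "f \<in> hom C (ob C d) (ob C c)" "g \<in> hom C (ob C c) (ob C e)"
    "set P \<subseteq> Obj C" "set Q \<subseteq> Obj C" "set c \<subseteq> Obj C" "set d \<subseteq> Obj C" "set e \<subseteq> Obj C"
  shows "layer_arrow C P g Q \<cdot> layer_arrow C P f Q = layer_arrow C P (g \<cdot> f) Q"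
proof -
  have P: "Ident C (ob C P) \<in> hom C (ob C P) (ob C P)"
   and Q: "Ident C (ob C Q) \<in> hom C (ob C Q) (ob C Q)" using assms by auto
  have "Ident C (ob C P) \<boxtimes> (g \<cdot> f) = (Ident C (ob C P) \<boxtimes> g) \<cdot> (Ident C (ob C P) \<boxtimes> f)"
    using interchange[OF P P assms(1,2)] P by simp
  moreover have "\<dots> \<boxtimes> Ident C (ob C Q) = (Ident C (ob C P) \<boxtimes> g \<boxtimes> Ident C (ob C Q))
      \<cdot> (Ident C (ob C P) \<boxtimes> f \<boxtimes> Ident C (ob C Q))"
    using interchange[OF tens_in[OF P assms(1)] tens_in[OF P assms(2)] Q Q] Q by simp
  ultimately show ?thesis by (simp add: layer_arrow_def)
qed

lemma layer_par:
  assumes "f \<in> hom C (ob C d) (ob C c)" "g \<in> hom C (ob C d') (ob C c')"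
    "set P \<subseteq> Obj C" "set Q \<subseteq> Obj C" "set c \<subseteq> Obj C" "set d \<subseteq> Obj C"
    "set c' \<subseteq> Obj C" "set d' \<subseteq> Obj C"
  shows "layer_arrow C (P @ c) g Q \<cdot> layer_arrow C P f (d' @ Q) = layer_arrow C P (f \<boxtimes> g) Q"
    and "layer_arrow C P f (c' @ Q) \<cdot> layer_arrow C (P @ d) g Q = layer_arrow C P (f \<boxtimes> g) Q"
proof -
  let ?i = "\<lambda>w. Ident C (ob C w)"
  have i: "?i P \<in> hom C (ob C P) (ob C P)" "?i Q \<in> hom C (ob C Q) (ob C Q)"
    "?i c \<in> hom C (ob C c) (ob C c)" "?i d \<in> hom C (ob C d) (ob C d)"
    "?i c' \<in> hom C (ob C c') (ob C c')" "?i d' \<in> hom C (ob C d') (ob C d')" using assms by auto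
  have A: "layer_arrow C (P @ c) h Q = layer_arrow C P (?i c \<boxtimes> h) Q"
    if "h \<in> hom C (ob C d') (ob C c')" "set c \<subseteq> Obj C" for h c
  proof -
    have c: "?i c \<in> hom C (ob C c) (ob C c)" using that by auto
    show ?thesis using that assms tens_assoc[OF i(1) c that(1)]
      by (simp add: layer_arrow_def ob_append tens_id[symmetric])
  qed
  have B: "layer_arrow C P h (c' @ Q) = layer_arrow C P (h \<boxtimes> ?i c') Q"
    if "h \<in> hom C (ob C d) (ob C c)" "set c' \<subseteq> Obj C" for h c'
  proof -
    have c': "?i c' \<in> hom C (ob C c') (ob C c')" using that by auto
    show ?thesis using that assms tens_assoc[OF i(1) that(1) c'] tens_assoc[OF tens_in[OF i(1) that(1)] c' i(2)]
      by (simp add: layer_arrow_def ob_append tens_id[symmetric])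
  qed
  have X: "(?i c \<boxtimes> g) \<cdot> (f \<boxtimes> ?i d') = f \<boxtimes> g"
    using interchange[OF assms(1) i(3) i(6) assms(2)] assms by simp
  have Y: "(f \<boxtimes> ?i c') \<cdot> (?i d \<boxtimes> g) = f \<boxtimes> g"
    using interchange[OF i(4) assms(1) assms(2) i(5)] assms by simp
  have h: "f \<boxtimes> ?i d' \<in> hom C (ob C (d @ d')) (ob C (c @ d'))" "?i c \<boxtimes> g \<in> hom C (ob C (c @ d')) (ob C (c @ c'))"
    "f \<boxtimes> ?i c' \<in> hom C (ob C (d @ c')) (ob C (c @ c'))" "?i d \<boxtimes> g \<in> hom C (ob C (d @ d')) (ob C (d @ c'))"
    using assms i by (auto simp: ob_append intro!: tens_in)
  show "layer_arrow C (P @ c) g Q \<cdot> layer_arrow C P f (d' @ Q) = layer_arrow C P (f \<boxtimes> g) Q"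
    unfolding A[OF assms(2,5)] B[OF assms(1,8)] X[symmetric] using assms by (intro layer_comp[OF h(1,2)]) auto
  show "layer_arrow C P f (c' @ Q) \<cdot> layer_arrow C (P @ d) g Q = layer_arrow C P (f \<boxtimes> g) Q"
    unfolding A[OF assms(2,6)] B[OF assms(1,7)] Y[symmetric] using assms by (intro layer_comp[OF h(4,3)]) auto
qed

lemma layers_diagram:
  assumes "well_typed t" "interpretable C t" "set P \<subseteq> Obj C" "set Q \<subseteq> Obj C"
  shows "fits C (P @ src t @ Q) (layers (length P) t) \<and>
    word_after (P @ src t @ Q) (layers (length P) t) = P @ tgt t @ Q \<and>
    layers_arrow C (P @ src t @ Q) (layers (length P) t) = layer_arrow C P (arrow C t) Q"
  using assms
proof (induction t arbitrary: P Q)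
  case (Box d f c)
  then show ?case using layer_in[OF Box(2-4)] by auto
next
  case (Wires w)
  then show ?case by (auto simp: layer_arrow_def tens_id ob_append tens_obj_assoc)
next
  case (Seq s t)
  note t = Seq.IH(2)[of P Q] and s = Seq.IH(1)[of P Q]
  show ?case using Seq.prems s t arrow_in[of s] arrow_in[of t]
    by (auto simp: fits_append word_after_append layers_arrow_append intro!: layer_comp)
next
  case (Par s t)
  have st: "set (src t) \<subseteq> Obj C" "set (tgt s) \<subseteq> Obj C" using Par.prems arrow_in by auto
  have s: "fits C (P @ src s @ src t @ Q) (layers (length P) s) \<and>
    word_after (P @ src s @ src t @ Q) (layers (length P) s) = P @ tgt s @ src t @ Q \<and>
    layers_arrow C (P @ src s @ src t @ Q) (layers (length P) s) = layer_arrow C P (arrow C s) (src t @ Q)"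
    using Par.IH(1)[of P "src t @ Q"] Par.prems st by auto
  have t: "fits C (P @ tgt s @ src t @ Q) (layers (length P + length (tgt s)) t) \<and>
    word_after (P @ tgt s @ src t @ Q) (layers (length P + length (tgt s)) t) = P @ tgt s @ tgt t @ Q \<and>
    layers_arrow C (P @ tgt s @ src t @ Q) (layers (length P + length (tgt s)) t)
      = layer_arrow C (P @ tgt s) (arrow C t) Q"
    using Par.IH(2)[of "P @ tgt s" Q] Par.prems st by auto
  show ?case using s t Par.prems arrow_in[of s] arrow_in[of t]
    by (auto simp: fits_append word_after_append layers_arrow_append intro!: layer_par)
qed

definition same :: "'o list \<Rightarrow> ('o, 'a) layer list \<Rightarrow> ('o, 'a) layer list \<Rightarrow> bool" where
  "same w p q \<longleftrightarrow> fits C w q \<and> word_after w q = word_after w p \<and>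
     layers_arrow C w q = layers_arrow C w p"

lemma same_context:
  assumes "fits C w (p @ q @ r)" "same (word_after w p) q q'"
  shows "same w (p @ q @ r) (p @ q' @ r)"
proof -
  have "fits C w (p @ q' @ r)" using assms by (auto simp: fits_append same_def word_after_append)
  then show ?thesis using assms
    by (auto simp: fits_append same_def word_after_append layers_arrow_append)
qed

lemma same_append: "fits C w (q @ p) \<Longrightarrow> same w q q' \<Longrightarrow> same w (q @ p) (q' @ p)"
  using same_context[of w "[]" q p q'] by simp

lemma same_refl: "fits C w p \<Longrightarrow> same w p p"
  by (simp add: same_def)

lemma same_swap_right:
  assumes "interpretable C (Box d f c)" "interpretable C (Box d' f' c')"
    "set P \<subseteq> Obj C" "set R \<subseteq> Obj C" "set Q \<subseteq> Obj C"
  shows "layers_arrow C (P @ d @ R @ d' @ Q) [(length P, d, f, c), (length (P @ c @ R), d', f', c')]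
       = layers_arrow C (P @ d @ R @ d' @ Q) [(length (P @ d @ R), d', f', c'), (length P, d, f, c)]"
proof -
  let ?s = "Seq (Par (Wires (c @ R)) (Box d' f' c')) (Par (Box d f c) (Wires (R @ d')))"
  let ?t = "Seq (Par (Box d f c) (Wires (R @ c'))) (Par (Wires (d @ R)) (Box d' f' c'))"
  have f: "f \<in> hom C (ob C d) (ob C c)" and f': "f' \<in> hom C (ob C d') (ob C c')"
    and o: "set d \<subseteq> Obj C" "set c \<subseteq> Obj C" "set d' \<subseteq> Obj C" "set c' \<subseteq> Obj C"
    using assms by auto
  let ?i = "\<lambda>w. Ident C (ob C w)"
  have i: "?i R \<in> hom C (ob C R) (ob C R)" "?i d' \<in> hom C (ob C d') (ob C d')"
    "?i c' \<in> hom C (ob C c') (ob C c')" "?i c \<in> hom C (ob C c) (ob C c)" "?i d \<in> hom C (ob C d) (ob C d)"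
    using assms o by auto
  have *: "?i (c @ R) \<boxtimes> f' = ?i c \<boxtimes> (?i R \<boxtimes> f')" "?i (d @ R) \<boxtimes> f' = ?i d \<boxtimes> (?i R \<boxtimes> f')"
    "f \<boxtimes> ?i (R @ d') = f \<boxtimes> (?i R \<boxtimes> ?i d')" "f \<boxtimes> ?i (R @ c') = f \<boxtimes> (?i R \<boxtimes> ?i c')"
    using assms o tens_assoc[OF i(4,1) f'] tens_assoc[OF i(5,1) f']
    by (simp_all add: ob_append tens_id)
  have "?i c \<boxtimes> (?i R \<boxtimes> f') \<cdot> f \<boxtimes> (?i R \<boxtimes> ?i d') = (?i c \<cdot> f) \<boxtimes> ((?i R \<boxtimes> f') \<cdot> (?i R \<boxtimes> ?i d'))"
    using interchange[OF f i(4) tens_in[OF i(1,2)] tens_in[OF i(1) f']] by simp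
  also have "\<dots> = (f \<cdot> ?i d) \<boxtimes> ((?i R \<boxtimes> ?i c') \<cdot> (?i R \<boxtimes> f'))"
    using interchange[OF i(1,1) i(2) f'] interchange[OF i(1,1) f' i(3)] f f' i by simp
  also have "\<dots> = f \<boxtimes> (?i R \<boxtimes> ?i c') \<cdot> ?i d \<boxtimes> (?i R \<boxtimes> f')"
    using interchange[OF i(5) f tens_in[OF i(1) f'] tens_in[OF i(1,3)]] by simp
  finally have st: "arrow C ?s = arrow C ?t" using * by simp
  have "interpretable C ?s" "interpretable C ?t" using assms by auto
  then show ?thesis
    using layers_diagram[of ?s P Q] layers_diagram[of ?t P Q] st assms(3,5) by (simp add: add.assoc)
qed

lemma same_swap_boxes:
  assumes "interpretable C (Box d f c)" "interpretable C (Box d' f' c')"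
    "set P \<subseteq> Obj C" "set R \<subseteq> Obj C" "set Q \<subseteq> Obj C"
  shows "same (P @ d @ R @ d' @ Q)
      [(length P, d, f, c), (length (P @ c @ R), d', f', c')]
      [(length (P @ d @ R), d', f', c'), (length P, d, f, c)]" (is "same ?w ?p ?q")
    "same (P @ d @ R @ d' @ Q)
      [(length (P @ d @ R), d', f', c'), (length P, d, f, c)]
      [(length P, d, f, c), (length (P @ c @ R), d', f', c')]"
proof -
  have "fits C ?w ?p" "fits C ?w ?q" "word_after ?w ?p = P @ c @ R @ c' @ Q"
    "word_after ?w ?q = P @ c @ R @ c' @ Q"
    using assms by auto
  then show "same ?w ?p ?q" "same ?w ?q ?p"
    using same_swap_right[OF assms] unfolding same_def by presburger+
qed

lemma same_swap_head: "fits C w p \<Longrightarrow> same w p (swap_head p)"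
proof (induction p rule: swap_head.induct)
  case (1 n d f c n' d' f' c' p)
  from 1 obtain P Q where
    w: "w = P @ d @ Q" "n = length P" "set P \<subseteq> Obj C" "set Q \<subseteq> Obj C"
    "interpretable C (Box d f c)" and "fits C (P @ c @ Q) ((n', d', f', c') # p)"
    by (rule fits_split)
  from this(6) obtain P' Q' where
    w': "P @ c @ Q = P' @ d' @ Q'" "n' = length P'" "set P' \<subseteq> Obj C" "set Q' \<subseteq> Obj C"
    "interpretable C (Box d' f' c')" "fits C (P' @ c' @ Q') p"
    by (rule fits_split)
  consider (right) "n + length c \<le> n'" | (left) "\<not> n + length c \<le> n'" "n' + length d' \<le> n"
    | (none) "\<not> n + length c \<le> n'" "\<not> n' + length d' \<le> n" by blast
  then show ?case
  proof cases
    case right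
    define R where "R = drop (length (P @ c)) P'"
    have "take (length (P @ c)) P' = P @ c"
      using arg_cong[OF w'(1), of "take (length (P @ c))"] right w(2) w'(2) by simp
    then have P': "P' = P @ c @ R" unfolding R_def by (metis append.assoc append_take_drop_id)
    with w'(1) have Q: "Q = R @ d' @ Q'" by simp
    have *: "swap_head ((n, d, f, c) # (n', d', f', c') # p)
      = [(length (P @ d @ R), d', f', c'), (length P, d, f, c)] @ p"
      using right by (simp add: w(2) w'(2) P')
    have **: "(n, d, f, c) # (n', d', f', c') # p
       = [(length P, d, f, c), (length (P @ c @ R), d', f', c')] @ p"
      by (simp add: w(2) w'(2) P')
    have "set R \<subseteq> Obj C" using w'(3) P' by simp
    from same_swap_boxes(1)[OF w(5) w'(5) w(3) this w'(4)] show ?thesis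
      using 1 unfolding * unfolding ** w(1) Q by (rule same_append[rotated])
  next
    case left
    define R where "R = drop (length (P' @ d')) P"
    have "take (length (P' @ d')) P = P' @ d'"
      using arg_cong[OF w'(1), of "take (length (P' @ d'))"] left w(2) w'(2) by simp
    then have P: "P = P' @ d' @ R" unfolding R_def by (metis append.assoc append_take_drop_id)
    with w'(1) have Q: "Q' = R @ c @ Q" by simp
    have *: "swap_head ((n, d, f, c) # (n', d', f', c') # p)
      = [(length P', d', f', c'), (length (P' @ c' @ R), d, f, c)] @ p"
      using left by (auto simp: w(2) w'(2) P)
    have **: "(n, d, f, c) # (n', d', f', c') # p
       = [(length (P' @ d' @ R), d, f, c), (length P', d', f', c')] @ p"
      by (simp add: w(2) w'(2) P)
    have "set R \<subseteq> Obj C" using w(3) P by simp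
    from same_swap_boxes(2)[OF w'(5) w(5) w'(3) this w(4)] show ?thesis
      using 1 unfolding * unfolding ** w(1) P append.assoc by (rule same_append[rotated])
  next
    case none
    then have "swap_head ((n, d, f, c) # (n', d', f', c') # p) = (n, d, f, c) # (n', d', f', c') # p"
      by simp
    then show ?thesis using same_refl[OF 1] by (simp only:)
  qed
qed (auto simp: same_refl)

lemma same_trans: "same w p q \<Longrightarrow> same w q r \<Longrightarrow> same w p r"
  by (simp add: same_def)

lemma same_fits: "same w p q \<Longrightarrow> fits C w q"
  by (simp add: same_def)

lemma same_swap_at: "fits C w p \<Longrightarrow> same w p (swap_at k p)"
proof (induction k arbitrary: w p)
  case 0
  then show ?case by (simp add: same_swap_head)
next
  case (Suc k)
  show ?case
  proof (cases p)
    case Nil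
    then show ?thesis using Suc.prems by (simp add: same_refl)
  next
    case (Cons l p')
    have "fits C (word_after w [l]) p'" using Suc.prems fits_append[of w "[l]" p'] Cons by simp
    from Suc.IH[OF this] show ?thesis
      using same_context[of w "[l]" p' "[]" "swap_at k p'"] Suc.prems Cons by simp
  qed
qed

lemma same_lift: "fits C w p \<Longrightarrow> same w p (lift i j p)"
proof (induction i j p rule: lift.induct)
  case (1 i p)
  then show ?case by (simp add: same_refl)
next
  case (2 i j p)
  then show ?case using same_swap_at same_trans same_fits by (metis lift.simps(2))
qed

lemma same_replace:
  assumes "fits C w p" "parallel s t" "interpretable C s" "interpretable C t" "arrow C s = arrow C t"
  shows "same w p (replace w k n s t p)"
proof -
  let ?w' = "word_after w (take k p)" and ?l = "layers n s"
  show ?thesis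
  proof (cases "take (length ?l) (drop k p) = ?l \<and> n + length (src s) \<le> length ?w' \<and>
         take (length (src s)) (drop n ?w') = src s")
    case True
    define P Q where "P = take n ?w'" and "Q = drop (n + length (src s)) ?w'"
    have w': "?w' = P @ src s @ Q" and n: "n = length P" unfolding P_def Q_def
      using True by (auto, metis add.commute append_take_drop_id drop_drop)
    have p: "p = take k p @ ?l @ drop (k + length ?l) p"
      using True by (metis add.commute append_take_drop_id drop_drop)
    then have fits: "fits C w (take k p @ ?l @ drop (k + length ?l) p)" using assms(1) by simp
    then have "set ?w' \<subseteq> Obj C" using fits_obj by (auto simp: fits_append)
    then have same: "same ?w' ?l (layers n t)"
      using layers_diagram[of s P Q] layers_diagram[of t P Q] assms(2-5) w' unfolding n
      by (simp add: same_def parallel_def)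
    have "replace w k n s t p = take k p @ layers n t @ drop (k + length ?l) p"
      unfolding replace_def Let_def by (rule if_P) (rule True)
    then show ?thesis using same_context[OF fits same] p by metis
  next
    case False
    then have "replace w k n s t p = p" unfolding replace_def Let_def by (rule if_not_P)
    then show ?thesis using assms(1) by (simp add: same_refl)
  qed
qed

definition equations :: "(('o, 'a) diagram \<times> ('o, 'a) diagram) list \<Rightarrow> bool" where
  "equations es \<longleftrightarrow> (\<forall>(s, t) \<in> set es. interpretable C s \<and> interpretable C t \<and> arrow C s = arrow C t)"

lemma same_exec:
  assumes "\<forall>(s, t) \<in> set es. parallel s t" "equations es" "fits C w p" 
    "\<forall>x \<in> set c. case x of Up i j \<Rightarrow> True | Rw e k n \<Rightarrow> e < length es | Rv e k n \<Rightarrow> e < length es"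
  shows "same w p (exec es w c p)"
  using assms
proof (induction es w c p rule: exec.induct)
  case (1 es w p)
  then show ?case by (simp add: same_refl)
next
  case (2 es w i j c p)
  have "same w p (lift i j p)" by (rule same_lift) (rule 2)
  from same_trans[OF this 2(1)[OF 2(2,3) same_fits[OF this]]] 2(5) show ?case by simp
next
  case (3 es w e k n c p)
  then have e: "es ! e \<in> set es" by simp
  then have e': "parallel (fst (es ! e)) (snd (es ! e))" "parallel (snd (es ! e)) (fst (es ! e))"
      "interpretable C (fst (es ! e))" "interpretable C (snd (es ! e))"
      "arrow C (fst (es ! e)) = arrow C (snd (es ! e))"
    using 3(2,3) by (auto simp: equations_def parallel_def case_prod_beta)
  have "same w p (replace w k n (fst (es ! e)) (snd (es ! e)) p)"
    using 3(4) e' by (intro same_replace)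
  from same_trans[OF this 3(1)[OF 3(2,3) same_fits[OF this]]] 3(5) show ?case by simp
next
  case (4 es w e k n c p)
  then have e: "es ! e \<in> set es" by simp
  then have e': "parallel (fst (es ! e)) (snd (es ! e))" "parallel (snd (es ! e)) (fst (es ! e))"
      "interpretable C (fst (es ! e))" "interpretable C (snd (es ! e))"
      "arrow C (fst (es ! e)) = arrow C (snd (es ! e))"
    using 4(2,3) by (auto simp: equations_def parallel_def case_prod_beta)
  have "same w p (replace w k n (snd (es ! e)) (fst (es ! e)) p)"
    using 4(4) e' by (intro same_replace) simp_all
  from same_trans[OF this 4(1)[OF 4(2,3) same_fits[OF this]]] 4(5) show ?case by simp
qed

lemma derivable_arrow:
  assumes "derivable es c s t" "equations es" "interpretable C s" "interpretable C t"
  shows "arrow C s = arrow C t"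
proof -
  have "same (src s) (layers 0 s) (layers 0 t)"
    using same_exec[of es "src s" "layers 0 s" c] layers_diagram[of s "[]" "[]"] assms
    by (auto simp: derivable_def parallel_def)
  moreover have "layers_arrow C (src u) (layers 0 u) = arrow C u"
    if "well_typed u" "interpretable C u" for u
  proof -
    have u: "arrow C u \<in> hom C (ob C (src u)) (ob C (tgt u))" using arrow_in[OF that] by simp
    show ?thesis using layers_diagram[of u "[]" "[]"] that tens_unit(1)[OF u] tens_unit(2)[OF u]
      by (simp add: layer_arrow_def)
  qed
  ultimately show ?thesis
    using assms unfolding derivable_def parallel_def same_def by metis
qed

lemma depicts_intros:
  "depicts C f s \<Longrightarrow> depicts C g t \<Longrightarrow> depicts C (f \<cdot> g) (Seq s t)"
  "depicts_obj C X u \<Longrightarrow> depicts C f t \<Longrightarrow> depicts C (X \<lhd> f) (Par (Wires u) t)"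
  "depicts_obj C X u \<Longrightarrow> depicts C f t \<Longrightarrow> depicts C (f \<rhd> X) (Par t (Wires u))"
  "depicts C f s \<Longrightarrow> depicts C g t \<Longrightarrow> depicts C (f \<boxtimes> g) (Par s t)"
  "depicts_obj C X u \<Longrightarrow> depicts C (Ident C X) (Wires u)"
  "depicts_obj C (tunit C) []"
  "depicts_obj C X u \<Longrightarrow> depicts_obj C Y v \<Longrightarrow> depicts_obj C (X \<otimes> Y) (u @ v)"
  by (auto simp: depicts_def depicts_obj_def whiskL_def whiskR_def ob_append)

lemma depicts_atom: "X \<in> Obj C \<Longrightarrow> depicts_obj C X [X]"
  by (simp add: depicts_obj_def)

lemma depicts_box:
  "f \<in> hom C X Y \<Longrightarrow> depicts_obj C X d \<Longrightarrow> depicts_obj C Y c \<Longrightarrow> depicts C f (Box d f c)"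
  by (simp add: depicts_obj_def depicts_def)

lemma depicts_in:
  "depicts C f t \<Longrightarrow> depicts_obj C X u \<Longrightarrow> depicts_obj C Y v \<Longrightarrow>
   well_typed t \<and> src t = u \<and> tgt t = v \<Longrightarrow> f \<in> hom C X Y"
  using arrow_in by (auto simp: depicts_def depicts_obj_def)

lemma eqs0: "equations []"
  by (simp add: equations_def)

lemma eqs_Cons:
  "f = g \<Longrightarrow> equations es \<Longrightarrow> depicts C f s \<Longrightarrow> depicts C g t \<Longrightarrow> equations ((s, t) # es)"
  by (simp add: equations_def depicts_def)

lemmas eqs1 = eqs_Cons[OF _ eqs0]
lemmas eqs2 = eqs_Cons[OF _ eqs1]
lemmas eqs3 = eqs_Cons[OF _ eqs2]
lemmas eqs4 = eqs_Cons[OF _ eqs3]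
lemmas eqs5 = eqs_Cons[OF _ eqs4]
lemmas eqs6 = eqs_Cons[OF _ eqs5]
lemmas eqs7 = eqs_Cons[OF _ eqs6]
lemmas eqs8 = eqs_Cons[OF _ eqs7]

lemma diagram_eq:
  "equations es \<Longrightarrow> depicts C f s \<Longrightarrow> depicts C g t \<Longrightarrow> derivable es c s t \<Longrightarrow> f = g"
  using derivable_arrow by (auto simp: depicts_def)

definition epi :: "'a \<Rightarrow> bool" where
  "epi q \<longleftrightarrow> (\<forall>h h' W. h \<in> hom C (Cod C q) W \<longrightarrow> h' \<in> hom C (Cod C q) W \<longrightarrow> h \<cdot> q = h' \<cdot> q \<longrightarrow> h = h')"

lemma epiD:
  assumes "epi q" "q \<in> hom C Y T" "h \<in> hom C T W" "h' \<in> hom C T W" "h \<cdot> q = h' \<cdot> q"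
  shows "h = h'"
proof -
  have "Cod C q = T" using assms(2) by (simp add: hom_def)
  then show ?thesis using assms(1,3-5) unfolding epi_def by blast
qed

lemma epi_diagram_eq:
  assumes "epi q" "equations es" "depicts C q r" "depicts C f s" "depicts C g t"
    "derivable es c (Seq s r) (Seq t r)"
  shows "f = g"
proof (rule epiD[OF assms(1)])
  have t: "well_typed r" "well_typed s" "well_typed t" "src s = tgt r" "src t = tgt r" "tgt s = tgt t"
    using assms(6) by (auto simp: derivable_def parallel_def)
  show "q \<in> hom C (ob C (src r)) (ob C (tgt r))" "f \<in> hom C (ob C (tgt r)) (ob C (tgt s))"
    "g \<in> hom C (ob C (tgt r)) (ob C (tgt s))"
    using assms(3-5) t arrow_in[of r] arrow_in[of s] arrow_in[of t] by (simp_all add: depicts_def)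
  show "f \<cdot> q = g \<cdot> q"
    using assms(2) depicts_intros(1)[OF assms(4,3)] depicts_intros(1)[OF assms(5,3)] assms(6)
    by (rule diagram_eq)
qed

lemmas depicts = depicts_intros depicts_atom depicts_box

end

lemmas derivable_simps = derivable_def parallel_def replace_def Let_def numeral_eq_Suc

section \<open>Coseparable coalgebras\<close>

context strict_moncat
begin

lemma assoc_id:
  "X \<in> Obj C \<Longrightarrow> Y \<in> Obj C \<Longrightarrow> Z \<in> Obj C \<Longrightarrow> assoc C X Y Z = Ident C (X \<otimes> Y \<otimes> Z)"
  using strict by (simp add: strict_monoidal_def)

lemma lunit_id: "X \<in> Obj C \<Longrightarrow> lunit C X = Ident C X"
  and runit_id: "X \<in> Obj C \<Longrightarrow> runit C X = Ident C X"
  using strict by (simp_all add: strict_monoidal_def)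

lemma whiskL_in: "X \<in> Obj C \<Longrightarrow> f \<in> hom C Y Z \<Longrightarrow> X \<lhd> f \<in> hom C (X \<otimes> Y) (X \<otimes> Z)"
  unfolding whiskL_def by (intro tens_in id_in)

lemma whiskR_in: "X \<in> Obj C \<Longrightarrow> f \<in> hom C Y Z \<Longrightarrow> f \<rhd> X \<in> hom C (Y \<otimes> X) (Z \<otimes> X)"
  unfolding whiskR_def by (intro tens_in id_in)

lemma coalgebra_strict:
  "coalgebra C K \<Delta> e \<longleftrightarrow> K \<in> Obj C \<and> \<Delta> \<in> hom C K (K \<otimes> K) \<and> e \<in> hom C K (tunit C) \<and>
     (\<Delta> \<rhd> K) \<cdot> \<Delta> = (K \<lhd> \<Delta>) \<cdot> \<Delta> \<and> (e \<rhd> K) \<cdot> \<Delta> = Ident C K \<and> (K \<lhd> e) \<cdot> \<Delta> = Ident C K"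
proof (cases "K \<in> Obj C \<and> \<Delta> \<in> hom C K (K \<otimes> K) \<and> e \<in> hom C K (tunit C)")
  case True
  then have K [typing]: "K \<in> Obj C" and D [typing]: "\<Delta> \<in> hom C K (K \<otimes> K)" and e [typing]: "e \<in> hom C K (tunit C)" by auto
  have "assoc C K K K \<cdot> (\<Delta> \<rhd> K) = \<Delta> \<rhd> K" "lunit C K \<cdot> (e \<rhd> K) = e \<rhd> K" "runit C K \<cdot> (K \<lhd> e) = K \<lhd> e"
    using id_comp[OF whiskR_in[OF K D]] id_comp[OF whiskR_in[OF K e]] id_comp[OF whiskL_in[OF K e]] K
    by (simp_all add: assoc_id lunit_id runit_id)
  then show ?thesis using True by (simp add: coalgebra_def)
qed (auto simp: coalgebra_def)

lemma bicomodule_strict: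
  assumes "coalgebra C K \<Delta> e"
  shows "bicomodule C K \<Delta> e N l r \<longleftrightarrow> N \<in> Obj C \<and> l \<in> hom C N (K \<otimes> N) \<and> r \<in> hom C N (N \<otimes> K) \<and>
     (\<Delta> \<rhd> N) \<cdot> l = (K \<lhd> l) \<cdot> l \<and> (e \<rhd> N) \<cdot> l = Ident C N \<and>
     (r \<rhd> K) \<cdot> r = (N \<lhd> \<Delta>) \<cdot> r \<and> (N \<lhd> e) \<cdot> r = Ident C N \<and>
     (l \<rhd> K) \<cdot> r = (K \<lhd> r) \<cdot> l"
proof (cases "N \<in> Obj C \<and> l \<in> hom C N (K \<otimes> N) \<and> r \<in> hom C N (N \<otimes> K)")
  case True
  then have N [typing]: "N \<in> Obj C" and l [typing]: "l \<in> hom C N (K \<otimes> N)" and r [typing]: "r \<in> hom C N (N \<otimes> K)" by auto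
  from assms have K [typing]: "K \<in> Obj C" and D [typing]: "\<Delta> \<in> hom C K (K \<otimes> K)" and e [typing]: "e \<in> hom C K (tunit C)"
    by (auto simp: coalgebra_strict)
  have "assoc C K K N \<cdot> (\<Delta> \<rhd> N) = \<Delta> \<rhd> N" "lunit C N \<cdot> (e \<rhd> N) = e \<rhd> N" "runit C N \<cdot> (N \<lhd> e) = N \<lhd> e"
    "assoc C N K K \<cdot> (r \<rhd> K) = r \<rhd> K" "assoc C K N K \<cdot> (l \<rhd> K) = l \<rhd> K"
    using id_comp[OF whiskR_in[OF N D]] id_comp[OF whiskR_in[OF N e]] id_comp[OF whiskL_in[OF N e]]
      id_comp[OF whiskR_in[OF K r]] id_comp[OF whiskR_in[OF K l]] K N
    by (simp_all add: assoc_id lunit_id runit_id)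
  then show ?thesis using True by (simp add: bicomodule_def)
qed (auto simp: bicomodule_def)

lemma coseparable_casimir:
  assumes "coseparable_coalgebra C K \<Delta> e"
  shows "\<exists>B \<in> hom C (K \<otimes> K) (tunit C). (B \<rhd> K) \<cdot> (K \<lhd> \<Delta>) = (K \<lhd> B) \<cdot> (\<Delta> \<rhd> K) \<and> B \<cdot> \<Delta> = e"
proof -
  have co: "coalgebra C K \<Delta> e" using assms by (simp add: coseparable_coalgebra_def)
  then have K [typing]: "K \<in> Obj C" and D [typing]: "\<Delta> \<in> hom C K (K \<otimes> K)" and e [typing]: "e \<in> hom C K (tunit C)"
    and coassoc: "(\<Delta> \<rhd> K) \<cdot> \<Delta> = (K \<lhd> \<Delta>) \<cdot> \<Delta>" and cl: "(e \<rhd> K) \<cdot> \<Delta> = Ident C K"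
    and cr: "(K \<lhd> e) \<cdot> \<Delta> = Ident C K"
    by (auto simp: coalgebra_strict)
  have "(\<Delta> \<rhd> K \<otimes> K) \<cdot> (\<Delta> \<rhd> K) = (K \<lhd> \<Delta> \<rhd> K) \<cdot> (\<Delta> \<rhd> K)"
    by (rule diagram_eq[OF eqs1[OF coassoc], where c = "[Rw 0 0 0]"], (rule depicts typing)+,
      simp add: derivable_simps)
  moreover have "(e \<rhd> K \<otimes> K) \<cdot> (\<Delta> \<rhd> K) = Ident C (K \<otimes> K)"
    by (rule diagram_eq[OF eqs1[OF cl], where c = "[Rw 0 0 0]"], (rule depicts typing)+,
      simp add: derivable_simps)
  moreover have "((K \<lhd> \<Delta>) \<rhd> K) \<cdot> (K \<lhd> \<Delta>) = (K \<otimes> K \<lhd> \<Delta>) \<cdot> (K \<lhd> \<Delta>)"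
    by (rule diagram_eq[OF eqs1[OF coassoc], where c = "[Rw 0 0 1]"], (rule depicts typing)+,
      simp add: derivable_simps)
  moreover have "(K \<otimes> K \<lhd> e) \<cdot> (K \<lhd> \<Delta>) = Ident C (K \<otimes> K)"
    by (rule diagram_eq[OF eqs1[OF cr], where c = "[Rw 0 0 1]"], (rule depicts typing)+,
      simp add: derivable_simps)
  moreover have "(\<Delta> \<rhd> K \<rhd> K) \<cdot> (K \<lhd> \<Delta>) = (K \<lhd> K \<lhd> \<Delta>) \<cdot> (\<Delta> \<rhd> K)"
    by (rule diagram_eq[OF eqs0, where c = "[Up 1 1]"], (rule depicts typing)+,
      simp add: derivable_simps)
  ultimately have N: "bicomodule C K \<Delta> e (K \<otimes> K) (\<Delta> \<rhd> K) (K \<lhd> \<Delta>)"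
    using K D e whiskR_in[OF K D] whiskL_in[OF K D] tens_obj_assoc[OF K K K]
    by (simp add: bicomodule_strict[OF co])
  have M: "bicomodule C K \<Delta> e K \<Delta> \<Delta>"
    using co K D e coassoc cl cr by (simp add: bicomodule_strict[OF co])
  have i: "bicolinear C K K \<Delta> \<Delta> (K \<otimes> K) (\<Delta> \<rhd> K) (K \<lhd> \<Delta>) \<Delta>"
    using D coassoc by (simp add: bicolinear_def)
  have p: "\<exists>p \<in> hom C (K \<otimes> K) K. p \<cdot> \<Delta> = Ident C K"
    using cr whiskL_in[OF K e] K by auto
  have f: "bicolinear C K K \<Delta> \<Delta> K \<Delta> \<Delta> (Ident C K)"
  proof -
    have "\<Delta> \<cdot> Ident C K = (K \<lhd> Ident C K) \<cdot> \<Delta>"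
      by (rule diagram_eq[OF eqs0, where c = "[]"], (rule depicts typing)+,
        simp add: derivable_simps)
    moreover have "\<Delta> \<cdot> Ident C K = (Ident C K \<rhd> K) \<cdot> \<Delta>"
      by (rule diagram_eq[OF eqs0, where c = "[]"], (rule depicts typing)+,
        simp add: derivable_simps)
    ultimately show ?thesis using K by (simp add: bicolinear_def)
  qed
  from assms[unfolded coseparable_coalgebra_def, THEN conjunct2, rule_format, OF M N i p f]
  obtain g where g [typing]: "g \<in> hom C (K \<otimes> K) K"
    and gl: "\<Delta> \<cdot> g = (K \<lhd> g) \<cdot> (\<Delta> \<rhd> K)" and gr: "\<Delta> \<cdot> g = (g \<rhd> K) \<cdot> (K \<lhd> \<Delta>)"
    and gi: "g \<cdot> \<Delta> = Ident C K"
    unfolding bicolinear_def by metis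
  have "((e \<cdot> g) \<rhd> K) \<cdot> (K \<lhd> \<Delta>) = (K \<lhd> (e \<cdot> g)) \<cdot> (\<Delta> \<rhd> K)"
    by (rule diagram_eq[OF eqs4[OF gl gr cl cr], where c = "[Rv 1 0 0, Rw 2 1 0, Rv 3 1 0,
      Rw 0 0 0]"], (rule depicts typing)+, simp add: derivable_simps)
  moreover have "e \<cdot> g \<cdot> \<Delta> = e"
    by (rule diagram_eq[OF eqs1[OF gi], where c = "[Rw 0 0 0]"], (rule depicts typing)+,
      simp add: derivable_simps)
  ultimately show ?thesis using comp_in[OF g e] by auto
qed

lemma casimir_coseparable:
  assumes co: "coalgebra C K \<Delta> e" and B [typing]: "B \<in> hom C (K \<otimes> K) (tunit C)"
    and cas: "(B \<rhd> K) \<cdot> (K \<lhd> \<Delta>) = (K \<lhd> B) \<cdot> (\<Delta> \<rhd> K)" and norm: "B \<cdot> \<Delta> = e"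
  shows "coseparable_coalgebra C K \<Delta> e"
  unfolding coseparable_coalgebra_def
proof (intro conjI allI impI)
  show "coalgebra C K \<Delta> e" by (rule co)
  then have K [typing]: "K \<in> Obj C" and D [typing]: "\<Delta> \<in> hom C K (K \<otimes> K)" and e [typing]: "e \<in> hom C K (tunit C)"
    and coassoc: "(\<Delta> \<rhd> K) \<cdot> \<Delta> = (K \<lhd> \<Delta>) \<cdot> \<Delta>" and cl: "(e \<rhd> K) \<cdot> \<Delta> = Ident C K"
    and cr: "(K \<lhd> e) \<cdot> \<Delta> = Ident C K"
    by (auto simp: coalgebra_strict)
  fix M lM rM N l r i f
  assume "bicomodule C K \<Delta> e M lM rM" "bicomodule C K \<Delta> e N l r"
    "bicolinear C K M lM rM N l r i" "\<exists>p \<in> hom C N M. p \<cdot> i = Ident C M"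
    "bicolinear C K M lM rM K \<Delta> \<Delta> f"
  then obtain p where M [typing]: "M \<in> Obj C" and N [typing]: "N \<in> Obj C" and lM [typing]: "lM \<in> hom C M (K \<otimes> M)"
    and rM [typing]: "rM \<in> hom C M (M \<otimes> K)" and l [typing]: "l \<in> hom C N (K \<otimes> N)" and r [typing]: "r \<in> hom C N (N \<otimes> K)"
    and ll: "(\<Delta> \<rhd> N) \<cdot> l = (K \<lhd> l) \<cdot> l" and rr: "(r \<rhd> K) \<cdot> r = (N \<lhd> \<Delta>) \<cdot> r"
    and lr: "(l \<rhd> K) \<cdot> r = (K \<lhd> r) \<cdot> l"
    and i [typing]: "i \<in> hom C M N" and il: "l \<cdot> i = (K \<lhd> i) \<cdot> lM" and ir: "r \<cdot> i = (i \<rhd> K) \<cdot> rM"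
    and p [typing]: "p \<in> hom C N M" and pi: "p \<cdot> i = Ident C M"
    and f [typing]: "f \<in> hom C M K" and fl: "\<Delta> \<cdot> f = (K \<lhd> f) \<cdot> lM" and fr: "\<Delta> \<cdot> f = (f \<rhd> K) \<cdot> rM"
    by (auto simp: bicomodule_strict[OF co] bicolinear_def)
  obtain \<gamma> where \<gamma>1: "\<gamma> = (B \<rhd> K) \<cdot> (K \<lhd> \<Delta>)" by blast
  have "(B \<rhd> K) \<cdot> (K \<lhd> \<Delta>) \<in> hom C (K \<otimes> K) K" by (rule depicts_in, (rule depicts typing)+, simp)
  then have \<gamma> [typing]: "\<gamma> \<in> hom C (K \<otimes> K) K" by (simp add: \<gamma>1)
  have \<gamma>l: "\<Delta> \<cdot> \<gamma> = (K \<lhd> \<gamma>) \<cdot> (\<Delta> \<rhd> K)"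
    by (rule diagram_eq[OF eqs3[OF \<gamma>1 cas coassoc], where c = "[Rw 0 0 0, Up 2 1, Rv 2 0 1,
      Rw 1 1 0, Up 1 1, Rv 0 1 1]"], (rule depicts typing)+, simp add: derivable_simps)
  have \<gamma>r: "\<Delta> \<cdot> \<gamma> = (\<gamma> \<rhd> K) \<cdot> (K \<lhd> \<Delta>)"
    by (rule diagram_eq[OF eqs2[OF \<gamma>1 coassoc], where c = "[Rw 0 0 0, Up 2 1, Rv 1 0 1,
      Rv 0 1 0]"], (rule depicts typing)+, simp add: derivable_simps)
  have \<gamma>d: "\<gamma> \<cdot> \<Delta> = Ident C K"
    by (rule diagram_eq[OF eqs4[OF \<gamma>1 coassoc norm cl], where c = "[Rw 0 1 0, Rv 1 0 0,
      Rw 2 1 0, Rw 3 0 0]"], (rule depicts typing)+, simp add: derivable_simps)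
  obtain h where h1: "h = \<gamma> \<cdot> ((f \<cdot> p) \<rhd> K) \<cdot> r" by blast
  have "\<gamma> \<cdot> ((f \<cdot> p) \<rhd> K) \<cdot> r \<in> hom C N K" by (rule depicts_in, (rule depicts typing)+, simp)
  then have h [typing]: "h \<in> hom C N K" by (simp add: h1)
  have hr: "\<Delta> \<cdot> h = (h \<rhd> K) \<cdot> r"
    by (rule diagram_eq[OF eqs3[OF h1 \<gamma>r rr], where c = "[Rw 0 0 0, Rw 1 3 0, Up 3 2,
      Rv 2 0 0, Rv 0 1 0]"], (rule depicts typing)+, simp add: derivable_simps)
  have hi: "h \<cdot> i = f"
    by (rule diagram_eq[OF eqs5[OF h1 ir pi fr \<gamma>d], where c = "[Rw 0 1 0, Rw 1 0 0, Rw 2 1 0,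
      Rv 3 0 0, Rw 4 1 0]"], (rule depicts typing)+, simp add: derivable_simps)
  obtain g where g1: "g = \<gamma> \<cdot> (K \<lhd> h) \<cdot> l" by blast
  have "\<gamma> \<cdot> (K \<lhd> h) \<cdot> l \<in> hom C N K" by (rule depicts_in, (rule depicts typing)+, simp)
  then have g [typing]: "g \<in> hom C N K" by (simp add: g1)
  have "\<Delta> \<cdot> g = (K \<lhd> g) \<cdot> l"
    by (rule diagram_eq[OF eqs3[OF g1 \<gamma>l ll], where c = "[Rw 0 0 0, Rw 1 2 0, Up 2 1,
      Rw 2 0 0, Rv 0 1 1]"], (rule depicts typing)+, simp add: derivable_simps)
  moreover have "\<Delta> \<cdot> g = (g \<rhd> K) \<cdot> r"
    by (rule diagram_eq[OF eqs4[OF g1 \<gamma>r hr lr], where c = "[Rw 0 0 0, Rw 1 2 0, Rw 2 1 1,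
      Rv 3 0 0, Rv 0 1 0]"], (rule depicts typing)+, simp add: derivable_simps)
  moreover have "f = g \<cdot> i"
    by (rule diagram_eq[OF eqs5[OF g1 il hi fl \<gamma>d], where c = "[Rv 4 1 0, Rw 3 0 0, Rv 2 1 1,
      Rv 1 0 0, Rv 0 1 0]"], (rule depicts typing)+, simp add: derivable_simps)
  ultimately show "\<exists>g. bicolinear C K N l r K \<Delta> \<Delta> g \<and> f = g \<cdot> i"
    using g by (auto simp: bicolinear_def)
qed

end

section \<open>The transfer category\<close>

locale moncat_algebra = strict_moncat +
  fixes A m \<eta>
  assumes algebra: "algebra C A m \<eta>"
begin

lemma A: "A \<in> Obj C"
  and m: "m \<in> hom C (A \<otimes> A) A"
  and \<eta>: "\<eta> \<in> hom C (tunit C) A"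
  and m_assoc: "m \<cdot> (m \<rhd> A) = m \<cdot> (A \<lhd> m)"
  and \<eta>l: "m \<cdot> (\<eta> \<rhd> A) = Ident C A"
  and \<eta>r: "m \<cdot> (A \<lhd> \<eta>) = Ident C A"
  using algebra by (simp_all add: algebra_def)

lemmas [typing] = A m \<eta>

abbreviation "tobj \<equiv> transfer C A m \<eta>"

definition tmor :: "'a \<times> 'b \<Rightarrow> 'b \<Rightarrow> 'a \<times> 'b \<Rightarrow> bool" where
  "tmor = (\<lambda>(X, \<chi>) f (Y, \<upsilon>). tobj X \<chi> \<and> tobj Y \<upsilon> \<and> f \<in> hom C X (A \<otimes> Y) \<and>
     (m \<rhd> Y) \<cdot> (A \<lhd> f) \<cdot> \<chi> = (m \<rhd> Y) \<cdot> (A \<lhd> \<upsilon>) \<cdot> (f \<rhd> A))"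

lemma transferD:
  assumes "tobj X \<chi>"
  shows "X \<in> Obj C" "\<chi> \<in> hom C (X \<otimes> A) (A \<otimes> X)"
    "\<chi> \<cdot> (X \<lhd> m) = (m \<rhd> X) \<cdot> (A \<lhd> \<chi>) \<cdot> (\<chi> \<rhd> A)" "\<chi> \<cdot> (X \<lhd> \<eta>) = \<eta> \<rhd> X"
  using assms by (simp_all add: transfer_def)

lemma tmorD:
  assumes "tmor (X, \<chi>) f (Y, \<upsilon>)"
  shows "tobj X \<chi>" "tobj Y \<upsilon>" "f \<in> hom C X (A \<otimes> Y)"
    "(m \<rhd> Y) \<cdot> (A \<lhd> f) \<cdot> \<chi> = (m \<rhd> Y) \<cdot> (A \<lhd> \<upsilon>) \<cdot> (f \<rhd> A)"
  using assms by (simp_all add: tmor_def)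

lemma Tsharp_simps:
  "Obj (Tsharp C A m \<eta>) = {(X, \<chi>). tobj X \<chi>}"
  "Arr (Tsharp C A m \<eta>) = {(X, f, Y). tmor X f Y}"
  "Dom (Tsharp C A m \<eta>) (P, f, Q) = P"
  "Cod (Tsharp C A m \<eta>) (P, f, Q) = Q"
  "Ident (Tsharp C A m \<eta>) (X, \<chi>) = ((X, \<chi>), \<eta> \<rhd> X, (X, \<chi>))"
  "Comp (Tsharp C A m \<eta>) (Q', g, R) (P, f, Q) = (P, (m \<rhd> fst R) \<cdot> (A \<lhd> g) \<cdot> f, R)"
  "tensO (Tsharp C A m \<eta>) (X, \<chi>) (Y, \<upsilon>) = (X \<otimes> Y, (\<chi> \<rhd> Y) \<cdot> (X \<lhd> \<upsilon>))"
  "tensA (Tsharp C A m \<eta>) (P, f, (X', \<chi>')) (Q, g, (Y', \<upsilon>')) =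
     (transfer_tensor C P Q, (m \<rhd> X' \<otimes> Y') \<cdot> (A \<lhd> \<chi>' \<rhd> Y') \<cdot> (f \<boxtimes> g),
      (X' \<otimes> Y', (\<chi>' \<rhd> Y') \<cdot> (X' \<lhd> \<upsilon>')))"
  "tunit (Tsharp C A m \<eta>) = (tunit C, Ident C A)"
  "assoc (Tsharp C A m \<eta>) P Q R = Ident (Tsharp C A m \<eta>) (transfer_tensor C (transfer_tensor C P Q) R)"
  "lunit (Tsharp C A m \<eta>) P = Ident (Tsharp C A m \<eta>) P"
  "runit (Tsharp C A m \<eta>) P = Ident (Tsharp C A m \<eta>) P"
  by (auto simp: Tsharp_def Let_def transfer_tensor_def tmor_def)

lemma transfer_tensor_tobj:
  assumes "tobj X \<chi>" "tobj Y \<upsilon>"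
  shows "tobj (X \<otimes> Y) ((\<chi> \<rhd> Y) \<cdot> (X \<lhd> \<upsilon>))"
proof -
  note D = transferD[OF assms(1)] transferD[OF assms(2)]
  from D have X [typing]: "X \<in> Obj C" and \<chi> [typing]: "\<chi> \<in> hom C (X \<otimes> A) (A \<otimes> X)"
    and \<chi>m: "\<chi> \<cdot> (X \<lhd> m) = (m \<rhd> X) \<cdot> (A \<lhd> \<chi>) \<cdot> (\<chi> \<rhd> A)"
    and \<chi>\<eta>: "\<chi> \<cdot> (X \<lhd> \<eta>) = \<eta> \<rhd> X" by simp_all
  from D have Y [typing]: "Y \<in> Obj C" and \<upsilon> [typing]: "\<upsilon> \<in> hom C (Y \<otimes> A) (A \<otimes> Y)"
    and \<upsilon>m: "\<upsilon> \<cdot> (Y \<lhd> m) = (m \<rhd> Y) \<cdot> (A \<lhd> \<upsilon>) \<cdot> (\<upsilon> \<rhd> A)"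
    and \<upsilon>\<eta>: "\<upsilon> \<cdot> (Y \<lhd> \<eta>) = \<eta> \<rhd> Y" by simp_all
  have "(\<chi> \<rhd> Y) \<cdot> (X \<lhd> \<upsilon>) \<in> hom C (X \<otimes> Y \<otimes> A) (A \<otimes> (X \<otimes> Y))"
    by (rule depicts_in, (rule depicts typing)+, simp)
  moreover have "(\<chi> \<rhd> Y) \<cdot> (X \<lhd> \<upsilon>) \<cdot> (X \<otimes> Y \<lhd> m)
      = (m \<rhd> X \<otimes> Y) \<cdot> (A \<lhd> ((\<chi> \<rhd> Y) \<cdot> (X \<lhd> \<upsilon>))) \<cdot> (((\<chi> \<rhd> Y) \<cdot> (X \<lhd> \<upsilon>)) \<rhd> A)"
        by (rule diagram_eq[OF eqs2[OF \<chi>m \<upsilon>m], where c = "[Rw 1 0 1, Rw 0 2 0, Up 2 1]"],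
          (rule depicts typing)+, simp add: derivable_simps)
  moreover have "(\<chi> \<rhd> Y) \<cdot> (X \<lhd> \<upsilon>) \<cdot> (X \<otimes> Y \<lhd> \<eta>) = \<eta> \<rhd> X \<otimes> Y"
    by (rule diagram_eq[OF eqs2[OF \<chi>\<eta> \<upsilon>\<eta>], where c = "[Rw 1 0 1, Rw 0 0 0]"],
      (rule depicts typing)+, simp add: derivable_simps)
  ultimately show ?thesis using X Y by (simp add: transfer_def)
qed

lemma transfer_unit: "tobj (tunit C) (Ident C A)"
proof -
  have "Ident C A \<cdot> (tunit C \<lhd> m) = (m \<rhd> tunit C) \<cdot> (A \<lhd> Ident C A) \<cdot> (Ident C A \<rhd> A)"
    by (rule diagram_eq[OF eqs0, where c = "[]"], (rule depicts typing)+,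
      simp add: derivable_simps)
  moreover have "Ident C A \<cdot> (tunit C \<lhd> \<eta>) = \<eta> \<rhd> tunit C"
    by (rule diagram_eq[OF eqs0, where c = "[]"], (rule depicts typing)+,
      simp add: derivable_simps)
  ultimately show ?thesis using A by (simp add: transfer_def)
qed

lemma tmor_id:
  assumes "tobj X \<chi>"
  shows "tmor (X, \<chi>) (\<eta> \<rhd> X) (X, \<chi>)"
proof -
  note X [typing] = transferD[OF assms]
  have "\<eta> \<rhd> X \<in> hom C X (A \<otimes> X)" by (rule depicts_in, (rule depicts typing)+, simp)
  moreover have "(m \<rhd> X) \<cdot> (A \<lhd> \<eta> \<rhd> X) \<cdot> \<chi> = (m \<rhd> X) \<cdot> (A \<lhd> \<chi>) \<cdot> (\<eta> \<rhd> X \<rhd> A)"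
    by (rule diagram_eq[OF eqs2[OF \<eta>l \<eta>r], where c = "[Rw 1 1 0, Rv 0 1 0, Up 1 1]"],
      (rule depicts typing)+, simp add: derivable_simps)
  ultimately show ?thesis using assms by (simp add: tmor_def)
qed

lemma tmor_comp:
  assumes "tmor (X, \<chi>) f (Y, \<upsilon>)" "tmor (Y, \<upsilon>) g (Z, \<zeta>)"
  shows "tmor (X, \<chi>) ((m \<rhd> Z) \<cdot> (A \<lhd> g) \<cdot> f) (Z, \<zeta>)"
proof -
  note f' = tmorD[OF assms(1)] and g' = tmorD[OF assms(2)]
  note X [typing] = transferD[OF f'(1)]
  note Y [typing] = transferD[OF f'(2)]
  note Z [typing] = transferD[OF g'(2)]
  from f' have f [typing]: "f \<in> hom C X (A \<otimes> Y)"
    and fl: "(m \<rhd> Y) \<cdot> (A \<lhd> f) \<cdot> \<chi> = (m \<rhd> Y) \<cdot> (A \<lhd> \<upsilon>) \<cdot> (f \<rhd> A)" by simp_all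
  from g' have g [typing]: "g \<in> hom C Y (A \<otimes> Z)"
    and gl: "(m \<rhd> Z) \<cdot> (A \<lhd> g) \<cdot> \<upsilon> = (m \<rhd> Z) \<cdot> (A \<lhd> \<zeta>) \<cdot> (g \<rhd> A)" by simp_all
  have "(m \<rhd> Z) \<cdot> (A \<lhd> g) \<cdot> f \<in> hom C X (A \<otimes> Z)" by (rule depicts_in, (rule depicts typing)+, simp)
  moreover have "(m \<rhd> Z) \<cdot> (A \<lhd> ((m \<rhd> Z) \<cdot> (A \<lhd> g) \<cdot> f)) \<cdot> \<chi>
      = (m \<rhd> Z) \<cdot> (A \<lhd> \<zeta>) \<cdot> (((m \<rhd> Z) \<cdot> (A \<lhd> g) \<cdot> f) \<rhd> A)"
        by (rule diagram_eq[OF eqs3[OF fl gl m_assoc], where c = "[Rv 2 3 0, Up 3 1, Rw 0 0 0,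
          Up 3 1, Rw 2 3 0, Rw 1 1 1, Rv 2 3 0, Up 3 1]"], (rule depicts typing)+,
          simp add: derivable_simps)
  ultimately show ?thesis using f' g' by (simp add: tmor_def)
qed

lemma tmor_comp_id:
  assumes "tmor (X, \<chi>) f (Y, \<upsilon>)"
  shows "(m \<rhd> Y) \<cdot> (A \<lhd> \<eta> \<rhd> Y) \<cdot> f = f" "(m \<rhd> Y) \<cdot> (A \<lhd> f) \<cdot> (\<eta> \<rhd> X) = f"
proof -
  note f' = tmorD[OF assms(1)]
  note X [typing] = transferD[OF f'(1)]
  note Y [typing] = transferD[OF f'(2)]
  from f' have f [typing]: "f \<in> hom C X (A \<otimes> Y)"
    and fl: "(m \<rhd> Y) \<cdot> (A \<lhd> f) \<cdot> \<chi> = (m \<rhd> Y) \<cdot> (A \<lhd> \<upsilon>) \<cdot> (f \<rhd> A)" by simp_all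
  show "(m \<rhd> Y) \<cdot> (A \<lhd> \<eta> \<rhd> Y) \<cdot> f = f"
    by (rule diagram_eq[OF eqs1[OF \<eta>r], where c = "[Rw 0 1 0]"], (rule depicts typing)+,
      simp add: derivable_simps)
  show "(m \<rhd> Y) \<cdot> (A \<lhd> f) \<cdot> (\<eta> \<rhd> X) = f"
    by (rule diagram_eq[OF eqs1[OF \<eta>l], where c = "[Up 1 1, Rw 0 1 0]"],
      (rule depicts typing)+, simp add: derivable_simps)
qed

lemma tmor_comp_assoc:
  assumes "tmor (X, \<chi>) f (Y, \<upsilon>)" "tmor (Y, \<upsilon>) g (Z, \<zeta>)" "tmor (Z, \<zeta>) h (W, \<omega>)"
  shows "(m \<rhd> W) \<cdot> (A \<lhd> ((m \<rhd> W) \<cdot> (A \<lhd> h) \<cdot> g)) \<cdot> f = (m \<rhd> W) \<cdot> (A \<lhd> h) \<cdot> ((m \<rhd> Z) \<cdot> (A \<lhd> g) \<cdot> f)"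
proof -
  note f' = tmorD[OF assms(1)] and g' = tmorD[OF assms(2)] and h' = tmorD[OF assms(3)]
  note X [typing] = transferD[OF f'(1)]
  note Y [typing] = transferD[OF f'(2)]
  note Z [typing] = transferD[OF h'(1)]
  note W [typing] = transferD[OF h'(2)]
  from f' have f [typing]: "f \<in> hom C X (A \<otimes> Y)" by simp
  from g' have g [typing]: "g \<in> hom C Y (A \<otimes> Z)" by simp
  from h' have h [typing]: "h \<in> hom C Z (A \<otimes> W)" by simp
  show "(m \<rhd> W) \<cdot> (A \<lhd> ((m \<rhd> W) \<cdot> (A \<lhd> h) \<cdot> g)) \<cdot> f = (m \<rhd> W) \<cdot> (A \<lhd> h) \<cdot> ((m \<rhd> Z) \<cdot> (A \<lhd> g) \<cdot> f)"
    by (rule diagram_eq[OF eqs1[OF m_assoc], where c = "[Rv 0 3 0, Up 3 1]"],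
      (rule depicts typing)+, simp add: derivable_simps)
qed

lemma tmor_tensor:
  assumes "tmor (X, \<chi>) f (Y, \<upsilon>)" "tmor (X', \<chi>') f' (Y', \<upsilon>')"
  shows "tmor (X \<otimes> X', (\<chi> \<rhd> X') \<cdot> (X \<lhd> \<chi>')) ((m \<rhd> Y \<otimes> Y') \<cdot> (A \<lhd> \<upsilon> \<rhd> Y') \<cdot> (f \<boxtimes> f'))
    (Y \<otimes> Y', (\<upsilon> \<rhd> Y') \<cdot> (Y \<lhd> \<upsilon>'))"
proof -
  note f1 = tmorD[OF assms(1)] and f2 = tmorD[OF assms(2)]
  note X [typing] = transferD[OF f1(1)]
  note Y [typing] = transferD[OF f1(2)]
  note X' [typing] = transferD[OF f2(1)]
  note Y' [typing] = transferD[OF f2(2)]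
  from f1 have f [typing]: "f \<in> hom C X (A \<otimes> Y)"
    and fl: "(m \<rhd> Y) \<cdot> (A \<lhd> f) \<cdot> \<chi> = (m \<rhd> Y) \<cdot> (A \<lhd> \<upsilon>) \<cdot> (f \<rhd> A)" by simp_all
  from f2 have f' [typing]: "f' \<in> hom C X' (A \<otimes> Y')"
    and f'l: "(m \<rhd> Y') \<cdot> (A \<lhd> f') \<cdot> \<chi>' = (m \<rhd> Y') \<cdot> (A \<lhd> \<upsilon>') \<cdot> (f' \<rhd> A)" by simp_all
  have "(m \<rhd> Y \<otimes> Y') \<cdot> (A \<lhd> \<upsilon> \<rhd> Y') \<cdot> (f \<boxtimes> f') \<in> hom C (X \<otimes> X') (A \<otimes> (Y \<otimes> Y'))"
    by (rule depicts_in, (rule depicts typing)+, simp)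
  moreover have "(m \<rhd> Y \<otimes> Y') \<cdot> (A \<lhd> ((m \<rhd> Y \<otimes> Y') \<cdot> (A \<lhd> \<upsilon> \<rhd> Y') \<cdot> (f \<boxtimes> f'))) \<cdot> ((\<chi> \<rhd> X') \<cdot> (X \<lhd> \<chi>'))
      = (m \<rhd> Y \<otimes> Y') \<cdot> (A \<lhd> ((\<upsilon> \<rhd> Y') \<cdot> (Y \<lhd> \<upsilon>'))) \<cdot> (((m \<rhd> Y \<otimes> Y') \<cdot> (A \<lhd> \<upsilon> \<rhd> Y') \<cdot> (f \<boxtimes> f')) \<rhd> A)"
        by (rule diagram_eq[OF eqs4[OF fl f'l Y(3) m_assoc], where c = "[Rv 3 5 0, Up 5 2,
          Rw 0 1 0, Up 1 1, Up 4 1, Up 5 1, Rw 3 5 0, Up 3 1, Rv 2 3 1, Rw 1 1 2, Rw 2 3 1,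
          Up 3 1, Rv 3 5 0, Up 5 2]"], (rule depicts typing)+, simp add: derivable_simps)
  ultimately show ?thesis using transfer_tensor_tobj f1 f2 by (simp add: tmor_def)
qed

lemma tmor_tensor_id:
  assumes "tobj X \<chi>" "tobj Y \<upsilon>"
  shows "(m \<rhd> X \<otimes> Y) \<cdot> (A \<lhd> \<chi> \<rhd> Y) \<cdot> ((\<eta> \<rhd> X) \<boxtimes> (\<eta> \<rhd> Y)) = \<eta> \<rhd> X \<otimes> Y"
proof -
  note X [typing] = transferD[OF assms(1)]
  note Y [typing] = transferD[OF assms(2)]
  show "(m \<rhd> X \<otimes> Y) \<cdot> (A \<lhd> \<chi> \<rhd> Y) \<cdot> ((\<eta> \<rhd> X) \<boxtimes> (\<eta> \<rhd> Y)) = \<eta> \<rhd> X \<otimes> Y"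
    by (rule diagram_eq[OF eqs2[OF X(4) \<eta>l], where c = "[Up 1 1, Up 2 1, Rw 1 2 0,
      Rw 0 0 0]"], (rule depicts typing)+, simp add: derivable_simps)
qed

lemma tmor_interchange:
  assumes "tmor (X, \<chi>) f (Y, \<upsilon>)" "tmor (X', \<chi>') f' (Y', \<upsilon>')"
    "tmor (Y, \<upsilon>) g (Z, \<zeta>)" "tmor (Y', \<upsilon>') g' (Z', \<zeta>')"
  shows "(m \<rhd> Z \<otimes> Z') \<cdot> (A \<lhd> \<zeta> \<rhd> Z') \<cdot> (((m \<rhd> Z) \<cdot> (A \<lhd> g) \<cdot> f) \<boxtimes> ((m \<rhd> Z') \<cdot> (A \<lhd> g') \<cdot> f'))
    = (m \<rhd> Z \<otimes> Z') \<cdot> (A \<lhd> ((m \<rhd> Z \<otimes> Z') \<cdot> (A \<lhd> \<zeta> \<rhd> Z') \<cdot> (g \<boxtimes> g'))) \<cdot> ((m \<rhd> Y \<otimes> Y') \<cdot> (A \<lhd> \<upsilon> \<rhd> Y') \<cdot> (f \<boxtimes> f'))"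
proof -
  note f1 = tmorD[OF assms(1)] and f2 = tmorD[OF assms(2)] and g1 = tmorD[OF assms(3)] and g2 = tmorD[OF assms(4)]
  note X [typing] = transferD[OF f1(1)]
  note X' [typing] = transferD[OF f2(1)]
  note Y [typing] = transferD[OF f1(2)]
  note Y' [typing] = transferD[OF f2(2)]
  note Z [typing] = transferD[OF g1(2)]
  note Z' [typing] = transferD[OF g2(2)]
  from f1 have f [typing]: "f \<in> hom C X (A \<otimes> Y)" by simp
  from f2 have f' [typing]: "f' \<in> hom C X' (A \<otimes> Y')" by simp
  from g1 have g [typing]: "g \<in> hom C Y (A \<otimes> Z)"
    and gl: "(m \<rhd> Z) \<cdot> (A \<lhd> g) \<cdot> \<upsilon> = (m \<rhd> Z) \<cdot> (A \<lhd> \<zeta>) \<cdot> (g \<rhd> A)" by simp_all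
  from g2 have g' [typing]: "g' \<in> hom C Y' (A \<otimes> Z')" by simp
  show "(m \<rhd> Z \<otimes> Z') \<cdot> (A \<lhd> \<zeta> \<rhd> Z') \<cdot> (((m \<rhd> Z) \<cdot> (A \<lhd> g) \<cdot> f) \<boxtimes> ((m \<rhd> Z') \<cdot> (A \<lhd> g') \<cdot> f'))
    = (m \<rhd> Z \<otimes> Z') \<cdot> (A \<lhd> ((m \<rhd> Z \<otimes> Z') \<cdot> (A \<lhd> \<zeta> \<rhd> Z') \<cdot> (g \<boxtimes> g'))) \<cdot> ((m \<rhd> Y \<otimes> Y') \<cdot> (A \<lhd> \<upsilon> \<rhd> Y') \<cdot> (f \<boxtimes> f'))"
    by (rule diagram_eq[OF eqs3[OF gl Z(3) m_assoc], where c = "[Rw 1 5 1, Up 3 1, Up 5 2,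
      Up 5 1, Up 6 1, Up 7 1, Rw 2 7 0, Rv 2 6 1, Up 2 1, Up 6 2, Rv 0 2 1, Up 5 1, Up 6 1,
      Rw 2 6 1, Rv 2 7 0, Up 7 4]"], (rule depicts typing)+, simp add: derivable_simps)
qed

lemma tmor_tensor_assoc:
  assumes "tmor (X, \<chi>) f (X', \<chi>')" "tmor (Y, \<upsilon>) g (Y', \<upsilon>')" "tmor (Z, \<zeta>) h (Z', \<zeta>')"
  shows "(m \<rhd> X' \<otimes> Y' \<otimes> Z') \<cdot> (A \<lhd> ((\<chi>' \<rhd> Y') \<cdot> (X' \<lhd> \<upsilon>')) \<rhd> Z') \<cdot> (((m \<rhd> X' \<otimes> Y') \<cdot> (A \<lhd> \<chi>' \<rhd> Y') \<cdot> (f \<boxtimes> g)) \<boxtimes> h)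
    = (m \<rhd> X' \<otimes> (Y' \<otimes> Z')) \<cdot> (A \<lhd> \<chi>' \<rhd> Y' \<otimes> Z') \<cdot> (f \<boxtimes> ((m \<rhd> Y' \<otimes> Z') \<cdot> (A \<lhd> \<upsilon>' \<rhd> Z') \<cdot> (g \<boxtimes> h)))"
proof -
  note f1 = tmorD[OF assms(1)] and g1 = tmorD[OF assms(2)] and h1 = tmorD[OF assms(3)]
  note X [typing] = transferD[OF f1(1)]
  note Y [typing] = transferD[OF g1(1)]
  note Z [typing] = transferD[OF h1(1)]
  note X' [typing] = transferD[OF f1(2)]
  note Y' [typing] = transferD[OF g1(2)]
  note Z' [typing] = transferD[OF h1(2)]
  from f1 have f [typing]: "f \<in> hom C X (A \<otimes> X')" by simp
  from g1 have g [typing]: "g \<in> hom C Y (A \<otimes> Y')" by simp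
  from h1 have h [typing]: "h \<in> hom C Z (A \<otimes> Z')" by simp
  show "(m \<rhd> X' \<otimes> Y' \<otimes> Z') \<cdot> (A \<lhd> ((\<chi>' \<rhd> Y') \<cdot> (X' \<lhd> \<upsilon>')) \<rhd> Z') \<cdot> (((m \<rhd> X' \<otimes> Y') \<cdot> (A \<lhd> \<chi>' \<rhd> Y') \<cdot> (f \<boxtimes> g)) \<boxtimes> h)
    = (m \<rhd> X' \<otimes> (Y' \<otimes> Z')) \<cdot> (A \<lhd> \<chi>' \<rhd> Y' \<otimes> Z') \<cdot> (f \<boxtimes> ((m \<rhd> Y' \<otimes> Z') \<cdot> (A \<lhd> \<upsilon>' \<rhd> Z') \<cdot> (g \<boxtimes> h)))"
    by (rule diagram_eq[OF eqs2[OF X'(3) m_assoc], where c = "[Up 4 1, Up 5 1, Up 6 1,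
      Rw 1 6 0, Up 3 1, Up 4 1, Rv 0 4 1]"], (rule depicts typing)+, simp add: derivable_simps)
qed

end

context moncat_algebra
begin

lemma transfer_tensor_assoc:
  assumes "tobj X \<chi>" "tobj Y \<upsilon>" "tobj Z \<zeta>"
  shows "(((\<chi> \<rhd> Y) \<cdot> (X \<lhd> \<upsilon>)) \<rhd> Z) \<cdot> (X \<otimes> Y \<lhd> \<zeta>) = (\<chi> \<rhd> Y \<otimes> Z) \<cdot> (X \<lhd> ((\<upsilon> \<rhd> Z) \<cdot> (Y \<lhd> \<zeta>)))"
proof -
  note X [typing] = transferD[OF assms(1)]
  note Y [typing] = transferD[OF assms(2)]
  note Z [typing] = transferD[OF assms(3)]
  show "(((\<chi> \<rhd> Y) \<cdot> (X \<lhd> \<upsilon>)) \<rhd> Z) \<cdot> (X \<otimes> Y \<lhd> \<zeta>) = (\<chi> \<rhd> Y \<otimes> Z) \<cdot> (X \<lhd> ((\<upsilon> \<rhd> Z) \<cdot> (Y \<lhd> \<zeta>)))"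
    by (rule diagram_eq[OF eqs0, where c = "[]"], (rule depicts typing)+,
      simp add: derivable_simps)
qed

lemma transfer_tensor_unit:
  assumes "tobj X \<chi>"
  shows "(\<chi> \<rhd> tunit C) \<cdot> (X \<lhd> Ident C A) = \<chi>" "(Ident C A \<rhd> X) \<cdot> (tunit C \<lhd> \<chi>) = \<chi>"
proof -
  note X [typing] = transferD[OF assms(1)]
  show "(\<chi> \<rhd> tunit C) \<cdot> (X \<lhd> Ident C A) = \<chi>"
    by (rule diagram_eq[OF eqs0, where c = "[]"], (rule depicts typing)+,
      simp add: derivable_simps)
  show "(Ident C A \<rhd> X) \<cdot> (tunit C \<lhd> \<chi>) = \<chi>"
    by (rule diagram_eq[OF eqs0, where c = "[]"], (rule depicts typing)+,
      simp add: derivable_simps)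
qed

lemma tmor_tensor_unit:
  assumes "X \<in> Obj C" "Y \<in> Obj C" "f \<in> hom C X (A \<otimes> Y)" "tobj Y \<upsilon>"
  shows "(m \<rhd> tunit C \<otimes> Y) \<cdot> (A \<lhd> (Ident C A \<rhd> Y)) \<cdot> ((\<eta> \<rhd> tunit C) \<boxtimes> f) = f"
    "(m \<rhd> Y \<otimes> tunit C) \<cdot> (A \<lhd> \<upsilon> \<rhd> tunit C) \<cdot> (f \<boxtimes> (\<eta> \<rhd> tunit C)) = f"
proof -
  note \<upsilon> [typing] = transferD[OF assms(4)]
  from assms have X [typing]: "X \<in> Obj C" and Y [typing]: "Y \<in> Obj C" and f [typing]: "f \<in> hom C X (A \<otimes> Y)" by simp_all
  show "(m \<rhd> tunit C \<otimes> Y) \<cdot> (A \<lhd> (Ident C A \<rhd> Y)) \<cdot> ((\<eta> \<rhd> tunit C) \<boxtimes> f) = f"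
    by (rule diagram_eq[OF eqs1[OF \<eta>l], where c = "[Up 1 1, Rw 0 1 0]"],
      (rule depicts typing)+, simp add: derivable_simps)
  show "(m \<rhd> Y \<otimes> tunit C) \<cdot> (A \<lhd> \<upsilon> \<rhd> tunit C) \<cdot> (f \<boxtimes> (\<eta> \<rhd> tunit C)) = f"
    by (rule diagram_eq[OF eqs2[OF \<upsilon>(4) \<eta>r], where c = "[Rw 0 1 1, Rw 1 1 0]"],
      (rule depicts typing)+, simp add: derivable_simps)
qed

lemma strict_monoidal_Tsharp: "strict_monoidal (Tsharp C A m \<eta>)"
proof -
  let ?T = "Tsharp C A m \<eta>"
  have arrE: thesis if "F \<in> Arr ?T" "\<And>X \<chi> f Y \<upsilon>. F = ((X, \<chi>), f, (Y, \<upsilon>)) \<Longrightarrow> tmor (X, \<chi>) f (Y, \<upsilon>) \<Longrightarrow> thesis"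
    for F thesis using that by (cases F) (auto simp: Tsharp_simps)
  note S = Tsharp_simps hom_def
  note obj = tmorD(1,2)
  have cat: "is_category ?T"
    unfolding is_category_def
  proof (intro conjI ballI impI)
    fix F assume F: "F \<in> Arr ?T"
    then show "Dom ?T F \<in> Obj ?T" "Cod ?T F \<in> Obj ?T" by (auto elim!: arrE simp: S dest: obj)
    from F show "Comp ?T F (Ident ?T (Dom ?T F)) = F" "Comp ?T (Ident ?T (Cod ?T F)) F = F"
      by (auto elim!: arrE simp: S tmor_comp_id)
  next
    fix P assume "P \<in> Obj ?T"
    then show "Ident ?T P \<in> hom ?T P P" by (cases P) (auto simp: S tmor_id)
  next
    fix F G assume "F \<in> Arr ?T" "G \<in> Arr ?T" "Cod ?T F = Dom ?T G"
    then show "Comp ?T G F \<in> hom ?T (Dom ?T F) (Cod ?T G)"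
      by (auto elim!: arrE simp: S tmor_comp)
  next
    fix F G H assume "F \<in> Arr ?T" "G \<in> Arr ?T" "H \<in> Arr ?T" "Cod ?T F = Dom ?T G" "Cod ?T G = Dom ?T H"
    then show "Comp ?T (Comp ?T H G) F = Comp ?T H (Comp ?T G F)"
      by (auto elim!: arrE simp: S intro: tmor_comp_assoc)
  qed
  show ?thesis
    unfolding strict_monoidal_def
  proof (intro conjI ballI impI)
    show "is_category ?T" by (rule cat)
    show "tunit ?T \<in> Obj ?T" by (simp add: S transfer_unit)
  next
    fix P Q assume "P \<in> Obj ?T" "Q \<in> Obj ?T"
    then show "tensO ?T P Q \<in> Obj ?T" "tensA ?T (Ident ?T P) (Ident ?T Q) = Ident ?T (tensO ?T P Q)"
      by (auto simp: S transfer_tensor_tobj tmor_tensor_id transfer_tensor_def)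
  next
    fix F G assume "F \<in> Arr ?T" "G \<in> Arr ?T"
    then show "tensA ?T F G \<in> hom ?T (tensO ?T (Dom ?T F) (Dom ?T G)) (tensO ?T (Cod ?T F) (Cod ?T G))"
      by (auto elim!: arrE simp: S tmor_tensor transfer_tensor_def)
  next
    fix F F' G G' assume "F \<in> Arr ?T" "F' \<in> Arr ?T" "G \<in> Arr ?T" "G' \<in> Arr ?T"
      "Cod ?T F = Dom ?T F'" "Cod ?T G = Dom ?T G'"
    then show "tensA ?T (Comp ?T F' F) (Comp ?T G' G) = Comp ?T (tensA ?T F' G') (tensA ?T F G)"
      by (auto elim!: arrE simp: S transfer_tensor_def intro: tmor_interchange)
  next
    fix P Q R assume PQR: "P \<in> Obj ?T" "Q \<in> Obj ?T" "R \<in> Obj ?T"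
    then show "tensO ?T (tensO ?T P Q) R = tensO ?T P (tensO ?T Q R)"
      using transfer_tensor_assoc by (auto simp: S intro!: tens_obj_assoc intro: transferD(1))
    show "assoc ?T P Q R = Ident ?T (tensO ?T (tensO ?T P Q) R)"
      by (cases P, cases Q, cases R) (simp add: S transfer_tensor_def)
  next
    fix P assume "P \<in> Obj ?T"
    then show "tensO ?T (tunit ?T) P = P" "tensO ?T P (tunit ?T) = P"
      using transfer_tensor_unit by (auto simp: S intro!: tens_obj_unit intro: transferD(1))
    show "lunit ?T P = Ident ?T P" "runit ?T P = Ident ?T P" by (auto simp: S)
  next
    fix F G H assume "F \<in> Arr ?T" "G \<in> Arr ?T" "H \<in> Arr ?T"
    then obtain X \<chi> f X' \<chi>' Y \<upsilon> g Y' \<upsilon>' Z \<zeta> h Z' \<zeta>'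
      where E: "F = ((X, \<chi>), f, (X', \<chi>'))" "G = ((Y, \<upsilon>), g, (Y', \<upsilon>'))" "H = ((Z, \<zeta>), h, (Z', \<zeta>'))"
        and M: "tmor (X, \<chi>) f (X', \<chi>')" "tmor (Y, \<upsilon>) g (Y', \<upsilon>')" "tmor (Z, \<zeta>) h (Z', \<zeta>')"
      by (metis arrE)
    note t = tmorD(1)[OF M(1)] tmorD(1)[OF M(2)] tmorD(1)[OF M(3)]
    note t' = tmorD(2)[OF M(1)] tmorD(2)[OF M(2)] tmorD(2)[OF M(3)]
    note o = transferD(1)[OF t(1)] transferD(1)[OF t(2)] transferD(1)[OF t(3)]
    note o' = transferD(1)[OF t'(1)] transferD(1)[OF t'(2)] transferD(1)[OF t'(3)]
    show "tensA ?T (tensA ?T F G) H = tensA ?T F (tensA ?T G H)"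
      using transfer_tensor_assoc[OF t] transfer_tensor_assoc[OF t'] tmor_tensor_assoc[OF M]
        tens_obj_assoc[OF o] tens_obj_assoc[OF o']
      unfolding E by (simp add: S transfer_tensor_def)
  next
    fix F assume "F \<in> Arr ?T"
    then obtain X \<chi> f Y \<upsilon> where E: "F = ((X, \<chi>), f, (Y, \<upsilon>))" and M: "tmor (X, \<chi>) f (Y, \<upsilon>)" by (metis arrE)
    note t = tmorD(1,2)[OF M]
    note o = transferD(1)[OF t(1)] transferD(1)[OF t(2)]
    show "tensA ?T (Ident ?T (tunit ?T)) F = F" "tensA ?T F (Ident ?T (tunit ?T)) = F"
      using tmor_tensor_unit[OF o tmorD(3)[OF M] t(2)] transfer_tensor_unit[OF t(1)] transfer_tensor_unit[OF t(2)] o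
      unfolding E by (simp_all add: S transfer_tensor_def)
  qed
qed

lemma tmor_whisker_left:
  assumes "tobj X \<chi>" "Y \<in> Obj C" "Z \<in> Obj C" "f \<in> hom C Y (A \<otimes> Z)"
  shows "(m \<rhd> X \<otimes> Z) \<cdot> (A \<lhd> \<chi> \<rhd> Z) \<cdot> ((\<eta> \<rhd> X) \<boxtimes> f) = (\<chi> \<rhd> Z) \<cdot> (X \<lhd> f)"
proof -
  note X [typing] = transferD[OF assms(1)]
  from assms have Y [typing]: "Y \<in> Obj C" and Z [typing]: "Z \<in> Obj C" and f [typing]: "f \<in> hom C Y (A \<otimes> Z)" by simp_all
  show "(m \<rhd> X \<otimes> Z) \<cdot> (A \<lhd> \<chi> \<rhd> Z) \<cdot> ((\<eta> \<rhd> X) \<boxtimes> f) = (\<chi> \<rhd> Z) \<cdot> (X \<lhd> f)"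
    by (rule diagram_eq[OF eqs1[OF \<eta>l], where c = "[Up 1 1, Up 2 1, Rw 0 2 0]"],
      (rule depicts typing)+, simp add: derivable_simps)
qed

lemma tmor_whisker_right:
  assumes "X \<in> Obj C" "Y \<in> Obj C" "tobj Z \<zeta>" "f \<in> hom C Y (A \<otimes> Z)"
  shows "(m \<rhd> Z \<otimes> X) \<cdot> (A \<lhd> \<zeta> \<rhd> X) \<cdot> (f \<boxtimes> (\<eta> \<rhd> X)) = f \<rhd> X"
proof -
  note Z [typing] = transferD[OF assms(3)]
  from assms have X [typing]: "X \<in> Obj C" and Y [typing]: "Y \<in> Obj C" and f [typing]: "f \<in> hom C Y (A \<otimes> Z)" by simp_all
  show "(m \<rhd> Z \<otimes> X) \<cdot> (A \<lhd> \<zeta> \<rhd> X) \<cdot> (f \<boxtimes> (\<eta> \<rhd> X)) = f \<rhd> X"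
    by (rule diagram_eq[OF eqs2[OF Z(4) \<eta>r], where c = "[Rw 0 1 1, Rw 1 1 0]"],
      (rule depicts typing)+, simp add: derivable_simps)
qed

end

locale cowreath_data = moncat_algebra +
  fixes X \<psi> \<delta> \<epsilon>
  assumes cowreath: "cowreath C A m \<eta> X \<psi> \<delta> \<epsilon>"
begin

definition casimir :: "'b \<Rightarrow> bool" where
  "casimir B \<longleftrightarrow> B \<in> hom C (X \<otimes> X) A \<and>
     m \<cdot> (A \<lhd> B) \<cdot> ((\<psi> \<rhd> X) \<cdot> (X \<lhd> \<psi>)) = m \<cdot> (B \<rhd> A) \<and>
     (m \<rhd> X) \<cdot> (A \<lhd> B \<rhd> X) \<cdot> ((\<psi> \<rhd> X \<otimes> X) \<cdot> (X \<lhd> \<delta>)) = (m \<rhd> X) \<cdot> (A \<lhd> (\<psi> \<cdot> (X \<lhd> B))) \<cdot> (\<delta> \<rhd> X) \<and>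
     m \<cdot> (A \<lhd> B) \<cdot> \<delta> = \<epsilon>"

lemma tobj: "tobj X \<psi>"
  and cowreath_eqs: "\<delta> \<in> hom C X (A \<otimes> (X \<otimes> X))" "\<epsilon> \<in> hom C X A"
    "(m \<rhd> X \<otimes> X) \<cdot> (A \<lhd> \<delta>) \<cdot> \<psi> = (m \<rhd> X \<otimes> X) \<cdot> (A \<lhd> ((\<psi> \<rhd> X) \<cdot> (X \<lhd> \<psi>))) \<cdot> (\<delta> \<rhd> A)"
    "m \<cdot> (A \<lhd> \<epsilon>) \<cdot> \<psi> = m \<cdot> (\<epsilon> \<rhd> A)"
    "(m \<rhd> X \<otimes> X \<otimes> X) \<cdot> (A \<lhd> \<delta> \<rhd> X) \<cdot> \<delta> = (m \<rhd> X \<otimes> X \<otimes> X) \<cdot> (A \<lhd> ((\<psi> \<rhd> X \<otimes> X) \<cdot> (X \<lhd> \<delta>))) \<cdot> \<delta>"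
    "(m \<rhd> X) \<cdot> (A \<lhd> \<epsilon> \<rhd> X) \<cdot> \<delta> = \<eta> \<rhd> X" "(m \<rhd> X) \<cdot> (A \<lhd> (\<psi> \<cdot> (X \<lhd> \<epsilon>))) \<cdot> \<delta> = \<eta> \<rhd> X"
  and coseparable_iff_casimir:
    "coseparable_coalgebra (Tsharp C A m \<eta>) (X, \<psi>) (cowreath_comult C X \<psi> \<delta>) (cowreath_counit C A X \<psi> \<epsilon>)
      \<longleftrightarrow> (\<exists>B. casimir B)"
proof -
  let ?T = "Tsharp C A m \<eta>" and ?K = "(X, \<psi>)"
  let ?D = "cowreath_comult C X \<psi> \<delta>" and ?e = "cowreath_counit C A X \<psi> \<epsilon>"
  interpret T: strict_moncat ?T by standard (rule strict_monoidal_Tsharp)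
  note S = Tsharp_simps cowreath_comult_def cowreath_counit_def transfer_tensor_def
    whiskL_def[of ?T] whiskR_def[of ?T]
  have co: "coalgebra ?T ?K ?D ?e" using cowreath by (simp add: cowreath_def)
  then show t: "tobj X \<psi>" by (simp add: coalgebra_def S)
  note X = transferD(1)[OF t]
  have XX [typing]: "X \<otimes> X \<in> Obj C" using X by simp
  have u: "tobj (tunit C) (Ident C A)" by (rule transfer_unit)
  have tt: "tobj (X \<otimes> X) ((\<psi> \<rhd> X) \<cdot> (X \<lhd> \<psi>))" by (rule transfer_tensor_tobj[OF t t])
  have "tmor ?K \<delta> (X \<otimes> X, (\<psi> \<rhd> X) \<cdot> (X \<lhd> \<psi>))" "tmor ?K \<epsilon> (tunit C, Ident C A)"
    using co by (auto simp: coalgebra_def S hom_def)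
  note d = tmorD[OF this(1)] and c = tmorD[OF this(2)]
  from d show \<delta> [typing]: "\<delta> \<in> hom C X (A \<otimes> (X \<otimes> X))" by simp
  from c have \<epsilon>1 [typing]: "\<epsilon> \<in> hom C X (A \<otimes> tunit C)" by simp
  with A show \<epsilon> [typing]: "\<epsilon> \<in> hom C X A" by simp
  from d show "(m \<rhd> X \<otimes> X) \<cdot> (A \<lhd> \<delta>) \<cdot> \<psi> = (m \<rhd> X \<otimes> X) \<cdot> (A \<lhd> ((\<psi> \<rhd> X) \<cdot> (X \<lhd> \<psi>))) \<cdot> (\<delta> \<rhd> A)" by simp
  have m1: "m \<rhd> tunit C = m" using tens_unit(2)[OF m] by (simp add: whiskR_def)
  have e1: "A \<lhd> Ident C A = Ident C (A \<otimes> A)" using tens_id[OF A A] by (simp add: whiskL_def)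
  from c(4) show "m \<cdot> (A \<lhd> \<epsilon>) \<cdot> \<psi> = m \<cdot> (\<epsilon> \<rhd> A)"
    using comp_id[OF m] by (simp add: m1 e1)
  have DK: "whiskR ?T ?D ?K = (transfer_tensor C ?K ?K, \<delta> \<rhd> X, transfer_tensor C (transfer_tensor C ?K ?K) ?K)"
    using tmor_whisker_right[OF X X tt \<delta>] by (simp add: S)
  have KD: "whiskL ?T ?K ?D = (transfer_tensor C ?K ?K, (\<psi> \<rhd> X \<otimes> X) \<cdot> (X \<lhd> \<delta>), transfer_tensor C ?K (transfer_tensor C ?K ?K))"
    using tmor_whisker_left[OF t X XX \<delta>] by (simp add: S)
  have eK: "whiskR ?T ?e ?K = (transfer_tensor C ?K ?K, \<epsilon> \<rhd> X, transfer_tensor C (tunit C, Ident C A) ?K)"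
    using tmor_whisker_right[OF X X u \<epsilon>1] by (simp add: S)
  have Ke: "whiskL ?T ?K ?e = (transfer_tensor C ?K ?K, \<psi> \<cdot> (X \<lhd> \<epsilon>), transfer_tensor C ?K (tunit C, Ident C A))"
  proof -
    have "\<psi> \<rhd> tunit C = \<psi>" using tens_unit(2)[OF transferD(2)[OF t]] by (simp add: whiskR_def)
    then show ?thesis using tmor_whisker_left[OF t X unit_obj \<epsilon>1] by (simp add: S)
  qed
  note eqs = co[unfolded T.coalgebra_strict, THEN conjunct2, THEN conjunct2, THEN conjunct2]
  show "(m \<rhd> X \<otimes> X \<otimes> X) \<cdot> (A \<lhd> \<delta> \<rhd> X) \<cdot> \<delta> = (m \<rhd> X \<otimes> X \<otimes> X) \<cdot> (A \<lhd> ((\<psi> \<rhd> X \<otimes> X) \<cdot> (X \<lhd> \<delta>))) \<cdot> \<delta>"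
    using eqs X by (simp add: DK KD) (simp add: S tens_obj_assoc)
  show "(m \<rhd> X) \<cdot> (A \<lhd> \<epsilon> \<rhd> X) \<cdot> \<delta> = \<eta> \<rhd> X" "(m \<rhd> X) \<cdot> (A \<lhd> (\<psi> \<cdot> (X \<lhd> \<epsilon>))) \<cdot> \<delta> = \<eta> \<rhd> X"
    using eqs X by (simp_all add: eK Ke) (simp_all add: S)
  let ?B = "\<lambda>B. (transfer_tensor C ?K ?K, B, (tunit C, Ident C A))"
  have BK: "whiskR ?T (?B B) ?K = (transfer_tensor C (transfer_tensor C ?K ?K) ?K, B \<rhd> X, transfer_tensor C (tunit C, Ident C A) ?K)"
    and KB: "whiskL ?T ?K (?B B) = (transfer_tensor C ?K (transfer_tensor C ?K ?K), \<psi> \<cdot> (X \<lhd> B), transfer_tensor C ?K (tunit C, Ident C A))"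
    and Bm: "m \<cdot> (A \<lhd> B) \<cdot> ((\<psi> \<rhd> X) \<cdot> (X \<lhd> \<psi>)) = (m \<rhd> tunit C) \<cdot> (A \<lhd> Ident C A) \<cdot> (B \<rhd> A) \<longleftrightarrow> m \<cdot> (A \<lhd> B) \<cdot> ((\<psi> \<rhd> X) \<cdot> (X \<lhd> \<psi>)) = m \<cdot> (B \<rhd> A)"
    if B [typing]: "B \<in> hom C (X \<otimes> X) (A \<otimes> tunit C)" for B
  proof -
    show "whiskR ?T (?B B) ?K = (transfer_tensor C (transfer_tensor C ?K ?K) ?K, B \<rhd> X, transfer_tensor C (tunit C, Ident C A) ?K)"
      using tmor_whisker_right[OF X XX u B] by (simp add: S)
    have "\<psi> \<rhd> tunit C = \<psi>" using tens_unit(2)[OF transferD(2)[OF t]] by (simp add: whiskR_def)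
    then show "whiskL ?T ?K (?B B) = (transfer_tensor C ?K (transfer_tensor C ?K ?K), \<psi> \<cdot> (X \<lhd> B), transfer_tensor C ?K (tunit C, Ident C A))"
      using tmor_whisker_left[OF t XX unit_obj B] by (simp add: S)
    show "m \<cdot> (A \<lhd> B) \<cdot> ((\<psi> \<rhd> X) \<cdot> (X \<lhd> \<psi>)) = (m \<rhd> tunit C) \<cdot> (A \<lhd> Ident C A) \<cdot> (B \<rhd> A) \<longleftrightarrow> m \<cdot> (A \<lhd> B) \<cdot> ((\<psi> \<rhd> X) \<cdot> (X \<lhd> \<psi>)) = m \<cdot> (B \<rhd> A)"
      using comp_id[OF m] by (simp add: m1 e1)
  qed
  have uo: "transfer_tensor C (tunit C, Ident C A) ?K = transfer_tensor C ?K (tunit C, Ident C A)"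
    using transfer_tensor_unit[OF t] X by (simp add: S)
  have oa: "transfer_tensor C (transfer_tensor C ?K ?K) ?K = transfer_tensor C ?K (transfer_tensor C ?K ?K)"
    using transfer_tensor_assoc[OF t t t] X by (simp add: S tens_obj_assoc)
  have iff: "(?B B \<in> hom ?T (tensO ?T ?K ?K) (tunit ?T) \<and>
      Comp ?T (whiskR ?T (?B B) ?K) (whiskL ?T ?K ?D) = Comp ?T (whiskL ?T ?K (?B B)) (whiskR ?T ?D ?K)
      \<and> Comp ?T (?B B) ?D = ?e) \<longleftrightarrow> casimir B" (is "?l \<longleftrightarrow> ?r") for B
  proof -
    have B [typing]: "B \<in> hom C (X \<otimes> X) (A \<otimes> tunit C)" if "?l \<or> ?r"
      using that A by (auto simp: casimir_def S hom_def[of ?T] dest: tmorD(3))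
    have "?B B \<in> hom ?T (tensO ?T ?K ?K) (tunit ?T) \<longleftrightarrow> B \<in> hom C (X \<otimes> X) (A \<otimes> tunit C) \<and>
        m \<cdot> (A \<lhd> B) \<cdot> ((\<psi> \<rhd> X) \<cdot> (X \<lhd> \<psi>)) = m \<cdot> (B \<rhd> A)"
      using tt u Bm[of B] by (auto simp: S hom_def[of ?T] tmor_def m1)
    moreover have "Comp ?T (?B B) ?D = ?e \<longleftrightarrow> m \<cdot> (A \<lhd> B) \<cdot> \<delta> = \<epsilon>" by (simp add: S m1)
    moreover have "Comp ?T (whiskR ?T (?B B) ?K) (whiskL ?T ?K ?D) = Comp ?T (whiskL ?T ?K (?B B)) (whiskR ?T ?D ?K)
       \<longleftrightarrow> (m \<rhd> X) \<cdot> (A \<lhd> B \<rhd> X) \<cdot> ((\<psi> \<rhd> X \<otimes> X) \<cdot> (X \<lhd> \<delta>)) = (m \<rhd> X) \<cdot> (A \<lhd> (\<psi> \<cdot> (X \<lhd> B))) \<cdot> (\<delta> \<rhd> X)"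
      if "B \<in> hom C (X \<otimes> X) (A \<otimes> tunit C)"
      unfolding BK[OF that] KB[OF that] DK KD uo oa Tsharp_simps using X by (simp add: S)
    ultimately show ?thesis using A B unfolding casimir_def by auto
  qed
  show "coseparable_coalgebra ?T ?K ?D ?e \<longleftrightarrow> (\<exists>B. casimir B)"
  proof
    assume "coseparable_coalgebra ?T ?K ?D ?e"
    from T.coseparable_casimir[OF this] obtain F where F: "F \<in> hom ?T (tensO ?T ?K ?K) (tunit ?T)"
      "Comp ?T (whiskR ?T F ?K) (whiskL ?T ?K ?D) = Comp ?T (whiskL ?T ?K F) (whiskR ?T ?D ?K)"
      "Comp ?T F ?D = ?e" by blast
    from F(1) obtain B where "F = ?B B" by (cases F) (auto simp: S hom_def[of ?T])
    with F iff[of B] show "\<exists>B. casimir B" by blast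
  next
    assume "\<exists>B. casimir B"
    then obtain B where "casimir B" by blast
    with iff[of B] T.casimir_coseparable[OF co, of "?B B"] show "coseparable_coalgebra ?T ?K ?D ?e" by blast
  qed
qed

end

section \<open>Entwined modules\<close>

context strict_moncat
begin

lemma generator_eq:
  assumes "left_tensor_generator C (tunit C)" "Y \<in> Obj C" "Z \<in> Obj C"
    "f \<in> hom C (Y \<otimes> Z) W" "g \<in> hom C (Y \<otimes> Z) W"
    "\<And>h. h \<in> hom C (tunit C) Y \<Longrightarrow> f \<cdot> (h \<rhd> Z) = g \<cdot> (h \<rhd> Z)"
  shows "f = g"
  using assms(1)[unfolded left_tensor_generator_def, THEN conjunct2, rule_format, OF assms(2,3) _ assms(4,5)]
    hom_objs(2)[OF assms(4)] assms(6) by blast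

end

context moncat_algebra
begin

abbreviation "rmod \<equiv> right_module C A m \<eta>"
abbreviation "linear \<equiv> right_linear C A"

lemma rmodD:
  assumes "rmod M \<mu>"
  shows "M \<in> Obj C" "\<mu> \<in> hom C (M \<otimes> A) M" "\<mu> \<cdot> (\<mu> \<rhd> A) = \<mu> \<cdot> (M \<lhd> m)" "\<mu> \<cdot> (M \<lhd> \<eta>) = Ident C M"
  using assms by (simp_all add: right_module_def)

lemma linearD:
  assumes "linear M \<mu> N \<nu> f"
  shows "f \<in> hom C M N" "f \<cdot> \<mu> = \<nu> \<cdot> (f \<rhd> A)"
  using assms by (simp_all add: right_linear_def)

lemma linear_id: "rmod M \<mu> \<Longrightarrow> linear M \<mu> M \<mu> (Ident C M)"
proof -
  assume "rmod M \<mu>"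
  note M [typing] = rmodD[OF this]
  have "Ident C M \<cdot> \<mu> = \<mu> \<cdot> (Ident C M \<rhd> A)"
    by (rule diagram_eq[OF eqs0, where c = "[]"], (rule depicts typing)+,
      simp add: derivable_simps)
  then show ?thesis using M(1) by (simp add: right_linear_def)
qed

lemma rmod_A: "rmod A m"
  using A m m_assoc \<eta>r by (simp add: right_module_def)

lemma free_rmod:
  assumes Y [typing]: "Y \<in> Obj C"
  shows "rmod (Y \<otimes> A) (Y \<lhd> m)"
proof -
  have "Y \<lhd> m \<in> hom C (Y \<otimes> A \<otimes> A) (Y \<otimes> A)" by (rule depicts_in, (rule depicts typing)+, simp)
  moreover have "(Y \<lhd> m) \<cdot> ((Y \<lhd> m) \<rhd> A) = (Y \<lhd> m) \<cdot> (Y \<otimes> A \<lhd> m)"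
    by (rule diagram_eq[OF eqs1[OF m_assoc], where c = "[Rw 0 0 1]"], (rule depicts typing)+,
      simp add: derivable_simps)
  moreover have "(Y \<lhd> m) \<cdot> (Y \<otimes> A \<lhd> \<eta>) = Ident C (Y \<otimes> A)"
    by (rule diagram_eq[OF eqs1[OF \<eta>r], where c = "[Rw 0 0 1]"], (rule depicts typing)+,
      simp add: derivable_simps)
  ultimately show ?thesis using Y A by (simp add: right_module_def)
qed

end

context cowreath_data
begin

lemma X: "X \<in> Obj C"
  and \<psi>: "\<psi> \<in> hom C (X \<otimes> A) (A \<otimes> X)"
  and \<psi>m: "\<psi> \<cdot> (X \<lhd> m) = (m \<rhd> X) \<cdot> (A \<lhd> \<psi>) \<cdot> (\<psi> \<rhd> A)"
  and \<psi>\<eta>: "\<psi> \<cdot> (X \<lhd> \<eta>) = \<eta> \<rhd> X"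
  by (fact transferD[OF tobj])+

lemmas \<delta> = cowreath_eqs(1) and \<epsilon> = cowreath_eqs(2) and \<delta>\<psi> = cowreath_eqs(3)
  and \<epsilon>\<psi> = cowreath_eqs(4) and \<delta>\<delta> = cowreath_eqs(5) and \<epsilon>\<delta> = cowreath_eqs(6) and \<delta>\<epsilon> = cowreath_eqs(7)

abbreviation "AX \<equiv> A \<otimes> X"
abbreviation "AXX \<equiv> A \<otimes> X \<otimes> X"

lemmas [typing] = X \<psi> \<delta> \<epsilon>

abbreviation "\<D> \<equiv> entwined_modules C A m \<eta> X \<psi> \<delta> \<epsilon>"
abbreviation "\<C> \<equiv> right_modules C A m \<eta>"
abbreviation "emod \<equiv> entwined_module C A m \<eta> X \<psi> \<delta> \<epsilon>"
definition colinear :: "'a \<Rightarrow> 'b \<Rightarrow> 'b \<Rightarrow> 'a \<Rightarrow> 'b \<Rightarrow> 'b \<Rightarrow> 'b \<Rightarrow> bool" where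
  "colinear M \<mu> \<rho> N \<nu> \<sigma> f \<longleftrightarrow> linear M \<mu> N \<nu> f \<and> (f \<rhd> X) \<cdot> \<rho> = \<sigma> \<cdot> f"

lemma emodD:
  assumes "emod M \<mu> \<rho>"
  shows "rmod M \<mu>" "M \<in> Obj C" "\<mu> \<in> hom C (M \<otimes> A) M" "\<mu> \<cdot> (\<mu> \<rhd> A) = \<mu> \<cdot> (M \<lhd> m)" "\<mu> \<cdot> (M \<lhd> \<eta>) = Ident C M"
    "\<rho> \<in> hom C M (M \<otimes> X)" "\<rho> \<cdot> \<mu> = (\<mu> \<rhd> X) \<cdot> (M \<lhd> \<psi>) \<cdot> (\<rho> \<rhd> A)"
    "(\<rho> \<rhd> X) \<cdot> \<rho> = (\<mu> \<rhd> X \<otimes> X) \<cdot> (M \<lhd> \<delta>) \<cdot> \<rho>" "\<mu> \<cdot> (M \<lhd> \<epsilon>) \<cdot> \<rho> = Ident C M"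
  using assms by (simp_all add: entwined_module_def right_module_def)

lemma colinearD:
  assumes "colinear M \<mu> \<rho> N \<nu> \<sigma> f"
  shows "linear M \<mu> N \<nu> f" "f \<in> hom C M N" "f \<cdot> \<mu> = \<nu> \<cdot> (f \<rhd> A)" "(f \<rhd> X) \<cdot> \<rho> = \<sigma> \<cdot> f"
  using assms by (simp_all add: right_linear_def colinear_def)

lemma cofree_emod:
  assumes "rmod M \<mu>"
  shows "emod (M \<otimes> X) ((\<mu> \<rhd> X) \<cdot> (M \<lhd> \<psi>)) ((\<mu> \<rhd> X \<otimes> X) \<cdot> (M \<lhd> \<delta>))"
proof -
  note M [typing] = rmodD[OF assms]
  have "(\<mu> \<rhd> X) \<cdot> (M \<lhd> \<psi>) \<in> hom C (M \<otimes> X \<otimes> A) (M \<otimes> X)"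
    by (rule depicts_in, (rule depicts typing)+, simp)
  moreover have "(\<mu> \<rhd> X) \<cdot> (M \<lhd> \<psi>) \<cdot> (((\<mu> \<rhd> X) \<cdot> (M \<lhd> \<psi>)) \<rhd> A) = (\<mu> \<rhd> X) \<cdot> (M \<lhd> \<psi>) \<cdot> (M \<otimes> X \<lhd> m)"
    by (rule diagram_eq[OF eqs2[OF \<psi>m M(3)], where c = "[Up 2 1, Rw 1 2 0, Rv 0 0 1]"],
      (rule depicts typing)+, simp add: derivable_simps)
  moreover have "(\<mu> \<rhd> X) \<cdot> (M \<lhd> \<psi>) \<cdot> (M \<otimes> X \<lhd> \<eta>) = Ident C (M \<otimes> X)"
    by (rule diagram_eq[OF eqs2[OF \<psi>\<eta> M(4)], where c = "[Rw 0 0 1, Rw 1 0 0]"],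
      (rule depicts typing)+, simp add: derivable_simps)
  ultimately have "rmod (M \<otimes> X) ((\<mu> \<rhd> X) \<cdot> (M \<lhd> \<psi>))" using M(1) X by (simp add: right_module_def)
  moreover have "(\<mu> \<rhd> X \<otimes> X) \<cdot> (M \<lhd> \<delta>) \<in> hom C (M \<otimes> X) (M \<otimes> X \<otimes> X)"
    by (rule depicts_in, (rule depicts typing)+, simp)
  moreover have "(\<mu> \<rhd> X \<otimes> X) \<cdot> (M \<lhd> \<delta>) \<cdot> ((\<mu> \<rhd> X) \<cdot> (M \<lhd> \<psi>))
      = (((\<mu> \<rhd> X) \<cdot> (M \<lhd> \<psi>)) \<rhd> X) \<cdot> (M \<otimes> X \<lhd> \<psi>) \<cdot> (((\<mu> \<rhd> X \<otimes> X) \<cdot> (M \<lhd> \<delta>)) \<rhd> A)"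
        by (rule diagram_eq[OF eqs2[OF \<delta>\<psi> M(3)], where c = "[Up 2 1, Rw 1 2 0, Rw 0 0 1,
          Rv 1 3 0, Up 3 2]"], (rule depicts typing)+, simp add: derivable_simps)
  moreover have "(((\<mu> \<rhd> X \<otimes> X) \<cdot> (M \<lhd> \<delta>)) \<rhd> X) \<cdot> ((\<mu> \<rhd> X \<otimes> X) \<cdot> (M \<lhd> \<delta>))
      = (((\<mu> \<rhd> X) \<cdot> (M \<lhd> \<psi>)) \<rhd> X \<otimes> X) \<cdot> (M \<otimes> X \<lhd> \<delta>) \<cdot> ((\<mu> \<rhd> X \<otimes> X) \<cdot> (M \<lhd> \<delta>))"
        by (rule diagram_eq[OF eqs2[OF \<delta>\<delta> M(3)], where c = "[Up 2 1, Rw 1 2 0, Rw 0 0 1,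
          Rv 1 3 0, Up 3 2]"], (rule depicts typing)+, simp add: derivable_simps)
  moreover have "(\<mu> \<rhd> X) \<cdot> (M \<lhd> \<psi>) \<cdot> (M \<otimes> X \<lhd> \<epsilon>) \<cdot> ((\<mu> \<rhd> X \<otimes> X) \<cdot> (M \<lhd> \<delta>)) = Ident C (M \<otimes> X)"
    by (rule diagram_eq[OF eqs3[OF \<delta>\<epsilon> M(3) M(4)], where c = "[Up 2 1, Up 3 1, Rw 1 3 0,
      Rw 0 0 1, Rw 2 0 0]"], (rule depicts typing)+, simp add: derivable_simps)
  ultimately show ?thesis by (simp add: entwined_module_def)
qed

lemma cofree_colinear:
  assumes "rmod M \<mu>" "rmod N \<nu>" "linear M \<mu> N \<nu> f"
  shows "colinear (M \<otimes> X) ((\<mu> \<rhd> X) \<cdot> (M \<lhd> \<psi>)) ((\<mu> \<rhd> X \<otimes> X) \<cdot> (M \<lhd> \<delta>))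
     (N \<otimes> X) ((\<nu> \<rhd> X) \<cdot> (N \<lhd> \<psi>)) ((\<nu> \<rhd> X \<otimes> X) \<cdot> (N \<lhd> \<delta>)) (f \<rhd> X)"
proof -
  note M [typing] = rmodD[OF assms(1)]
  note N [typing] = rmodD[OF assms(2)]
  note f [typing] = linearD[OF assms(3)]
  have "f \<rhd> X \<in> hom C (M \<otimes> X) (N \<otimes> X)" by (rule depicts_in, (rule depicts typing)+, simp)
  moreover have "(f \<rhd> X) \<cdot> ((\<mu> \<rhd> X) \<cdot> (M \<lhd> \<psi>)) = (\<nu> \<rhd> X) \<cdot> (N \<lhd> \<psi>) \<cdot> (f \<rhd> X \<rhd> A)"
    by (rule diagram_eq[OF eqs1[OF f(2)], where c = "[Rw 0 1 0, Up 1 1]"],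
      (rule depicts typing)+, simp add: derivable_simps)
  moreover have "(f \<rhd> X \<rhd> X) \<cdot> ((\<mu> \<rhd> X \<otimes> X) \<cdot> (M \<lhd> \<delta>)) = (\<nu> \<rhd> X \<otimes> X) \<cdot> (N \<lhd> \<delta>) \<cdot> (f \<rhd> X)"
    by (rule diagram_eq[OF eqs1[OF f(2)], where c = "[Rw 0 1 0, Up 1 1]"],
      (rule depicts typing)+, simp add: derivable_simps)
  ultimately show ?thesis by (simp add: colinear_def right_linear_def)
qed

lemma coaction_colinear:
  assumes "emod M \<mu> \<rho>"
  shows "colinear M \<mu> \<rho> (M \<otimes> X) ((\<mu> \<rhd> X) \<cdot> (M \<lhd> \<psi>)) ((\<mu> \<rhd> X \<otimes> X) \<cdot> (M \<lhd> \<delta>)) \<rho>"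
  using emodD[OF assms] by (simp add: colinear_def right_linear_def)

lemma coaction_counit_linear:
  assumes "rmod M \<mu>"
  shows "linear (M \<otimes> X) ((\<mu> \<rhd> X) \<cdot> (M \<lhd> \<psi>)) M \<mu> (\<mu> \<cdot> (M \<lhd> \<epsilon>))"
proof -
  note M [typing] = rmodD[OF assms(1)]
  have "\<mu> \<cdot> (M \<lhd> \<epsilon>) \<in> hom C (M \<otimes> X) M" by (rule depicts_in, (rule depicts typing)+, simp)
  moreover have "\<mu> \<cdot> (M \<lhd> \<epsilon>) \<cdot> ((\<mu> \<rhd> X) \<cdot> (M \<lhd> \<psi>)) = \<mu> \<cdot> ((\<mu> \<cdot> (M \<lhd> \<epsilon>)) \<rhd> A)"
    by (rule diagram_eq[OF eqs2[OF \<epsilon>\<psi> M(3)], where c = "[Up 2 1, Rw 1 2 0, Rw 0 0 1,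
      Rv 1 1 0]"], (rule depicts typing)+, simp add: derivable_simps)
  ultimately show ?thesis by (simp add: right_linear_def)
qed

lemma entwined_simps:
  "Obj \<D> = {(M, \<mu>, \<rho>). emod M \<mu> \<rho>}"
  "F \<in> hom \<D> (M, \<mu>, \<rho>) (N, \<nu>, \<sigma>) \<longleftrightarrow>
     (\<exists>f'. F = ((M, \<mu>, \<rho>), f', (N, \<nu>, \<sigma>)) \<and> emod M \<mu> \<rho> \<and> emod N \<nu> \<sigma> \<and> colinear M \<mu> \<rho> N \<nu> \<sigma> f')"
  "Ident \<D> (M, \<mu>, \<rho>) = ((M, \<mu>, \<rho>), Ident C M, (M, \<mu>, \<rho>))"
  "Comp \<D> (Q, g, R) (P, f, Q) = (P, g \<cdot> f, R)"
  by (auto simp: entwined_modules_def hom_def colinear_def)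

lemma right_modules_simps:
  "Obj \<C> = {(M, \<mu>). rmod M \<mu>}"
  "F \<in> hom \<C> (M, \<mu>) (N, \<nu>) \<longleftrightarrow>
     (\<exists>f'. F = ((M, \<mu>), f', (N, \<nu>)) \<and> rmod M \<mu> \<and> rmod N \<nu> \<and> linear M \<mu> N \<nu> f')"
  "Ident \<C> (M, \<mu>) = ((M, \<mu>), Ident C M, (M, \<mu>))"
  "Comp \<C> (Q', g, R) (P, f, Q) = (P, g \<cdot> f, R)"
  by (auto simp: right_modules_def hom_def)

lemma forget_functor:
  "is_functor \<D> \<C> forget_obj forget_arr"
  unfolding is_functor_def
  by (auto simp: entwined_simps right_modules_simps forget_obj_def forget_arr_def dest: emodD colinearD)
     (auto simp: entwined_modules_def right_modules_simps hom_def forget_obj_def right_modules_def colinear_def dest: emodD)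

lemma colinear_id: "emod M \<mu> \<rho> \<Longrightarrow> colinear M \<mu> \<rho> M \<mu> \<rho> (Ident C M)"
proof -
  assume e: "emod M \<mu> \<rho>"
  note M [typing] = emodD[OF e]
  have "(Ident C M \<rhd> X) \<cdot> \<rho> = \<rho> \<cdot> Ident C M"
    by (rule diagram_eq[OF eqs0, where c = "[]"], (rule depicts typing)+,
      simp add: derivable_simps)
  then show ?thesis using linear_id emodD(1)[OF e] by (simp add: colinear_def)
qed

end

section \<open>Separability of the forgetful functor\<close>

lemma separable_functorE:
  assumes "separable_functor D E Fo Fa"
  obtains \<phi> where
    "\<And>P Q G. P \<in> Obj D \<Longrightarrow> Q \<in> Obj D \<Longrightarrow> G \<in> hom E (Fo P) (Fo Q) \<Longrightarrow> \<phi> P Q G \<in> hom D P Q"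
    "\<And>P Q F. P \<in> Obj D \<Longrightarrow> Q \<in> Obj D \<Longrightarrow> F \<in> hom D P Q \<Longrightarrow> \<phi> P Q (Fa F) = F"
    "\<And>P P' Q Q' U V G. P \<in> Obj D \<Longrightarrow> P' \<in> Obj D \<Longrightarrow> Q \<in> Obj D \<Longrightarrow> Q' \<in> Obj D \<Longrightarrow>
       U \<in> hom D P' P \<Longrightarrow> V \<in> hom D Q Q' \<Longrightarrow> G \<in> hom E (Fo P) (Fo Q) \<Longrightarrow>
       \<phi> P' Q' (Comp E (Comp E (Fa V) G) (Fa U)) = Comp D (Comp D V (\<phi> P Q G)) U"
proof -
  from assms obtain \<phi> where
    "\<forall>P \<in> Obj D. \<forall>Q \<in> Obj D. \<forall>G \<in> hom E (Fo P) (Fo Q). \<phi> P Q G \<in> hom D P Q"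
    and "\<forall>P \<in> Obj D. \<forall>Q \<in> Obj D. \<forall>F \<in> hom D P Q. \<phi> P Q (Fa F) = F"
    and "\<forall>P \<in> Obj D. \<forall>P' \<in> Obj D. \<forall>Q \<in> Obj D. \<forall>Q' \<in> Obj D.
       \<forall>U \<in> hom D P' P. \<forall>V \<in> hom D Q Q'. \<forall>G \<in> hom E (Fo P) (Fo Q).
       \<phi> P' Q' (Comp E (Comp E (Fa V) G) (Fa U)) = Comp D (Comp D V (\<phi> P Q G)) U"
    unfolding separable_functor_def by (elim conjE exE) (rule that)
  from that[of \<phi>, OF this(1)[rule_format] this(2)[rule_format] this(3)[rule_format]]
  show thesis by blast
qed

context cowreath_data
begin

lemma casimirD:
  assumes "casimir B"
  shows "B \<in> hom C (X \<otimes> X) A"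
    "m \<cdot> (A \<lhd> B) \<cdot> ((\<psi> \<rhd> X) \<cdot> (X \<lhd> \<psi>)) = m \<cdot> (B \<rhd> A)"
    "(m \<rhd> X) \<cdot> (A \<lhd> B \<rhd> X) \<cdot> ((\<psi> \<rhd> X \<otimes> X) \<cdot> (X \<lhd> \<delta>)) = (m \<rhd> X) \<cdot> (A \<lhd> (\<psi> \<cdot> (X \<lhd> B))) \<cdot> (\<delta> \<rhd> X)"
    "m \<cdot> (A \<lhd> B) \<cdot> \<delta> = \<epsilon>"
  using assms by (simp_all add: casimir_def)

definition average :: "'b \<Rightarrow> 'a \<Rightarrow> 'b \<Rightarrow> 'b \<Rightarrow> 'b \<Rightarrow> 'b \<Rightarrow> 'b" where
  "average B N \<nu> \<sigma> \<rho> g = \<nu> \<cdot> (N \<lhd> B) \<cdot> (\<sigma> \<rhd> X) \<cdot> (g \<rhd> X) \<cdot> \<rho>"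

lemma average_colinear:
  assumes "casimir B" "emod M \<mu> \<rho>" "emod N \<nu> \<sigma>" "linear M \<mu> N \<nu> g"
  shows "colinear M \<mu> \<rho> N \<nu> \<sigma> (average B N \<nu> \<sigma> \<rho> g)"
proof -
  note B [typing] = casimirD[OF assms(1)]
  note M [typing] = emodD[OF assms(2)]
  note N [typing] = emodD[OF assms(3)]
  note g [typing] = linearD[OF assms(4)]
  have "\<nu> \<cdot> (N \<lhd> B) \<cdot> (\<sigma> \<rhd> X) \<cdot> (g \<rhd> X) \<cdot> \<rho> \<in> hom C M N"
    by (rule depicts_in, (rule depicts typing)+, simp)
  moreover have "\<nu> \<cdot> (N \<lhd> B) \<cdot> (\<sigma> \<rhd> X) \<cdot> (g \<rhd> X) \<cdot> \<rho> \<cdot> \<mu> = \<nu> \<cdot> ((\<nu> \<cdot> (N \<lhd> B) \<cdot> (\<sigma> \<rhd> X) \<cdot> (g \<rhd> X) \<cdot> \<rho>) \<rhd> A)"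
    by (rule diagram_eq[OF eqs5[OF M(7) g(2) N(7) B(2) N(4)], where c = "[Rw 0 0 0, Rw 1 2 0,
      Up 2 1, Rw 2 3 0, Up 3 1, Up 6 1, Rw 4 6 0, Rw 3 3 1, Rv 4 4 0]"], (rule depicts typing)+,
      simp add: derivable_simps)
  moreover have "((\<nu> \<cdot> (N \<lhd> B) \<cdot> (\<sigma> \<rhd> X) \<cdot> (g \<rhd> X) \<cdot> \<rho>) \<rhd> X) \<cdot> \<rho> = \<sigma> \<cdot> (\<nu> \<cdot> (N \<lhd> B) \<cdot> (\<sigma> \<rhd> X) \<cdot> (g \<rhd> X) \<cdot> \<rho>)"
    by (rule diagram_eq[OF eqs6[OF M(8) g(2) N(7) N(8) N(4) B(3)], where c = "[Rw 0 0 0,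
      Rw 1 2 0, Up 2 1, Rw 2 3 0, Up 3 1, Up 6 1, Rw 4 6 0, Rw 5 3 1, Rv 4 6 0, Up 6 2,
      Rv 3 2 0, Up 4 1, Rv 2 4 0]"], (rule depicts typing)+, simp add: derivable_simps)
  ultimately show ?thesis by (simp add: colinear_def right_linear_def average_def)
qed

lemma average_natural:
  assumes "casimir B" "emod M \<mu> \<rho>" "emod N \<nu> \<sigma>" "linear M \<mu> N \<nu> g"
    "emod M' \<mu>' \<rho>'" "emod N' \<nu>' \<sigma>'" "colinear M' \<mu>' \<rho>' M \<mu> \<rho> u" "colinear N \<nu> \<sigma> N' \<nu>' \<sigma>' v"
  shows "average B N' \<nu>' \<sigma>' \<rho>' (v \<cdot> g \<cdot> u) = v \<cdot> average B N \<nu> \<sigma> \<rho> g \<cdot> u"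
proof -
  note B [typing] = casimirD[OF assms(1)]
  note M [typing] = emodD[OF assms(2)]
  note N [typing] = emodD[OF assms(3)]
  note M' [typing] = emodD[OF assms(5)]
  note N' [typing] = emodD[OF assms(6)]
  note g [typing] = linearD[OF assms(4)]
  note u [typing] = colinearD[OF assms(7)]
  note v [typing] = colinearD[OF assms(8)]
  have "\<nu>' \<cdot> (N' \<lhd> B) \<cdot> (\<sigma>' \<rhd> X) \<cdot> ((v \<cdot> g \<cdot> u) \<rhd> X) \<cdot> \<rho>' = v \<cdot> (\<nu> \<cdot> (N \<lhd> B) \<cdot> (\<sigma> \<rhd> X) \<cdot> (g \<rhd> X) \<cdot> \<rho>) \<cdot> u"
    by (rule diagram_eq[OF eqs3[OF u(4) v(3) v(4)], where c = "[Rw 0 0 0, Rv 2 3 0, Up 5 1,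
      Rv 1 5 0]"], (rule depicts typing)+, simp add: derivable_simps)
  then show ?thesis by (simp add: average_def)
qed

lemma average_section:
  assumes "casimir B" "emod M \<mu> \<rho>" "emod N \<nu> \<sigma>" "colinear M \<mu> \<rho> N \<nu> \<sigma> f"
  shows "average B N \<nu> \<sigma> \<rho> f = f"
proof -
  note B [typing] = casimirD[OF assms(1)]
  note M [typing] = emodD[OF assms(2)]
  note N [typing] = emodD[OF assms(3)]
  note f [typing] = colinearD[OF assms(4)]
  have "\<nu> \<cdot> (N \<lhd> B) \<cdot> (\<sigma> \<rhd> X) \<cdot> (f \<rhd> X) \<cdot> \<rho> = f"
    by (rule diagram_eq[OF eqs5[OF f(4) N(8) N(4) B(4) N(9)], where c = "[Rw 0 0 0, Rw 1 1 0,
      Up 4 1, Rw 2 4 0, Rw 3 2 1, Rw 4 1 0]"], (rule depicts typing)+,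
      simp add: derivable_simps)
  then show ?thesis by (simp add: average_def)
qed

lemma casimir_separable:
  assumes B: "casimir B"
  shows "separable_functor \<D> \<C> forget_obj forget_arr"
proof -
  let ?\<phi> = "\<lambda>(M, \<mu>, \<rho>) (N, \<nu>, \<sigma>) G. ((M, \<mu>, \<rho>), average B N \<nu> \<sigma> \<rho> (fst (snd G)), (N, \<nu>, \<sigma>))"
  show ?thesis
    unfolding separable_functor_def
  proof (intro conjI exI[of _ ?\<phi>] ballI forget_functor)
    fix P Q G assume "P \<in> Obj \<D>" "Q \<in> Obj \<D>"
      "G \<in> hom \<C> (forget_obj P) (forget_obj Q)"
    then show "?\<phi> P Q G \<in> hom \<D> P Q"
      using average_colinear[OF B] by (auto simp: entwined_simps right_modules_simps forget_obj_def)
  next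
    fix P Q F assume "P \<in> Obj \<D>" "Q \<in> Obj \<D>"
      "F \<in> hom \<D> P Q"
    then show "?\<phi> P Q (forget_arr F) = F"
      using average_section[OF B] by (auto simp: entwined_simps forget_arr_def)
  next
    fix P P' Q Q' U V G
    assume "P \<in> Obj \<D>" "P' \<in> Obj \<D>"
      "Q \<in> Obj \<D>" "Q' \<in> Obj \<D>"
      "U \<in> hom \<D> P' P" "V \<in> hom \<D> Q Q'"
      "G \<in> hom \<C> (forget_obj P) (forget_obj Q)"
    then obtain M \<mu> \<rho> M' \<mu>' \<rho>' N \<nu> \<sigma> N' \<nu>' \<sigma>' u v g where
      E: "P = (M, \<mu>, \<rho>)" "P' = (M', \<mu>', \<rho>')" "Q = (N, \<nu>, \<sigma>)" "Q' = (N', \<nu>', \<sigma>')"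
        "U = (P', u, P)" "V = (Q, v, Q')" "G = ((M, \<mu>), g, (N, \<nu>))"
      and e: "emod M \<mu> \<rho>" "emod N \<nu> \<sigma>" "linear M \<mu> N \<nu> g" "emod M' \<mu>' \<rho>'" "emod N' \<nu>' \<sigma>'"
        "colinear M' \<mu>' \<rho>' M \<mu> \<rho> u" "colinear N \<nu> \<sigma> N' \<nu>' \<sigma>' v"
      by (cases P, cases P', cases Q, cases Q') (auto simp: entwined_simps right_modules_simps forget_obj_def)
    show "?\<phi> P' Q' (Comp \<C> (Comp \<C> (forget_arr V) G) (forget_arr U))
        = Comp \<D> (Comp \<D> V (?\<phi> P Q G)) U"
      using average_natural[OF B e]
      by (simp add: E entwined_simps right_modules_simps forget_obj_def forget_arr_def)
  qed
qed

text \<open>A splitting of the forgetful functor is determined by its values on the counits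
  of the adjunction with the cofree entwined modules, which are natural retractions of the coactions.\<close>

lemma separable_retraction:
  assumes "separable_functor \<D> \<C> forget_obj forget_arr"
  obtains r where
    "\<And>M \<mu> \<rho>. emod M \<mu> \<rho> \<Longrightarrow> colinear (M \<otimes> X) ((\<mu> \<rhd> X) \<cdot> (M \<lhd> \<psi>)) ((\<mu> \<rhd> X \<otimes> X) \<cdot> (M \<lhd> \<delta>)) M \<mu> \<rho> (r M \<mu> \<rho>)"
    "\<And>M \<mu> \<rho>. emod M \<mu> \<rho> \<Longrightarrow> r M \<mu> \<rho> \<cdot> \<rho> = Ident C M"
    "\<And>M \<mu> \<rho> N \<nu> \<sigma> f. emod M \<mu> \<rho> \<Longrightarrow> emod N \<nu> \<sigma> \<Longrightarrow> colinear M \<mu> \<rho> N \<nu> \<sigma> f \<Longrightarrow>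
       r N \<nu> \<sigma> \<cdot> (f \<rhd> X) = f \<cdot> r M \<mu> \<rho>"
proof -
  obtain \<phi> where
    \<phi>_in: "\<And>P Q G. P \<in> Obj \<D> \<Longrightarrow> Q \<in> Obj \<D> \<Longrightarrow> G \<in> hom \<C> (forget_obj P) (forget_obj Q) \<Longrightarrow> \<phi> P Q G \<in> hom \<D> P Q"
    and \<phi>_sec: "\<And>P Q F. P \<in> Obj \<D> \<Longrightarrow> Q \<in> Obj \<D> \<Longrightarrow> F \<in> hom \<D> P Q \<Longrightarrow> \<phi> P Q (forget_arr F) = F"
    and \<phi>_nat: "\<And>P P' Q Q' U V G. P \<in> Obj \<D> \<Longrightarrow> P' \<in> Obj \<D> \<Longrightarrow> Q \<in> Obj \<D> \<Longrightarrow> Q' \<in> Obj \<D> \<Longrightarrow>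
       U \<in> hom \<D> P' P \<Longrightarrow> V \<in> hom \<D> Q Q' \<Longrightarrow> G \<in> hom \<C> (forget_obj P) (forget_obj Q) \<Longrightarrow>
       \<phi> P' Q' (Comp \<C> (Comp \<C> (forget_arr V) G) (forget_arr U)) = Comp \<D> (Comp \<D> V (\<phi> P Q G)) U"
    by (rule separable_functorE[OF assms]) (rule that)
  define G where "G M \<mu> = (M \<otimes> X, (\<mu> \<rhd> X) \<cdot> (M \<lhd> \<psi>), (\<mu> \<rhd> X \<otimes> X) \<cdot> (M \<lhd> \<delta>))" for M \<mu>
  define c where "c M \<mu> = (forget_obj (G M \<mu>), \<mu> \<cdot> (M \<lhd> \<epsilon>), (M, \<mu>))" for M \<mu>
  define r where "r M \<mu> \<rho> = fst (snd (\<phi> (G M \<mu>) (M, \<mu>, \<rho>) (c M \<mu>)))" for M \<mu> \<rho>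
  have G: "G M \<mu> \<in> Obj \<D>" if "emod M \<mu> \<rho>" for M \<mu> \<rho>
    using cofree_emod emodD(1)[OF that] by (simp add: G_def entwined_simps)
  have P: "(M, \<mu>, \<rho>) \<in> Obj \<D>" if "emod M \<mu> \<rho>" for M \<mu> \<rho>
    using that by (simp add: entwined_simps)
  have c: "c M \<mu> \<in> hom \<C> (forget_obj (G M \<mu>)) (forget_obj (M, \<mu>, \<rho>))" if "emod M \<mu> \<rho>" for M \<mu> \<rho>
    using coaction_counit_linear emodD(1)[OF that] emodD(1)[OF cofree_emod]
    by (simp add: G_def c_def right_modules_simps forget_obj_def)
  have r: "\<phi> (G M \<mu>) (M, \<mu>, \<rho>) (c M \<mu>) = (G M \<mu>, r M \<mu> \<rho>, (M, \<mu>, \<rho>))"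
    and r_col: "colinear (M \<otimes> X) ((\<mu> \<rhd> X) \<cdot> (M \<lhd> \<psi>)) ((\<mu> \<rhd> X \<otimes> X) \<cdot> (M \<lhd> \<delta>)) M \<mu> \<rho> (r M \<mu> \<rho>)"
    if e: "emod M \<mu> \<rho>" for M \<mu> \<rho>
    using \<phi>_in[OF G[OF e] P[OF e] c[OF e]] by (auto simp: G_def entwined_simps r_def)
  have I: "(P, Ident C (fst P), P) \<in> hom \<D> P P" if "P \<in> Obj \<D>" for P
    using that colinear_id by (cases P) (auto simp: entwined_simps)
  have sec: "r M \<mu> \<rho> \<cdot> \<rho> = Ident C M" if e: "emod M \<mu> \<rho>" for M \<mu> \<rho>
  proof -
    note M [typing] = emodD[OF e]
    have U: "((M, \<mu>, \<rho>), \<rho>, G M \<mu>) \<in> hom \<D> (M, \<mu>, \<rho>) (G M \<mu>)"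
      using coaction_colinear[OF e] e G[OF e] by (simp add: G_def entwined_simps)
    have rM: "r M \<mu> \<rho> \<in> hom C (M \<otimes> X) M" using r_col[OF e] by (simp add: colinearD)
    have "((M, \<mu>, \<rho>), Ident C M, (M, \<mu>, \<rho>)) = \<phi> (M, \<mu>, \<rho>) (M, \<mu>, \<rho>) (forget_arr ((M, \<mu>, \<rho>), Ident C M, (M, \<mu>, \<rho>)))"
      using \<phi>_sec[OF P[OF e] P[OF e] I[OF P[OF e]]] by simp
    also have "forget_arr ((M, \<mu>, \<rho>), Ident C M, (M, \<mu>, \<rho>))
        = Comp \<C> (Comp \<C> (forget_arr ((M, \<mu>, \<rho>), Ident C M, (M, \<mu>, \<rho>))) (c M \<mu>)) (forget_arr ((M, \<mu>, \<rho>), \<rho>, G M \<mu>))"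
    proof -
      have "\<mu> \<cdot> (M \<lhd> \<epsilon>) \<in> hom C (M \<otimes> X) M" by (rule depicts_in, (rule depicts typing)+, simp)
      from id_comp[OF this] show ?thesis
        using M(9) by (simp add: forget_arr_def forget_obj_def c_def G_def right_modules_simps)
    qed
    also have "\<phi> (M, \<mu>, \<rho>) (M, \<mu>, \<rho>) \<dots> = Comp \<D> (Comp \<D> ((M, \<mu>, \<rho>), Ident C M, (M, \<mu>, \<rho>)) (\<phi> (G M \<mu>) (M, \<mu>, \<rho>) (c M \<mu>))) ((M, \<mu>, \<rho>), \<rho>, G M \<mu>)"
      using \<phi>_nat[OF G[OF e] P[OF e] P[OF e] P[OF e] U I[OF P[OF e]] c[OF e]] by simp
    finally show ?thesis using id_comp[OF rM] by (simp add: r[OF e] entwined_simps)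
  qed
  have nat: "r N \<nu> \<sigma> \<cdot> (f \<rhd> X) = f \<cdot> r M \<mu> \<rho>"
    if e: "emod M \<mu> \<rho>" and e': "emod N \<nu> \<sigma>" and f': "colinear M \<mu> \<rho> N \<nu> \<sigma> f" for M \<mu> \<rho> N \<nu> \<sigma> f
  proof -
    note M [typing] = emodD[OF e]
    note N [typing] = emodD[OF e']
    note f [typing] = colinearD[OF f']
    have U: "(G M \<mu>, f \<rhd> X, G N \<nu>) \<in> hom \<D> (G M \<mu>) (G N \<nu>)"
      using cofree_colinear[OF emodD(1)[OF e] emodD(1)[OF e'] colinearD(1)[OF f']] G[OF e] G[OF e']
      by (simp add: G_def entwined_simps)
    have V: "((M, \<mu>, \<rho>), f, (N, \<nu>, \<sigma>)) \<in> hom \<D> (M, \<mu>, \<rho>) (N, \<nu>, \<sigma>)"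
      using e e' f' by (simp add: entwined_simps)
    have rM: "r M \<mu> \<rho> \<in> hom C (M \<otimes> X) M" and rN: "r N \<nu> \<sigma> \<in> hom C (N \<otimes> X) N"
      using r_col[OF e] r_col[OF e'] by (simp_all add: colinearD)
    have 1: "\<phi> (G M \<mu>) (N, \<nu>, \<sigma>) (Comp \<C> (Comp \<C> (forget_arr ((N, \<nu>, \<sigma>), Ident C N, (N, \<nu>, \<sigma>))) (c N \<nu>)) (forget_arr (G M \<mu>, f \<rhd> X, G N \<nu>)))
       = Comp \<D> (Comp \<D> ((N, \<nu>, \<sigma>), Ident C N, (N, \<nu>, \<sigma>)) (\<phi> (G N \<nu>) (N, \<nu>, \<sigma>) (c N \<nu>))) (G M \<mu>, f \<rhd> X, G N \<nu>)"
      using \<phi>_nat[OF G[OF e'] G[OF e] P[OF e'] P[OF e'] U I[OF P[OF e']] c[OF e']] by simp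
    have 2: "\<phi> (G M \<mu>) (N, \<nu>, \<sigma>) (Comp \<C> (Comp \<C> (forget_arr ((M, \<mu>, \<rho>), f, (N, \<nu>, \<sigma>))) (c M \<mu>)) (forget_arr (G M \<mu>, Ident C (M \<otimes> X), G M \<mu>)))
       = Comp \<D> (Comp \<D> ((M, \<mu>, \<rho>), f, (N, \<nu>, \<sigma>)) (\<phi> (G M \<mu>) (M, \<mu>, \<rho>) (c M \<mu>))) (G M \<mu>, Ident C (M \<otimes> X), G M \<mu>)"
      using \<phi>_nat[OF G[OF e] G[OF e] P[OF e] P[OF e'] I[OF G[OF e]] V c[OF e]] by (simp add: G_def)
    have "Ident C N \<cdot> (\<nu> \<cdot> (N \<lhd> \<epsilon>)) \<cdot> (f \<rhd> X) = f \<cdot> (\<mu> \<cdot> (M \<lhd> \<epsilon>)) \<cdot> Ident C (M \<otimes> X)"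
      by (rule diagram_eq[OF eqs1[OF f(3)], where c = "[Up 1 1, Rv 0 1 0]"],
        (rule depicts typing)+, simp add: derivable_simps)
    then have "Comp \<C> (Comp \<C> (forget_arr ((N, \<nu>, \<sigma>), Ident C N, (N, \<nu>, \<sigma>))) (c N \<nu>)) (forget_arr (G M \<mu>, f \<rhd> X, G N \<nu>))
      = Comp \<C> (Comp \<C> (forget_arr ((M, \<mu>, \<rho>), f, (N, \<nu>, \<sigma>))) (c M \<mu>)) (forget_arr (G M \<mu>, Ident C (M \<otimes> X), G M \<mu>))"
      by (simp add: forget_arr_def forget_obj_def c_def G_def right_modules_simps)
    with 1 2 have "Ident C N \<cdot> r N \<nu> \<sigma> \<cdot> (f \<rhd> X) = f \<cdot> r M \<mu> \<rho> \<cdot> Ident C (M \<otimes> X)"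
      by (simp add: r[OF e] r[OF e'] entwined_simps)
    then show ?thesis using id_comp[OF rN] comp_id[OF comp_in[OF rM f(2)]] by simp
  qed
  show thesis by (rule that[of r]) (fact r_col sec nat)+
qed

end

context cowreath_data
begin

lemma retraction_casimir:
  assumes \<beta>1: "\<beta> = (m \<rhd> X) \<cdot> (A \<lhd> \<psi>)" and \<kappa>1: "\<kappa> = (m \<rhd> X \<otimes> X) \<cdot> (A \<lhd> \<delta>)"
    and z [typing]: "z \<in> hom C AXX AX" and zl: "z \<cdot> (m \<rhd> X \<otimes> X) = (m \<rhd> X) \<cdot> (A \<lhd> z)"
    and zr: "z \<cdot> ((\<beta> \<rhd> X) \<cdot> (AX \<lhd> \<psi>)) = \<beta> \<cdot> (z \<rhd> A)"
    and zc: "(z \<rhd> X) \<cdot> ((\<beta> \<rhd> X \<otimes> X) \<cdot> (AX \<lhd> \<delta>)) = \<kappa> \<cdot> z"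
    and z\<kappa>: "z \<cdot> \<kappa> = Ident C AX"
    and zd: "\<beta> \<cdot> (AX \<lhd> (m \<cdot> (A \<lhd> \<epsilon>) \<cdot> z \<cdot> (\<eta> \<rhd> X \<otimes> X))) \<cdot> (\<delta> \<rhd> X) = z \<cdot> (\<eta> \<rhd> X \<otimes> X)"
  shows "casimir (m \<cdot> (A \<lhd> \<epsilon>) \<cdot> z \<cdot> (\<eta> \<rhd> X \<otimes> X))"
proof -
  note D = emodD[OF cofree_emod[OF rmod_A], folded \<beta>1 \<kappa>1]
  from D have \<beta> [typing]: "\<beta> \<in> hom C (AX \<otimes> A) AX" and \<kappa> [typing]: "\<kappa> \<in> hom C AX AXX"
    by simp_all
  obtain B where B1: "B = m \<cdot> (A \<lhd> \<epsilon>) \<cdot> z \<cdot> (\<eta> \<rhd> X \<otimes> X)" by blast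
  have "m \<cdot> (A \<lhd> \<epsilon>) \<cdot> z \<cdot> (\<eta> \<rhd> X \<otimes> X) \<in> hom C (X \<otimes> X) A"
    by (rule depicts_in, (rule depicts typing)+, simp)
  then have B [typing]: "B \<in> hom C (X \<otimes> X) A" by (simp add: B1)
  have AB: "m \<cdot> (A \<lhd> B) = m \<cdot> (A \<lhd> \<epsilon>) \<cdot> z"
    by (rule diagram_eq[OF eqs4[OF B1 m_assoc zl \<eta>r], where c = "[Rw 0 0 1, Rv 1 3 0, Up 3 1,
      Rv 2 1 0, Rw 3 0 0]"], (rule depicts typing)+, simp add: derivable_simps)
  have "m \<cdot> (A \<lhd> B) \<cdot> ((\<psi> \<rhd> X) \<cdot> (X \<lhd> \<psi>)) = m \<cdot> (A \<lhd> \<epsilon>) \<cdot> z \<cdot> ((\<psi> \<rhd> X) \<cdot> (X \<lhd> \<psi>))"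
    by (rule diagram_eq[OF eqs1[OF AB], where c = "[Rw 0 2 0]"], (rule depicts typing)+,
      simp add: derivable_simps)
  also have "\<dots> = m \<cdot> (A \<lhd> \<epsilon>) \<cdot> z \<cdot> ((\<beta> \<rhd> X) \<cdot> (AX \<lhd> \<psi>)) \<cdot> (\<eta> \<rhd> X \<otimes> X \<otimes> A)"
    by (rule diagram_eq[OF eqs2[OF \<beta>1 \<eta>l], where c = "[Rv 1 2 0, Up 2 2, Rv 0 2 0]"],
      (rule depicts typing)+, simp add: derivable_simps)
  also have "\<dots> = m \<cdot> (A \<lhd> \<epsilon>) \<cdot> \<beta> \<cdot> (z \<rhd> A) \<cdot> (\<eta> \<rhd> X \<otimes> X \<otimes> A)"
    by (rule diagram_eq[OF eqs1[OF zr], where c = "[Rw 0 1 0]"], (rule depicts typing)+,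
      simp add: derivable_simps)
  also have "\<dots> = m \<cdot> (B \<rhd> A)"
    by (rule diagram_eq[OF eqs4[OF \<beta>1 B1 \<epsilon>\<psi> m_assoc], where c = "[Rw 0 2 0, Up 4 1, Rw 3 4 0,
      Rw 2 2 1, Rv 3 3 0, Rv 1 0 0]"], (rule depicts typing)+, simp add: derivable_simps)
  finally have 1: "m \<cdot> (A \<lhd> B) \<cdot> ((\<psi> \<rhd> X) \<cdot> (X \<lhd> \<psi>)) = m \<cdot> (B \<rhd> A)" .
  have "m \<cdot> (A \<lhd> B) \<cdot> \<delta> = m \<cdot> (A \<lhd> \<epsilon>) \<cdot> z \<cdot> \<delta>"
    by (rule diagram_eq[OF eqs1[OF AB], where c = "[Rw 0 1 0]"], (rule depicts typing)+,
      simp add: derivable_simps)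
  also have "\<dots> = m \<cdot> (A \<lhd> \<epsilon>) \<cdot> z \<cdot> \<kappa> \<cdot> (\<eta> \<rhd> X)"
    by (rule diagram_eq[OF eqs2[OF \<kappa>1 \<eta>l], where c = "[Rv 1 1 0, Up 1 1, Rv 0 1 0]"],
      (rule depicts typing)+, simp add: derivable_simps)
  also have "\<dots> = \<epsilon>"
    by (rule diagram_eq[OF eqs2[OF z\<kappa> \<eta>l], where c = "[Rw 0 1 0, Up 1 1, Rw 1 1 0]"],
      (rule depicts typing)+, simp add: derivable_simps)
  finally have 2: "m \<cdot> (A \<lhd> B) \<cdot> \<delta> = \<epsilon>" .
  have "(m \<rhd> X) \<cdot> (A \<lhd> B \<rhd> X) \<cdot> ((\<psi> \<rhd> X \<otimes> X) \<cdot> (X \<lhd> \<delta>))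
      = (m \<rhd> X) \<cdot> (A \<lhd> \<epsilon> \<rhd> X) \<cdot> (z \<rhd> X) \<cdot> ((\<psi> \<rhd> X \<otimes> X) \<cdot> (X \<lhd> \<delta>))"
        by (rule diagram_eq[OF eqs1[OF AB], where c = "[Rw 0 2 0]"], (rule depicts typing)+,
          simp add: derivable_simps)
  also have "\<dots> = (m \<rhd> X) \<cdot> (A \<lhd> \<epsilon> \<rhd> X) \<cdot> (z \<rhd> X) \<cdot> ((\<beta> \<rhd> X \<otimes> X) \<cdot> (AX \<lhd> \<delta>)) \<cdot> (\<eta> \<rhd> X \<otimes> X)"
    by (rule diagram_eq[OF eqs2[OF \<beta>1 \<eta>l], where c = "[Rv 1 2 0, Up 2 2, Rv 0 2 0]"],
      (rule depicts typing)+, simp add: derivable_simps)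
  also have "\<dots> = (m \<rhd> X) \<cdot> (A \<lhd> \<epsilon> \<rhd> X) \<cdot> \<kappa> \<cdot> z \<cdot> (\<eta> \<rhd> X \<otimes> X)"
    by (rule diagram_eq[OF eqs1[OF zc], where c = "[Rw 0 1 0]"], (rule depicts typing)+,
      simp add: derivable_simps)
  also have "\<dots> = z \<cdot> (\<eta> \<rhd> X \<otimes> X)"
    by (rule diagram_eq[OF eqs4[OF \<kappa>1 m_assoc \<epsilon>\<delta> \<eta>r], where c = "[Rw 0 2 0, Up 4 1, Rw 1 4 0,
      Rw 2 2 1, Rw 3 2 0]"], (rule depicts typing)+, simp add: derivable_simps)
  finally have 3: "(m \<rhd> X) \<cdot> (A \<lhd> B \<rhd> X) \<cdot> ((\<psi> \<rhd> X \<otimes> X) \<cdot> (X \<lhd> \<delta>)) = z \<cdot> (\<eta> \<rhd> X \<otimes> X)" .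
  have "(m \<rhd> X) \<cdot> (A \<lhd> (\<psi> \<cdot> (X \<lhd> B))) \<cdot> (\<delta> \<rhd> X)
      = \<beta> \<cdot> (AX \<lhd> (m \<cdot> (A \<lhd> \<epsilon>) \<cdot> z \<cdot> (\<eta> \<rhd> X \<otimes> X))) \<cdot> (\<delta> \<rhd> X)"
        by (rule diagram_eq[OF eqs2[OF \<beta>1 B1], where c = "[Rw 1 1 2, Rv 0 5 0]"],
          (rule depicts typing)+, simp add: derivable_simps)
  with zd have "(m \<rhd> X) \<cdot> (A \<lhd> (\<psi> \<cdot> (X \<lhd> B))) \<cdot> (\<delta> \<rhd> X) = z \<cdot> (\<eta> \<rhd> X \<otimes> X)" by simp
  with B 1 2 3 have "casimir B" by (simp add: casimir_def)
  then show ?thesis by (simp add: B1)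
qed

lemma separable_casimir:
  assumes gen: "left_tensor_generator C (tunit C)"
    and sep: "separable_functor \<D> \<C> forget_obj forget_arr"
  shows "\<exists>B. casimir B"
proof -
  from sep obtain r where
    r_col: "\<And>M \<mu> \<rho>. emod M \<mu> \<rho> \<Longrightarrow> colinear (M \<otimes> X) ((\<mu> \<rhd> X) \<cdot> (M \<lhd> \<psi>)) ((\<mu> \<rhd> X \<otimes> X) \<cdot> (M \<lhd> \<delta>)) M \<mu> \<rho> (r M \<mu> \<rho>)"
    and r_sec: "\<And>M \<mu> \<rho>. emod M \<mu> \<rho> \<Longrightarrow> r M \<mu> \<rho> \<cdot> \<rho> = Ident C M"
    and r_nat: "\<And>M \<mu> \<rho> N \<nu> \<sigma> f. emod M \<mu> \<rho> \<Longrightarrow> emod N \<nu> \<sigma> \<Longrightarrow> colinear M \<mu> \<rho> N \<nu> \<sigma> f \<Longrightarrow>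
       r N \<nu> \<sigma> \<cdot> (f \<rhd> X) = f \<cdot> r M \<mu> \<rho>"
    by (rule separable_retraction) (rule that)
  obtain \<beta> where \<beta>1: "\<beta> = (m \<rhd> X) \<cdot> (A \<lhd> \<psi>)" by blast
  obtain \<kappa> where \<kappa>1: "\<kappa> = (m \<rhd> X \<otimes> X) \<cdot> (A \<lhd> \<delta>)" by blast
  have eA: "emod AX \<beta> \<kappa>" using cofree_emod[OF rmod_A] by (simp add: \<beta>1 \<kappa>1)
  note D = emodD[OF eA]
  from D have \<beta> [typing]: "\<beta> \<in> hom C (AX \<otimes> A) AX" and \<beta>\<beta>: "\<beta> \<cdot> (\<beta> \<rhd> A) = \<beta> \<cdot> (AX \<lhd> m)"
    and \<kappa> [typing]: "\<kappa> \<in> hom C AX AXX"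
    and \<kappa>\<beta>: "\<kappa> \<cdot> \<beta> = (\<beta> \<rhd> X) \<cdot> (AX \<lhd> \<psi>) \<cdot> (\<kappa> \<rhd> A)"
    and \<kappa>\<epsilon>: "\<beta> \<cdot> (AX \<lhd> \<epsilon>) \<cdot> \<kappa> = Ident C AX"
    and \<beta>\<eta>: "\<beta> \<cdot> (AX \<lhd> \<eta>) = Ident C AX"
    by simp_all
  have AX [typing]: "AX \<in> Obj C" using A X by simp
  obtain z where z1: "z = r AX \<beta> \<kappa>" by blast
  note rz = colinearD[OF r_col[OF eA, folded z1]]
  from rz have z [typing]: "z \<in> hom C AXX AX"
    and zr: "z \<cdot> ((\<beta> \<rhd> X) \<cdot> (AX \<lhd> \<psi>)) = \<beta> \<cdot> (z \<rhd> A)"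
    and zc: "(z \<rhd> X) \<cdot> ((\<beta> \<rhd> X \<otimes> X) \<cdot> (AX \<lhd> \<delta>)) = \<kappa> \<cdot> z" by simp_all
  have z\<kappa>: "z \<cdot> \<kappa> = Ident C AX" using r_sec[OF eA] by (simp add: z1)
  have zl: "z \<cdot> (m \<rhd> X \<otimes> X) = (m \<rhd> X) \<cdot> (A \<lhd> z)"
  proof (rule generator_eq[OF gen A])
    show "AXX \<in> Obj C" using A X by simp
    show "z \<cdot> (m \<rhd> X \<otimes> X) \<in> hom C (A \<otimes> AXX) AX" by (rule depicts_in, (rule depicts typing)+, simp)
    show "(m \<rhd> X) \<cdot> (A \<lhd> z) \<in> hom C (A \<otimes> AXX) AX" by (rule depicts_in, (rule depicts typing)+, simp)
    fix h assume h [typing]: "h \<in> hom C (tunit C) A"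
    have "m \<cdot> (h \<rhd> A) \<in> hom C A A" by (rule depicts_in, (rule depicts typing)+, simp)
    moreover have "m \<cdot> (h \<rhd> A) \<cdot> m = m \<cdot> ((m \<cdot> (h \<rhd> A)) \<rhd> A)"
      by (rule diagram_eq[OF eqs1[OF m_assoc], where c = "[Up 1 1, Rv 0 1 0]"],
        (rule depicts typing)+, simp add: derivable_simps)
    ultimately have "linear A m A m (m \<cdot> (h \<rhd> A))" by (simp add: right_linear_def)
    from r_nat[OF eA eA cofree_colinear[OF rmod_A rmod_A this, folded \<beta>1 \<kappa>1], folded z1]
    have zh: "z \<cdot> ((m \<cdot> (h \<rhd> A)) \<rhd> X \<rhd> X) = ((m \<cdot> (h \<rhd> A)) \<rhd> X) \<cdot> z" .
    show "z \<cdot> (m \<rhd> X \<otimes> X) \<cdot> (h \<rhd> AXX) = (m \<rhd> X) \<cdot> (A \<lhd> z) \<cdot> (h \<rhd> AXX)"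
      by (rule diagram_eq[OF eqs1[OF zh], where c = "[Rw 0 0 0, Up 1 1]"],
        (rule depicts typing)+, simp add: derivable_simps)
  qed
  note fr = free_rmod[OF AX]
  note eY = cofree_emod[OF fr]
  obtain y where y1: "y = r (AX \<otimes> A \<otimes> X) (((AX \<lhd> m) \<rhd> X) \<cdot> (AX \<otimes> A \<lhd> \<psi>)) (((AX \<lhd> m) \<rhd> X \<otimes> X) \<cdot> (AX \<otimes> A \<lhd> \<delta>))"
    by blast
  have y [typing]: "y \<in> hom C (AX \<otimes> A \<otimes> X \<otimes> X) (AX \<otimes> A \<otimes> X)"
    using colinearD[OF r_col[OF eY, folded y1]] by simp
  have yz: "y = AX \<lhd> z"
  proof (rule generator_eq[OF gen AX])
    show "AXX \<in> Obj C" using A X by simp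
    show "y \<in> hom C (AX \<otimes> AXX) (AX \<otimes> AX)" by (rule depicts_in, (rule depicts typing)+, simp)
    show "AX \<lhd> z \<in> hom C (AX \<otimes> AXX) (AX \<otimes> AX)" by (rule depicts_in, (rule depicts typing)+, simp)
    fix h assume h [typing]: "h \<in> hom C (tunit C) AX"
    have "h \<rhd> A \<in> hom C A (AX \<otimes> A)" by (rule depicts_in, (rule depicts typing)+, simp)
    moreover have "(h \<rhd> A) \<cdot> m = (AX \<lhd> m) \<cdot> (h \<rhd> A \<rhd> A)"
      by (rule diagram_eq[OF eqs0, where c = "[Up 1 1]"], (rule depicts typing)+,
        simp add: derivable_simps)
    ultimately have "linear A m (AX \<otimes> A) (AX \<lhd> m) (h \<rhd> A)" by (simp add: right_linear_def)
    from r_nat[OF eA eY cofree_colinear[OF rmod_A fr this, folded \<beta>1 \<kappa>1], folded z1 y1]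
    have zh: "y \<cdot> (h \<rhd> A \<rhd> X \<rhd> X) = (h \<rhd> A \<rhd> X) \<cdot> z" .
    show "y \<cdot> (h \<rhd> AXX) = (AX \<lhd> z) \<cdot> (h \<rhd> AXX)"
      by (rule diagram_eq[OF eqs1[OF zh], where c = "[Rw 0 0 0, Up 1 1]"],
        (rule depicts typing)+, simp add: derivable_simps)
  qed
  note eW = cofree_emod[OF D(1)]
  obtain w where w1: "w = r AXX ((\<beta> \<rhd> X) \<cdot> (AX \<lhd> \<psi>)) ((\<beta> \<rhd> X \<otimes> X) \<cdot> (AX \<lhd> \<delta>))" by blast
  have w [typing]: "w \<in> hom C (AXX \<otimes> X) AXX"
    using colinearD[OF r_col[OF eW, folded w1]] by simp
  have "linear (AX \<otimes> A) (AX \<lhd> m) AX \<beta> \<beta>"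
    using \<beta> \<beta>\<beta> by (simp add: right_linear_def)
  from r_nat[OF eY eW cofree_colinear[OF fr D(1) this], folded w1 y1]
  have "w \<cdot> (\<beta> \<rhd> X \<rhd> X) = (\<beta> \<rhd> X) \<cdot> y" .
  then have wz: "w \<cdot> (\<beta> \<rhd> X \<rhd> X) = (\<beta> \<rhd> X) \<cdot> (AX \<lhd> z)" by (simp add: yz)
  from r_nat[OF eA eW coaction_colinear[OF eA], folded w1 z1]
  have w\<kappa>: "w \<cdot> (\<kappa> \<rhd> X) = \<kappa> \<cdot> z" .
  have "\<beta> \<cdot> (AX \<lhd> (m \<cdot> (A \<lhd> \<epsilon>) \<cdot> z \<cdot> (\<eta> \<rhd> X \<otimes> X))) \<cdot> (\<delta> \<rhd> X)
      = \<beta> \<cdot> (AX \<lhd> \<epsilon>) \<cdot> (\<beta> \<rhd> X) \<cdot> (AX \<lhd> z) \<cdot> (AX \<lhd> \<eta> \<rhd> X \<otimes> X) \<cdot> (\<delta> \<rhd> X)"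
    by (rule diagram_eq[OF eqs1[OF \<beta>\<beta>], where c = "[Rv 0 4 0, Up 4 1]"],
      (rule depicts typing)+, simp add: derivable_simps)
  also have "\<dots> = \<beta> \<cdot> (AX \<lhd> \<epsilon>) \<cdot> w \<cdot> (\<delta> \<rhd> X)"
    by (rule diagram_eq[OF eqs2[OF wz \<beta>\<eta>], where c = "[Rv 0 2 0, Rw 1 1 0]"],
      (rule depicts typing)+, simp add: derivable_simps)
  also have "\<dots> = \<beta> \<cdot> (AX \<lhd> \<epsilon>) \<cdot> w \<cdot> (\<kappa> \<rhd> X) \<cdot> (\<eta> \<rhd> X \<otimes> X)"
    by (rule diagram_eq[OF eqs2[OF \<kappa>1 \<eta>l], where c = "[Rv 1 1 0, Up 1 1, Rv 0 1 0]"],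
      (rule depicts typing)+, simp add: derivable_simps)
  also have "\<dots> = z \<cdot> (\<eta> \<rhd> X \<otimes> X)"
    by (rule diagram_eq[OF eqs2[OF w\<kappa> \<kappa>\<epsilon>], where c = "[Rw 0 1 0, Rw 1 2 0]"],
      (rule depicts typing)+, simp add: derivable_simps)
  finally show ?thesis using retraction_casimir[OF \<beta>1 \<kappa>1 z zl zr zc z\<kappa>] by blast
qed

end

section \<open>Coequalizers\<close>

context strict_moncat
begin

lemma epi_comp:
  assumes "epi q" "epi q'" "q \<in> hom C X Y" "q' \<in> hom C Y Z"
  shows "epi (q' \<cdot> q)"
  unfolding epi_def
proof (intro allI impI)
  fix h h' W
  have "Cod C (q' \<cdot> q) = Z" using comp_in[OF assms(3,4)] by (simp add: hom_def)
  moreover assume "h \<in> hom C (Cod C (q' \<cdot> q)) W" "h' \<in> hom C (Cod C (q' \<cdot> q)) W" "h \<cdot> (q' \<cdot> q) = h' \<cdot> (q' \<cdot> q)"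
  ultimately have h [typing]: "h \<in> hom C Z W" "h' \<in> hom C Z W" and "(h \<cdot> q') \<cdot> q = (h' \<cdot> q') \<cdot> q"
    using comp_assoc[OF assms(3,4)] by simp_all
  then show "h = h'"
    using epiD[OF assms(1,3) comp_in[OF assms(4) h(1)] comp_in[OF assms(4) h(2)]] epiD[OF assms(2,4) h] by blast
qed

lemma split_epi:
  assumes "q \<in> hom C Y T" "j \<in> hom C T Y" "q \<cdot> j = Ident C T"
  shows "epi q"
  unfolding epi_def
proof (intro allI impI)
  fix h h' W
  have c: "Cod C q = T" using assms(1) by (simp add: hom_def)
  assume h: "h \<in> hom C (Cod C q) W" "h' \<in> hom C (Cod C q) W" and e: "h \<cdot> q = h' \<cdot> q"
  have "h \<cdot> (q \<cdot> j) = h' \<cdot> (q \<cdot> j)"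
    using comp_assoc[OF assms(2,1) h(1)[unfolded c]] comp_assoc[OF assms(2,1) h(2)[unfolded c]] e by simp
  then show "h = h'" using h c by (simp add: assms(3))
qed

lemma factor_eq:
  assumes "q \<in> hom C Y T" "epi q" "h \<in> hom C T W" "h \<cdot> q = k"
  shows "factor C q k = h"
proof -
  have "Cod C q = T" "Cod C k = W" using assms(1) comp_in[OF assms(1,3)] assms(4) by (auto simp: hom_def)
  note c = this
  show ?thesis
    unfolding factor_def c
  proof (rule the_equality)
    show "h \<in> hom C T W \<and> h \<cdot> q = k" using assms(3,4) by simp
    fix h' assume "h' \<in> hom C T W \<and> h' \<cdot> q = k"
    then show "h' = h" using epiD[OF assms(2,1) _ assms(3)] assms(4) by simp
  qed
qed

lemma coequalizer_in: "is_coequalizer C f g q \<Longrightarrow> f \<in> hom C X Y \<Longrightarrow> q \<in> hom C Y (Cod C q)"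
  by (simp add: is_coequalizer_def hom_def)

lemma coequalizer_eq: "is_coequalizer C f g q \<Longrightarrow> q \<cdot> f = q \<cdot> g"
  by (simp add: is_coequalizer_def)

lemma coequalizer_ex:
  assumes "is_coequalizer C f g q" "q \<in> hom C Y T" "k \<in> hom C Y W" "k \<cdot> f = k \<cdot> g"
  shows "\<exists>h \<in> hom C T W. h \<cdot> q = k"
proof -
  have "k \<in> Arr C" "Dom C k = Cod C f" "Cod C q = T" "Cod C k = W"
    using assms by (auto simp: is_coequalizer_def hom_def)
  then show ?thesis using assms(1,4) unfolding is_coequalizer_def by metis
qed

lemma coequalizer_epi:
  assumes "is_coequalizer C f g q"
  shows "epi q"
  unfolding epi_def
proof (intro allI impI)
  fix h h' W
  assume h: "h \<in> hom C (Cod C q) W" "h' \<in> hom C (Cod C q) W" and e: "h \<cdot> q = h' \<cdot> q"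
  have q: "q \<in> hom C (Cod C f) (Cod C q)" and f: "f \<in> hom C (Dom C f) (Cod C f)"
    and g: "g \<in> hom C (Dom C f) (Cod C f)" and qf: "q \<cdot> f = q \<cdot> g"
    using assms by (auto simp: is_coequalizer_def hom_def)
  have k: "h \<cdot> q \<in> hom C (Cod C f) W" by (rule comp_in[OF q h(1)])
  have "h \<cdot> q \<cdot> f = h \<cdot> q \<cdot> g" using comp_assoc[OF f q h(1)] comp_assoc[OF g q h(1)] qf by simp
  moreover have "h \<cdot> q \<in> Arr C" "Dom C (h \<cdot> q) = Cod C f" "Cod C (h \<cdot> q) = W" using k by (auto simp: hom_def)
  ultimately have "\<exists>!h'. h' \<in> hom C (Cod C q) W \<and> h' \<cdot> q = h \<cdot> q"
    using assms unfolding is_coequalizer_def by metis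
  then show "h = h'" using h e by metis
qed

lemma coequalizer_factor:
  assumes "is_coequalizer C f g q" "q \<in> hom C Y T" "k \<in> hom C Y W" "k \<cdot> f = k \<cdot> g"
  shows "factor C q k \<in> hom C T W" "factor C q k \<cdot> q = k"
proof -
  obtain h where "h \<in> hom C T W" "h \<cdot> q = k" using coequalizer_ex[OF assms] by blast
  moreover from this have "factor C q k = h" using factor_eq coequalizer_epi assms by blast
  ultimately show "factor C q k \<in> hom C T W" "factor C q k \<cdot> q = k" by simp_all
qed

lemma coequalizerI:
  assumes "f \<in> hom C X Y" "g \<in> hom C X Y" "q \<in> hom C Y T" "q \<cdot> f = q \<cdot> g" "epi q"
    "\<And>k W. k \<in> hom C Y W \<Longrightarrow> k \<cdot> f = k \<cdot> g \<Longrightarrow> \<exists>h \<in> hom C T W. h \<cdot> q = k"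
  shows "is_coequalizer C f g q"
proof -
  have D: "f \<in> Arr C" "Dom C f = X" "Cod C f = Y" "q \<in> Arr C" "Dom C q = Y" "Cod C q = T"
    using assms(1,3) by (auto simp: hom_def)
  have "\<exists>!h. h \<in> hom C T (Cod C k) \<and> h \<cdot> q = k" if k: "k \<in> Arr C" "Dom C k = Y" "k \<cdot> f = k \<cdot> g" for k
  proof -
    have "k \<in> hom C Y (Cod C k)" using k by (simp add: hom_def)
    from assms(6)[OF this k(3)] show ?thesis using epiD[OF assms(5,3)] by metis
  qed
  then show ?thesis using assms(2,4) D by (simp add: is_coequalizer_def)
qed

lemma split_coequalizer:
  assumes f [typing]: "f \<in> hom C X Y" and g [typing]: "g \<in> hom C X Y" and q [typing]: "q \<in> hom C Y T" and qf: "q \<cdot> f = q \<cdot> g"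
    and j [typing]: "j \<in> hom C T Y" and i [typing]: "i \<in> hom C Y X" and qj: "q \<cdot> j = Ident C T"
    and fi: "f \<cdot> i = j \<cdot> q" and gi: "g \<cdot> i = Ident C Y"
  shows "is_coequalizer C f g q"
proof (rule coequalizerI[OF f g q qf split_epi[OF q j qj]])
  fix k W assume k [typing]: "k \<in> hom C Y W" and kf: "k \<cdot> f = k \<cdot> g"
  have "k \<cdot> j \<cdot> q = k \<cdot> (j \<cdot> q)" using comp_assoc[OF q j k] .
  also have "\<dots> = k \<cdot> g \<cdot> i" using comp_assoc[OF i f k] kf fi by simp
  also have "\<dots> = k" using comp_assoc[OF i g k] gi k by simp
  finally show "\<exists>h \<in> hom C T W. h \<cdot> q = k" using comp_in[OF j k] by blast
qed

lemma coequalizer_iso: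
  assumes c: "is_coequalizer C f g q" and f [typing]: "f \<in> hom C X Y" and q [typing]: "q \<in> hom C Y T"
    and u [typing]: "u \<in> hom C T S" and v [typing]: "v \<in> hom C S T" and vu: "v \<cdot> u = Ident C T" and uv: "u \<cdot> v = Ident C S"
  shows "is_coequalizer C f g (u \<cdot> q)"
proof -
  have g [typing]: "g \<in> hom C X Y" using c f by (auto simp: is_coequalizer_def hom_def)
  have uq: "u \<cdot> q \<in> hom C Y S" by (rule comp_in[OF q u])
  show ?thesis
  proof (rule coequalizerI[OF f g uq])
    show "u \<cdot> q \<cdot> f = u \<cdot> q \<cdot> g"
      using comp_assoc[OF f q u] comp_assoc[OF g q u] coequalizer_eq[OF c] by simp
    show "epi (u \<cdot> q)" by (rule epi_comp[OF coequalizer_epi[OF c] split_epi[OF u v uv] q u])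
    fix k W assume k [typing]: "k \<in> hom C Y W" and kf: "k \<cdot> f = k \<cdot> g"
    obtain h where h [typing]: "h \<in> hom C T W" and hq: "h \<cdot> q = k" using coequalizer_ex[OF c q k kf] by blast
    have "h \<cdot> v \<cdot> (u \<cdot> q) = h \<cdot> (v \<cdot> u \<cdot> q)"
      using comp_assoc[OF uq v h] comp_assoc[OF q u v] by simp
    also have "\<dots> = k" using id_comp[OF q] hq by (simp add: vu)
    finally show "\<exists>h \<in> hom C S W. h \<cdot> (u \<cdot> q) = k" using comp_in[OF v h] by blast
  qed
qed

lemma left_coflatD: "left_coflat C X \<Longrightarrow> is_coequalizer C f g q \<Longrightarrow> is_coequalizer C (f \<rhd> X) (g \<rhd> X) (q \<rhd> X)"
  by (simp add: left_coflat_def)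

lemma left_coflat_obj: "left_coflat C X \<Longrightarrow> X \<in> Obj C"
  by (simp add: left_coflat_def)

lemma coequalizer_homs:
  assumes "is_coequalizer C f g q"
  obtains X Y T where "f \<in> hom C X Y" "g \<in> hom C X Y" "q \<in> hom C Y T"
  using assms that[of "Dom C f" "Cod C f" "Cod C q"] by (auto simp: is_coequalizer_def hom_def)

lemma left_coflat_tensor:
  assumes "left_coflat C X" "left_coflat C Y"
  shows "left_coflat C (X \<otimes> Y)"
proof -
  have XY [typing]: "X \<in> Obj C" "Y \<in> Obj C" using assms left_coflat_obj by blast+
  have *: "f \<rhd> X \<rhd> Y = f \<rhd> X \<otimes> Y" if "f \<in> hom C P Q" for f P Q
    using tens_assoc[OF that id_in[OF XY(1)] id_in[OF XY(2)]] tens_id[OF XY] by (simp add: whiskR_def)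
  have "is_coequalizer C (f \<rhd> X \<otimes> Y) (g \<rhd> X \<otimes> Y) (q \<rhd> X \<otimes> Y)" if c: "is_coequalizer C f g q" for f g q
    using coequalizer_homs[OF c] left_coflatD[OF assms(2) left_coflatD[OF assms(1) c]] * by metis
  then show ?thesis using XY by (simp add: left_coflat_def)
qed

lemma left_coflat_iso:
  assumes X: "left_coflat C X" and Y [typing]: "Y \<in> Obj C" and u [typing]: "u \<in> hom C X Y" and v [typing]: "v \<in> hom C Y X"
    and vu: "v \<cdot> u = Ident C X" and uv: "u \<cdot> v = Ident C Y"
  shows "left_coflat C Y"
proof -
  have X' [typing]: "X \<in> Obj C" using X by (rule left_coflat_obj)
  have "is_coequalizer C (f \<rhd> Y) (g \<rhd> Y) (q \<rhd> Y)" if c: "is_coequalizer C f g q" for f g q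
  proof -
    obtain P Q T where f [typing]: "f \<in> hom C P Q" and g [typing]: "g \<in> hom C P Q" and q [typing]: "q \<in> hom C Q T"
      using coequalizer_homs[OF c] .
    have P [typing]: "P \<in> Obj C" and Q [typing]: "Q \<in> Obj C" and T [typing]: "T \<in> Obj C"
      using hom_objs[OF f] hom_objs[OF q] by simp_all
    note cX = left_coflatD[OF X c]
    have fY: "f \<rhd> Y \<in> hom C (P \<otimes> Y) (Q \<otimes> Y)" and gY: "g \<rhd> Y \<in> hom C (P \<otimes> Y) (Q \<otimes> Y)"
      and qY: "q \<rhd> Y \<in> hom C (Q \<otimes> Y) (T \<otimes> Y)" and qX: "q \<rhd> X \<in> hom C (Q \<otimes> X) (T \<otimes> X)"
      using f g q X' Y by (auto intro: whiskR_in)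
    have qf: "q \<cdot> f = q \<cdot> g" using coequalizer_eq[OF c] .
    have Tu: "T \<lhd> u \<in> hom C (T \<otimes> X) (T \<otimes> Y)" and Qv: "Q \<lhd> v \<in> hom C (Q \<otimes> Y) (Q \<otimes> X)"
      and Qu: "Q \<lhd> u \<in> hom C (Q \<otimes> X) (Q \<otimes> Y)" and Tv: "T \<lhd> v \<in> hom C (T \<otimes> Y) (T \<otimes> X)"
      using u v Q T by (auto intro: whiskL_in)
    show ?thesis
    proof (rule coequalizerI[OF fY gY qY])
      show "(q \<rhd> Y) \<cdot> (f \<rhd> Y) = (q \<rhd> Y) \<cdot> (g \<rhd> Y)"
        by (rule diagram_eq[OF eqs1[OF qf], where c = "[Rw 0 0 0]"], (rule depicts typing)+,
          simp add: derivable_simps)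
      have "epi (Q \<lhd> v)"
      proof (rule split_epi[OF Qv Qu])
        show "(Q \<lhd> v) \<cdot> (Q \<lhd> u) = Ident C (Q \<otimes> X)"
          by (rule diagram_eq[OF eqs1[OF vu], where c = "[Rw 0 0 1]"], (rule depicts typing)+,
            simp add: derivable_simps)
      qed
      moreover have "epi (T \<lhd> u)"
      proof (rule split_epi[OF Tu Tv])
        show "(T \<lhd> u) \<cdot> (T \<lhd> v) = Ident C (T \<otimes> Y)"
          by (rule diagram_eq[OF eqs1[OF uv], where c = "[Rw 0 0 1]"], (rule depicts typing)+,
            simp add: derivable_simps)
      qed
      ultimately have "epi ((T \<lhd> u) \<cdot> ((q \<rhd> X) \<cdot> (Q \<lhd> v)))"
        by (meson epi_comp coequalizer_epi[OF cX] Qv qX Tu comp_in)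
      moreover have "(T \<lhd> u) \<cdot> ((q \<rhd> X) \<cdot> (Q \<lhd> v)) = q \<rhd> Y"
        by (rule diagram_eq[OF eqs1[OF uv], where c = "[Up 1 1, Rw 0 1 1]"],
          (rule depicts typing)+, simp add: derivable_simps)
      ultimately show "epi (q \<rhd> Y)" by simp
      fix k W assume k [typing]: "k \<in> hom C (Q \<otimes> Y) W" and kf: "k \<cdot> (f \<rhd> Y) = k \<cdot> (g \<rhd> Y)"
      have W [typing]: "W \<in> Obj C" using hom_objs(2)[OF k] .
      have "k \<cdot> (Q \<lhd> u) \<in> hom C (Q \<otimes> X) W" by (rule depicts_in, (rule depicts typing)+, simp)
      moreover have "k \<cdot> (Q \<lhd> u) \<cdot> (f \<rhd> X) = k \<cdot> (Q \<lhd> u) \<cdot> (g \<rhd> X)"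
        by (rule diagram_eq[OF eqs1[OF kf], where c = "[Up 1 1, Rw 0 1 0, Up 1 1]"],
          (rule depicts typing)+, simp add: derivable_simps)
      ultimately obtain h where h [typing]: "h \<in> hom C (T \<otimes> X) W" and hq: "h \<cdot> (q \<rhd> X) = k \<cdot> (Q \<lhd> u)"
        using coequalizer_ex[OF cX qX] by blast
      have "h \<cdot> (T \<lhd> v) \<in> hom C (T \<otimes> Y) W" by (rule depicts_in, (rule depicts typing)+, simp)
      moreover have "h \<cdot> (T \<lhd> v) \<cdot> (q \<rhd> Y) = k"
        by (rule diagram_eq[OF eqs2[OF hq uv], where c = "[Up 1 1, Rw 0 1 0, Rw 1 0 1]"],
          (rule depicts typing)+, simp add: derivable_simps)
      ultimately show "\<exists>h \<in> hom C (T \<otimes> Y) W. h \<cdot> (q \<rhd> Y) = k" by blast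
    qed
  qed
  then show ?thesis using Y by (simp add: left_coflat_def)
qed

end

section \<open>Tensor products over an algebra\<close>

context moncat_algebra
begin

abbreviation "bimod \<equiv> bimodule C A m \<eta>"

lemma bimodD:
  assumes "bimod (N, \<nu>, \<xi>)"
  shows "rmod N \<xi>" "N \<in> Obj C" "\<nu> \<in> hom C (A \<otimes> N) N" "\<xi> \<in> hom C (N \<otimes> A) N"
    "\<nu> \<cdot> (A \<lhd> \<nu>) = \<nu> \<cdot> (m \<rhd> N)" "\<nu> \<cdot> (\<eta> \<rhd> N) = Ident C N"
    "\<xi> \<cdot> (\<xi> \<rhd> A) = \<xi> \<cdot> (N \<lhd> m)" "\<xi> \<cdot> (N \<lhd> \<eta>) = Ident C N" "\<xi> \<cdot> (\<nu> \<rhd> A) = \<nu> \<cdot> (A \<lhd> \<xi>)"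
  using assms by (auto simp: bimodule_def left_module_def right_module_def)

lemma bimodI:
  assumes "rmod N \<xi>" "\<nu> \<in> hom C (A \<otimes> N) N" "\<nu> \<cdot> (A \<lhd> \<nu>) = \<nu> \<cdot> (m \<rhd> N)" "\<nu> \<cdot> (\<eta> \<rhd> N) = Ident C N"
    "\<xi> \<cdot> (\<nu> \<rhd> A) = \<nu> \<cdot> (A \<lhd> \<xi>)"
  shows "bimod (N, \<nu>, \<xi>)"
  using assms by (auto simp: bimodule_def left_module_def right_module_def)

end

locale coflat_algebra = moncat_algebra +
  assumes coequalizers: "has_coequalizers C" and coflat_A: "left_coflat C A"
begin

abbreviation "robust_left \<equiv> robust C A m \<eta>"

lemma tensorE:
  assumes "M \<in> Obj C" "N \<in> Obj C" "\<mu> \<in> hom C (M \<otimes> A) M" "\<nu> \<in> hom C (A \<otimes> N) N"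
  obtains q T where "q = tq C (M, \<mu>) (N, \<nu>)" "q \<in> hom C (M \<otimes> N) T" "T \<in> Obj C"
    "is_coequalizer C (\<mu> \<rhd> N) (M \<lhd> \<nu>) q" "q \<cdot> (\<mu> \<rhd> N) = q \<cdot> (M \<lhd> \<nu>)" "epi q"
proof -
  from assms have M [typing]: "M \<in> Obj C" and N [typing]: "N \<in> Obj C" and \<mu> [typing]: "\<mu> \<in> hom C (M \<otimes> A) M"
    and \<nu> [typing]: "\<nu> \<in> hom C (A \<otimes> N) N" by simp_all
  have f: "\<mu> \<rhd> N \<in> hom C (M \<otimes> A \<otimes> N) (M \<otimes> N)" by (rule depicts_in, (rule depicts typing)+, simp)
  have g: "M \<lhd> \<nu> \<in> hom C (M \<otimes> A \<otimes> N) (M \<otimes> N)" by (rule depicts_in, (rule depicts typing)+, simp)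
  have "\<exists>q. is_coequalizer C (\<mu> \<rhd> N) (M \<lhd> \<nu>) q"
    using coequalizers f g by (simp add: has_coequalizers_def hom_def)
  then have c: "is_coequalizer C (\<mu> \<rhd> N) (M \<lhd> \<nu>) (tq C (M, \<mu>) (N, \<nu>))"
    unfolding tq_def coeq_def by (simp add: someI_ex)
  note q = coequalizer_in[OF c f]
  show thesis
    using that[OF refl q _ c coequalizer_eq[OF c] coequalizer_epi[OF c]] hom_objs[OF q] by simp
qed

lemma coflat_epi: "left_coflat C Y \<Longrightarrow> is_coequalizer C f g q \<Longrightarrow> epi (q \<rhd> Y)"
  using left_coflatD coequalizer_epi by blast

definition act_tensor :: "'a \<Rightarrow> 'b \<Rightarrow> 'a \<Rightarrow> 'b \<Rightarrow> 'b \<Rightarrow> 'b \<Rightarrow> 'a \<Rightarrow> 'b \<Rightarrow> bool" where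
  "act_tensor M \<mu> N \<nu> \<xi> q T \<alpha> \<longleftrightarrow> rmod M \<mu> \<and> bimod (N, \<nu>, \<xi>) \<and> q = tq C (M, \<mu>) (N, \<nu>) \<and> q \<in> hom C (M \<otimes> N) T \<and>
     is_coequalizer C (\<mu> \<rhd> N) (M \<lhd> \<nu>) q \<and> act_obj C A (M, \<mu>) (N, \<nu>, \<xi>) = (T, \<alpha>) \<and>
     \<alpha> \<in> hom C (T \<otimes> A) T \<and> \<alpha> \<cdot> (q \<rhd> A) = q \<cdot> (M \<lhd> \<xi>) \<and> rmod T \<alpha>"

lemma act_tensorD:
  assumes "act_tensor M \<mu> N \<nu> \<xi> q T \<alpha>"
  shows "q \<in> hom C (M \<otimes> N) T" "T \<in> Obj C" "\<alpha> \<in> hom C (T \<otimes> A) T"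
    "\<alpha> \<cdot> (q \<rhd> A) = q \<cdot> (M \<lhd> \<xi>)" "q \<cdot> (\<mu> \<rhd> N) = q \<cdot> (M \<lhd> \<nu>)" "epi q"
    "q = tq C (M, \<mu>) (N, \<nu>)" "is_coequalizer C (\<mu> \<rhd> N) (M \<lhd> \<nu>) q"
    "act_obj C A (M, \<mu>) (N, \<nu>, \<xi>) = (T, \<alpha>)" "rmod M \<mu>" "bimod (N, \<nu>, \<xi>)" "rmod T \<alpha>"
  using assms rmodD(1) coequalizer_eq coequalizer_epi unfolding act_tensor_def by blast+

lemma act_tensorE:
  assumes M': "rmod M \<mu>" and N': "bimod (N, \<nu>, \<xi>)"
  obtains q T \<alpha> where "act_tensor M \<mu> N \<nu> \<xi> q T \<alpha>"
proof -
  note M [typing] = rmodD[OF M']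
  note N [typing] = bimodD[OF N']
  obtain q T where q1: "q = tq C (M, \<mu>) (N, \<nu>)" and q [typing]: "q \<in> hom C (M \<otimes> N) T" and T [typing]: "T \<in> Obj C"
    and c: "is_coequalizer C (\<mu> \<rhd> N) (M \<lhd> \<nu>) q" and qb: "q \<cdot> (\<mu> \<rhd> N) = q \<cdot> (M \<lhd> \<nu>)"
    by (rule tensorE[OF M(1) N(2) M(2) N(3)])
  have cA: "is_coequalizer C (\<mu> \<rhd> N \<rhd> A) ((M \<lhd> \<nu>) \<rhd> A) (q \<rhd> A)" by (rule left_coflatD[OF coflat_A c])
  have qA: "q \<rhd> A \<in> hom C (M \<otimes> N \<otimes> A) (T \<otimes> A)" by (rule depicts_in, (rule depicts typing)+, simp)
  have k: "q \<cdot> (M \<lhd> \<xi>) \<in> hom C (M \<otimes> N \<otimes> A) T" by (rule depicts_in, (rule depicts typing)+, simp)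
  have "q \<cdot> (M \<lhd> \<xi>) \<cdot> (\<mu> \<rhd> N \<rhd> A) = q \<cdot> (M \<lhd> \<xi>) \<cdot> ((M \<lhd> \<nu>) \<rhd> A)"
    by (rule diagram_eq[OF eqs2[OF qb N(9)], where c = "[Up 1 1, Rw 0 1 0, Rv 1 0 1]"],
      (rule depicts typing)+, simp add: derivable_simps)
  note F = coequalizer_factor[OF cA qA k this]
  define \<alpha> where "\<alpha> = factor C (q \<rhd> A) (q \<cdot> (M \<lhd> \<xi>))"
  from F have \<alpha> [typing]: "\<alpha> \<in> hom C (T \<otimes> A) T" and \<alpha>q: "\<alpha> \<cdot> (q \<rhd> A) = q \<cdot> (M \<lhd> \<xi>)" by (simp_all add: \<alpha>_def)
  have \<alpha>m: "\<alpha> \<cdot> (\<alpha> \<rhd> A) = \<alpha> \<cdot> (T \<lhd> m)"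
    by (rule epi_diagram_eq[OF coflat_epi[OF coflat_A cA] eqs2[OF \<alpha>q N(7)],
      where c = "[Rw 0 0 0, Rw 0 1 0, Rw 1 0 1, Rv 0 1 0, Up 1 1]"], (rule depicts typing)+,
      simp add: derivable_simps)
  have \<alpha>\<eta>: "\<alpha> \<cdot> (T \<lhd> \<eta>) = Ident C T"
    by (rule epi_diagram_eq[OF coequalizer_epi[OF c] eqs2[OF \<alpha>q N(8)], where c = "[Up 1 1,
      Rw 0 1 0, Rw 1 0 1]"], (rule depicts typing)+, simp add: derivable_simps)
  have "act_obj C A (M, \<mu>) (N, \<nu>, \<xi>) = (T, \<alpha>)"
    using q by (simp add: act_obj_def q1[symmetric] \<alpha>_def Let_def hom_def)
  moreover have "rmod T \<alpha>" using T \<alpha> \<alpha>m \<alpha>\<eta> by (simp add: right_module_def)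
  ultimately show thesis using that M' N' q1 q c \<alpha> \<alpha>q by (simp add: act_tensor_def)
qed

definition bimod_tensor :: "'a \<Rightarrow> 'b \<Rightarrow> 'b \<Rightarrow> 'a \<Rightarrow> 'b \<Rightarrow> 'b \<Rightarrow> 'b \<Rightarrow> 'a \<Rightarrow> 'b \<Rightarrow> 'b \<Rightarrow> bool" where
  "bimod_tensor M l \<mu> N \<nu> \<xi> q T \<alpha> \<kappa> \<longleftrightarrow> act_tensor M \<mu> N \<nu> \<xi> q T \<alpha> \<and> bimod (M, l, \<mu>) \<and>
     bim_tensor C A (M, l, \<mu>) (N, \<nu>, \<xi>) = (T, \<kappa>, \<alpha>) \<and> \<kappa> \<in> hom C (A \<otimes> T) T \<and> \<kappa> \<cdot> (A \<lhd> q) = q \<cdot> (l \<rhd> N) \<and>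
     bimod (T, \<kappa>, \<alpha>)"

lemma bimod_tensorD:
  assumes "bimod_tensor M l \<mu> N \<nu> \<xi> q T \<alpha> \<kappa>"
  shows "act_tensor M \<mu> N \<nu> \<xi> q T \<alpha>" "\<kappa> \<in> hom C (A \<otimes> T) T" "\<kappa> \<cdot> (A \<lhd> q) = q \<cdot> (l \<rhd> N)"
    "bim_tensor C A (M, l, \<mu>) (N, \<nu>, \<xi>) = (T, \<kappa>, \<alpha>)" "bimod (M, l, \<mu>)" "bimod (T, \<kappa>, \<alpha>)"
  using assms by (simp_all add: bimod_tensor_def)

lemma robust_coequalizer:
  "robust_left N \<nu> \<Longrightarrow> act_tensor M \<mu> N \<nu> \<xi> q T \<alpha> \<Longrightarrow> L \<in> Obj C \<Longrightarrow>
   is_coequalizer C (L \<lhd> (\<mu> \<rhd> N)) (L \<lhd> (M \<lhd> \<nu>)) (L \<lhd> q)"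
  by (auto simp: robust_def act_tensor_def)

lemma bim_tensorE:
  assumes M': "bimod (M, l, \<mu>)" and rb: "robust_left N \<nu>" and t: "act_tensor M \<mu> N \<nu> \<xi> q T \<alpha>"
  obtains \<kappa> where "bimod_tensor M l \<mu> N \<nu> \<xi> q T \<alpha> \<kappa>"
proof -
  note q [typing] = act_tensorD[OF t]
  note M [typing] = bimodD[OF M']
  note N [typing] = bimodD[OF q(11)]
  have cA: "is_coequalizer C (A \<lhd> (\<mu> \<rhd> N)) (A \<lhd> (M \<lhd> \<nu>)) (A \<lhd> q)"
    by (rule robust_coequalizer[OF rb t A])
  have Aq: "A \<lhd> q \<in> hom C (A \<otimes> (M \<otimes> N)) (A \<otimes> T)" by (rule depicts_in, (rule depicts typing)+, simp)
  have k: "q \<cdot> (l \<rhd> N) \<in> hom C (A \<otimes> (M \<otimes> N)) T" by (rule depicts_in, (rule depicts typing)+, simp)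
  have "q \<cdot> (l \<rhd> N) \<cdot> (A \<lhd> (\<mu> \<rhd> N)) = q \<cdot> (l \<rhd> N) \<cdot> (A \<lhd> (M \<lhd> \<nu>))"
    by (rule diagram_eq[OF eqs2[OF q(5) M(9)], where c = "[Rv 1 0 0, Rw 0 1 0, Up 1 1]"],
      (rule depicts typing)+, simp add: derivable_simps)
  note F = coequalizer_factor[OF cA Aq k this]
  define \<kappa> where "\<kappa> = factor C (A \<lhd> q) (q \<cdot> (l \<rhd> N))"
  from F have \<kappa> [typing]: "\<kappa> \<in> hom C (A \<otimes> T) T" and \<kappa>q: "\<kappa> \<cdot> (A \<lhd> q) = q \<cdot> (l \<rhd> N)" by (simp_all add: \<kappa>_def)
  have bt: "bim_tensor C A (M, l, \<mu>) (N, \<nu>, \<xi>) = (T, \<kappa>, \<alpha>)"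
    by (simp add: bim_tensor_def q(9) q(7)[symmetric] \<kappa>_def Let_def)
  have AA [typing]: "A \<otimes> A \<in> Obj C" using A by simp
  have eAA: "epi (A \<otimes> A \<lhd> q)" by (rule coequalizer_epi[OF robust_coequalizer[OF rb t AA]])
  have "\<kappa> \<cdot> (A \<lhd> \<kappa>) = \<kappa> \<cdot> (m \<rhd> T)"
    by (rule epi_diagram_eq[OF eAA eqs2[OF \<kappa>q M(5)], where c = "[Rw 0 0 1, Rw 0 1 0, Rw 1 0 0,
      Rv 0 1 0, Up 1 1]"], (rule depicts typing)+, simp add: derivable_simps)
  moreover have "\<kappa> \<cdot> (\<eta> \<rhd> T) = Ident C T"
    by (rule epi_diagram_eq[OF q(6) eqs2[OF \<kappa>q M(6)], where c = "[Up 1 1, Rw 0 1 0,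
      Rw 1 0 0]"], (rule depicts typing)+, simp add: derivable_simps)
  moreover have "\<alpha> \<cdot> (\<kappa> \<rhd> A) = \<kappa> \<cdot> (A \<lhd> \<alpha>)"
    by (rule epi_diagram_eq[OF coflat_epi[OF coflat_A cA] eqs2[OF \<kappa>q q(4)],
      where c = "[Rw 0 0 0, Rw 1 1 0, Up 1 1, Rv 0 1 0, Rv 1 0 1]"], (rule depicts typing)+,
      simp add: derivable_simps)
  ultimately have "bimod (T, \<kappa>, \<alpha>)" by (rule bimodI[OF q(12) \<kappa>])
  then show thesis using that t M' bt \<kappa> \<kappa>q by (simp add: bimod_tensor_def)
qed

lemma bimod_tensorE:
  assumes "bimod (M, l, \<mu>)" "bimod (N, \<nu>, \<xi>)" "robust_left N \<nu>"
  obtains q T \<alpha> \<kappa> where "bimod_tensor M l \<mu> N \<nu> \<xi> q T \<alpha> \<kappa>"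
  by (rule act_tensorE[OF bimodD(1)[OF assms(1)] assms(2)]) (rule bim_tensorE[OF assms(1,3)], assumption, rule that)

lemma act_assoc:
  assumes t: "act_tensor M \<mu> N \<nu> \<xi> q T \<alpha>" and b: "bimod_tensor N \<nu> \<xi> P \<pi> \<chi> p S \<beta> \<kappa>"
    and s: "act_tensor T \<alpha> P \<pi> \<chi> u U \<gamma>" and r: "act_tensor M \<mu> S \<kappa> \<beta> v V \<zeta>"
    and rb: "robust_left P \<pi>" and cP: "left_coflat C P"
  shows "act_assoc C A (M, \<mu>) (N, \<nu>, \<xi>) (P, \<pi>, \<chi>) \<in> hom C U V"
    "act_assoc C A (M, \<mu>) (N, \<nu>, \<xi>) (P, \<pi>, \<chi>) \<cdot> (u \<cdot> (q \<rhd> P)) = v \<cdot> (M \<lhd> p)" "epi (u \<cdot> (q \<rhd> P))"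
proof -
  note q [typing] = act_tensorD[OF t]
  note p [typing] = act_tensorD[OF bimod_tensorD(1)[OF b]]
  note bt [typing] = bimod_tensorD[OF b]
  note u [typing] = act_tensorD[OF s]
  note v [typing] = act_tensorD[OF r]
  note M [typing] = rmodD[OF q(10)]
  note N [typing] = bimodD[OF q(11)]
  note P [typing] = bimodD[OF u(11)]
  have cP': "is_coequalizer C (\<mu> \<rhd> N \<rhd> P) ((M \<lhd> \<nu>) \<rhd> P) (q \<rhd> P)" by (rule left_coflatD[OF cP q(8)])
  have qP: "q \<rhd> P \<in> hom C (M \<otimes> N \<otimes> P) (T \<otimes> P)" by (rule depicts_in, (rule depicts typing)+, simp)
  have k: "v \<cdot> (M \<lhd> p) \<in> hom C (M \<otimes> N \<otimes> P) V" by (rule depicts_in, (rule depicts typing)+, simp)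
  have "v \<cdot> (M \<lhd> p) \<cdot> (\<mu> \<rhd> N \<rhd> P) = v \<cdot> (M \<lhd> p) \<cdot> ((M \<lhd> \<nu>) \<rhd> P)"
    by (rule diagram_eq[OF eqs2[OF v(5) bt(3)], where c = "[Up 1 1, Rw 0 1 0, Rw 1 0 1]"],
      (rule depicts typing)+, simp add: derivable_simps)
  from coequalizer_ex[OF cP' qP k this] obtain h where h [typing]: "h \<in> hom C (T \<otimes> P) V"
    and hq: "h \<cdot> (q \<rhd> P) = v \<cdot> (M \<lhd> p)" by blast
  have "h \<cdot> (\<alpha> \<rhd> P) = h \<cdot> (T \<lhd> \<pi>)"
    by (rule epi_diagram_eq[OF coflat_epi[OF cP left_coflatD[OF coflat_A q(8)]] eqs3[OF q(4)
      hq p(5)], where c = "[Rw 0 0 0, Rw 1 1 0, Rw 2 0 1, Rv 1 1 0, Up 1 1]"],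
      (rule depicts typing)+, simp add: derivable_simps)
  from coequalizer_ex[OF u(8) u(1) h this] obtain a' where a' [typing]: "a' \<in> hom C U V" and au: "a' \<cdot> u = h" by blast
  have uq: "u \<cdot> (q \<rhd> P) \<in> hom C (M \<otimes> N \<otimes> P) U" by (rule depicts_in, (rule depicts typing)+, simp)
  show e: "epi (u \<cdot> (q \<rhd> P))"
    by (rule epi_comp[OF coequalizer_epi[OF cP'] u(6) qP u(1)])
  have auq: "a' \<cdot> (u \<cdot> (q \<rhd> P)) = v \<cdot> (M \<lhd> p)"
    by (rule diagram_eq[OF eqs2[OF au hq], where c = "[Rw 0 1 0, Rw 1 0 0]"],
      (rule depicts typing)+, simp add: derivable_simps)
  have "act_assoc C A (M, \<mu>) (N, \<nu>, \<xi>) (P, \<pi>, \<chi>) = factor C (u \<cdot> (q \<rhd> P)) (v \<cdot> (M \<lhd> p))"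
    by (simp add: act_assoc_def q(9) bt(4) q(7)[symmetric] p(7)[symmetric] u(7)[symmetric] v(7)[symmetric])
  with factor_eq[OF uq e a' auq] a' auq
  show "act_assoc C A (M, \<mu>) (N, \<nu>, \<xi>) (P, \<pi>, \<chi>) \<in> hom C U V"
    "act_assoc C A (M, \<mu>) (N, \<nu>, \<xi>) (P, \<pi>, \<chi>) \<cdot> (u \<cdot> (q \<rhd> P)) = v \<cdot> (M \<lhd> p)" by simp_all
qed

definition free_left :: "'a \<Rightarrow> 'b \<Rightarrow> 'a \<Rightarrow> 'b \<Rightarrow> 'b \<Rightarrow> bool" where
  "free_left N \<nu> Y s t \<longleftrightarrow> N \<in> Obj C \<and> Y \<in> Obj C \<and> \<nu> \<in> hom C (A \<otimes> N) N \<and> s \<in> hom C (A \<otimes> Y) N \<and>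
     t \<in> hom C N (A \<otimes> Y) \<and> s \<cdot> t = Ident C N \<and> t \<cdot> s = Ident C (A \<otimes> Y) \<and> \<nu> \<cdot> (A \<lhd> s) = s \<cdot> (m \<rhd> Y)"

lemma free_leftD:
  assumes "free_left N \<nu> Y s t"
  shows "N \<in> Obj C" "Y \<in> Obj C" "\<nu> \<in> hom C (A \<otimes> N) N" "s \<in> hom C (A \<otimes> Y) N" "t \<in> hom C N (A \<otimes> Y)"
    "s \<cdot> t = Ident C N" "t \<cdot> s = Ident C (A \<otimes> Y)" "\<nu> \<cdot> (A \<lhd> s) = s \<cdot> (m \<rhd> Y)"
  using assms by (simp_all add: free_left_def)

lemma free_left_refl: "Y \<in> Obj C \<Longrightarrow> free_left (A \<otimes> Y) (m \<rhd> Y) Y (Ident C (A \<otimes> Y)) (Ident C (A \<otimes> Y))"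
proof -
  assume Y [typing]: "Y \<in> Obj C"
  have "m \<rhd> Y \<in> hom C (A \<otimes> (A \<otimes> Y)) (A \<otimes> Y)" by (rule depicts_in, (rule depicts typing)+, simp)
  moreover have "(m \<rhd> Y) \<cdot> (A \<lhd> Ident C (A \<otimes> Y)) = Ident C (A \<otimes> Y) \<cdot> (m \<rhd> Y)"
    by (rule diagram_eq[OF eqs0, where c = "[]"], (rule depicts typing)+,
      simp add: derivable_simps)
  moreover have "Ident C (A \<otimes> Y) \<cdot> Ident C (A \<otimes> Y) = Ident C (A \<otimes> Y)"
    by (rule diagram_eq[OF eqs0, where c = "[]"], (rule depicts typing)+,
      simp add: derivable_simps)
  ultimately show ?thesis using Y A by (simp add: free_left_def)
qed

text \<open>Over a free left module the defining coequalizer is split, with quotient object M \<otimes> Y.\<close>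

lemma free_split:
  assumes M': "rmod M \<mu>" and N': "free_left N \<nu> Y s t" and L [typing]: "L \<in> Obj C"
  shows "is_coequalizer C (L \<lhd> (\<mu> \<rhd> N)) (L \<lhd> (M \<lhd> \<nu>)) (L \<lhd> ((\<mu> \<rhd> Y) \<cdot> (M \<lhd> t)))"
    and "is_coequalizer C (\<mu> \<rhd> N) (M \<lhd> \<nu>) ((\<mu> \<rhd> Y) \<cdot> (M \<lhd> t))"
proof -
  note M [typing] = rmodD[OF M']
  note N [typing] = free_leftD[OF N']
  have t\<nu>: "t \<cdot> \<nu> = (m \<rhd> Y) \<cdot> (A \<lhd> t)"
  proof -
    have "t \<cdot> \<nu> = t \<cdot> \<nu> \<cdot> (A \<lhd> (s \<cdot> t))"
      by (rule diagram_eq[OF eqs1[OF N(6)], where c = "[Rv 0 0 1]"], (rule depicts typing)+,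
        simp add: derivable_simps)
    also have "\<dots> = (m \<rhd> Y) \<cdot> (A \<lhd> t)"
      by (rule diagram_eq[OF eqs2[OF N(8) N(7)], where c = "[Rw 0 1 0, Rw 1 2 0]"],
        (rule depicts typing)+, simp add: derivable_simps)
    finally show ?thesis .
  qed
  show "is_coequalizer C (L \<lhd> (\<mu> \<rhd> N)) (L \<lhd> (M \<lhd> \<nu>)) (L \<lhd> ((\<mu> \<rhd> Y) \<cdot> (M \<lhd> t)))"
  proof (rule split_coequalizer)
    show "L \<lhd> (\<mu> \<rhd> N) \<in> hom C (L \<otimes> M \<otimes> A \<otimes> N) (L \<otimes> M \<otimes> N)"
      by (rule depicts_in, (rule depicts typing)+, simp)
    show "L \<lhd> (M \<lhd> \<nu>) \<in> hom C (L \<otimes> M \<otimes> A \<otimes> N) (L \<otimes> M \<otimes> N)"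
      by (rule depicts_in, (rule depicts typing)+, simp)
    show "L \<lhd> ((\<mu> \<rhd> Y) \<cdot> (M \<lhd> t)) \<in> hom C (L \<otimes> M \<otimes> N) (L \<otimes> M \<otimes> Y)"
      by (rule depicts_in, (rule depicts typing)+, simp)
    show "(L \<lhd> ((\<mu> \<rhd> Y) \<cdot> (M \<lhd> t))) \<cdot> (L \<lhd> (\<mu> \<rhd> N)) = (L \<lhd> ((\<mu> \<rhd> Y) \<cdot> (M \<lhd> t))) \<cdot> (L \<lhd> (M \<lhd> \<nu>))"
      by (rule diagram_eq[OF eqs2[OF t\<nu> M(3)], where c = "[Up 1 1, Rw 1 1 1, Rv 0 0 2]"],
        (rule depicts typing)+, simp add: derivable_simps)
    show "L \<otimes> M \<lhd> (s \<cdot> (\<eta> \<rhd> Y)) \<in> hom C (L \<otimes> M \<otimes> Y) (L \<otimes> M \<otimes> N)"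
      by (rule depicts_in, (rule depicts typing)+, simp)
    show "(L \<otimes> M \<otimes> A \<lhd> (s \<cdot> (\<eta> \<rhd> Y))) \<cdot> (L \<otimes> M \<lhd> t) \<in> hom C (L \<otimes> M \<otimes> N) (L \<otimes> M \<otimes> A \<otimes> N)"
      by (rule depicts_in, (rule depicts typing)+, simp)
    show "(L \<lhd> ((\<mu> \<rhd> Y) \<cdot> (M \<lhd> t))) \<cdot> (L \<otimes> M \<lhd> (s \<cdot> (\<eta> \<rhd> Y))) = Ident C (L \<otimes> M \<otimes> Y)"
      by (rule diagram_eq[OF eqs2[OF N(7) M(4)], where c = "[Rw 0 1 2, Rw 1 0 1]"],
        (rule depicts typing)+, simp add: derivable_simps)
    show "(L \<lhd> (\<mu> \<rhd> N)) \<cdot> ((L \<otimes> M \<otimes> A \<lhd> (s \<cdot> (\<eta> \<rhd> Y))) \<cdot> (L \<otimes> M \<lhd> t)) = (L \<otimes> M \<lhd> (s \<cdot> (\<eta> \<rhd> Y))) \<cdot> (L \<lhd> ((\<mu> \<rhd> Y) \<cdot> (M \<lhd> t)))"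
      by (rule diagram_eq[OF eqs0, where c = "[Up 3 2]"], (rule depicts typing)+,
        simp add: derivable_simps)
    show "(L \<lhd> (M \<lhd> \<nu>)) \<cdot> ((L \<otimes> M \<otimes> A \<lhd> (s \<cdot> (\<eta> \<rhd> Y))) \<cdot> (L \<otimes> M \<lhd> t)) = Ident C (L \<otimes> M \<otimes> N)"
      by (rule diagram_eq[OF eqs3[OF N(8) \<eta>r N(6)], where c = "[Rw 0 2 2, Rw 1 1 2,
        Rw 2 0 2]"], (rule depicts typing)+, simp add: derivable_simps)
  qed
  show "is_coequalizer C (\<mu> \<rhd> N) (M \<lhd> \<nu>) ((\<mu> \<rhd> Y) \<cdot> (M \<lhd> t))"
  proof (rule split_coequalizer)
    show "\<mu> \<rhd> N \<in> hom C (M \<otimes> A \<otimes> N) (M \<otimes> N)" by (rule depicts_in, (rule depicts typing)+, simp)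
    show "M \<lhd> \<nu> \<in> hom C (M \<otimes> A \<otimes> N) (M \<otimes> N)" by (rule depicts_in, (rule depicts typing)+, simp)
    show "(\<mu> \<rhd> Y) \<cdot> (M \<lhd> t) \<in> hom C (M \<otimes> N) (M \<otimes> Y)"
      by (rule depicts_in, (rule depicts typing)+, simp)
    show "(\<mu> \<rhd> Y) \<cdot> (M \<lhd> t) \<cdot> (\<mu> \<rhd> N) = (\<mu> \<rhd> Y) \<cdot> (M \<lhd> t) \<cdot> (M \<lhd> \<nu>)"
      by (rule diagram_eq[OF eqs2[OF t\<nu> M(3)], where c = "[Up 1 1, Rw 1 1 0, Rv 0 0 1]"],
        (rule depicts typing)+, simp add: derivable_simps)
    show "M \<lhd> (s \<cdot> (\<eta> \<rhd> Y)) \<in> hom C (M \<otimes> Y) (M \<otimes> N)"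
      by (rule depicts_in, (rule depicts typing)+, simp)
    show "(M \<otimes> A \<lhd> (s \<cdot> (\<eta> \<rhd> Y))) \<cdot> (M \<lhd> t) \<in> hom C (M \<otimes> N) (M \<otimes> A \<otimes> N)"
      by (rule depicts_in, (rule depicts typing)+, simp)
    show "(\<mu> \<rhd> Y) \<cdot> (M \<lhd> t) \<cdot> (M \<lhd> (s \<cdot> (\<eta> \<rhd> Y))) = Ident C (M \<otimes> Y)"
      by (rule diagram_eq[OF eqs2[OF N(7) M(4)], where c = "[Rw 0 1 1, Rw 1 0 0]"],
        (rule depicts typing)+, simp add: derivable_simps)
    show "(\<mu> \<rhd> N) \<cdot> ((M \<otimes> A \<lhd> (s \<cdot> (\<eta> \<rhd> Y))) \<cdot> (M \<lhd> t)) = (M \<lhd> (s \<cdot> (\<eta> \<rhd> Y))) \<cdot> ((\<mu> \<rhd> Y) \<cdot> (M \<lhd> t))"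
      by (rule diagram_eq[OF eqs0, where c = "[Up 3 2]"], (rule depicts typing)+,
        simp add: derivable_simps)
    show "(M \<lhd> \<nu>) \<cdot> ((M \<otimes> A \<lhd> (s \<cdot> (\<eta> \<rhd> Y))) \<cdot> (M \<lhd> t)) = Ident C (M \<otimes> N)"
      by (rule diagram_eq[OF eqs3[OF N(8) \<eta>r N(6)], where c = "[Rw 0 2 1, Rw 1 1 1,
        Rw 2 0 1]"], (rule depicts typing)+, simp add: derivable_simps)
  qed
qed

definition split_tensor :: "'a \<Rightarrow> 'b \<Rightarrow> 'a \<Rightarrow> 'b \<Rightarrow> 'b \<Rightarrow> 'b \<Rightarrow> 'a \<Rightarrow> 'b \<Rightarrow> 'a \<Rightarrow> 'b \<Rightarrow> 'b \<Rightarrow> 'b \<Rightarrow> 'b \<Rightarrow> bool" where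
  "split_tensor M \<mu> N \<nu> \<xi> q T \<alpha> Y s t \<theta> l \<longleftrightarrow> act_tensor M \<mu> N \<nu> \<xi> q T \<alpha> \<and> free_left N \<nu> Y s t \<and>
     \<theta> \<in> hom C (M \<otimes> Y) T \<and> l \<in> hom C T (M \<otimes> Y) \<and> l \<cdot> q = (\<mu> \<rhd> Y) \<cdot> (M \<lhd> t) \<and> q = \<theta> \<cdot> (\<mu> \<rhd> Y) \<cdot> (M \<lhd> t) \<and>
     \<theta> = q \<cdot> (M \<lhd> s) \<cdot> (M \<lhd> \<eta> \<rhd> Y) \<and> \<theta> \<cdot> l = Ident C T \<and> l \<cdot> \<theta> = Ident C (M \<otimes> Y)"

lemma split_tensorD:
  assumes "split_tensor M \<mu> N \<nu> \<xi> q T \<alpha> Y s t \<theta> l"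
  shows "\<theta> \<in> hom C (M \<otimes> Y) T" "l \<in> hom C T (M \<otimes> Y)" "l \<cdot> q = (\<mu> \<rhd> Y) \<cdot> (M \<lhd> t)"
    "q = \<theta> \<cdot> (\<mu> \<rhd> Y) \<cdot> (M \<lhd> t)" "\<theta> = q \<cdot> (M \<lhd> s) \<cdot> (M \<lhd> \<eta> \<rhd> Y)" "\<theta> \<cdot> l = Ident C T" "l \<cdot> \<theta> = Ident C (M \<otimes> Y)"
    "free_left N \<nu> Y s t" "act_tensor M \<mu> N \<nu> \<xi> q T \<alpha>"
  using assms unfolding split_tensor_def by blast+

lemma split_tensorE:
  assumes N': "free_left N \<nu> Y s t" and a: "act_tensor M \<mu> N \<nu> \<xi> q T \<alpha>"
  obtains \<theta> l where "split_tensor M \<mu> N \<nu> \<xi> q T \<alpha> Y s t \<theta> l"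
proof -
  note q [typing] = act_tensorD[OF a]
  note M [typing] = rmodD[OF q(10)]
  note N [typing] = free_leftD[OF N']
  have k: "(\<mu> \<rhd> Y) \<cdot> (M \<lhd> t) \<in> hom C (M \<otimes> N) (M \<otimes> Y)"
    by (rule depicts_in, (rule depicts typing)+, simp)
  from coequalizer_ex[OF q(8) q(1) k coequalizer_eq[OF free_split(2)[OF q(10) N']]]
  obtain l where l [typing]: "l \<in> hom C T (M \<otimes> Y)" and lq: "l \<cdot> q = (\<mu> \<rhd> Y) \<cdot> (M \<lhd> t)" by blast
  obtain \<theta> where \<theta>1: "\<theta> = q \<cdot> (M \<lhd> s) \<cdot> (M \<lhd> \<eta> \<rhd> Y)" by blast
  have "q \<cdot> (M \<lhd> s) \<cdot> (M \<lhd> \<eta> \<rhd> Y) \<in> hom C (M \<otimes> Y) T"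
    by (rule depicts_in, (rule depicts typing)+, simp)
  then have \<theta> [typing]: "\<theta> \<in> hom C (M \<otimes> Y) T" by (simp add: \<theta>1)
  have "\<theta> \<cdot> (\<mu> \<rhd> Y) \<cdot> (M \<lhd> t) = q \<cdot> (\<mu> \<rhd> N) \<cdot> (M \<otimes> A \<lhd> (s \<cdot> (\<eta> \<rhd> Y))) \<cdot> (M \<lhd> t)"
    by (rule diagram_eq[OF eqs1[OF \<theta>1], where c = "[Rw 0 2 0, Up 2 1, Up 3 1]"],
      (rule depicts typing)+, simp add: derivable_simps)
  also have "\<dots> = q"
    by (rule diagram_eq[OF eqs4[OF q(5) N(8) \<eta>r N(6)], where c = "[Rw 0 3 0, Rw 1 2 1,
      Rw 2 1 1, Rw 3 0 1]"], (rule depicts typing)+, simp add: derivable_simps)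
  finally have \<theta>q: "\<theta> \<cdot> (\<mu> \<rhd> Y) \<cdot> (M \<lhd> t) = q" .
  have "\<theta> \<cdot> l = Ident C T"
    by (rule epi_diagram_eq[OF q(6) eqs2[OF lq \<theta>q], where c = "[Rw 0 0 0, Rw 1 0 0]"],
      (rule depicts typing)+, simp add: derivable_simps)
  moreover have "l \<cdot> \<theta> = Ident C (M \<otimes> Y)"
    by (rule diagram_eq[OF eqs4[OF \<theta>1 lq N(7) M(4)], where c = "[Rw 0 0 0, Rw 1 2 0, Rw 2 1 1,
      Rw 3 0 0]"], (rule depicts typing)+, simp add: derivable_simps)
  ultimately have "split_tensor M \<mu> N \<nu> \<xi> q T \<alpha> Y s t \<theta> l"
    unfolding split_tensor_def using N' a \<theta> l lq \<theta>q[symmetric] \<theta>1 by blast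
  then show thesis by (rule that)
qed

lemma free_robust:
  assumes bN: "bimod (N, \<nu>, \<xi>)" and N': "free_left N \<nu> Y s t"
  shows "robust_left N \<nu>"
  unfolding robust_def
proof (intro conjI ballI allI impI)
  show "left_module C A m \<eta> N \<nu>" using bN by (simp add: bimodule_def)
  fix L M \<mu> assume L [typing]: "L \<in> Obj C" and M': "rmod M \<mu>"
  obtain q T \<alpha> where a: "act_tensor M \<mu> N \<nu> \<xi> q T \<alpha>" by (rule act_tensorE[OF M' bN])
  obtain \<theta> l where s: "split_tensor M \<mu> N \<nu> \<xi> q T \<alpha> Y s t \<theta> l" by (rule split_tensorE[OF N' a])
  note q [typing] = act_tensorD[OF a]
  note sp [typing] = split_tensorD[OF s]
  note M [typing] = rmodD[OF M']
  note N [typing] = free_leftD[OF N']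
  have "is_coequalizer C (L \<lhd> (\<mu> \<rhd> N)) (L \<lhd> (M \<lhd> \<nu>)) ((L \<lhd> \<theta>) \<cdot> (L \<lhd> ((\<mu> \<rhd> Y) \<cdot> (M \<lhd> t))))"
  proof (rule coequalizer_iso[OF free_split(1)[OF M' N' L]])
    show "L \<lhd> (\<mu> \<rhd> N) \<in> hom C (L \<otimes> M \<otimes> A \<otimes> N) (L \<otimes> M \<otimes> N)"
      by (rule depicts_in, (rule depicts typing)+, simp)
    show "L \<lhd> ((\<mu> \<rhd> Y) \<cdot> (M \<lhd> t)) \<in> hom C (L \<otimes> M \<otimes> N) (L \<otimes> M \<otimes> Y)"
      by (rule depicts_in, (rule depicts typing)+, simp)
    show "L \<lhd> \<theta> \<in> hom C (L \<otimes> M \<otimes> Y) (L \<otimes> T)" by (rule depicts_in, (rule depicts typing)+, simp)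
    show "L \<lhd> l \<in> hom C (L \<otimes> T) (L \<otimes> M \<otimes> Y)" by (rule depicts_in, (rule depicts typing)+, simp)
    show "(L \<lhd> l) \<cdot> (L \<lhd> \<theta>) = Ident C (L \<otimes> M \<otimes> Y)"
      by (rule diagram_eq[OF eqs1[OF sp(7)], where c = "[Rw 0 0 1]"], (rule depicts typing)+,
        simp add: derivable_simps)
    show "(L \<lhd> \<theta>) \<cdot> (L \<lhd> l) = Ident C (L \<otimes> T)"
      by (rule diagram_eq[OF eqs1[OF sp(6)], where c = "[Rw 0 0 1]"], (rule depicts typing)+,
        simp add: derivable_simps)
  qed
  moreover have "(L \<lhd> \<theta>) \<cdot> (L \<lhd> ((\<mu> \<rhd> Y) \<cdot> (M \<lhd> t))) = L \<lhd> q"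
    by (rule diagram_eq[OF eqs1[OF sp(4)], where c = "[Rv 0 0 1]"], (rule depicts typing)+,
      simp add: derivable_simps)
  ultimately show "is_coequalizer C (L \<lhd> (\<mu> \<rhd> N)) (L \<lhd> (M \<lhd> \<nu>)) (L \<lhd> tq C (M, \<mu>) (N, \<nu>))" by (simp add: q(7))
qed

end

context coflat_algebra
begin

lemma free_tensor:
  assumes b: "bimod_tensor M \<kappa>M \<mu> N \<nu> \<xi> q T \<alpha> \<kappa>" and fM: "free_left M \<kappa>M Y s t"
    and sN: "split_tensor M \<mu> N \<nu> \<xi> q T \<alpha> Z s' t' \<theta> l"
  shows "free_left T \<kappa> (Y \<otimes> Z) (\<theta> \<cdot> (s \<rhd> Z)) ((t \<rhd> Z) \<cdot> l)"
proof -
  note q [typing] = act_tensorD[OF bimod_tensorD(1)[OF b]]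
  note bt [typing] = bimod_tensorD[OF b]
  note sp [typing] = split_tensorD[OF sN]
  note M [typing] = bimodD[OF bt(5)]
  note Y [typing] = free_leftD[OF fM]
  note N [typing] = free_leftD[OF sp(8)]
  have "\<theta> \<cdot> (s \<rhd> Z) \<in> hom C (A \<otimes> (Y \<otimes> Z)) T" by (rule depicts_in, (rule depicts typing)+, simp)
  moreover have "(t \<rhd> Z) \<cdot> l \<in> hom C T (A \<otimes> (Y \<otimes> Z))"
    by (rule depicts_in, (rule depicts typing)+, simp)
  moreover have "\<theta> \<cdot> (s \<rhd> Z) \<cdot> ((t \<rhd> Z) \<cdot> l) = Ident C T"
    by (rule diagram_eq[OF eqs2[OF Y(6) sp(6)], where c = "[Rw 0 1 0, Rw 1 0 0]"],
      (rule depicts typing)+, simp add: derivable_simps)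
  moreover have "(t \<rhd> Z) \<cdot> l \<cdot> (\<theta> \<cdot> (s \<rhd> Z)) = Ident C (A \<otimes> (Y \<otimes> Z))"
    by (rule diagram_eq[OF eqs2[OF Y(7) sp(7)], where c = "[Rw 1 1 0, Rw 0 0 0]"],
      (rule depicts typing)+, simp add: derivable_simps)
  moreover have "\<kappa> \<cdot> (A \<lhd> (\<theta> \<cdot> (s \<rhd> Z))) = \<theta> \<cdot> (s \<rhd> Z) \<cdot> (m \<rhd> Y \<otimes> Z)"
    by (rule diagram_eq[OF eqs3[OF sp(5) bt(3) Y(8)], where c = "[Rw 0 1 1, Rw 1 3 0, Up 3 2,
      Rw 2 0 0, Rv 0 2 0]"], (rule depicts typing)+, simp add: derivable_simps)
  ultimately show ?thesis using q(2) Y(2) N(2) bt(2) by (simp add: free_left_def)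
qed

lemma free_cr:
  assumes "bimod (N, \<nu>, \<xi>)" "free_left N \<nu> Y s t" "left_coflat C Y"
  shows "cr_bimodule C A m \<eta> (N, \<nu>, \<xi>)"
proof -
  note f = free_leftD[OF assms(2)]
  have "left_coflat C N"
    by (rule left_coflat_iso[OF left_coflat_tensor[OF coflat_A assms(3)] f(1) f(4) f(5) f(7) f(6)])
  then show ?thesis
    using assms(1) free_robust[OF assms(1,2)] by (simp add: cr_bimodule_def)
qed

lemma free_bimod_tensorE:
  assumes M': "bimod (M, \<kappa>M, \<mu>)" and N': "bimod (N, \<nu>, \<xi>)" and fN: "free_left N \<nu> Y s t"
  obtains q T \<alpha> \<kappa> \<theta> l where "bimod_tensor M \<kappa>M \<mu> N \<nu> \<xi> q T \<alpha> \<kappa>" "split_tensor M \<mu> N \<nu> \<xi> q T \<alpha> Y s t \<theta> l"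
proof -
  obtain q T \<alpha> \<kappa> where b: "bimod_tensor M \<kappa>M \<mu> N \<nu> \<xi> q T \<alpha> \<kappa>"
    by (rule bimod_tensorE[OF M' N' free_robust[OF N' fN]])
  show thesis by (rule split_tensorE[OF fN bimod_tensorD(1)[OF b]]) (rule that[OF b])
qed

lemma free_act:
  assumes sN: "split_tensor M \<mu> N \<nu> \<xi> q T \<alpha> Y s t \<theta> l"
  shows "l \<cdot> \<alpha> = (\<mu> \<rhd> Y) \<cdot> (M \<lhd> (t \<cdot> \<xi> \<cdot> ((s \<cdot> (\<eta> \<rhd> Y)) \<rhd> A))) \<cdot> (l \<rhd> A)"
proof -
  note sp [typing] = split_tensorD[OF sN]
  note q [typing] = act_tensorD[OF sp(9)]
  note M [typing] = rmodD[OF q(10)]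
  note N [typing] = bimodD[OF q(11)]
  note Y [typing] = free_leftD[OF sp(8)]
  have "l \<cdot> \<alpha> = l \<cdot> \<alpha> \<cdot> ((\<theta> \<cdot> l) \<rhd> A)"
    by (rule diagram_eq[OF eqs1[OF sp(6)], where c = "[Rv 0 0 0]"], (rule depicts typing)+,
      simp add: derivable_simps)
  also have "\<dots> = (\<mu> \<rhd> Y) \<cdot> (M \<lhd> (t \<cdot> \<xi> \<cdot> ((s \<cdot> (\<eta> \<rhd> Y)) \<rhd> A))) \<cdot> (l \<rhd> A)"
    by (rule diagram_eq[OF eqs3[OF sp(5) q(4) sp(3)], where c = "[Rw 0 1 0, Rw 1 3 0,
      Rw 2 4 0]"], (rule depicts typing)+, simp add: derivable_simps)
  finally show ?thesis .
qed

lemma free_act_arr: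
  assumes f': "linear M \<mu> M' \<mu>' f" and g [typing]: "g \<in> hom C N N'" and g\<nu>: "g \<cdot> \<nu> = \<nu>' \<cdot> (A \<lhd> g)"
    and sN: "split_tensor M \<mu> N \<nu> \<xi> q T \<alpha> Y s t \<theta>' l" and sN': "split_tensor M' \<mu>' N' \<nu>' \<xi>' p S \<alpha>' Y' s' t' \<theta> l'"
  shows "act_arr C (M, \<mu>) (M', \<mu>') (N, \<nu>, \<xi>) (N', \<nu>', \<xi>') f g
     = \<theta> \<cdot> (\<mu>' \<rhd> Y') \<cdot> (f \<boxtimes> (t' \<cdot> g \<cdot> s \<cdot> (\<eta> \<rhd> Y))) \<cdot> l"
proof -
  note sp [typing] = split_tensorD[OF sN]
  note q [typing] = act_tensorD[OF sp(9)]
  note sp' [typing] = split_tensorD[OF sN']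
  note p [typing] = act_tensorD[OF sp'(9)]
  note M [typing] = rmodD[OF q(10)]
  note M' [typing] = rmodD[OF p(10)]
  note f [typing] = linearD[OF f']
  note N [typing] = free_leftD[OF sp(8)]
  note N' [typing] = free_leftD[OF sp'(8)]
  have h: "\<theta> \<cdot> (\<mu>' \<rhd> Y') \<cdot> (f \<boxtimes> (t' \<cdot> g \<cdot> s \<cdot> (\<eta> \<rhd> Y))) \<cdot> l \<in> hom C T S"
    by (rule depicts_in, (rule depicts typing)+, simp)
  have t\<nu>': "t' \<cdot> \<nu>' = (m \<rhd> Y') \<cdot> (A \<lhd> t')"
  proof -
    have "t' \<cdot> \<nu>' = t' \<cdot> \<nu>' \<cdot> (A \<lhd> (s' \<cdot> t'))"
      by (rule diagram_eq[OF eqs1[OF N'(6)], where c = "[Rv 0 0 1]"], (rule depicts typing)+,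
        simp add: derivable_simps)
    also have "\<dots> = (m \<rhd> Y') \<cdot> (A \<lhd> t')"
      by (rule diagram_eq[OF eqs2[OF N'(8) N'(7)], where c = "[Rw 0 1 0, Rw 1 2 0]"],
        (rule depicts typing)+, simp add: derivable_simps)
    finally show ?thesis .
  qed
  have gs: "(m \<rhd> Y') \<cdot> (A \<lhd> (t' \<cdot> g \<cdot> s \<cdot> (\<eta> \<rhd> Y))) \<cdot> t = t' \<cdot> g"
  proof -
    have "(m \<rhd> Y') \<cdot> (A \<lhd> (t' \<cdot> g \<cdot> s \<cdot> (\<eta> \<rhd> Y))) \<cdot> t = t' \<cdot> \<nu>' \<cdot> (A \<lhd> (g \<cdot> s \<cdot> (\<eta> \<rhd> Y))) \<cdot> t"
      by (rule diagram_eq[OF eqs1[OF t\<nu>'], where c = "[Rv 0 4 0]"], (rule depicts typing)+,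
        simp add: derivable_simps)
    also have "\<dots> = t' \<cdot> g"
      by (rule diagram_eq[OF eqs4[OF g\<nu> N(8) \<eta>r N(6)], where c = "[Rv 0 3 0, Rw 1 2 0,
        Rw 2 1 0, Rw 3 0 0]"], (rule depicts typing)+, simp add: derivable_simps)
    finally show ?thesis .
  qed
  have "\<theta> \<cdot> (\<mu>' \<rhd> Y') \<cdot> (f \<boxtimes> (t' \<cdot> g \<cdot> s \<cdot> (\<eta> \<rhd> Y))) \<cdot> l \<cdot> q
      = \<theta> \<cdot> (\<mu>' \<rhd> Y') \<cdot> (f \<boxtimes> (t' \<cdot> g \<cdot> s \<cdot> (\<eta> \<rhd> Y))) \<cdot> (\<mu> \<rhd> Y) \<cdot> (M \<lhd> t)"
        by (rule diagram_eq[OF eqs1[OF sp(3)], where c = "[Rw 0 0 0]"],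
          (rule depicts typing)+, simp add: derivable_simps)
  also have "\<dots> = \<theta> \<cdot> (\<mu>' \<rhd> Y') \<cdot> (f \<boxtimes> ((m \<rhd> Y') \<cdot> (A \<lhd> (t' \<cdot> g \<cdot> s \<cdot> (\<eta> \<rhd> Y))) \<cdot> t))"
    by (rule diagram_eq[OF eqs2[OF f(2) M'(3)], where c = "[Rw 0 1 0, Up 1 1, Up 3 1, Up 4 1,
      Up 5 1, Up 6 1, Rw 1 6 0]"], (rule depicts typing)+, simp add: derivable_simps)
  also have "\<dots> = p \<cdot> (f \<boxtimes> g)"
    by (rule diagram_eq[OF eqs2[OF gs sp'(4)], where c = "[Rw 0 1 1, Rv 1 2 0]"],
      (rule depicts typing)+, simp add: derivable_simps)
  finally have "\<theta> \<cdot> (\<mu>' \<rhd> Y') \<cdot> (f \<boxtimes> (t' \<cdot> g \<cdot> s \<cdot> (\<eta> \<rhd> Y))) \<cdot> l \<cdot> q = p \<cdot> (f \<boxtimes> g)" .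
  from factor_eq[OF q(1) q(6) h this]
  show ?thesis by (simp add: act_arr_def q(7)[symmetric] p(7)[symmetric])
qed

lemma free_act_assoc:
  assumes s1: "split_tensor M \<mu> N \<nu> \<xi> q T \<alpha> Y s t \<theta> l"
    and b: "bimod_tensor N \<nu> \<xi> P \<pi> \<chi> p S \<beta> \<kappa>" and s2: "split_tensor N \<xi> P \<pi> \<chi> p S \<beta> Z s' t' \<theta>' k"
    and s3: "split_tensor T \<alpha> P \<pi> \<chi> u U \<gamma> Z s' t' \<theta>'' j"
    and s4: "split_tensor M \<mu> S \<kappa> \<beta> v V \<zeta> (Y \<otimes> Z) (\<theta>' \<cdot> (s \<rhd> Z)) ((t \<rhd> Z) \<cdot> k) h i" and cP: "left_coflat C P"
  shows "act_assoc C A (M, \<mu>) (N, \<nu>, \<xi>) (P, \<pi>, \<chi>) = h \<cdot> (l \<rhd> Z) \<cdot> j"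
proof -
  note f1 [typing] = split_tensorD[OF s1]
  note q [typing] = act_tensorD[OF f1(9)]
  note f2 [typing] = split_tensorD[OF s2]
  note p [typing] = act_tensorD[OF f2(9)]
  note f3 [typing] = split_tensorD[OF s3]
  note u [typing] = act_tensorD[OF f3(9)]
  note f4 [typing] = split_tensorD[OF s4]
  note v [typing] = act_tensorD[OF f4(9)]
  note M [typing] = rmodD[OF q(10)]
  note N [typing] = bimodD[OF q(11)]
  note P [typing] = bimodD[OF u(11)]
  note Y [typing] = free_leftD[OF f1(8)]
  note Z [typing] = free_leftD[OF f2(8)]
  note as = act_assoc[OF f1(9) b f3(9) f4(9) free_robust[OF u(11) f2(8)] cP]
  have uq: "u \<cdot> (q \<rhd> P) \<in> hom C (M \<otimes> N \<otimes> P) U" by (rule depicts_in, (rule depicts typing)+, simp)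
  show ?thesis
  proof (rule epiD[OF as(3) uq as(1)])
    show "h \<cdot> (l \<rhd> Z) \<cdot> j \<in> hom C U V" by (rule depicts_in, (rule depicts typing)+, simp)
    have "h \<cdot> (l \<rhd> Z) \<cdot> j \<cdot> (u \<cdot> (q \<rhd> P)) = v \<cdot> (M \<lhd> p)"
      by (rule diagram_eq[OF eqs5[OF f3(3) q(4) f1(3) f4(4) f2(3)], where c = "[Rw 0 1 0,
        Up 1 1, Rw 1 1 0, Rv 4 0 1, Rw 2 2 0, Rv 3 1 0]"], (rule depicts typing)+,
        simp add: derivable_simps)
    then show "act_assoc C A (M, \<mu>) (N, \<nu>, \<xi>) (P, \<pi>, \<chi>) \<cdot> (u \<cdot> (q \<rhd> P)) = h \<cdot> (l \<rhd> Z) \<cdot> j \<cdot> (u \<cdot> (q \<rhd> P))"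
      using as(2) by simp
  qed
qed

lemma act_arr_comp:
  assumes f': "linear M \<mu> M' \<mu>' f" and g [typing]: "g \<in> hom C N N'" and g\<nu>: "g \<cdot> \<nu> = \<nu>' \<cdot> (A \<lhd> g)"
    and a: "act_tensor M \<mu> N \<nu> \<xi> q T \<alpha>" and a': "act_tensor M' \<mu>' N' \<nu>' \<xi>' p S \<alpha>'"
  shows "act_arr C (M, \<mu>) (M', \<mu>') (N, \<nu>, \<xi>) (N', \<nu>', \<xi>') f g \<in> hom C T S"
    "act_arr C (M, \<mu>) (M', \<mu>') (N, \<nu>, \<xi>) (N', \<nu>', \<xi>') f g \<cdot> q = p \<cdot> (f \<boxtimes> g)"
proof -
  note q [typing] = act_tensorD[OF a]
  note p [typing] = act_tensorD[OF a']
  note M [typing] = rmodD[OF q(10)]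
  note M' [typing] = rmodD[OF p(10)]
  note N [typing] = bimodD[OF q(11)]
  note N' [typing] = bimodD[OF p(11)]
  note f [typing] = linearD[OF f']
  have k: "p \<cdot> (f \<boxtimes> g) \<in> hom C (M \<otimes> N) S" by (rule depicts_in, (rule depicts typing)+, simp)
  have "p \<cdot> (f \<boxtimes> g) \<cdot> (\<mu> \<rhd> N) = p \<cdot> (f \<boxtimes> g) \<cdot> (M \<lhd> \<nu>)"
    by (rule diagram_eq[OF eqs3[OF p(5) f(2) g\<nu>], where c = "[Rw 1 0 0, Up 2 1, Rw 0 2 0,
      Rv 2 1 1, Up 1 1]"], (rule depicts typing)+, simp add: derivable_simps)
  from coequalizer_factor[OF q(8) q(1) k this]
  show "act_arr C (M, \<mu>) (M', \<mu>') (N, \<nu>, \<xi>) (N', \<nu>', \<xi>') f g \<in> hom C T S"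
    "act_arr C (M, \<mu>) (M', \<mu>') (N, \<nu>, \<xi>) (N', \<nu>', \<xi>') f g \<cdot> q = p \<cdot> (f \<boxtimes> g)"
    by (simp_all add: act_arr_def q(7)[symmetric] p(7)[symmetric])
qed

end

section \<open>The coring of a cowreath\<close>

locale coflat_cowreath = cowreath_data + coflat_algebra +
  assumes coflat_X: "left_coflat C X"
begin

abbreviation "AXb \<equiv> AX_bim C A m X \<psi>"
abbreviation "\<beta> \<equiv> (m \<rhd> X) \<cdot> (A \<lhd> \<psi>)"

lemma AXb: "AXb = (AX, m \<rhd> X, \<beta>)"
  by (simp add: AX_bim_def)

lemma free_bimod:
  assumes "tobj Y \<upsilon>"
  shows "bimod (A \<otimes> Y, m \<rhd> Y, (m \<rhd> Y) \<cdot> (A \<lhd> \<upsilon>))"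
proof -
  note Y [typing] = transferD[OF assms(1)]
  show ?thesis
  proof (rule bimodI)
    have "(m \<rhd> Y) \<cdot> (A \<lhd> \<upsilon>) \<in> hom C (A \<otimes> Y \<otimes> A) (A \<otimes> Y)"
      by (rule depicts_in, (rule depicts typing)+, simp)
    moreover have "(m \<rhd> Y) \<cdot> (A \<lhd> \<upsilon>) \<cdot> (((m \<rhd> Y) \<cdot> (A \<lhd> \<upsilon>)) \<rhd> A) = (m \<rhd> Y) \<cdot> (A \<lhd> \<upsilon>) \<cdot> (A \<otimes> Y \<lhd> m)"
      by (rule diagram_eq[OF eqs2[OF Y(3) m_assoc], where c = "[Up 2 1, Rw 1 2 0, Rv 0 0 1]"],
        (rule depicts typing)+, simp add: derivable_simps)
    moreover have "(m \<rhd> Y) \<cdot> (A \<lhd> \<upsilon>) \<cdot> (A \<otimes> Y \<lhd> \<eta>) = Ident C (A \<otimes> Y)"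
      by (rule diagram_eq[OF eqs2[OF Y(4) \<eta>r], where c = "[Rw 0 0 1, Rw 1 0 0]"],
        (rule depicts typing)+, simp add: derivable_simps)
    ultimately show "rmod (A \<otimes> Y) ((m \<rhd> Y) \<cdot> (A \<lhd> \<upsilon>))" using A Y(1) by (simp add: right_module_def)
    show "m \<rhd> Y \<in> hom C (A \<otimes> (A \<otimes> Y)) (A \<otimes> Y)" by (rule depicts_in, (rule depicts typing)+, simp)
    show "(m \<rhd> Y) \<cdot> (A \<lhd> (m \<rhd> Y)) = (m \<rhd> Y) \<cdot> (m \<rhd> A \<otimes> Y)"
      by (rule diagram_eq[OF eqs1[OF m_assoc], where c = "[Rv 0 0 0]"],
        (rule depicts typing)+, simp add: derivable_simps)
    show "(m \<rhd> Y) \<cdot> (\<eta> \<rhd> A \<otimes> Y) = Ident C (A \<otimes> Y)"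
      by (rule diagram_eq[OF eqs1[OF \<eta>l], where c = "[Rw 0 0 0]"], (rule depicts typing)+,
        simp add: derivable_simps)
    show "(m \<rhd> Y) \<cdot> (A \<lhd> \<upsilon>) \<cdot> ((m \<rhd> Y) \<rhd> A) = (m \<rhd> Y) \<cdot> (A \<lhd> ((m \<rhd> Y) \<cdot> (A \<lhd> \<upsilon>)))"
      by (rule diagram_eq[OF eqs1[OF m_assoc], where c = "[Up 1 1, Rw 0 1 0]"],
        (rule depicts typing)+, simp add: derivable_simps)
  qed
qed

lemmas AX_bimod = free_bimod[OF tobj]

lemma AX_free: "free_left AX (m \<rhd> X) X (Ident C AX) (Ident C AX)"
  by (rule free_left_refl[OF X])

lemma AX_robust: "robust_left AX (m \<rhd> X)"
  by (rule free_robust[OF AX_bimod AX_free])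

lemma AX_coflat: "left_coflat C AX"
  by (rule left_coflat_tensor[OF coflat_A coflat_X])

abbreviation "AX_tensor M \<mu> q T \<alpha> \<equiv> split_tensor M \<mu> AX (m \<rhd> X) \<beta> q T \<alpha> X (Ident C AX) (Ident C AX)"

lemma AX_tensorE:
  assumes "rmod M \<mu>"
  obtains q T \<alpha> \<theta> l where "AX_tensor M \<mu> q T \<alpha> \<theta> l"
  by (rule act_tensorE[OF assms AX_bimod]) (rule split_tensorE[OF AX_free], assumption, rule that)

lemma AX_tensorD:
  assumes s: "AX_tensor M \<mu> q T \<alpha> \<theta> l"
  shows "\<theta> \<in> hom C (M \<otimes> X) T" "l \<in> hom C T (M \<otimes> X)" "l \<cdot> q = \<mu> \<rhd> X" "q = \<theta> \<cdot> (\<mu> \<rhd> X)"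
    "\<theta> = q \<cdot> (M \<lhd> \<eta> \<rhd> X)" "\<theta> \<cdot> l = Ident C T" "l \<cdot> \<theta> = Ident C (M \<otimes> X)"
    "l \<cdot> \<alpha> = (\<mu> \<rhd> X) \<cdot> (M \<lhd> \<psi>) \<cdot> (l \<rhd> A)"
proof -
  note sp [typing] = split_tensorD[OF s]
  note q [typing] = act_tensorD[OF sp(9)]
  note M [typing] = rmodD[OF q(10)]
  show "\<theta> \<in> hom C (M \<otimes> X) T" "l \<in> hom C T (M \<otimes> X)" "\<theta> \<cdot> l = Ident C T" "l \<cdot> \<theta> = Ident C (M \<otimes> X)"
    by (rule sp(1) sp(2) sp(6) sp(7))+
  show "l \<cdot> q = \<mu> \<rhd> X"
    by (rule diagram_eq[OF eqs1[OF sp(3)], where c = "[Rw 0 0 0]"], (rule depicts typing)+,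
      simp add: derivable_simps)
  show "q = \<theta> \<cdot> (\<mu> \<rhd> X)"
    by (rule diagram_eq[OF eqs1[OF sp(4)], where c = "[Rw 0 0 0]"], (rule depicts typing)+,
      simp add: derivable_simps)
  show "\<theta> = q \<cdot> (M \<lhd> \<eta> \<rhd> X)"
    by (rule diagram_eq[OF eqs1[OF sp(5)], where c = "[Rw 0 0 0]"], (rule depicts typing)+,
      simp add: derivable_simps)
  have "l \<cdot> \<alpha> = l \<cdot> \<alpha> \<cdot> ((\<theta> \<cdot> l) \<rhd> A)"
    by (rule diagram_eq[OF eqs1[OF sp(6)], where c = "[Rv 0 0 0]"], (rule depicts typing)+,
      simp add: derivable_simps)
  also have "\<dots> = (\<mu> \<rhd> X) \<cdot> (M \<lhd> \<psi>) \<cdot> (l \<rhd> A)"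
    by (rule diagram_eq[OF eqs4[OF sp(5) q(4) sp(3) \<eta>l], where c = "[Rw 0 1 0, Rw 1 2 0,
      Up 2 1, Rw 3 2 1, Rw 2 2 0]"], (rule depicts typing)+, simp add: derivable_simps)
  finally show "l \<cdot> \<alpha> = (\<mu> \<rhd> X) \<cdot> (M \<lhd> \<psi>) \<cdot> (l \<rhd> A)" .
qed

lemma act_arr_AX:
  assumes f': "linear M \<mu> N \<nu> f" and s: "AX_tensor M \<mu> q T \<alpha> \<theta>' l" and s': "AX_tensor N \<nu> p S \<alpha>' \<theta> l'"
  shows "act_arr C (M, \<mu>) (N, \<nu>) AXb AXb f (Ident C (fst AXb)) = \<theta> \<cdot> (f \<rhd> X) \<cdot> l"
proof -
  note tts [typing] = act_tensorD[OF split_tensorD(9)[OF s]]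
    and ffs [typing] = AX_tensorD[OF s]
  note ttp [typing] = act_tensorD[OF split_tensorD(9)[OF s']]
    and ffp [typing] = AX_tensorD[OF s']
  note M [typing] = rmodD[OF tts(10)]
  note N [typing] = rmodD[OF ttp(10)]
  note f [typing] = linearD[OF f']
  have h: "\<theta> \<cdot> (f \<rhd> X) \<cdot> l \<in> hom C T S" by (rule depicts_in, (rule depicts typing)+, simp)
  have "\<theta> \<cdot> (f \<rhd> X) \<cdot> l \<cdot> q = p \<cdot> (f \<boxtimes> Ident C AX)"
    by (rule diagram_eq[OF eqs3[OF ffs(3) ffp(4) f(2)], where c = "[Rw 0 0 0, Rw 2 0 0,
      Rv 1 1 0]"], (rule depicts typing)+, simp add: derivable_simps)
  from factor_eq[OF tts(1) tts(6) h this]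
  show ?thesis by (simp add: act_arr_def AXb tts(7)[symmetric] ttp(7)[symmetric])
qed

lemma AX_square:
  obtains p S \<beta>' \<kappa> \<theta> l where "bimod_tensor AX (m \<rhd> X) \<beta> AX (m \<rhd> X) \<beta> p S \<beta>' \<kappa>" "AX_tensor AX \<beta> p S \<beta>' \<theta> l"
    "free_left S \<kappa> (X \<otimes> X) \<theta> l" "AX_comult C A m X \<psi> \<delta> = \<theta> \<cdot> ((m \<rhd> X \<otimes> X) \<cdot> (A \<lhd> \<delta>))"
proof -
  obtain p S \<beta>' \<kappa> \<theta> l where b: "bimod_tensor AX (m \<rhd> X) \<beta> AX (m \<rhd> X) \<beta> p S \<beta>' \<kappa>"
    and s: "AX_tensor AX \<beta> p S \<beta>' \<theta> l"
    by (rule free_bimod_tensorE[OF AX_bimod AX_bimod AX_free])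
  note tts [typing] = act_tensorD[OF split_tensorD(9)[OF s]]
    and ffs [typing] = AX_tensorD[OF s]
  have "free_left S \<kappa> (X \<otimes> X) (\<theta> \<cdot> (Ident C AX \<rhd> X)) ((Ident C AX \<rhd> X) \<cdot> l)"
    by (rule free_tensor[OF b AX_free s])
  moreover have "\<theta> \<cdot> (Ident C AX \<rhd> X) = \<theta>"
    by (rule diagram_eq[OF eqs0, where c = "[]"], (rule depicts typing)+,
      simp add: derivable_simps)
  moreover have "(Ident C AX \<rhd> X) \<cdot> l = l"
    by (rule diagram_eq[OF eqs0, where c = "[]"], (rule depicts typing)+,
      simp add: derivable_simps)
  ultimately have f: "free_left S \<kappa> (X \<otimes> X) \<theta> l" by simp
  have \<beta>X: "((m \<rhd> X) \<cdot> (A \<lhd> \<psi>)) \<rhd> X \<in> hom C (AX \<otimes> A \<otimes> X) AXX"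
    by (rule depicts_in, (rule depicts typing)+, simp)
  have j: "AX \<lhd> \<eta> \<rhd> X \<in> hom C AXX (AX \<otimes> A \<otimes> X)" by (rule depicts_in, (rule depicts typing)+, simp)
  have "(((m \<rhd> X) \<cdot> (A \<lhd> \<psi>)) \<rhd> X) \<cdot> (AX \<lhd> \<eta> \<rhd> X) = Ident C AXX"
    by (rule diagram_eq[OF eqs2[OF \<psi>\<eta> \<eta>r], where c = "[Rw 0 0 1, Rw 1 0 0]"],
      (rule depicts typing)+, simp add: derivable_simps)
  from factor_eq[OF \<beta>X split_epi[OF \<beta>X j this] ffs(1) ffs(4)[symmetric]]
  have "AX_comult C A m X \<psi> \<delta> = \<theta> \<cdot> ((m \<rhd> X \<otimes> X) \<cdot> (A \<lhd> \<delta>))"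
    by (simp add: AX_comult_def AX_bim_def tts(7)[symmetric])
  from that[OF b s f this] show thesis .
qed

end

context strict_moncat
begin

lemma iso_cancel:
  assumes "\<theta> \<in> hom C Y T" "l \<in> hom C T Y" "l \<cdot> \<theta> = Ident C Y" "x \<in> hom C M Y" "y \<in> hom C M Y"
  shows "\<theta> \<cdot> x = \<theta> \<cdot> y \<longleftrightarrow> x = y"
proof
  assume "\<theta> \<cdot> x = \<theta> \<cdot> y"
  then have "l \<cdot> \<theta> \<cdot> x = l \<cdot> \<theta> \<cdot> y" using comp_assoc[OF _ assms(1,2)] assms(4,5) by simp
  then show "x = y" using assms(3-5) by simp
qed simp

end

context coflat_cowreath
begin

abbreviation "AXc \<equiv> AX_comult C A m X \<psi> \<delta>"
abbreviation "AXe \<equiv> AX_counit C A m \<epsilon>"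

lemma comodule_iff:
  assumes sM: "AX_tensor M \<mu> q T \<alpha> \<theta> l" and r [typing]: "r \<in> hom C M T"
  shows "comodule C A m \<eta> AXb AXc AXe M \<mu> r \<longleftrightarrow> emod M \<mu> (l \<cdot> r)"
proof -
  note ttM [typing] = act_tensorD[OF split_tensorD(9)[OF sM]]
    and ffM [typing] = AX_tensorD[OF sM]
  note M' = ttM(10)
  note M [typing] = rmodD[OF M']
  obtain u U \<alpha>' \<theta>' l' where su: "AX_tensor T \<alpha> u U \<alpha>' \<theta>' l'" by (rule AX_tensorE[OF ttM(12)])
  note ttu [typing] = act_tensorD[OF split_tensorD(9)[OF su]]
    and ffu [typing] = AX_tensorD[OF su]
  obtain p S \<beta>' \<kappa> d e where bp: "bimod_tensor AX (m \<rhd> X) \<beta> AX (m \<rhd> X) \<beta> p S \<beta>' \<kappa>" and sp: "AX_tensor AX \<beta> p S \<beta>' d e"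
    and fS: "free_left S \<kappa> (X \<otimes> X) d e" and D: "AXc = d \<cdot> ((m \<rhd> X \<otimes> X) \<cdot> (A \<lhd> \<delta>))"
    by (rule AX_square)
  note ttp [typing] = act_tensorD[OF split_tensorD(9)[OF sp]]
    and ffp [typing] = AX_tensorD[OF sp]
  note bs [typing] = bimod_tensorD[OF bp]
  obtain v V \<zeta> where av: "act_tensor M \<mu> S \<kappa> \<beta>' v V \<zeta>" by (rule act_tensorE[OF M' bs(6)])
  obtain f g where sv: "split_tensor M \<mu> S \<kappa> \<beta>' v V \<zeta> (X \<otimes> X) d e f g" by (rule split_tensorE[OF fS av])
  note v [typing] = act_tensorD[OF av]
  note sv [typing] = split_tensorD[OF sv]
  obtain s where s1: "s = act_assoc C A (M, \<mu>) AXb AXb" by blast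
  note as = act_assoc[OF split_tensorD(9)[OF sM] bp split_tensorD(9)[OF su] av AX_robust AX_coflat, folded AXb, folded s1]
  have uq: "u \<cdot> (q \<rhd> AX) \<in> hom C (M \<otimes> AX \<otimes> AX) U" by (rule depicts_in, (rule depicts typing)+, simp)
  have s: "s = f \<cdot> (l \<rhd> X) \<cdot> l'"
  proof (rule epiD[OF as(3) uq as(1)])
    show "f \<cdot> (l \<rhd> X) \<cdot> l' \<in> hom C U V" by (rule depicts_in, (rule depicts typing)+, simp)
    have "f \<cdot> (l \<rhd> X) \<cdot> l' \<cdot> (u \<cdot> (q \<rhd> AX)) = v \<cdot> (M \<lhd> p)"
      by (rule diagram_eq[OF eqs5[OF ffu(3) ttM(4) ffM(3) sv(4) ffp(3)], where c = "[Rw 0 1 0,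
        Rw 1 0 0, Rv 4 0 1, Rw 2 2 0, Rv 3 1 0]"], (rule depicts typing)+,
        simp add: derivable_simps)
    then show "s \<cdot> (u \<cdot> (q \<rhd> AX)) = f \<cdot> (l \<rhd> X) \<cdot> l' \<cdot> (u \<cdot> (q \<rhd> AX))" using as(2) by simp
  qed
  obtain n where n1: "n = l \<cdot> r" by blast
  have "l \<cdot> r \<in> hom C M (M \<otimes> X)" by (rule depicts_in, (rule depicts typing)+, simp)
  then have n [typing]: "n \<in> hom C M (M \<otimes> X)" by (simp add: n1)
  have rn: "r = \<theta> \<cdot> n"
  proof -
    have "r = (\<theta> \<cdot> l) \<cdot> r" using r by (simp add: ffM(6))
    then show ?thesis by (simp add: n1 comp_assoc[OF r ffM(2) ffM(1)])
  qed
  have lin: "linear M \<mu> T \<alpha> r \<longleftrightarrow> n \<cdot> \<mu> = (\<mu> \<rhd> X) \<cdot> (M \<lhd> \<psi>) \<cdot> (n \<rhd> A)"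
  proof
    assume "linear M \<mu> T \<alpha> r"
    then have r\<mu>: "r \<cdot> \<mu> = \<alpha> \<cdot> (r \<rhd> A)" by (rule linearD)
    show "n \<cdot> \<mu> = (\<mu> \<rhd> X) \<cdot> (M \<lhd> \<psi>) \<cdot> (n \<rhd> A)"
      by (rule diagram_eq[OF eqs3[OF n1 r\<mu> ffM(8)], where c = "[Rw 0 1 0, Rw 1 0 0, Rw 2 1 0,
        Rv 0 0 0]"], (rule depicts typing)+, simp add: derivable_simps)
  next
    assume n\<mu>: "n \<cdot> \<mu> = (\<mu> \<rhd> X) \<cdot> (M \<lhd> \<psi>) \<cdot> (n \<rhd> A)"
    have "r \<cdot> \<mu> = \<theta> \<cdot> (l \<cdot> \<alpha>) \<cdot> (\<theta> \<rhd> A) \<cdot> (n \<rhd> A)"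
      by (rule diagram_eq[OF eqs4[OF rn n\<mu> ffM(8) ffM(7)], where c = "[Rw 0 1 0, Rw 1 0 0,
        Rv 3 1 0, Rv 2 2 0]"], (rule depicts typing)+, simp add: derivable_simps)
    also have "\<dots> = \<alpha> \<cdot> (r \<rhd> A)"
      by (rule diagram_eq[OF eqs2[OF ffM(6) rn], where c = "[Rw 0 3 0, Rv 1 0 0]"],
        (rule depicts typing)+, simp add: derivable_simps)
    finally show "linear M \<mu> T \<alpha> r" using r by (simp add: right_linear_def)
  qed
  have E1: "s \<cdot> act_arr C (M, \<mu>) (T, \<alpha>) AXb AXb r (Ident C (fst AXb)) \<cdot> r = f \<cdot> ((n \<rhd> X) \<cdot> n)"
    if "linear M \<mu> T \<alpha> r"
  proof -
    have "f \<cdot> (l \<rhd> X) \<cdot> l' \<cdot> (\<theta>' \<cdot> (r \<rhd> X) \<cdot> l) \<cdot> r = f \<cdot> ((n \<rhd> X) \<cdot> n)"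
      by (rule diagram_eq[OF eqs2[OF n1 ffu(7)], where c = "[Rv 0 0 0, Rw 1 2 0, Rv 0 1 0]"],
        (rule depicts typing)+, simp add: derivable_simps)
    then show ?thesis
      by (simp add: s act_arr_AX[OF that sM su])
  qed
  have E2: "act_arr C (M, \<mu>) (M, \<mu>) AXb (bim_tensor C A AXb AXb) (Ident C M) AXc \<cdot> r = f \<cdot> ((\<mu> \<rhd> X \<otimes> X) \<cdot> (M \<lhd> \<delta>) \<cdot> n)"
  proof -
    have h: "f \<cdot> (\<mu> \<rhd> X \<otimes> X) \<cdot> (M \<lhd> \<delta>) \<cdot> l \<in> hom C T V"
      by (rule depicts_in, (rule depicts typing)+, simp)
    have "f \<cdot> (\<mu> \<rhd> X \<otimes> X) \<cdot> (M \<lhd> \<delta>) \<cdot> l \<cdot> q = v \<cdot> (Ident C M \<boxtimes> (d \<cdot> ((m \<rhd> X \<otimes> X) \<cdot> (A \<lhd> \<delta>))))"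
      by (rule diagram_eq[OF eqs4[OF ffM(3) sv(4) ffp(7) M(3)], where c = "[Rw 0 0 0, Up 1 1,
        Rw 3 1 0, Rv 2 2 1, Rv 1 3 0]"], (rule depicts typing)+, simp add: derivable_simps)
    from factor_eq[OF ttM(1) ttM(6) h this]
    have "act_arr C (M, \<mu>) (M, \<mu>) AXb (bim_tensor C A AXb AXb) (Ident C M) AXc = f \<cdot> (\<mu> \<rhd> X \<otimes> X) \<cdot> (M \<lhd> \<delta>) \<cdot> l"
      by (simp add: act_arr_def AXb bs(4) D v(7)[symmetric] ttM(7)[symmetric])
    moreover have "f \<cdot> (\<mu> \<rhd> X \<otimes> X) \<cdot> (M \<lhd> \<delta>) \<cdot> l \<cdot> r = f \<cdot> ((\<mu> \<rhd> X \<otimes> X) \<cdot> (M \<lhd> \<delta>) \<cdot> n)"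
      by (rule diagram_eq[OF eqs1[OF n1], where c = "[Rv 0 0 0]"], (rule depicts typing)+,
        simp add: derivable_simps)
    ultimately show ?thesis by simp
  qed
  have E3: "act_runit C A m (M, \<mu>) \<cdot> act_arr C (M, \<mu>) (M, \<mu>) AXb (A, m, m) (Ident C M) AXe \<cdot> r = \<mu> \<cdot> (M \<lhd> \<epsilon>) \<cdot> n"
  proof -
    obtain w W where w1: "w = tq C (M, \<mu>) (A, m)" and w [typing]: "w \<in> hom C (M \<otimes> A) W" and W [typing]: "W \<in> Obj C"
      and cw: "is_coequalizer C (\<mu> \<rhd> A) (M \<lhd> m) w"
      by (rule tensorE[OF M(1) A M(2) m])
    have wb: "w \<cdot> (\<mu> \<rhd> A) = w \<cdot> (M \<lhd> m)" by (rule coequalizer_eq[OF cw])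
    obtain x where x1: "x = act_runit C A m (M, \<mu>)" by blast
    have x [typing]: "x \<in> hom C W M" and xw: "x \<cdot> w = \<mu>"
      using coequalizer_factor[OF cw w M(2) M(3)] by (simp_all add: x1 act_runit_def w1)
    obtain y where y1: "y = act_arr C (M, \<mu>) (M, \<mu>) AXb (A, m, m) (Ident C M) AXe" by blast
    have k: "w \<cdot> (Ident C M \<boxtimes> (m \<cdot> (A \<lhd> \<epsilon>))) \<in> hom C (M \<otimes> AX) W"
      by (rule depicts_in, (rule depicts typing)+, simp)
    have "w \<cdot> (Ident C M \<boxtimes> (m \<cdot> (A \<lhd> \<epsilon>))) \<cdot> (\<mu> \<rhd> AX) = w \<cdot> (Ident C M \<boxtimes> (m \<cdot> (A \<lhd> \<epsilon>))) \<cdot> (M \<lhd> (m \<rhd> X))"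
      by (rule diagram_eq[OF eqs2[OF wb m_assoc], where c = "[Up 1 1, Up 2 1, Rw 0 2 0,
        Rv 1 1 1, Up 1 1]"], (rule depicts typing)+, simp add: derivable_simps)
    note F = coequalizer_factor[OF ttM(8) ttM(1) k this]
    have y [typing]: "y \<in> hom C T W" and yq: "y \<cdot> q = w \<cdot> (Ident C M \<boxtimes> (m \<cdot> (A \<lhd> \<epsilon>)))"
      using F by (simp_all add: y1 act_arr_def AX_counit_def AXb ttM(7)[symmetric] w1)
    have "x \<cdot> y = \<mu> \<cdot> (M \<lhd> \<epsilon>) \<cdot> l"
      by (rule epi_diagram_eq[OF ttM(6) eqs4[OF yq xw ffM(3) M(3)], where c = "[Rw 0 0 0,
        Rw 1 2 0, Rv 3 1 0, Up 1 1, Rv 2 0 0]"], (rule depicts typing)+,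
        simp add: derivable_simps)
    moreover have "\<mu> \<cdot> (M \<lhd> \<epsilon>) \<cdot> l \<cdot> r = \<mu> \<cdot> (M \<lhd> \<epsilon>) \<cdot> n"
      by (rule diagram_eq[OF eqs1[OF n1], where c = "[Rv 0 0 0]"], (rule depicts typing)+,
        simp add: derivable_simps)
    ultimately show ?thesis by (simp add: x1[symmetric] y1[symmetric])
  qed
  have nn: "(n \<rhd> X) \<cdot> n \<in> hom C M (M \<otimes> (X \<otimes> X))" by (rule depicts_in, (rule depicts typing)+, simp)
  have \<delta>n: "(\<mu> \<rhd> X \<otimes> X) \<cdot> (M \<lhd> \<delta>) \<cdot> n \<in> hom C M (M \<otimes> (X \<otimes> X))"
    by (rule depicts_in, (rule depicts typing)+, simp)
  have "comodule C A m \<eta> AXb AXc AXe M \<mu> r \<longleftrightarrow>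
     n \<cdot> \<mu> = (\<mu> \<rhd> X) \<cdot> (M \<lhd> \<psi>) \<cdot> (n \<rhd> A) \<and> (n \<rhd> X) \<cdot> n = (\<mu> \<rhd> X \<otimes> X) \<cdot> (M \<lhd> \<delta>) \<cdot> n \<and> \<mu> \<cdot> (M \<lhd> \<epsilon>) \<cdot> n = Ident C M"
    unfolding comodule_def ttM(9)[folded AXb] Let_def fst_conv snd_conv E2 E3 lin[symmetric] iso_cancel[OF sv(1) sv(2) sv(7) nn \<delta>n, symmetric]
    using M' E1 by (auto simp: s1)
  also have "\<dots> \<longleftrightarrow> emod M \<mu> n" using M' n by (simp add: entwined_module_def)
  finally show ?thesis by (simp add: n1)
qed

end

lemma separable_transport:
  assumes F: "is_functor D' E forget_obj forget_arr"
    and sep: "separable_functor D E forget_obj forget_arr"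
    and J: "\<And>P. P \<in> Obj D' \<Longrightarrow> J P \<in> Obj D" "\<And>P. P \<in> Obj D' \<Longrightarrow> forget_obj (J P) = forget_obj P"
    and hom': "\<And>P Q f. P \<in> Obj D' \<Longrightarrow> Q \<in> Obj D' \<Longrightarrow> (P, f, Q) \<in> hom D' P Q \<longleftrightarrow> (J P, f, J Q) \<in> hom D (J P) (J Q)"
    and triple: "\<And>P Q F. F \<in> hom D P Q \<Longrightarrow> \<exists>f. F = (P, f, Q)" "\<And>P Q F. F \<in> hom D' P Q \<Longrightarrow> \<exists>f. F = (P, f, Q)"
    and comp: "\<And>P Q R f g. Comp D (Q, g, R) (P, f, Q) = (P, c g f, R)"
      "\<And>P Q R f g. Comp D' (Q, g, R) (P, f, Q) = (P, c g f, R)"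
  shows "separable_functor D' E forget_obj forget_arr"
proof -
  obtain \<phi> where
    \<phi>_in: "\<And>P Q G. P \<in> Obj D \<Longrightarrow> Q \<in> Obj D \<Longrightarrow> G \<in> hom E (forget_obj P) (forget_obj Q) \<Longrightarrow> \<phi> P Q G \<in> hom D P Q"
    and \<phi>_sec: "\<And>P Q F. P \<in> Obj D \<Longrightarrow> Q \<in> Obj D \<Longrightarrow> F \<in> hom D P Q \<Longrightarrow> \<phi> P Q (forget_arr F) = F"
    and \<phi>_nat: "\<And>P P' Q Q' U V G. P \<in> Obj D \<Longrightarrow> P' \<in> Obj D \<Longrightarrow> Q \<in> Obj D \<Longrightarrow> Q' \<in> Obj D \<Longrightarrow>
       U \<in> hom D P' P \<Longrightarrow> V \<in> hom D Q Q' \<Longrightarrow> G \<in> hom E (forget_obj P) (forget_obj Q) \<Longrightarrow>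
       \<phi> P' Q' (Comp E (Comp E (forget_arr V) G) (forget_arr U)) = Comp D (Comp D V (\<phi> P Q G)) U"
    by (rule separable_functorE[OF sep]) (rule that)
  let ?\<phi> = "\<lambda>P Q G. (P, fst (snd (\<phi> (J P) (J Q) G)), Q)"
  have arr: "forget_arr (J P, f, J Q) = forget_arr (P, f, Q)" if "P \<in> Obj D'" "Q \<in> Obj D'" for P Q f
    using J(2) that by (simp add: forget_arr_def)
  have \<phi>': "(J P, fst (snd (\<phi> (J P) (J Q) G)), J Q) = \<phi> (J P) (J Q) G"
    "\<phi> (J P) (J Q) G \<in> hom D (J P) (J Q)"
    if "P \<in> Obj D'" "Q \<in> Obj D'" "G \<in> hom E (forget_obj P) (forget_obj Q)" for P Q G
  proof -
    show h: "\<phi> (J P) (J Q) G \<in> hom D (J P) (J Q)" using \<phi>_in[OF J(1) J(1)] J(2) that by simp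
    show "(J P, fst (snd (\<phi> (J P) (J Q) G)), J Q) = \<phi> (J P) (J Q) G"
      using triple(1)[OF h] by auto
  qed
  show ?thesis
    unfolding separable_functor_def
  proof (intro conjI exI[of _ ?\<phi>] ballI F)
    fix P Q G assume PQ: "P \<in> Obj D'" "Q \<in> Obj D'" "G \<in> hom E (forget_obj P) (forget_obj Q)"
    show "?\<phi> P Q G \<in> hom D' P Q" unfolding hom'[OF PQ(1,2)] \<phi>'(1)[OF PQ] by (rule \<phi>'(2)[OF PQ])
  next
    fix P Q G assume PQ: "P \<in> Obj D'" "Q \<in> Obj D'" "G \<in> hom D' P Q"
    then obtain f where f: "G = (P, f, Q)" using triple(2) by blast
    with PQ have "(J P, f, J Q) \<in> hom D (J P) (J Q)" using hom' by blast
    from \<phi>_sec[OF J(1)[OF PQ(1)] J(1)[OF PQ(2)] this] show "?\<phi> P Q (forget_arr G) = G"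
      using arr[OF PQ(1,2)] by (simp add: f)
  next
    fix P P' Q Q' U V G
    assume o: "P \<in> Obj D'" "P' \<in> Obj D'" "Q \<in> Obj D'" "Q' \<in> Obj D'"
      and U: "U \<in> hom D' P' P" and V: "V \<in> hom D' Q Q'" and G: "G \<in> hom E (forget_obj P) (forget_obj Q)"
    obtain u v where uv: "U = (P', u, P)" "V = (Q, v, Q')" using triple(2)[OF U] triple(2)[OF V] by blast
    have U': "(J P', u, J P) \<in> hom D (J P') (J P)" and V': "(J Q, v, J Q') \<in> hom D (J Q) (J Q')"
      using U V hom' o by (simp_all add: uv)
    have G': "G \<in> hom E (forget_obj (J P)) (forget_obj (J Q))" using G J(2) o by simp
    obtain g where g: "\<phi> (J P) (J Q) G = (J P, g, J Q)" using \<phi>'(1)[OF o(1,3) G] by metis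
    have "\<phi> (J P') (J Q') (Comp E (Comp E (forget_arr V) G) (forget_arr U)) = (J P', c (c v g) u, J Q')"
      using \<phi>_nat[OF J(1)[OF o(1)] J(1)[OF o(2)] J(1)[OF o(3)] J(1)[OF o(4)] U' V' G'] arr o
      by (simp add: uv g comp(1))
    then show "?\<phi> P' Q' (Comp E (Comp E (forget_arr V) G) (forget_arr U)) = Comp D' (Comp D' V (?\<phi> P Q G)) U"
      by (simp add: uv g comp(2))
  qed
qed

context coflat_cowreath
begin

definition tensor_AX :: "'a \<Rightarrow> 'b \<Rightarrow> 'b" where
  "tensor_AX M \<mu> = tq C (M, \<mu>) (AX, m \<rhd> X)"

definition up :: "'a \<Rightarrow> 'b \<Rightarrow> 'b \<Rightarrow> 'b" where
  "up M \<mu> \<rho> = tensor_AX M \<mu> \<cdot> (M \<lhd> \<eta> \<rhd> X) \<cdot> \<rho>"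

definition down :: "'a \<Rightarrow> 'b \<Rightarrow> 'b \<Rightarrow> 'b" where
  "down M \<mu> r = factor C (tensor_AX M \<mu>) (\<mu> \<rhd> X) \<cdot> r"

abbreviation "comod \<equiv> comodule C A m \<eta> AXb AXc AXe"

lemma emod_comod:
  assumes M': "rmod M \<mu>" and \<rho> [typing]: "\<rho> \<in> hom C M (M \<otimes> X)"
  shows "comod M \<mu> (up M \<mu> \<rho>) \<longleftrightarrow> emod M \<mu> \<rho>" "down M \<mu> (up M \<mu> \<rho>) = \<rho>"
proof -
  obtain q T \<alpha> \<theta> l where sM: "AX_tensor M \<mu> q T \<alpha> \<theta> l" by (rule AX_tensorE[OF M'])
  note ttM [typing] = act_tensorD[OF split_tensorD(9)[OF sM]]
    and ffM [typing] = AX_tensorD[OF sM]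
  have r: "\<theta> \<cdot> \<rho> \<in> hom C M T" by (rule comp_in[OF \<rho> ffM(1)])
  have l1: "factor C q (\<mu> \<rhd> X) = l" by (rule factor_eq[OF ttM(1) ttM(6) ffM(2) ffM(3)])
  have lr: "l \<cdot> (\<theta> \<cdot> \<rho>) = \<rho>" using comp_assoc[OF \<rho> ffM(1) ffM(2)] id_comp[OF \<rho>] ffM(7) by simp
  have u: "up M \<mu> \<rho> = \<theta> \<cdot> \<rho>" by (simp add: up_def tensor_AX_def ttM(7)[symmetric] ffM(5)[symmetric])
  show "down M \<mu> (up M \<mu> \<rho>) = \<rho>" using lr by (simp add: u down_def tensor_AX_def ttM(7)[symmetric] l1)
  show "comod M \<mu> (up M \<mu> \<rho>) \<longleftrightarrow> emod M \<mu> \<rho>"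
    unfolding u using comodule_iff[OF sM r] lr by simp
qed

lemma comod_up:
  assumes "comod M \<mu> r"
  shows "rmod M \<mu>" "down M \<mu> r \<in> hom C M (M \<otimes> X)" "up M \<mu> (down M \<mu> r) = r"
proof -
  show M': "rmod M \<mu>" using assms by (simp add: comodule_def)
  obtain q T \<alpha> \<theta> l where sM: "AX_tensor M \<mu> q T \<alpha> \<theta> l" by (rule AX_tensorE[OF M'])
  note ttM [typing] = act_tensorD[OF split_tensorD(9)[OF sM]]
    and ffM [typing] = AX_tensorD[OF sM]
  have r [typing]: "r \<in> hom C M T" using assms ttM(9) by (simp add: comodule_def right_linear_def AXb)
  have l1: "factor C q (\<mu> \<rhd> X) = l" by (rule factor_eq[OF ttM(1) ttM(6) ffM(2) ffM(3)])
  have d: "down M \<mu> r = l \<cdot> r" by (simp add: down_def tensor_AX_def ttM(7)[symmetric] l1)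
  show "down M \<mu> r \<in> hom C M (M \<otimes> X)" unfolding d by (rule comp_in[OF r ffM(2)])
  show "up M \<mu> (down M \<mu> r) = r"
    using comp_assoc[OF r ffM(2) ffM(1)] id_comp[OF r] ffM(6)
    by (simp add: d up_def tensor_AX_def ttM(7)[symmetric] ffM(5)[symmetric])
qed

lemma comod_emod: "comod M \<mu> r \<Longrightarrow> emod M \<mu> (down M \<mu> r)"
  using emod_comod(1) comod_up by metis

lemma comod_colinear:
  assumes M': "rmod M \<mu>" and N': "rmod N \<nu>" and f': "linear M \<mu> N \<nu> f"
    and \<rho> [typing]: "\<rho> \<in> hom C M (M \<otimes> X)" and \<sigma> [typing]: "\<sigma> \<in> hom C N (N \<otimes> X)"
  shows "act_arr C (M, \<mu>) (N, \<nu>) AXb AXb f (Ident C (fst AXb)) \<cdot> up M \<mu> \<rho> = up N \<nu> \<sigma> \<cdot> f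
     \<longleftrightarrow> (f \<rhd> X) \<cdot> \<rho> = \<sigma> \<cdot> f"
proof -
  note M [typing] = rmodD[OF M']
  note N [typing] = rmodD[OF N']
  note f [typing] = linearD[OF f']
  obtain q T \<alpha> \<theta> l where sM: "AX_tensor M \<mu> q T \<alpha> \<theta> l" by (rule AX_tensorE[OF M'])
  obtain p S \<alpha>' \<theta>' l' where sN: "AX_tensor N \<nu> p S \<alpha>' \<theta>' l'" by (rule AX_tensorE[OF N'])
  note ttM [typing] = act_tensorD[OF split_tensorD(9)[OF sM]]
    and ffM [typing] = AX_tensorD[OF sM]
  note ttN [typing] = act_tensorD[OF split_tensorD(9)[OF sN]]
    and ffN [typing] = AX_tensorD[OF sN]
  have x: "(f \<rhd> X) \<cdot> \<rho> \<in> hom C M (N \<otimes> X)" by (rule depicts_in, (rule depicts typing)+, simp)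
  have y: "\<sigma> \<cdot> f \<in> hom C M (N \<otimes> X)" by (rule depicts_in, (rule depicts typing)+, simp)
  have "\<theta>' \<cdot> (f \<rhd> X) \<cdot> l \<cdot> (\<theta> \<cdot> \<rho>) = \<theta>' \<cdot> ((f \<rhd> X) \<cdot> \<rho>)"
    by (rule diagram_eq[OF eqs1[OF ffM(7)], where c = "[Rw 0 1 0]"], (rule depicts typing)+,
      simp add: derivable_simps)
  moreover have "\<theta>' \<cdot> \<sigma> \<cdot> f = \<theta>' \<cdot> (\<sigma> \<cdot> f)"
    by (rule diagram_eq[OF eqs0, where c = "[]"], (rule depicts typing)+,
      simp add: derivable_simps)
  ultimately show ?thesis
    using iso_cancel[OF ffN(1) ffN(2) ffN(7) x y] act_arr_AX[OF f' sM sN]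
    by (simp add: up_def tensor_AX_def ttM(7)[symmetric] ttN(7)[symmetric] ffM(5)[symmetric] ffN(5)[symmetric])
qed

abbreviation "\<D>' \<equiv> comodules C A m \<eta> AXb AXc AXe"

lemma comodules_simps:
  "Obj \<D>' = {(M, \<mu>, r). comod M \<mu> r}"
  "F \<in> hom \<D>' (M, \<mu>, r) (N, \<nu>, s) \<longleftrightarrow>
     (\<exists>f. F = ((M, \<mu>, r), f, (N, \<nu>, s)) \<and> comod M \<mu> r \<and> comod N \<nu> s \<and> linear M \<mu> N \<nu> f \<and>
        act_arr C (M, \<mu>) (N, \<nu>) AXb AXb f (Ident C (fst AXb)) \<cdot> r = s \<cdot> f)"
  "Ident \<D>' (M, \<mu>, r) = ((M, \<mu>, r), Ident C M, (M, \<mu>, r))"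
  "Comp \<D>' (Q, g, R) (P, f, Q) = (P, g \<cdot> f, R)"
  by (auto simp: comodules_def hom_def)

lemma comodules_functor: "is_functor \<D>' \<C> forget_obj forget_arr"
  unfolding is_functor_def
  by (auto simp: comodules_simps right_modules_simps forget_obj_def forget_arr_def dest: comod_up)
     (auto simp: comodules_def right_modules_simps hom_def forget_obj_def right_modules_def dest: comod_up)

lemma comod_hom:
  assumes "comod M \<mu> r" "comod N \<nu> s"
  shows "((M, \<mu>, r), f, (N, \<nu>, s)) \<in> hom \<D>' (M, \<mu>, r) (N, \<nu>, s) \<longleftrightarrow>
     ((M, \<mu>, down M \<mu> r), f, (N, \<nu>, down N \<nu> s)) \<in> hom \<D> (M, \<mu>, down M \<mu> r) (N, \<nu>, down N \<nu> s)"
  using comod_up[OF assms(1)] comod_up[OF assms(2)] comod_colinear[of M \<mu> N \<nu> f "down M \<mu> r" "down N \<nu> s"]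
    comod_emod assms by (auto simp: comodules_simps entwined_simps colinear_def)

lemma separable_iff_comodules:
  "separable_functor \<D> \<C> forget_obj forget_arr \<longleftrightarrow>
   separable_functor \<D>' \<C> forget_obj forget_arr"
proof
  assume sep: "separable_functor \<D> \<C> forget_obj forget_arr"
  show "separable_functor \<D>' \<C> forget_obj forget_arr"
  proof (rule separable_transport[OF comodules_functor sep,
          where J = "\<lambda>(M, \<mu>, r). (M, \<mu>, down M \<mu> r)" and c = "Comp C"])
    fix P Q f assume "P \<in> Obj \<D>'" "Q \<in> Obj \<D>'"
    then show "(P, f, Q) \<in> hom \<D>' P Q \<longleftrightarrow>
      ((\<lambda>(M, \<mu>, r). (M, \<mu>, down M \<mu> r)) P, f, (\<lambda>(M, \<mu>, r). (M, \<mu>, down M \<mu> r)) Q)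
         \<in> hom \<D> ((\<lambda>(M, \<mu>, r). (M, \<mu>, down M \<mu> r)) P) ((\<lambda>(M, \<mu>, r). (M, \<mu>, down M \<mu> r)) Q)"
      using comod_hom by (auto simp: comodules_simps(1))
  qed (auto simp: comodules_simps entwined_simps forget_obj_def comod_emod)
next
  assume sep: "separable_functor \<D>' \<C> forget_obj forget_arr"
  show "separable_functor \<D> \<C> forget_obj forget_arr"
  proof (rule separable_transport[OF forget_functor sep,
          where J = "\<lambda>(M, \<mu>, \<rho>). (M, \<mu>, up M \<mu> \<rho>)" and c = "Comp C"])
    have c: "comod M \<mu> (up M \<mu> \<rho>)" "down M \<mu> (up M \<mu> \<rho>) = \<rho>" if "emod M \<mu> \<rho>" for M \<mu> \<rho>
      using emod_comod[OF emodD(1,6)[OF that]] that by simp_all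
    fix P Q f assume "P \<in> Obj \<D>" "Q \<in> Obj \<D>"
    then show "(P, f, Q) \<in> hom \<D> P Q \<longleftrightarrow>
      ((\<lambda>(M, \<mu>, \<rho>). (M, \<mu>, up M \<mu> \<rho>)) P, f, (\<lambda>(M, \<mu>, \<rho>). (M, \<mu>, up M \<mu> \<rho>)) Q)
         \<in> hom \<D>' ((\<lambda>(M, \<mu>, \<rho>). (M, \<mu>, up M \<mu> \<rho>)) P) ((\<lambda>(M, \<mu>, \<rho>). (M, \<mu>, up M \<mu> \<rho>)) Q)"
      using c by (auto simp: entwined_simps(1) comod_hom)
  qed (auto simp: comodules_simps entwined_simps forget_obj_def emod_comod emodD)
qed

end

context coflat_algebra
begin

abbreviation "\<V> \<equiv> cr_bimodules C A m \<eta>"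
abbreviation "crb \<equiv> cr_bimodule C A m \<eta>"
abbreviation "llinear \<equiv> left_linear C A"

lemma cr_simps:
  "Obj \<V> = {N'. crb N'}"
  "F \<in> hom \<V> (N, \<nu>, \<xi>) (P, \<pi>, \<chi>) \<longleftrightarrow> (\<exists>f. F = ((N, \<nu>, \<xi>), f, (P, \<pi>, \<chi>)) \<and> crb (N, \<nu>, \<xi>) \<and> crb (P, \<pi>, \<chi>) \<and>
     llinear N \<nu> P \<pi> f \<and> linear N \<xi> P \<chi> f)"
  "Ident \<V> N' = (N', Ident C (fst N'), N')"
  "Comp \<V> (Q', g, R') (P', f, Q'') = (P', g \<cdot> f, R')"
  "tensO \<V> = bim_tensor C A"
  "tunit \<V> = (A, m, m)"
  "whiskL \<V> (N, \<nu>, \<xi>) (P', f, Q') = (bim_tensor C A (N, \<nu>, \<xi>) P', act_arr C (N, \<xi>) (N, \<xi>) P' Q' (Ident C N) f,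
     bim_tensor C A (N, \<nu>, \<xi>) Q')"
  "whiskR \<V> ((P, \<pi>, \<chi>), f, (Q, \<omega>, \<zeta>)) N' = (bim_tensor C A (P, \<pi>, \<chi>) N', act_arr C (P, \<chi>) (Q, \<zeta>) N' N' f (Ident C (fst N')),
     bim_tensor C A (Q, \<omega>, \<zeta>) N')"
  "assoc \<V> (N, \<nu>, \<xi>) P' Q' = (bim_tensor C A (bim_tensor C A (N, \<nu>, \<xi>) P') Q', act_assoc C A (N, \<xi>) P' Q',
     bim_tensor C A (N, \<nu>, \<xi>) (bim_tensor C A P' Q'))"
  "lunit \<V> (N, \<nu>, \<xi>) = (bim_tensor C A (A, m, m) (N, \<nu>, \<xi>), factor C (tq C (A, m) (N, \<nu>)) \<nu>, (N, \<nu>, \<xi>))"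
  "runit \<V> (N, \<nu>, \<xi>) = (bim_tensor C A (N, \<nu>, \<xi>) (A, m, m), act_runit C A m (N, \<xi>), (N, \<nu>, \<xi>))"
  by (auto simp: cr_bimodules_def hom_def whiskL_def whiskR_def)

lemma cr_bimod: "crb (N, \<nu>, \<xi>) \<Longrightarrow> bimod (N, \<nu>, \<xi>)" "crb (N, \<nu>, \<xi>) \<Longrightarrow> left_coflat C N" "crb (N, \<nu>, \<xi>) \<Longrightarrow> robust_left N \<nu>"
  by (simp_all add: cr_bimodule_def)

lemma unit_coflat: "left_coflat C (tunit C)"
proof -
  have "f \<rhd> tunit C = f" if "f \<in> hom C P Q" for f P Q using that by (simp add: whiskR_def)
  then have "is_coequalizer C (f \<rhd> tunit C) (g \<rhd> tunit C) (q \<rhd> tunit C)" if "is_coequalizer C f g q" for f g q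
    using coequalizer_homs[OF that] that by metis
  then show ?thesis by (simp add: left_coflat_def)
qed

lemma unit_cr: "crb (A, m, m)"
proof (rule free_cr[OF _ _ unit_coflat])
  show "bimod (A, m, m)"
    using bimodI[OF rmod_A] m m_assoc \<eta>l by simp
  have "A \<otimes> tunit C = A" "m \<rhd> tunit C = m" using A m by (simp_all add: whiskR_def)
  then show "free_left A m (tunit C) (Ident C A) (Ident C A)"
    using free_left_refl[of "tunit C"] by simp
qed

end

context coflat_cowreath
begin

lemma AX_cr: "crb AXb"
  using free_cr[OF AX_bimod AX_free coflat_X] by (simp add: AXb)

lemma XX_coflat: "left_coflat C (X \<otimes> X)"
  by (rule left_coflat_tensor[OF coflat_X coflat_X])

lemma counit_linear: "linear AX \<beta> A m AXe" "llinear AX (m \<rhd> X) A m AXe"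
proof -
  have "m \<cdot> (A \<lhd> \<epsilon>) \<in> hom C AX A" by (rule depicts_in, (rule depicts typing)+, simp)
  moreover have "m \<cdot> (A \<lhd> \<epsilon>) \<cdot> (m \<rhd> X) = m \<cdot> (A \<lhd> (m \<cdot> (A \<lhd> \<epsilon>)))"
    by (rule diagram_eq[OF eqs1[OF m_assoc], where c = "[Up 1 1, Rw 0 1 0]"],
      (rule depicts typing)+, simp add: derivable_simps)
  ultimately show "llinear AX (m \<rhd> X) A m AXe" by (simp add: left_linear_def AX_counit_def)
  show "linear AX \<beta> A m AXe" using coaction_counit_linear[OF rmod_A] by (simp add: AX_counit_def)
qed

lemma AX_coalgebra:
  "coalgebra \<V> AXb (AXb, AXc, bim_tensor C A AXb AXb) (AXb, AXe, (A, m, m))"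
proof -
  obtain b where b1: "b = (m \<rhd> X) \<cdot> (A \<lhd> \<psi>)" by blast
  note K = AX_bimod[folded b1]
  have K3: "AXb = (AX, m \<rhd> X, b)" by (simp add: AXb b1)
  note b [typing] = bimodD[OF K]
  obtain p S \<beta>' \<kappa> d e where bp: "bimod_tensor AX (m \<rhd> X) b AX (m \<rhd> X) b p S \<beta>' \<kappa>"
    and sp: "split_tensor AX b AX (m \<rhd> X) b p S \<beta>' X (Ident C AX) (Ident C AX) d e"
    and fS: "free_left S \<kappa> (X \<otimes> X) d e" and D: "AXc = d \<cdot> ((m \<rhd> X \<otimes> X) \<cdot> (A \<lhd> \<delta>))"
    by (rule AX_square[folded b1])
  note ttp [typing] = act_tensorD[OF split_tensorD(9)[OF sp]]
    and ffp [typing] = AX_tensorD[folded b1, OF sp]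
  note bs [typing] = bimod_tensorD[OF bp]
  have crS: "crb (S, \<kappa>, \<beta>')" by (rule free_cr[OF bs(6) fS XX_coflat])
  note \<kappa>d [typing] = free_leftD[OF fS]
  have \<rho>: "(m \<rhd> X \<otimes> X) \<cdot> (A \<lhd> \<delta>) \<in> hom C AX AXX" by (rule depicts_in, (rule depicts typing)+, simp)
  have up: "up AX b ((m \<rhd> X \<otimes> X) \<cdot> (A \<lhd> \<delta>)) = AXc"
    by (simp add: up_def tensor_AX_def ttp(7)[symmetric] ffp(5)[symmetric] D)
  have cm: "comod AX b AXc"
    using emod_comod(1)[OF bimodD(1)[OF K] \<rho>] cofree_emod[OF rmod_A] unfolding up by (simp add: b1)
  have lin: "linear AX b S \<beta>' AXc"
    using cm by (simp add: comodule_def K3 ttp(9))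
  have "d \<cdot> ((m \<rhd> X \<otimes> X) \<cdot> (A \<lhd> \<delta>)) \<in> hom C AX S" by (rule depicts_in, (rule depicts typing)+, simp)
  moreover have "d \<cdot> ((m \<rhd> X \<otimes> X) \<cdot> (A \<lhd> \<delta>)) \<cdot> (m \<rhd> X) = \<kappa> \<cdot> (A \<lhd> (d \<cdot> ((m \<rhd> X \<otimes> X) \<cdot> (A \<lhd> \<delta>))))"
    by (rule diagram_eq[OF eqs2[OF \<kappa>d(8) m_assoc], where c = "[Up 1 1, Rw 1 1 0, Rv 0 2 0]"],
      (rule depicts typing)+, simp add: derivable_simps)
  ultimately have llin: "llinear AX (m \<rhd> X) S \<kappa> AXc" by (simp add: left_linear_def D)
  have "Cod \<V> (AXb, AXc, bim_tensor C A AXb AXb) = bim_tensor C A AXb AXb" by (simp add: cr_bimodules_def)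
  have lu: "factor C (tq C (A, m) (AX, m \<rhd> X)) (m \<rhd> X) \<cdot> act_arr C (AX, b) (A, m) AXb AXb AXe (Ident C AX) \<cdot> AXc
      = Ident C AX"
  proof -
    obtain q T \<alpha> \<theta> l where sA: "split_tensor A m AX (m \<rhd> X) b q T \<alpha> X (Ident C AX) (Ident C AX) \<theta> l"
      by (rule AX_tensorE[OF rmod_A, folded b1])
    note ttA [typing] = act_tensorD[OF split_tensorD(9)[OF sA]]
    and ffA [typing] = AX_tensorD[folded b1, OF sA]
    have 1: "factor C (tq C (A, m) (AX, m \<rhd> X)) (m \<rhd> X) = l"
      using factor_eq[OF ttA(1) ttA(6) ffA(2) ffA(3)] by (simp add: ttA(7)[symmetric])
    have 2: "act_arr C (AX, b) (A, m) AXb AXb AXe (Ident C AX) = \<theta> \<cdot> (AXe \<rhd> X) \<cdot> e"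
      using act_arr_AX[OF counit_linear(1), folded b1, OF sp sA] by (simp add: AXb)
    have "l \<cdot> (\<theta> \<cdot> ((m \<cdot> (A \<lhd> \<epsilon>)) \<rhd> X) \<cdot> e) \<cdot> (d \<cdot> ((m \<rhd> X \<otimes> X) \<cdot> (A \<lhd> \<delta>))) = Ident C AX"
      by (rule diagram_eq[OF eqs5[OF ffA(7) ffp(7) m_assoc \<epsilon>\<delta> \<eta>r], where c = "[Rw 0 6 0,
        Rw 1 2 0, Up 2 1, Rw 2 2 0, Rw 3 0 1, Rw 4 0 0]"], (rule depicts typing)+,
        simp add: derivable_simps)
    then show ?thesis unfolding 1 2 D by (simp add: AX_counit_def)
  qed
  show ?thesis
    using AX_cr crS unit_cr llin lin counit_linear[folded b1] cm[unfolded comodule_def K3 ttp(9) Let_def] lu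
    unfolding coalgebra_def
    by (simp add: K3 cr_simps bs(4))
qed

end

section \<open>Coseparability of the coring\<close>

context coflat_cowreath
begin

lemma AX_bicomodule:
  "bicomodule \<V> AXb (AXb, AXc, bim_tensor C A AXb AXb) (AXb, AXe, (A, m, m))
     AXb (AXb, AXc, bim_tensor C A AXb AXb) (AXb, AXc, bim_tensor C A AXb AXb)"
  using AX_coalgebra by (simp add: coalgebra_def bicomodule_def cr_simps)

lemma coring_casimir:
  assumes cosep: "coseparable_coring C A m \<eta> AXb AXc AXe"
  shows "\<exists>B. casimir B"
proof -
  obtain b where b1: "b = (m \<rhd> X) \<cdot> (A \<lhd> \<psi>)" by blast
  note K = AX_bimod[folded b1]
  have K3: "AXb = (AX, m \<rhd> X, b)" by (simp add: AXb b1)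
  let ?K = "(AX, m \<rhd> X, b)" and ?k = "(AX, b)"
  obtain d where d1: "d = (m \<rhd> X \<otimes> X) \<cdot> (A \<lhd> \<delta>)" by blast
  have eK: "emod AX b d" using cofree_emod[OF rmod_A] by (simp add: b1 d1)
  note b [typing] = emodD[OF eK]
  obtain n where n1: "n = (b \<rhd> X) \<cdot> (AX \<lhd> \<psi>)" by blast
  obtain r where r1: "r = (b \<rhd> X \<otimes> X) \<cdot> (AX \<lhd> \<delta>)" by blast
  note eN = cofree_emod[OF emodD(1)[OF eK], folded n1 r1]
  note n [typing] = emodD[OF eN]
  have oN: "A \<otimes> (X \<otimes> X) = AXX" using tens_obj_assoc[OF A X X] by simp
  have n2: "n = (m \<rhd> X \<otimes> X) \<cdot> (A \<lhd> ((\<psi> \<rhd> X) \<cdot> (X \<lhd> \<psi>)))"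
    by (rule diagram_eq[OF eqs2[OF n1 b1], where c = "[Rw 0 0 0, Rw 1 1 0]"],
      (rule depicts typing)+, simp add: derivable_simps)
  let ?N = "(AXX, m \<rhd> X \<otimes> X, n)" and ?n = "(AXX, n)"
  have N: "bimod ?N"
    using free_bimod[OF transfer_tensor_tobj[OF tobj tobj]] by (simp add: n2 oN)
  have fN: "free_left AXX (m \<rhd> X \<otimes> X) (X \<otimes> X) (Ident C AXX) (Ident C AXX)"
    using free_left_refl[of "X \<otimes> X"] X by (simp add: oN)
  have crN: "crb ?N" by (rule free_cr[OF N fN XX_coflat])
  have crK: "crb ?K" using AX_cr by (simp add: K3)
  have coN: "left_coflat C AXX" by (rule left_coflat_tensor[OF AX_coflat coflat_X])
  obtain p S \<beta>' \<kappa> \<theta> l where B0: "bimod_tensor AX (m \<rhd> X) b AX (m \<rhd> X) b p S \<beta>' \<kappa>"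
    and F0: "split_tensor AX b AX (m \<rhd> X) b p S \<beta>' X (Ident C AX) (Ident C AX) \<theta> l"
    and fS: "free_left S \<kappa> (X \<otimes> X) \<theta> l" and D: "AXc = \<theta> \<cdot> d"
    by (rule AX_square[folded b1 d1])
  note tt0 [typing] = act_tensorD[OF split_tensorD(9)[OF F0]]
    and ff0 [typing] = AX_tensorD[folded b1, OF F0]
  note bb0 [typing] = bimod_tensorD[OF B0]
  note arr_AX = act_arr_AX[folded b1, unfolded K3 fst_conv]
  have \<beta>'\<eta>: "\<beta>' \<cdot> (S \<lhd> \<eta>) = Ident C S" using rmodD(4)[OF tt0(12)] .
  obtain pn Sn \<alpha>n \<kappa>n \<theta>n ln where Bn: "bimod_tensor AXX (m \<rhd> X \<otimes> X) n AX (m \<rhd> X) b pn Sn \<alpha>n \<kappa>n"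
    and Fn: "split_tensor AXX n AX (m \<rhd> X) b pn Sn \<alpha>n X (Ident C AX) (Ident C AX) \<theta>n ln"
    by (rule free_bimod_tensorE[OF N K AX_free])
  note ttn [typing] = act_tensorD[OF bimod_tensorD(1)[OF Bn]]
    and bbn [typing] = bimod_tensorD[OF Bn] and ffn [typing] = split_tensorD[OF Fn]
  obtain pk Sk \<alpha>k \<kappa>k \<theta>k lk where Bk: "bimod_tensor AX (m \<rhd> X) b AXX (m \<rhd> X \<otimes> X) n pk Sk \<alpha>k \<kappa>k"
    and Fk: "split_tensor AX b AXX (m \<rhd> X \<otimes> X) n pk Sk \<alpha>k (X \<otimes> X) (Ident C AXX) (Ident C AXX) \<theta>k lk"
    by (rule free_bimod_tensorE[OF K N fN])
  note ttk [typing] = act_tensorD[OF bimod_tensorD(1)[OF Bk]]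
    and bbk [typing] = bimod_tensorD[OF Bk] and ffk [typing] = split_tensorD[OF Fk]
  obtain ps Ss \<alpha>s \<kappa>s \<theta>s ls where Bs: "bimod_tensor S \<kappa> \<beta>' AXX (m \<rhd> X \<otimes> X) n ps Ss \<alpha>s \<kappa>s"
    and Fs: "split_tensor S \<beta>' AXX (m \<rhd> X \<otimes> X) n ps Ss \<alpha>s (X \<otimes> X) (Ident C AXX) (Ident C AXX) \<theta>s ls"
    by (rule free_bimod_tensorE[OF bb0(6) N fN])
  note tts [typing] = act_tensorD[OF bimod_tensorD(1)[OF Bs]]
    and bbs [typing] = bimod_tensorD[OF Bs] and ffs [typing] = split_tensorD[OF Fs]
  note gk = free_tensor[OF Bk AX_free Fk]
  note gn = free_tensor[OF Bn fN Fn]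
  note \<kappa>\<theta>k [typing] = free_leftD[OF gk]
  note \<kappa>\<theta>n [typing] = free_leftD[OF gn]
  note cX3 = left_coflat_tensor[OF coflat_X XX_coflat] and cX3' = left_coflat_tensor[OF XX_coflat coflat_X]
  have crkk: "crb (Sk, \<kappa>k, \<alpha>k)" by (rule free_cr[OF bbk(6) gk cX3])
  have crn: "crb (Sn, \<kappa>n, \<alpha>n)" by (rule free_cr[OF bbn(6) gn cX3'])
  obtain pv Sv \<alpha>v \<kappa>v \<theta>v lv where Bv: "bimod_tensor AX (m \<rhd> X) b Sk \<kappa>k \<alpha>k pv Sv \<alpha>v \<kappa>v"
    and Fv: "split_tensor AX b Sk \<kappa>k \<alpha>k pv Sv \<alpha>v (X \<otimes> (X \<otimes> X)) (\<theta>k \<cdot> (Ident C AX \<rhd> X \<otimes> X)) ((Ident C AX \<rhd> X \<otimes> X) \<cdot> lk) \<theta>v lv"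
    by (rule free_bimod_tensorE[OF K bbk(6) gk])
  note ttv [typing] = act_tensorD[OF bimod_tensorD(1)[OF Bv]]
    and bbv [typing] = bimod_tensorD[OF Bv] and ffv [typing] = split_tensorD[OF Fv]
  obtain pw Sw \<alpha>w \<kappa>w \<theta>w lw where Bw: "bimod_tensor Sk \<kappa>k \<alpha>k AX (m \<rhd> X) b pw Sw \<alpha>w \<kappa>w"
    and Fw: "split_tensor Sk \<alpha>k AX (m \<rhd> X) b pw Sw \<alpha>w X (Ident C AX) (Ident C AX) \<theta>w lw"
    by (rule free_bimod_tensorE[OF bbk(6) K AX_free])
  note ttw [typing] = act_tensorD[OF bimod_tensorD(1)[OF Bw]]
    and bbw [typing] = bimod_tensorD[OF Bw] and ffw [typing] = split_tensorD[OF Fw]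
  obtain px Sx \<alpha>x \<kappa>x \<theta>x lx where Bx: "bimod_tensor AX (m \<rhd> X) b Sn \<kappa>n \<alpha>n px Sx \<alpha>x \<kappa>x"
    and Fx: "split_tensor AX b Sn \<kappa>n \<alpha>n px Sx \<alpha>x (X \<otimes> X \<otimes> X) (\<theta>n \<cdot> (Ident C AXX \<rhd> X)) ((Ident C AXX \<rhd> X) \<cdot> ln) \<theta>x lx"
    by (rule free_bimod_tensorE[OF K bbn(6) gn])
  note ttx [typing] = act_tensorD[OF bimod_tensorD(1)[OF Bx]]
    and bbx [typing] = bimod_tensorD[OF Bx] and ffx [typing] = split_tensorD[OF Fx]
  obtain pa Sa \<alpha>a \<kappa>a \<theta>a la where Ba: "bimod_tensor A m m AXX (m \<rhd> X \<otimes> X) n pa Sa \<alpha>a \<kappa>a"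
    and Fa: "split_tensor A m AXX (m \<rhd> X \<otimes> X) n pa Sa \<alpha>a (X \<otimes> X) (Ident C AXX) (Ident C AXX) \<theta>a la"
    by (rule free_bimod_tensorE[OF cr_bimod(1)[OF unit_cr] N fN])
  note tta [typing] = act_tensorD[OF bimod_tensorD(1)[OF Ba]]
    and bba [typing] = bimod_tensorD[OF Ba] and ffa [typing] = split_tensorD[OF Fa]
  obtain L where L1: "L = \<theta>k \<cdot> (d \<rhd> X)" by blast
  have "\<theta>k \<cdot> (d \<rhd> X) \<in> hom C AXX Sk" by (rule depicts_in, (rule depicts typing)+, simp)
  then have L [typing]: "L \<in> hom C AXX Sk" by (simp add: L1)
  obtain R where R1: "R = \<theta>n \<cdot> r" by blast
  have "\<theta>n \<cdot> r \<in> hom C AXX Sn" by (rule depicts_in, (rule depicts typing)+, simp)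
  then have R [typing]: "R \<in> hom C AXX Sn" by (simp add: R1)
  have dl: "d \<cdot> (m \<rhd> X) = (m \<rhd> X \<otimes> X) \<cdot> (A \<lhd> d)"
    by (rule diagram_eq[OF eqs2[OF d1 m_assoc], where c = "[Rw 0 1 0, Up 1 1, Rw 1 1 0,
      Rv 0 0 1]"], (rule depicts typing)+, simp add: derivable_simps)
  have "L \<cdot> (m \<rhd> X \<otimes> X) = \<kappa>k \<cdot> (A \<lhd> L)"
    by (rule diagram_eq[OF eqs3[OF L1 dl \<kappa>\<theta>k(8)], where c = "[Rw 0 1 0, Rw 1 0 0, Rv 2 1 0,
      Rv 0 0 1]"], (rule depicts typing)+, simp add: derivable_simps)
  then have Ll: "llinear AXX (m \<rhd> X \<otimes> X) Sk \<kappa>k L" using L by (simp add: left_linear_def)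
  have rl: "r \<cdot> (m \<rhd> X \<otimes> X) = (m \<rhd> X \<otimes> X \<otimes> X) \<cdot> (A \<lhd> r)"
    by (rule diagram_eq[OF eqs3[OF r1 b1 m_assoc], where c = "[Rw 0 1 0, Rw 1 2 0, Up 1 1,
      Up 2 1, Rw 2 2 0, Rv 1 1 1, Rv 0 0 1]"], (rule depicts typing)+,
      simp add: derivable_simps)
  have "R \<cdot> (m \<rhd> X \<otimes> X) = \<kappa>n \<cdot> (A \<lhd> R)"
    by (rule diagram_eq[OF eqs3[OF R1 rl \<kappa>\<theta>n(8)], where c = "[Rw 0 1 0, Rw 1 0 0, Rv 2 1 0,
      Rv 0 0 1]"], (rule depicts typing)+, simp add: derivable_simps)
  then have Rl: "llinear AXX (m \<rhd> X \<otimes> X) Sn \<kappa>n R" using R by (simp add: left_linear_def)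
  have l\<alpha>k: "lk \<cdot> \<alpha>k = (b \<rhd> X \<otimes> X) \<cdot> (AX \<lhd> (Ident C AXX \<cdot> n \<cdot> ((Ident C AXX \<cdot> (\<eta> \<rhd> X \<otimes> X)) \<rhd> A))) \<cdot> (lk \<rhd> A)"
    by (rule free_act[OF Fk])
  have "L \<cdot> n = \<theta>k \<cdot> (lk \<cdot> \<alpha>k) \<cdot> (\<theta>k \<rhd> A) \<cdot> (d \<rhd> X \<rhd> A)"
    by (rule diagram_eq[OF eqs7[OF L1 l\<alpha>k ffk(7) n1 b1 b(7) \<eta>l], where c = "[Rw 0 1 0,
      Rw 3 0 0, Rw 5 1 0, Up 1 1, Rv 6 3 2, Up 3 2, Rv 4 3 2, Rv 3 2 2, Rv 2 1 0, Rv 1 2 0]"],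
      (rule depicts typing)+, simp add: derivable_simps)
  also have "\<dots> = \<alpha>k \<cdot> (L \<rhd> A)"
    by (rule diagram_eq[OF eqs2[OF ffk(6) L1], where c = "[Rw 0 3 0, Rv 1 0 0]"],
      (rule depicts typing)+, simp add: derivable_simps)
  finally have Lr: "linear AXX n Sk \<alpha>k L" using L by (simp add: right_linear_def)
  have \<theta>n2: "\<theta>n = pn \<cdot> (AXX \<lhd> \<eta> \<rhd> X)"
    by (rule diagram_eq[OF eqs1[OF ffn(5)], where c = "[Rw 0 0 0]"], (rule depicts typing)+,
      simp add: derivable_simps)
  have upN: "up AXX n r = R"
    by (simp add: up_def tensor_AX_def ttn(7)[symmetric] \<theta>n2[symmetric] R1)
  have cN: "comod AXX n R"
    using emod_comod(1)[OF emodD(1)[OF eN] n(6)] eN unfolding upN by simp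
  have Rr: "linear AXX n Sn \<alpha>n R"
    using cN ttn(9) by (simp add: comodule_def K3)
  have upK: "up AX b d = AXc"
    by (simp add: up_def tensor_AX_def tt0(7)[symmetric] ff0(5)[symmetric] D)
  have cK: "comod AX b AXc"
    using emod_comod(1)[OF bimodD(1)[OF K] b(6)] eK unfolding upK by simp
  have Dr: "linear AX b S \<beta>' AXc"
    using cK by (simp add: comodule_def K3 tt0(9))
  have idK: "Ident C AX \<in> hom C AX AX" and idN: "Ident C AXX \<in> hom C AXX AXX"
    using A X by simp_all
  have idKl: "Ident C AX \<cdot> (m \<rhd> X) = (m \<rhd> X) \<cdot> (A \<lhd> Ident C AX)"
    by (rule diagram_eq[OF eqs0, where c = "[]"], (rule depicts typing)+,
      simp add: derivable_simps)
  have idNl: "Ident C AXX \<cdot> (m \<rhd> X \<otimes> X) = (m \<rhd> X \<otimes> X) \<cdot> (A \<lhd> Ident C AXX)"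
    by (rule diagram_eq[OF eqs0, where c = "[]"], (rule depicts typing)+,
      simp add: derivable_simps)
  note rK = bimodD(1)[OF K] and rN = bimodD(1)[OF N]
  note linK = linear_id[OF rK] and linN = linear_id[OF rN]
  have Llin: "L \<cdot> (m \<rhd> X \<otimes> X) = \<kappa>k \<cdot> (A \<lhd> L)" using Ll by (simp add: left_linear_def)
  have Rlin: "R \<cdot> (m \<rhd> X \<otimes> X) = \<kappa>n \<cdot> (A \<lhd> R)" using Rl by (simp add: left_linear_def)
  have coassoc: "act_assoc C A ?k ?K ?N \<cdot>
      act_arr C ?k (S, \<beta>') ?N ?N AXc (Ident C AXX) \<cdot> L
    = act_arr C ?k ?k ?N (Sk, \<kappa>k, \<alpha>k) (Ident C AX) L \<cdot> L"
  proof -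
    have 1: "act_assoc C A ?k ?K ?N = \<theta>v \<cdot> (l \<rhd> X \<otimes> X) \<cdot> ls"
      by (rule free_act_assoc[OF F0 Bk Fk Fs Fv coN])
    have 2: "act_arr C ?k (S, \<beta>') ?N ?N AXc (Ident C AXX)
      = \<theta>s \<cdot> (\<beta>' \<rhd> X \<otimes> X) \<cdot> (AXc \<boxtimes> (Ident C AXX \<cdot> Ident C AXX \<cdot> Ident C AXX \<cdot> (\<eta> \<rhd> X \<otimes> X))) \<cdot> lk"
      by (rule free_act_arr[OF Dr idN idNl Fk Fs])
    have 3: "act_arr C ?k ?k ?N (Sk, \<kappa>k, \<alpha>k) (Ident C AX) L
      = \<theta>v \<cdot> (b \<rhd> X \<otimes> (X \<otimes> X)) \<cdot> (Ident C AX \<boxtimes> ((Ident C AX \<rhd> X \<otimes> X) \<cdot> lk \<cdot> L \<cdot> Ident C AXX \<cdot> (\<eta> \<rhd> X \<otimes> X))) \<cdot> lk"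
      by (rule free_act_arr[OF linK L Llin Fk Fv])
    have "\<theta>v \<cdot> (l \<rhd> X \<otimes> X) \<cdot> ls \<cdot> (\<theta>s \<cdot> (\<beta>' \<rhd> X \<otimes> X) \<cdot> ((\<theta> \<cdot> d) \<boxtimes> (Ident C AXX \<cdot> Ident C AXX \<cdot> Ident C AXX \<cdot> (\<eta> \<rhd> X \<otimes> X))) \<cdot> lk) \<cdot> L
      = \<theta>v \<cdot> (d \<rhd> X \<otimes> X) \<cdot> (d \<rhd> X)"
        by (rule diagram_eq[OF eqs5[OF ffs(7) \<beta>'\<eta> ff0(7) L1 ffk(7)], where c = "[Rw 0 6 0,
          Rw 1 4 0, Rw 2 3 0, Rw 3 0 0, Rw 4 1 0]"], (rule depicts typing)+,
          simp add: derivable_simps)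
    also have "\<dots> = \<theta>v \<cdot> (b \<rhd> X \<otimes> (X \<otimes> X)) \<cdot> (Ident C AX \<boxtimes> ((Ident C AX \<rhd> X \<otimes> X) \<cdot> lk \<cdot> L \<cdot> Ident C AXX \<cdot> (\<eta> \<rhd> X \<otimes> X))) \<cdot> lk \<cdot> L"
      by (rule diagram_eq[OF eqs5[OF L1 ffk(7) b(8) d1 \<eta>l], where c = "[Rw 2 0 0, Rv 4 2 2,
        Up 2 1, Rv 3 2 2, Rv 1 3 2, Rv 1 1 0, Rv 0 4 2, Rv 0 0 0]"], (rule depicts typing)+,
        simp add: derivable_simps)
    finally show ?thesis unfolding 1 2 3 by (simp add: D)
  qed
  have lun: "factor C (tq C (A, m) (AXX, m \<rhd> X \<otimes> X)) (m \<rhd> X \<otimes> X) \<cdot>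
      act_arr C ?k (A, m) ?N ?N AXe (Ident C AXX) \<cdot> L
    = Ident C AXX"
  proof -
    have lpa': "la \<cdot> pa = m \<rhd> X \<otimes> X"
      by (rule diagram_eq[OF eqs1[OF ffa(3)], where c = "[Rw 0 0 0]"], (rule depicts typing)+,
        simp add: derivable_simps)
    have 1: "factor C (tq C (A, m) (AXX, m \<rhd> X \<otimes> X)) (m \<rhd> X \<otimes> X) = la"
      using factor_eq[OF tta(1) tta(6) ffa(2) lpa'] by (simp add: tta(7)[symmetric])
    have 2: "act_arr C ?k (A, m) ?N ?N AXe (Ident C AXX)
      = \<theta>a \<cdot> (m \<rhd> X \<otimes> X) \<cdot> (AXe \<boxtimes> (Ident C AXX \<cdot> Ident C AXX \<cdot> Ident C AXX \<cdot> (\<eta> \<rhd> X \<otimes> X))) \<cdot> lk"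
      by (rule free_act_arr[OF counit_linear(1)[folded b1] idN idNl Fk Fa])
    have "la \<cdot> (\<theta>a \<cdot> (m \<rhd> X \<otimes> X) \<cdot> ((m \<cdot> (A \<lhd> \<epsilon>)) \<boxtimes> (Ident C AXX \<cdot> Ident C AXX \<cdot> Ident C AXX \<cdot> (\<eta> \<rhd> X \<otimes> X))) \<cdot> lk) \<cdot> L
       = Ident C AXX"
         by (rule diagram_eq[OF eqs7[OF ffa(7) L1 ffk(7) d1 m_assoc \<epsilon>\<delta> \<eta>r],
           where c = "[Rw 0 6 0, Rw 1 0 0, Rw 2 1 0, Rw 3 0 0, Up 2 1, Rw 4 2 0, Rw 5 0 1,
           Rw 6 0 0, Rw 6 0 0]"], (rule depicts typing)+, simp add: derivable_simps)
    then show ?thesis unfolding 1 2 by (simp add: AX_counit_def)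
  qed
  have mixed: "act_assoc C A ?k ?N ?K \<cdot>
      act_arr C ?n (Sk, \<alpha>k) ?K ?K L (Ident C AX) \<cdot> R
    = act_arr C ?k ?k ?N (Sn, \<kappa>n, \<alpha>n) (Ident C AX) R \<cdot> L"
  proof -
    have 1: "act_assoc C A ?k ?N ?K = \<theta>x \<cdot> (lk \<rhd> X) \<cdot> lw"
      by (rule free_act_assoc[OF Fk Bn Fn Fw Fx AX_coflat])
    have 2: "act_arr C ?n (Sk, \<alpha>k) ?K ?K L (Ident C AX)
      = \<theta>w \<cdot> (L \<rhd> X) \<cdot> ln"
      by (rule arr_AX[OF Lr Fn Fw])
    have 3: "act_arr C ?k ?k ?N (Sn, \<kappa>n, \<alpha>n) (Ident C AX) R
      = \<theta>x \<cdot> (b \<rhd> X \<otimes> X \<otimes> X) \<cdot> (Ident C AX \<boxtimes> ((Ident C AXX \<rhd> X) \<cdot> ln \<cdot> R \<cdot> Ident C AXX \<cdot> (\<eta> \<rhd> X \<otimes> X))) \<cdot> lk"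
      by (rule free_act_arr[OF linK R Rlin Fk Fx])
    have "\<theta>x \<cdot> (lk \<rhd> X) \<cdot> lw \<cdot> (\<theta>w \<cdot> (L \<rhd> X) \<cdot> ln) \<cdot> R
       = \<theta>x \<cdot> (d \<rhd> X \<otimes> X) \<cdot> r"
         by (rule diagram_eq[OF eqs5[OF ffw(7) L1 ffk(7) R1 ffn(7)], where c = "[Rw 0 3 0,
           Rw 1 2 0, Rw 2 3 0, Rw 3 0 0, Rw 4 1 0]"], (rule depicts typing)+,
           simp add: derivable_simps)
    also have "\<dots> = \<theta>x \<cdot> (b \<rhd> X \<otimes> X \<otimes> X) \<cdot> (AX \<lhd> ((\<psi> \<rhd> X \<otimes> X) \<cdot> (X \<lhd> \<delta>))) \<cdot> (d \<rhd> X)"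
      by (rule diagram_eq[OF eqs2[OF r1 b(7)], where c = "[Rw 0 0 0, Rw 1 1 0, Up 1 1]"],
        (rule depicts typing)+, simp add: derivable_simps)
    also have "\<dots> = \<theta>x \<cdot> (b \<rhd> X \<otimes> X \<otimes> X) \<cdot> (Ident C AX \<boxtimes> ((Ident C AXX \<rhd> X) \<cdot> ln \<cdot> R \<cdot> Ident C AXX \<cdot> (\<eta> \<rhd> X \<otimes> X))) \<cdot> lk \<cdot> L"
      by (rule diagram_eq[OF eqs7[OF L1 ffk(7) R1 ffn(7) r1 b1 \<eta>l], where c = "[Rv 6 3 2,
        Up 3 2, Rv 5 3 2, Rv 4 2 2, Rv 3 3 2, Rv 2 2 2, Rv 1 1 0, Rv 0 0 0]"],
        (rule depicts typing)+, simp add: derivable_simps)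
    finally show ?thesis by (simp add: 1 2 3)
  qed
  let ?D = "(AXb, AXc, bim_tensor C A AXb AXb)" and ?e = "(AXb, AXe, (A, m, m))"
  let ?L = "(?N, L, (Sk, \<kappa>k, \<alpha>k))" and ?R = "(?N, R, (Sn, \<kappa>n, \<alpha>n))"
  have bicN: "bicomodule \<V> AXb ?D ?e ?N ?L ?R"
    using crN crkk crn Ll Lr Rl Rr coassoc lun mixed cN[unfolded comodule_def K3 ttn(9) Let_def]
    unfolding bicomodule_def K3 by (simp add: cr_simps bb0(4) bbk(4) bbn(4))
  have dlin: "llinear AX (m \<rhd> X) AXX (m \<rhd> X \<otimes> X) d" using b(6) dl by (simp add: left_linear_def)
  have drin: "linear AX b AXX n d" using b(6) b(7) by (simp add: right_linear_def n1)
  have bici: "bicolinear \<V> AXb AXb ?D ?D ?N ?L ?R (?K, d, ?N)"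
  proof -
    have 1: "act_arr C ?k ?k ?K ?N (Ident C AX) d
      = \<theta>k \<cdot> (b \<rhd> X \<otimes> X) \<cdot> (Ident C AX \<boxtimes> (Ident C AXX \<cdot> d \<cdot> Ident C AX \<cdot> (\<eta> \<rhd> X))) \<cdot> l"
      by (rule free_act_arr[OF linK b(6) dl F0 Fk])
    have "\<theta>k \<cdot> (b \<rhd> X \<otimes> X) \<cdot> (Ident C AX \<boxtimes> (Ident C AXX \<cdot> d \<cdot> Ident C AX \<cdot> (\<eta> \<rhd> X))) \<cdot> l \<cdot> (\<theta> \<cdot> d)
       = \<theta>k \<cdot> (b \<rhd> X \<otimes> X) \<cdot> (AX \<lhd> \<delta>) \<cdot> d"
         by (rule diagram_eq[OF eqs3[OF ff0(7) d1 \<eta>l], where c = "[Rw 0 1 0, Rw 1 2 2, Up 2 1,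
           Rw 2 2 2]"], (rule depicts typing)+, simp add: derivable_simps)
    also have "\<dots> = L \<cdot> d"
      by (rule diagram_eq[OF eqs2[OF L1 b(8)], where c = "[Rv 1 0 0, Rv 0 1 0]"],
        (rule depicts typing)+, simp add: derivable_simps)
    finally have l1: "L \<cdot> d = act_arr C ?k ?k ?K ?N (Ident C AX) d \<cdot> AXc" by (simp add: 1 D)
    have 2: "act_arr C ?k ?n ?K ?K d (Ident C AX)
      = \<theta>n \<cdot> (d \<rhd> X) \<cdot> l"
      by (rule arr_AX[OF drin F0 Fn])
    have "\<theta>n \<cdot> (d \<rhd> X) \<cdot> l \<cdot> (\<theta> \<cdot> d)
       = \<theta>n \<cdot> (d \<rhd> X) \<cdot> d"
         by (rule diagram_eq[OF eqs1[OF ff0(7)], where c = "[Rw 0 1 0]"],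
           (rule depicts typing)+, simp add: derivable_simps)
    also have "\<dots> = R \<cdot> d"
      by (rule diagram_eq[OF eqs3[OF R1 r1 b(8)], where c = "[Rw 2 0 0, Rv 1 1 0, Rv 0 1 0]"],
        (rule depicts typing)+, simp add: derivable_simps)
    finally have r1: "R \<cdot> d = act_arr C ?k ?n ?K ?K d (Ident C AX) \<cdot> AXc" by (simp add: 2 D)
    show ?thesis
      using crK crN dlin drin l1 r1 unfolding bicolinear_def K3 by (simp add: cr_simps bb0(4) bbk(4) bbn(4))
  qed
  obtain e where e1: "e = (m \<rhd> X) \<cdot> (A \<lhd> \<epsilon> \<rhd> X)" by blast
  have "\<exists>q \<in> hom \<V> ?N AXb. Comp \<V> q (?K, d, ?N) = Ident \<V> AXb"
  proof -
    have "(m \<rhd> X) \<cdot> (A \<lhd> \<epsilon> \<rhd> X) \<in> hom C AXX AX" by (rule depicts_in, (rule depicts typing)+, simp)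
    then have e [typing]: "e \<in> hom C AXX AX" by (simp add: e1)
    have "e \<cdot> (m \<rhd> X \<otimes> X) = (m \<rhd> X) \<cdot> (A \<lhd> e)"
      by (rule diagram_eq[OF eqs2[OF e1 m_assoc], where c = "[Rw 0 1 0, Up 1 1, Rw 1 1 0,
        Rv 0 0 1]"], (rule depicts typing)+, simp add: derivable_simps)
    moreover have "e \<cdot> n = b \<cdot> (e \<rhd> A)"
      by (rule diagram_eq[OF eqs5[OF e1 n1 b1 \<epsilon>\<psi> m_assoc], where c = "[Rw 0 1 0, Rw 1 0 0,
        Rw 2 1 0, Up 3 1, Rw 4 3 0, Rw 3 1 1, Up 1 1, Rv 4 2 0, Up 2 1, Rv 0 0 0, Rv 2 1 0]"],
        (rule depicts typing)+, simp add: derivable_simps)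
    moreover have "e \<cdot> d = Ident C AX"
      by (rule diagram_eq[OF eqs5[OF e1 d1 m_assoc \<epsilon>\<delta> \<eta>r], where c = "[Rw 0 1 0, Rw 1 0 0,
        Up 2 1, Rw 2 2 0, Rw 3 0 1, Rw 4 0 0]"], (rule depicts typing)+,
        simp add: derivable_simps)
    ultimately have "(?N, e, ?K) \<in> hom \<V> ?N AXb" "Comp \<V> (?N, e, ?K) (?K, d, ?N) = Ident \<V> AXb"
      using e crN crK unfolding K3 by (simp_all add: cr_simps left_linear_def right_linear_def)
    then show ?thesis by blast
  qed
  moreover have "bicolinear \<V> AXb AXb ?D ?D AXb ?D ?D (Ident \<V> AXb)"
  proof -
    have 1: "act_arr C ?k ?k ?K ?K (Ident C AX) (Ident C AX)
      = \<theta> \<cdot> (Ident C AX \<rhd> X) \<cdot> l"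
      by (rule arr_AX[OF linK F0 F0])
    have "\<theta> \<cdot> (Ident C AX \<rhd> X) \<cdot> l \<cdot> (\<theta> \<cdot> d)
       = \<theta> \<cdot> d \<cdot> Ident C AX"
         by (rule diagram_eq[OF eqs1[OF ff0(7)], where c = "[Rw 0 1 0]"],
           (rule depicts typing)+, simp add: derivable_simps)
    then have "AXc \<cdot> Ident C AX = act_arr C ?k ?k ?K ?K (Ident C AX) (Ident C AX) \<cdot> AXc"
      by (simp add: 1 D)
    moreover have "llinear AX (m \<rhd> X) AX (m \<rhd> X) (Ident C AX)"
      using idK idKl by (simp add: left_linear_def)
    ultimately show ?thesis
      using crK linK unfolding bicolinear_def K3 by (simp add: cr_simps bb0(4))
  qed
  ultimately obtain G where G: "bicolinear \<V> AXb ?N ?L ?R AXb ?D ?D G" "Ident \<V> AXb = Comp \<V> G (?K, d, ?N)"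
    using cosep[unfolded coseparable_coring_def coseparable_coalgebra_def, THEN conjunct2, rule_format,
        OF AX_bicomodule bicN bici] by blast
  then obtain g where g: "G = (?N, g, ?K)" and gl: "llinear AXX (m \<rhd> X \<otimes> X) AX (m \<rhd> X) g"
    and gr: "linear AXX n AX b g"
    unfolding bicolinear_def K3 by (auto simp: cr_simps)
  from gl have z [typing]: "g \<in> hom C AXX AX" and zl: "g \<cdot> (m \<rhd> X \<otimes> X) = (m \<rhd> X) \<cdot> (A \<lhd> g)"
    by (simp_all add: left_linear_def)
  from gr have zr: "g \<cdot> n = b \<cdot> (g \<rhd> A)" by (simp add: right_linear_def)
  have zd: "g \<cdot> d = Ident C AX" using G(2) by (simp add: g K3 cr_simps)
  have G1: "AXc \<cdot> g = act_arr C ?k ?k ?N ?K (Ident C AX) g \<cdot> L"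
    and G2: "AXc \<cdot> g = act_arr C ?n ?k ?K ?K g (Ident C AX) \<cdot> R"
    using G(1) unfolding bicolinear_def g K3 by (auto simp: cr_simps bb0(4) bbk(4) bbn(4))
  have dg: "d \<cdot> g \<in> hom C AXX AXX" by (rule depicts_in, (rule depicts typing)+, simp)
  have gL: "d \<cdot> g = (b \<rhd> X) \<cdot> (AX \<lhd> (g \<cdot> (\<eta> \<rhd> X \<otimes> X))) \<cdot> (d \<rhd> X)"
  proof -
    have y: "(b \<rhd> X) \<cdot> (AX \<lhd> (g \<cdot> (\<eta> \<rhd> X \<otimes> X))) \<cdot> (d \<rhd> X) \<in> hom C AXX AXX"
      by (rule depicts_in, (rule depicts typing)+, simp)
    have 1: "act_arr C ?k ?k ?N ?K (Ident C AX) g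
      = \<theta> \<cdot> (b \<rhd> X) \<cdot> (Ident C AX \<boxtimes> (Ident C AX \<cdot> g \<cdot> Ident C AXX \<cdot> (\<eta> \<rhd> X \<otimes> X))) \<cdot> lk"
      by (rule free_act_arr[OF linK z zl Fk F0])
    have "\<theta> \<cdot> (b \<rhd> X) \<cdot> (Ident C AX \<boxtimes> (Ident C AX \<cdot> g \<cdot> Ident C AXX \<cdot> (\<eta> \<rhd> X \<otimes> X))) \<cdot> lk \<cdot> L
       = \<theta> \<cdot> ((b \<rhd> X) \<cdot> (AX \<lhd> (g \<cdot> (\<eta> \<rhd> X \<otimes> X))) \<cdot> (d \<rhd> X))"
         by (rule diagram_eq[OF eqs2[OF L1 ffk(7)], where c = "[Rw 0 0 0, Rw 1 1 0]"],
           (rule depicts typing)+, simp add: derivable_simps)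
    then have "\<theta> \<cdot> (d \<cdot> g) = \<theta> \<cdot> ((b \<rhd> X) \<cdot> (AX \<lhd> (g \<cdot> (\<eta> \<rhd> X \<otimes> X))) \<cdot> (d \<rhd> X))"
      using G1 comp_assoc[OF z b(6) ff0(1)] by (simp add: 1 D)
    then show ?thesis using iso_cancel[OF ff0(1) ff0(2) ff0(7) dg y] by simp
  qed
  have gR: "(g \<rhd> X) \<cdot> r = d \<cdot> g"
  proof -
    have y: "(g \<rhd> X) \<cdot> r \<in> hom C AXX AXX" by (rule depicts_in, (rule depicts typing)+, simp)
    have 1: "act_arr C ?n ?k ?K ?K g (Ident C AX)
      = \<theta> \<cdot> (g \<rhd> X) \<cdot> ln"
      by (rule arr_AX[OF gr Fn F0])
    have "\<theta> \<cdot> (g \<rhd> X) \<cdot> ln \<cdot> R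
       = \<theta> \<cdot> ((g \<rhd> X) \<cdot> r)"
         by (rule diagram_eq[OF eqs2[OF R1 ffn(7)], where c = "[Rw 0 0 0, Rw 1 1 0]"],
           (rule depicts typing)+, simp add: derivable_simps)
    then have "\<theta> \<cdot> (d \<cdot> g) = \<theta> \<cdot> ((g \<rhd> X) \<cdot> r)"
      using G2 comp_assoc[OF z b(6) ff0(1)] by (simp add: 1 D)
    then show ?thesis using iso_cancel[OF ff0(1) ff0(2) ff0(7) dg y] by simp
  qed
  have "b \<cdot> (AX \<lhd> (m \<cdot> (A \<lhd> \<epsilon>) \<cdot> g \<cdot> (\<eta> \<rhd> X \<otimes> X))) \<cdot> (\<delta> \<rhd> X)
      = b \<cdot> (AX \<lhd> \<epsilon>) \<cdot> (b \<rhd> X) \<cdot> (AX \<lhd> (g \<cdot> (\<eta> \<rhd> X \<otimes> X))) \<cdot> (d \<rhd> X) \<cdot> (\<eta> \<rhd> X \<otimes> X)"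
    by (rule diagram_eq[OF eqs3[OF d1 b(4) \<eta>l], where c = "[Rv 1 4 0, Up 4 1, Rv 2 1 0,
      Up 1 1, Rv 0 1 0]"], (rule depicts typing)+, simp add: derivable_simps)
  also have "\<dots> = b \<cdot> (AX \<lhd> \<epsilon>) \<cdot> d \<cdot> g \<cdot> (\<eta> \<rhd> X \<otimes> X)"
    by (rule diagram_eq[OF eqs1[OF gL], where c = "[Rv 0 1 0]"], (rule depicts typing)+,
      simp add: derivable_simps)
  also have "\<dots> = g \<cdot> (\<eta> \<rhd> X \<otimes> X)"
    by (rule diagram_eq[OF eqs1[OF b(9)], where c = "[Rw 0 2 0]"], (rule depicts typing)+,
      simp add: derivable_simps)
  finally have "b \<cdot> (AX \<lhd> (m \<cdot> (A \<lhd> \<epsilon>) \<cdot> g \<cdot> (\<eta> \<rhd> X \<otimes> X))) \<cdot> (\<delta> \<rhd> X) = g \<cdot> (\<eta> \<rhd> X \<otimes> X)" .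
  from retraction_casimir[OF b1 d1 z zl zr[unfolded n1] gR[unfolded r1] zd this] show ?thesis by blast
qed

end

context coflat_cowreath
begin

lemma bicomodule_data:
  assumes "bicomodule \<V> AXb (AXb, AXc, bim_tensor C A AXb AXb) (AXb, AXe, (A, m, m)) (N, \<nu>, \<xi>) lN rN"
    and b: "AXb = (AX, m \<rhd> X, b)"
    and "bimod_tensor AX (m \<rhd> X) b AX (m \<rhd> X) b p S \<beta>' \<kappa>"
    and "bimod_tensor AX (m \<rhd> X) b N \<nu> \<xi> pk Sk \<alpha>k \<kappa>k" "bimod_tensor N \<nu> \<xi> AX (m \<rhd> X) b pn Sn \<alpha>n \<kappa>n"
  obtains l r where "lN = ((N, \<nu>, \<xi>), l, (Sk, \<kappa>k, \<alpha>k))" "rN = ((N, \<nu>, \<xi>), r, (Sn, \<kappa>n, \<alpha>n))"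
    "crb (N, \<nu>, \<xi>)" "crb (Sk, \<kappa>k, \<alpha>k)" "crb (Sn, \<kappa>n, \<alpha>n)"
    "llinear N \<nu> Sk \<kappa>k l" "linear N \<xi> Sk \<alpha>k l" "llinear N \<nu> Sn \<kappa>n r" "linear N \<xi> Sn \<alpha>n r"
    "comod N \<xi> r"
    "act_assoc C A (AX, b) (AX, m \<rhd> X, b) (N, \<nu>, \<xi>) \<cdot>
       act_arr C (AX, b) (S, \<beta>') (N, \<nu>, \<xi>) (N, \<nu>, \<xi>) AXc (Ident C N) \<cdot> l
     = act_arr C (AX, b) (AX, b) (N, \<nu>, \<xi>) (Sk, \<kappa>k, \<alpha>k) (Ident C AX) l \<cdot> l"
    "act_assoc C A (AX, b) (N, \<nu>, \<xi>) (AX, m \<rhd> X, b) \<cdot>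
       act_arr C (N, \<xi>) (Sk, \<alpha>k) (AX, m \<rhd> X, b) (AX, m \<rhd> X, b) l (Ident C AX) \<cdot> r
     = act_arr C (AX, b) (AX, b) (N, \<nu>, \<xi>) (Sn, \<kappa>n, \<alpha>n) (Ident C AX) r \<cdot> l"
proof -
  note bt = bimod_tensorD(4)[OF assms(3)] and btk = bimod_tensorD(4)[OF assms(4)]
    and btn = bimod_tensorD(4)[OF assms(5)] and an = act_tensorD(9)[OF bimod_tensorD(1)[OF assms(5)]]
  from assms(1) obtain l r where L: "lN = ((N, \<nu>, \<xi>), l, (Sk, \<kappa>k, \<alpha>k))" and R: "rN = ((N, \<nu>, \<xi>), r, (Sn, \<kappa>n, \<alpha>n))"
    and cr: "crb (N, \<nu>, \<xi>)" "crb (Sk, \<kappa>k, \<alpha>k)" "crb (Sn, \<kappa>n, \<alpha>n)"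
    and lin: "llinear N \<nu> Sk \<kappa>k l" "linear N \<xi> Sk \<alpha>k l" "llinear N \<nu> Sn \<kappa>n r" "linear N \<xi> Sn \<alpha>n r"
    unfolding bicomodule_def b by (auto simp: cr_simps btk btn)
  note B = assms(1)[unfolded bicomodule_def L R b]
  have "comod N \<xi> r"
    using B lin(4) bimodD(1)[OF cr_bimod(1)[OF cr(1)]] unfolding comodule_def b an Let_def
    by (simp add: cr_simps bt btk btn)
  then show thesis
    using B by (intro that[OF L R cr lin]) (simp_all add: cr_simps bt btk btn)
qed

end

context coflat_cowreath
begin

lemma casimir_coring:
  assumes cas: "casimir B"
  shows "coseparable_coring C A m \<eta> AXb AXc AXe"
  unfolding coseparable_coring_def coseparable_coalgebra_def
proof (intro conjI allI impI)
  let ?D = "(AXb, AXc, bim_tensor C A AXb AXb)" and ?e = "(AXb, AXe, (A, m, m))"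
  show "coalgebra \<V> AXb ?D ?e" by (rule AX_coalgebra)
  fix M' lM rM N' lN rN i' f'
  assume bicM: "bicomodule \<V> AXb ?D ?e M' lM rM" and bicN: "bicomodule \<V> AXb ?D ?e N' lN rN"
    and bici: "bicolinear \<V> AXb M' lM rM N' lN rN i'" and "\<exists>p \<in> hom \<V> N' M'. Comp \<V> p i' = Ident \<V> M'"
    and bicf: "bicolinear \<V> AXb M' lM rM AXb ?D ?D f'"
  then obtain p' where p': "p' \<in> hom \<V> N' M'" "Comp \<V> p' i' = Ident \<V> M'" by blast
  note B [typing] = casimirD[OF cas]
  obtain b where b1: "b = (m \<rhd> X) \<cdot> (A \<lhd> \<psi>)" by blast
  note K = AX_bimod[folded b1]
  have K3: "AXb = (AX, m \<rhd> X, b)" by (simp add: AXb b1)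
  let ?K = "(AX, m \<rhd> X, b)" and ?k = "(AX, b)"
  obtain d where d1: "d = (m \<rhd> X \<otimes> X) \<cdot> (A \<lhd> \<delta>)" by blast
  have eK: "emod AX b d" using cofree_emod[OF rmod_A] by (simp add: b1 d1)
  note b [typing] = emodD[OF eK]
  have bl: "b \<cdot> ((m \<rhd> X) \<rhd> A) = (m \<rhd> X) \<cdot> (A \<lhd> b)"
    by (rule diagram_eq[OF eqs2[OF b1 m_assoc], where c = "[Rw 0 1 0, Up 1 1, Rw 1 1 0,
      Rv 0 0 1]"], (rule depicts typing)+, simp add: derivable_simps)
  have dl: "d \<cdot> (m \<rhd> X) = (m \<rhd> X \<otimes> X) \<cdot> (A \<lhd> d)"
    by (rule diagram_eq[OF eqs2[OF d1 m_assoc], where c = "[Rw 0 1 0, Up 1 1, Rw 1 1 0,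
      Rv 0 0 1]"], (rule depicts typing)+, simp add: derivable_simps)
  note rK = bimodD(1)[OF K]
  note linK = linear_id[OF rK]
  have AX [typing]: "AX \<in> Obj C" and mX: "m \<rhd> X \<in> hom C (A \<otimes> AX) AX"
    using bimodD[OF K] by simp_all
  obtain p S \<beta>' \<kappa> \<theta> l where B0: "bimod_tensor AX (m \<rhd> X) b AX (m \<rhd> X) b p S \<beta>' \<kappa>"
    and F0: "split_tensor AX b AX (m \<rhd> X) b p S \<beta>' X (Ident C AX) (Ident C AX) \<theta> l"
    and D: "AXc = \<theta> \<cdot> d"
    by (rule AX_square[folded b1 d1])
  note tt0 [typing] = act_tensorD[OF split_tensorD(9)[OF F0]]
    and ff0 [typing] = AX_tensorD[folded b1, OF F0]
  note bb0 [typing] = bimod_tensorD[OF B0]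
  note arr_AX = act_arr_AX[folded b1, unfolded K3 fst_conv]
  have upK: "up AX b d = AXc" by (simp add: up_def tensor_AX_def tt0(7)[symmetric] ff0(5)[symmetric] D)
  have cK: "comod AX b AXc"
    using emod_comod(1)[OF rK b(6)] eK unfolding upK by simp
  have Dr: "linear AX b S \<beta>' AXc" using cK by (simp add: comodule_def K3 tt0(9))
  obtain M \<nu>' \<xi>' where M3: "M' = (M, \<nu>', \<xi>')" by (cases M') auto
  obtain N \<nu> \<xi> where N3: "N' = (N, \<nu>, \<xi>)" by (cases N') auto
  let ?M = "(M, \<nu>', \<xi>')" and ?N = "(N, \<nu>, \<xi>)"
  have crM: "crb ?M" and crN: "crb ?N"
    using bicM bicN by (simp_all add: bicomodule_def M3 N3 cr_simps)
  note M' = cr_bimod(1)[OF crM] and N' = cr_bimod(1)[OF crN]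
  note M [typing] = bimodD[OF M']
  note N [typing] = bimodD[OF N']
  note rbM = cr_bimod(3)[OF crM] and rbN = cr_bimod(3)[OF crN] and cN = cr_bimod(2)[OF crN]
  obtain pm Sm \<alpha>m \<kappa>m where Bm: "bimod_tensor AX (m \<rhd> X) b M \<nu>' \<xi>' pm Sm \<alpha>m \<kappa>m"
    by (rule bimod_tensorE[OF K M' rbM])
  note ttm [typing] = act_tensorD[OF bimod_tensorD(1)[OF Bm]] and bbm [typing] = bimod_tensorD[OF Bm]
  obtain pk Sk \<alpha>k \<kappa>k where Bk: "bimod_tensor AX (m \<rhd> X) b N \<nu> \<xi> pk Sk \<alpha>k \<kappa>k"
    by (rule bimod_tensorE[OF K N' rbN])
  note ttk [typing] = act_tensorD[OF bimod_tensorD(1)[OF Bk]] and bbk [typing] = bimod_tensorD[OF Bk]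
  obtain po So \<alpha>o \<kappa>o \<theta>o lo where Bo: "bimod_tensor M \<nu>' \<xi>' AX (m \<rhd> X) b po So \<alpha>o \<kappa>o"
    and Fo: "split_tensor M \<xi>' AX (m \<rhd> X) b po So \<alpha>o X (Ident C AX) (Ident C AX) \<theta>o lo"
    by (rule free_bimod_tensorE[OF M' K AX_free])
  note tto [typing] = act_tensorD[OF bimod_tensorD(1)[OF Bo]]
    and bbo [typing] = bimod_tensorD[OF Bo] and ffo [typing] = split_tensorD[OF Fo]
  obtain pn Sn \<alpha>n \<kappa>n \<theta>n ln where Bn: "bimod_tensor N \<nu> \<xi> AX (m \<rhd> X) b pn Sn \<alpha>n \<kappa>n"
    and Fn: "split_tensor N \<xi> AX (m \<rhd> X) b pn Sn \<alpha>n X (Ident C AX) (Ident C AX) \<theta>n ln"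
    by (rule free_bimod_tensorE[OF N' K AX_free])
  note ttn [typing] = act_tensorD[OF bimod_tensorD(1)[OF Bn]]
    and bbn [typing] = bimod_tensorD[OF Bn] and ffn [typing] = split_tensorD[OF Fn]
  obtain L' R' where eLM: "lM = (?M, L', (Sm, \<kappa>m, \<alpha>m))" and eRM: "rM = (?M, R', (So, \<kappa>o, \<alpha>o))"
    and LM: "linear M \<xi>' Sm \<alpha>m L'" and RM: "linear M \<xi>' So \<alpha>o R'" and cmM: "comod M \<xi>' R'"
    by (rule bicomodule_data[OF bicM[unfolded M3] K3 B0 Bm Bo])
  obtain L R where eLN: "lN = (?N, L, (Sk, \<kappa>k, \<alpha>k))" and eRN: "rN = (?N, R, (Sn, \<kappa>n, \<alpha>n))"
    and crSk: "crb (Sk, \<kappa>k, \<alpha>k)" and crSn: "crb (Sn, \<kappa>n, \<alpha>n)"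
    and Ll: "llinear N \<nu> Sk \<kappa>k L" and Lr: "linear N \<xi> Sk \<alpha>k L" and Rl: "llinear N \<nu> Sn \<kappa>n R" and cmN: "comod N \<xi> R"
    and coassoc: "act_assoc C A ?k ?K ?N \<cdot>
       act_arr C ?k (S, \<beta>') ?N ?N AXc (Ident C N) \<cdot> L
     = act_arr C ?k ?k ?N (Sk, \<kappa>k, \<alpha>k) (Ident C AX) L \<cdot> L"
    and mixed: "act_assoc C A ?k ?N ?K \<cdot>
       act_arr C (N, \<xi>) (Sk, \<alpha>k) ?K ?K L (Ident C AX) \<cdot> R
     = act_arr C ?k ?k ?N (Sn, \<kappa>n, \<alpha>n) (Ident C AX) R \<cdot> L"
    by (rule bicomodule_data[OF bicN[unfolded N3] K3 B0 Bk Bn])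
  from LM have L' [typing]: "L' \<in> hom C M Sm" by (rule linearD)
  from Lr have L [typing]: "L \<in> hom C N Sk" and L\<xi>: "L \<cdot> \<xi> = \<alpha>k \<cdot> (L \<rhd> A)" by (rule linearD)+
  from Ll have L\<nu>: "L \<cdot> \<nu> = \<kappa>k \<cdot> (A \<lhd> L)" by (simp add: left_linear_def)
  from Rl have R [typing]: "R \<in> hom C N Sn" and R\<nu>: "R \<cdot> \<nu> = \<kappa>n \<cdot> (A \<lhd> R)" by (simp_all add: left_linear_def)
  obtain i where i3: "i' = (?M, i, ?N)" and il: "llinear M \<nu>' N \<nu> i" and ir: "linear M \<xi>' N \<xi> i"
    using bici unfolding bicolinear_def M3 N3 by (auto simp: cr_simps)
  obtain f where f3: "f' = (?M, f, ?K)" and fl: "llinear M \<nu>' AX (m \<rhd> X) f"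
    and fr: "linear M \<xi>' AX b f"
    using bicf unfolding bicolinear_def M3 K3 by (auto simp: cr_simps)
  obtain y where y3: "p' = (?N, y, ?M)" and yl: "llinear N \<nu> M \<nu>' y" and yr: "linear N \<xi> M \<xi>' y"
    using p'(1) unfolding M3 N3 by (auto simp: cr_simps)
  have yi: "y \<cdot> i = Ident C M" using p'(2) by (simp add: y3 i3 M3 cr_simps)
  have iL: "L \<cdot> i = act_arr C ?k ?k ?M ?N (Ident C AX) i \<cdot> L'"
    and iR: "R \<cdot> i = act_arr C (M, \<xi>') (N, \<xi>) ?K ?K i (Ident C AX) \<cdot> R'"
    using bici unfolding bicolinear_def M3 N3 eLM eRM eLN eRN i3 K3 by (auto simp: cr_simps bb0(4) bbk(4) bbm(4) bbn(4) bbo(4))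
  have fL: "AXc \<cdot> f = act_arr C ?k ?k ?M ?K (Ident C AX) f \<cdot> L'"
    and fR: "AXc \<cdot> f = act_arr C (M, \<xi>') ?k ?K ?K f (Ident C AX) \<cdot> R'"
    using bicf unfolding bicolinear_def M3 eLM eRM f3 K3 by (auto simp: cr_simps bb0(4) bbm(4) bbo(4))
  from il have i [typing]: "i \<in> hom C M N" and i\<nu>: "i \<cdot> \<nu>' = \<nu> \<cdot> (A \<lhd> i)" by (simp_all add: left_linear_def)
  from fl have f [typing]: "f \<in> hom C M AX" and f\<nu>: "f \<cdot> \<nu>' = (m \<rhd> X) \<cdot> (A \<lhd> f)" by (simp_all add: left_linear_def)
  from yl have y [typing]: "y \<in> hom C N M" and y\<nu>: "y \<cdot> \<nu> = \<nu>' \<cdot> (A \<lhd> y)" by (simp_all add: left_linear_def)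
  from fr have f\<xi>: "f \<cdot> \<xi>' = b \<cdot> (f \<rhd> A)" by (rule linearD)
  from yr have y\<xi>: "y \<cdot> \<xi> = \<xi>' \<cdot> (y \<rhd> A)" by (rule linearD)
  obtain s where s1: "s = down M \<xi>' R'" by blast
  obtain r where r1: "r = down N \<xi> R" by blast
  have s [typing]: "s \<in> hom C M (M \<otimes> X)" and Rs: "up M \<xi>' s = R'" and eM: "emod M \<xi>' s"
    using comod_up[OF cmM] comod_emod[OF cmM] by (simp_all add: s1)
  have r [typing]: "r \<in> hom C N (N \<otimes> X)" and Rr: "up N \<xi> r = R" and eN: "emod N \<xi> r"
    using comod_up[OF cmN] comod_emod[OF cmN] by (simp_all add: r1)
  have i_col: "colinear M \<xi>' s N \<xi> r i"
    using comod_colinear[OF emodD(1)[OF eM] emodD(1)[OF eN] ir s r] iR ir by (simp add: Rs Rr K3 colinear_def)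
  have f_col: "colinear M \<xi>' s AX b d f"
    using comod_colinear[OF emodD(1)[OF eM] rK fr s b(6)] fR fr by (simp add: Rs upK K3 colinear_def)
  have \<theta>n2: "\<theta>n = pn \<cdot> (N \<lhd> \<eta> \<rhd> X)"
    by (rule diagram_eq[OF eqs1[OF ffn(5)], where c = "[Rw 0 0 0]"], (rule depicts typing)+,
      simp add: derivable_simps)
  have R\<theta>: "R = \<theta>n \<cdot> r" using Rr by (simp add: up_def tensor_AX_def ttn(7)[symmetric] \<theta>n2[symmetric])
  have eApn: "epi (A \<lhd> pn)"
    using coequalizer_epi[OF robust_coequalizer[OF AX_robust bbn(1) A]] .
  have l\<kappa>n: "ln \<cdot> \<kappa>n = (\<nu> \<rhd> X) \<cdot> (A \<lhd> ln)"
    by (rule epi_diagram_eq[OF eApn eqs3[OF bbn(3) ffn(3) N(9)], where c = "[Rw 0 0 0,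
      Rw 1 1 0, Rw 2 0 0, Rv 1 0 1]"], (rule depicts typing)+, simp add: derivable_simps)
  have "r \<cdot> \<nu> = ln \<cdot> R \<cdot> \<nu>"
    by (rule diagram_eq[OF eqs2[OF R\<theta> ffn(7)], where c = "[Rv 1 2 0, Rv 0 1 0]"],
      (rule depicts typing)+, simp add: derivable_simps)
  also have "\<dots> = (\<nu> \<rhd> X) \<cdot> (A \<lhd> r)"
    by (rule diagram_eq[OF eqs4[OF R\<nu> l\<kappa>n R\<theta> ffn(7)], where c = "[Rw 0 0 0, Rw 1 1 0,
      Rw 2 0 1, Rw 3 1 1]"], (rule depicts typing)+, simp add: derivable_simps)
  finally have r\<nu>: "r \<cdot> \<nu> = (\<nu> \<rhd> X) \<cdot> (A \<lhd> r)" .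
  obtain h where h1: "h = b \<cdot> (AX \<lhd> B) \<cdot> (d \<rhd> X) \<cdot> ((f \<cdot> y) \<rhd> X) \<cdot> r" by blast
  have h_av: "h = average B AX b d r (f \<cdot> y)" by (simp add: h1 average_def)
  have fy: "linear N \<xi> AX b (f \<cdot> y)"
  proof -
    have "f \<cdot> y \<in> hom C N AX" by (rule depicts_in, (rule depicts typing)+, simp)
    moreover have "f \<cdot> y \<cdot> \<xi> = b \<cdot> ((f \<cdot> y) \<rhd> A)"
      by (rule diagram_eq[OF eqs2[OF y\<xi> f\<xi>], where c = "[Rw 0 0 0, Rw 1 1 0]"],
        (rule depicts typing)+, simp add: derivable_simps)
    ultimately show ?thesis by (simp add: right_linear_def)
  qed
  have h_col: "colinear N \<xi> r AX b d h"
    unfolding h_av by (rule average_colinear[OF cas eN eK fy])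
  note h [typing] = colinearD[OF h_col]
  have "average B AX b d s (Ident C AX \<cdot> (f \<cdot> y) \<cdot> i) = Ident C AX \<cdot> h \<cdot> i"
    unfolding h_av by (rule average_natural[OF cas eN eK fy eM eK i_col colinear_id[OF eK]])
  moreover have "Ident C AX \<cdot> (f \<cdot> y) \<cdot> i = f"
    by (rule diagram_eq[OF eqs1[OF yi], where c = "[Rw 0 0 0]"], (rule depicts typing)+,
      simp add: derivable_simps)
  moreover have "Ident C AX \<cdot> h \<cdot> i = h \<cdot> i"
    by (rule diagram_eq[OF eqs0, where c = "[]"], (rule depicts typing)+,
      simp add: derivable_simps)
  ultimately have hi: "h \<cdot> i = f" using average_section[OF cas eM eK f_col] by simp
  have h\<nu>: "h \<cdot> \<nu> = (m \<rhd> X) \<cdot> (A \<lhd> h)"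
    by (rule diagram_eq[OF eqs6[OF h1 r\<nu> y\<nu> f\<nu> dl bl], where c = "[Rw 0 1 0, Rw 1 0 0,
      Rw 2 1 0, Rw 3 2 0, Rw 4 3 0, Up 5 1, Rw 5 5 0, Rv 0 0 1]"], (rule depicts typing)+,
      simp add: derivable_simps)
  obtain z where z1: "z = b \<cdot> (AX \<lhd> B) \<cdot> (d \<rhd> X)" by blast
  have "b \<cdot> (AX \<lhd> B) \<cdot> (d \<rhd> X) \<in> hom C AXX AX" by (rule depicts_in, (rule depicts typing)+, simp)
  then have z [typing]: "z \<in> hom C AXX AX" by (simp add: z1)
  have zl: "z \<cdot> (m \<rhd> X \<otimes> X) = (m \<rhd> X) \<cdot> (A \<lhd> z)"
    by (rule diagram_eq[OF eqs3[OF z1 dl bl], where c = "[Rw 0 1 0, Rw 1 0 0, Up 2 1,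
      Rw 2 2 0, Rv 0 0 1]"], (rule depicts typing)+, simp add: derivable_simps)
  have zr: "z \<cdot> ((b \<rhd> X) \<cdot> (AX \<lhd> \<psi>)) = b \<cdot> (z \<rhd> A)"
    by (rule diagram_eq[OF eqs4[OF z1 b(7) B(2) b(4)], where c = "[Rw 0 2 0, Rw 1 1 0, Up 1 1,
      Up 4 1, Rw 3 4 0, Rw 2 1 2, Rv 3 2 0, Rv 0 0 0]"], (rule depicts typing)+,
      simp add: derivable_simps)
  have zc: "(z \<rhd> X) \<cdot> ((b \<rhd> X \<otimes> X) \<cdot> (AX \<lhd> \<delta>)) = d \<cdot> z"
    by (rule diagram_eq[OF eqs5[OF z1 b(7) b(8) B(3) b(4)], where c = "[Rw 0 2 0, Rw 1 1 0,
      Up 1 1, Up 4 1, Rw 4 4 0, Rw 3 1 2, Rv 4 4 0, Up 4 2, Rv 2 0 0, Up 2 1, Rv 1 2 0,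
      Rv 0 0 0]"], (rule depicts typing)+, simp add: derivable_simps)
  have zd: "z \<cdot> d = Ident C AX"
    by (rule diagram_eq[OF eqs5[OF z1 b(8) B(4) b(4) b(9)], where c = "[Rw 0 1 0, Rw 1 0 0,
      Up 3 1, Rw 3 3 0, Rw 2 1 2, Rw 4 0 0]"], (rule depicts typing)+,
      simp add: derivable_simps)
  obtain t where t1: "t = (b \<rhd> X) \<cdot> (AX \<lhd> (z \<cdot> (\<eta> \<rhd> X \<otimes> X)))" by blast
  have "(b \<rhd> X) \<cdot> (AX \<lhd> (z \<cdot> (\<eta> \<rhd> X \<otimes> X))) \<in> hom C (AXX \<otimes> X) AXX"
    by (rule depicts_in, (rule depicts typing)+, simp)
  then have t [typing]: "t \<in> hom C (AXX \<otimes> X) AXX" by (simp add: t1)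
  have bA: "(b \<rhd> X) \<cdot> (AX \<lhd> (m \<rhd> X)) = (b \<rhd> X) \<cdot> (b \<rhd> AX)"
    by (rule diagram_eq[OF eqs1[OF b(4)], where c = "[Rv 0 0 0]"], (rule depicts typing)+,
      simp add: derivable_simps)
  have z\<eta>: "(m \<rhd> X) \<cdot> (A \<lhd> (z \<cdot> (\<eta> \<rhd> X \<otimes> X))) = z"
    by (rule diagram_eq[OF eqs2[OF zl \<eta>r], where c = "[Rv 0 1 0, Rw 1 0 0]"],
      (rule depicts typing)+, simp add: derivable_simps)
  have tb: "t \<cdot> (b \<rhd> X \<otimes> X) = (b \<rhd> X) \<cdot> (AX \<lhd> z)"
  proof -
    have "t \<cdot> (b \<rhd> X \<otimes> X) = (b \<rhd> X) \<cdot> (AX \<lhd> ((m \<rhd> X) \<cdot> (A \<lhd> (z \<cdot> (\<eta> \<rhd> X \<otimes> X)))))"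
      by (rule diagram_eq[OF eqs2[OF t1 bA], where c = "[Rw 0 1 0, Up 1 1, Up 2 1,
        Rv 1 2 0]"], (rule depicts typing)+, simp add: derivable_simps)
    then show ?thesis by (simp only: z\<eta>)
  qed
  have td: "t \<cdot> (d \<rhd> X) = d \<cdot> z"
    by (rule diagram_eq[OF eqs8[OF t1 z1 d1 b1 \<eta>l b(7) b(8) b(4)], where c = "[Rw 0 1 0,
      Rw 1 2 2, Rw 2 2 2, Rw 3 5 2, Up 2 1, Rw 4 2 2, Rv 7 4 0, Up 4 2, Rv 6 0 0, Up 2 1,
      Rv 5 2 0, Rv 1 0 0]"], (rule depicts typing)+, simp add: derivable_simps)
  note rN = emodD(1)[OF eN]
  obtain u where u [typing]: "u \<in> hom C Sk AXX" and upk: "u \<cdot> pk = (b \<rhd> X) \<cdot> (AX \<lhd> h)"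
  proof -
    have k: "(b \<rhd> X) \<cdot> (AX \<lhd> h) \<in> hom C (AX \<otimes> N) AXX"
      by (rule depicts_in, (rule depicts typing)+, simp)
    have "(b \<rhd> X) \<cdot> (AX \<lhd> h) \<cdot> (b \<rhd> N) = (b \<rhd> X) \<cdot> (AX \<lhd> h) \<cdot> (AX \<lhd> \<nu>)"
      by (rule diagram_eq[OF eqs2[OF h\<nu> b(4)], where c = "[Up 1 1, Rw 1 1 0, Rv 0 0 2]"],
        (rule depicts typing)+, simp add: derivable_simps)
    from coequalizer_ex[OF ttk(8) ttk(1) k this] show thesis using that by blast
  qed
  have eApk: "epi (A \<lhd> pk)"
    using coequalizer_epi[OF robust_coequalizer[OF rbN bbk(1) A]] .
  have u\<kappa>: "u \<cdot> \<kappa>k = (m \<rhd> X \<otimes> X) \<cdot> (A \<lhd> u)"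
    by (rule epi_diagram_eq[OF eApk eqs3[OF bbk(3) upk bl], where c = "[Rw 0 0 0, Rw 1 1 0,
      Up 1 1, Rw 2 1 0, Rv 1 0 1]"], (rule depicts typing)+, simp add: derivable_simps)
  have u\<alpha>: "u \<cdot> \<alpha>k = (b \<rhd> X) \<cdot> (AX \<lhd> \<psi>) \<cdot> (u \<rhd> A)"
    by (rule epi_diagram_eq[OF coflat_epi[OF coflat_A ttk(8)] eqs5[OF ttk(4) upk h(3) b(4)
      b1], where c = "[Rw 0 0 0, Rw 1 1 0, Rw 2 0 2, Rw 4 1 2, Rv 3 2 0, Up 2 1, Rv 1 0 0]"],
      (rule depicts typing)+, simp add: derivable_simps)
  obtain g where g1: "g = z \<cdot> u \<cdot> L" by blast
  have "z \<cdot> u \<cdot> L \<in> hom C N AX" by (rule depicts_in, (rule depicts typing)+, simp)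
  then have g [typing]: "g \<in> hom C N AX" by (simp add: g1)
  have g\<nu>: "g \<cdot> \<nu> = (m \<rhd> X) \<cdot> (A \<lhd> g)"
    by (rule diagram_eq[OF eqs4[OF g1 L\<nu> u\<kappa> zl], where c = "[Rw 0 1 0, Rw 1 0 0, Rw 2 1 0,
      Rw 3 2 0, Rv 0 0 1]"], (rule depicts typing)+, simp add: derivable_simps)
  have "g \<cdot> \<xi> = b \<cdot> (g \<rhd> A)"
    by (rule diagram_eq[OF eqs4[OF g1 L\<xi> u\<alpha> zr], where c = "[Rw 0 1 0, Rw 1 0 0, Rw 2 1 0,
      Rw 3 2 0, Rv 0 0 0]"], (rule depicts typing)+, simp add: derivable_simps)
  with g have gr: "linear N \<xi> AX b g" by (simp add: right_linear_def)
  have gi: "g \<cdot> i = f"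
  proof -
    note ai = act_arr_comp[OF linK i i\<nu> bbm(1) bbk(1)]
    note af = act_arr_comp[OF linK f f\<nu> bbm(1) bb0(1)]
    obtain w where w1: "w = act_arr C ?k ?k ?M ?N (Ident C AX) i" by blast
    obtain w' where w'1: "w' = act_arr C ?k ?k ?M ?K (Ident C AX) f" by blast
    have w [typing]: "w \<in> hom C Sm Sk" and wp: "w \<cdot> pm = pk \<cdot> (Ident C AX \<boxtimes> i)"
      using ai by (simp_all add: w1)
    have w' [typing]: "w' \<in> hom C Sm S" and wp': "w' \<cdot> pm = p \<cdot> (Ident C AX \<boxtimes> f)"
      using af by (simp_all add: w'1)
    have ww: "w' = \<theta> \<cdot> u \<cdot> w"
    proof (rule epiD[OF ttm(6) ttm(1) w'])
      show "\<theta> \<cdot> u \<cdot> w \<in> hom C Sm S" by (rule depicts_in, (rule depicts typing)+, simp)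
      have "\<theta> \<cdot> u \<cdot> w \<cdot> pm = p \<cdot> (Ident C AX \<boxtimes> f)"
        by (rule diagram_eq[OF eqs4[OF wp upk hi ff0(4)], where c = "[Rw 0 0 0, Rw 1 1 0,
          Rv 3 2 0, Rw 2 0 2]"], (rule depicts typing)+, simp add: derivable_simps)
      then show "w' \<cdot> pm = \<theta> \<cdot> u \<cdot> w \<cdot> pm" by (simp add: wp')
    qed
    have iL': "L \<cdot> i = w \<cdot> L'" using iL by (simp add: w1)
    have fL': "\<theta> \<cdot> d \<cdot> f = w' \<cdot> L'" using fL by (simp add: w'1 D)
    have x: "d \<cdot> f \<in> hom C M AXX" by (rule depicts_in, (rule depicts typing)+, simp)
    have x': "u \<cdot> L \<cdot> i \<in> hom C M AXX" by (rule depicts_in, (rule depicts typing)+, simp)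
    have "\<theta> \<cdot> (d \<cdot> f) = \<theta> \<cdot> (u \<cdot> L \<cdot> i)"
      by (rule diagram_eq[OF eqs3[OF fL' ww iL'], where c = "[Rw 0 0 0, Rw 1 1 0, Rv 2 0 0]"],
        (rule depicts typing)+, simp add: derivable_simps)
    then have df: "d \<cdot> f = u \<cdot> L \<cdot> i" using iso_cancel[OF ff0(1) ff0(2) ff0(7) x x'] by simp
    have "g \<cdot> i = z \<cdot> (u \<cdot> L \<cdot> i)"
      by (rule diagram_eq[OF eqs1[OF g1], where c = "[Rw 0 1 0]"], (rule depicts typing)+,
        simp add: derivable_simps)
    also have "\<dots> = z \<cdot> (d \<cdot> f)" by (simp only: df)
    also have "\<dots> = f"
      by (rule diagram_eq[OF eqs1[OF zd], where c = "[Rw 0 1 0]"], (rule depicts typing)+,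
        simp add: derivable_simps)
    finally show ?thesis .
  qed
  obtain px Sx \<alpha>x \<kappa>x where Bx: "bimod_tensor AX (m \<rhd> X) b Sn \<kappa>n \<alpha>n px Sx \<alpha>x \<kappa>x"
    by (rule bimod_tensorE[OF K bbn(6) cr_bimod(3)[OF crSn]])
  note ttx [typing] = act_tensorD[OF bimod_tensorD(1)[OF Bx]] and bbx [typing] = bimod_tensorD[OF Bx]
  obtain pv Sv \<alpha>v \<kappa>v where Bv: "bimod_tensor AX (m \<rhd> X) b Sk \<kappa>k \<alpha>k pv Sv \<alpha>v \<kappa>v"
    by (rule bimod_tensorE[OF K bbk(6) cr_bimod(3)[OF crSk]])
  note ttv [typing] = act_tensorD[OF bimod_tensorD(1)[OF Bv]] and bbv [typing] = bimod_tensorD[OF Bv]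
  obtain ps Ss \<alpha>s \<kappa>s where Bs: "bimod_tensor S \<kappa> \<beta>' N \<nu> \<xi> ps Ss \<alpha>s \<kappa>s"
    by (rule bimod_tensorE[OF bb0(6) N' rbN])
  note tts [typing] = act_tensorD[OF bimod_tensorD(1)[OF Bs]] and bbs [typing] = bimod_tensorD[OF Bs]
  obtain pw Sw \<alpha>w \<kappa>w \<theta>w lw where Bw: "bimod_tensor Sk \<kappa>k \<alpha>k AX (m \<rhd> X) b pw Sw \<alpha>w \<kappa>w"
    and Fw: "split_tensor Sk \<alpha>k AX (m \<rhd> X) b pw Sw \<alpha>w X (Ident C AX) (Ident C AX) \<theta>w lw"
    by (rule free_bimod_tensorE[OF bbk(6) K AX_free])
  note ttw [typing] = act_tensorD[OF bimod_tensorD(1)[OF Bw]]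
    and bbw [typing] = bimod_tensorD[OF Bw] and ffw [typing] = split_tensorD[OF Fw]
  have "(g \<rhd> X) \<cdot> r = d \<cdot> g"
  proof -
    obtain v where v [typing]: "v \<in> hom C Sx (AXX \<otimes> X)" and vpx: "v \<cdot> px = (b \<rhd> X \<otimes> X) \<cdot> (AX \<lhd> ((h \<rhd> X) \<cdot> ln))"
    proof -
      have k: "(b \<rhd> X \<otimes> X) \<cdot> (AX \<lhd> ((h \<rhd> X) \<cdot> ln)) \<in> hom C (AX \<otimes> Sn) (AXX \<otimes> X)"
        by (rule depicts_in, (rule depicts typing)+, simp)
      have "(b \<rhd> X \<otimes> X) \<cdot> (AX \<lhd> ((h \<rhd> X) \<cdot> ln)) \<cdot> (b \<rhd> Sn) = (b \<rhd> X \<otimes> X) \<cdot> (AX \<lhd> ((h \<rhd> X) \<cdot> ln)) \<cdot> (AX \<lhd> \<kappa>n)"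
        by (rule diagram_eq[OF eqs3[OF l\<kappa>n h\<nu> b(4)], where c = "[Up 1 1, Up 2 1, Rw 2 2 0,
          Rv 1 1 2, Rv 0 0 2]"], (rule depicts typing)+, simp add: derivable_simps)
      from coequalizer_ex[OF ttx(8) ttx(1) k this] show thesis using that by blast
    qed
    obtain q where q1: "q = act_arr C ?k ?k ?N (Sn, \<kappa>n, \<alpha>n) (Ident C AX) R" by blast
    have q [typing]: "q \<in> hom C Sk Sx" and qp: "q \<cdot> pk = px \<cdot> (Ident C AX \<boxtimes> R)"
      using act_arr_comp[OF linK R R\<nu> bbk(1) bbx(1)] by (simp_all add: q1)
    have vq: "v \<cdot> q = (b \<rhd> X \<otimes> X) \<cdot> (AX \<lhd> \<delta>) \<cdot> u"
    proof (rule epiD[OF ttk(6) ttk(1)])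
      show "v \<cdot> q \<in> hom C Sk (AXX \<otimes> X)" by (rule depicts_in, (rule depicts typing)+, simp)
      show "(b \<rhd> X \<otimes> X) \<cdot> (AX \<lhd> \<delta>) \<cdot> u \<in> hom C Sk (AXX \<otimes> X)"
        by (rule depicts_in, (rule depicts typing)+, simp)
      have "v \<cdot> q \<cdot> pk = (b \<rhd> X \<otimes> X) \<cdot> (AX \<lhd> (d \<cdot> h))"
        by (rule diagram_eq[OF eqs5[OF qp vpx R\<theta> ffn(7) h(4)], where c = "[Rw 0 0 0, Rw 1 1 0,
          Rw 2 0 2, Rw 3 1 2, Rw 4 0 2]"], (rule depicts typing)+, simp add: derivable_simps)
      also have "\<dots> = (b \<rhd> X \<otimes> X) \<cdot> (AX \<lhd> \<delta>) \<cdot> u \<cdot> pk"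
        by (rule diagram_eq[OF eqs3[OF d1 upk b(4)], where c = "[Rw 0 1 2, Rv 2 2 0, Up 2 1,
          Rv 1 0 0]"], (rule depicts typing)+, simp add: derivable_simps)
      finally show "v \<cdot> q \<cdot> pk = (b \<rhd> X \<otimes> X) \<cdot> (AX \<lhd> \<delta>) \<cdot> u \<cdot> pk" .
    qed
    obtain a where a1: "a = act_assoc C A ?k ?N ?K" by blast
    note asc = act_assoc[OF bbk(1) Bn bbw(1) bbx(1) AX_robust AX_coflat, folded a1]
    from asc have a [typing]: "a \<in> hom C Sw Sx" and ap: "a \<cdot> (pw \<cdot> (pk \<rhd> AX)) = px \<cdot> (AX \<lhd> pn)" by simp_all
    have pkX: "pk \<rhd> X \<in> hom C (AX \<otimes> N \<otimes> X) (Sk \<otimes> X)"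
      by (rule depicts_in, (rule depicts typing)+, simp)
    have va: "v \<cdot> a \<cdot> \<theta>w = u \<rhd> X"
    proof (rule epiD[OF coflat_epi[OF coflat_X ttk(8)] pkX])
      show "v \<cdot> a \<cdot> \<theta>w \<in> hom C (Sk \<otimes> X) (AXX \<otimes> X)"
        by (rule depicts_in, (rule depicts typing)+, simp)
      show "u \<rhd> X \<in> hom C (Sk \<otimes> X) (AXX \<otimes> X)" by (rule depicts_in, (rule depicts typing)+, simp)
      have "v \<cdot> a \<cdot> \<theta>w \<cdot> (pk \<rhd> X) = v \<cdot> (a \<cdot> (pw \<cdot> (pk \<rhd> AX))) \<cdot> (AX \<otimes> N \<lhd> \<eta> \<rhd> X)"
        by (rule diagram_eq[OF eqs1[OF ffw(5)], where c = "[Rw 0 1 0, Up 1 1]"],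
          (rule depicts typing)+, simp add: derivable_simps)
      also have "\<dots> = (u \<rhd> X) \<cdot> (pk \<rhd> X)"
        by (rule diagram_eq[OF eqs5[OF ap vpx ffn(3) N(8) upk], where c = "[Rw 0 1 0,
          Rw 1 2 0, Rw 2 1 2, Rw 3 0 2, Rv 4 0 0]"], (rule depicts typing)+,
          simp add: derivable_simps)
      finally show "v \<cdot> a \<cdot> \<theta>w \<cdot> (pk \<rhd> X) = (u \<rhd> X) \<cdot> (pk \<rhd> X)" .
    qed
    have aL: "act_arr C (N, \<xi>) (Sk, \<alpha>k) ?K ?K L (Ident C AX)
      = \<theta>w \<cdot> (L \<rhd> X) \<cdot> ln"
      by (rule arr_AX[OF Lr Fn Fw])
    have mx: "a \<cdot> (\<theta>w \<cdot> (L \<rhd> X) \<cdot> ln) \<cdot> R = q \<cdot> L"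
      using mixed by (simp add: aL a1[symmetric] q1[symmetric])
    have "(u \<rhd> X) \<cdot> (L \<rhd> X) \<cdot> r = v \<cdot> (a \<cdot> (\<theta>w \<cdot> (L \<rhd> X) \<cdot> ln) \<cdot> R)"
      by (rule diagram_eq[OF eqs3[OF va R\<theta> ffn(7)], where c = "[Rv 0 2 0, Rv 2 1 0,
        Rv 1 0 0]"], (rule depicts typing)+, simp add: derivable_simps)
    also have "\<dots> = v \<cdot> (q \<cdot> L)" by (simp only: mx)
    also have "\<dots> = (b \<rhd> X \<otimes> X) \<cdot> (AX \<lhd> \<delta>) \<cdot> u \<cdot> L"
      by (rule diagram_eq[OF eqs1[OF vq], where c = "[Rw 0 1 0]"], (rule depicts typing)+,
        simp add: derivable_simps)
    finally have uLr: "(u \<rhd> X) \<cdot> (L \<rhd> X) \<cdot> r = (b \<rhd> X \<otimes> X) \<cdot> (AX \<lhd> \<delta>) \<cdot> u \<cdot> L" .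
    show "(g \<rhd> X) \<cdot> r = d \<cdot> g"
      by (rule diagram_eq[OF eqs3[OF g1 uLr zc], where c = "[Rw 0 1 0, Rw 1 0 0, Rw 2 2 0,
        Rv 0 0 0]"], (rule depicts typing)+, simp add: derivable_simps)
  qed
  then have GR: "AXc \<cdot> g = act_arr C (N, \<xi>) ?k ?K ?K g (Ident C AX) \<cdot> R"
    using comod_colinear[OF rN rK gr r b(6)] by (simp add: Rr upK K3)
  have GL: "AXc \<cdot> g = act_arr C ?k ?k ?N ?K (Ident C AX) g \<cdot> L"
  proof -
    obtain v where v [typing]: "v \<in> hom C Sv (AXX \<otimes> X)" and vpv: "v \<cdot> pv = (b \<rhd> X \<otimes> X) \<cdot> (AX \<lhd> u)"
    proof -
      have k: "(b \<rhd> X \<otimes> X) \<cdot> (AX \<lhd> u) \<in> hom C (AX \<otimes> Sk) (AXX \<otimes> X)"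
        by (rule depicts_in, (rule depicts typing)+, simp)
      have "(b \<rhd> X \<otimes> X) \<cdot> (AX \<lhd> u) \<cdot> (b \<rhd> Sk) = (b \<rhd> X \<otimes> X) \<cdot> (AX \<lhd> u) \<cdot> (AX \<lhd> \<kappa>k)"
        by (rule diagram_eq[OF eqs2[OF u\<kappa> b(4)], where c = "[Up 1 1, Rw 1 1 0, Rv 0 0 2]"],
          (rule depicts typing)+, simp add: derivable_simps)
      from coequalizer_ex[OF ttv(8) ttv(1) k this] show thesis using that by blast
    qed
    obtain q where q1: "q = act_arr C ?k ?k ?N (Sk, \<kappa>k, \<alpha>k) (Ident C AX) L" by blast
    have q [typing]: "q \<in> hom C Sk Sv" and qp: "q \<cdot> pk = pv \<cdot> (Ident C AX \<boxtimes> L)"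
      using act_arr_comp[OF linK L L\<nu> bbk(1) bbv(1)] by (simp_all add: q1)
    obtain w where w1: "w = act_arr C ?k ?k ?N ?K (Ident C AX) g" by blast
    have w [typing]: "w \<in> hom C Sk S" and wp: "w \<cdot> pk = p \<cdot> (Ident C AX \<boxtimes> g)"
      using act_arr_comp[OF linK g g\<nu> bbk(1) bb0(1)] by (simp_all add: w1)
    have idN: "Ident C N \<in> hom C N N" using N(2) by simp
    have idNl: "Ident C N \<cdot> \<nu> = \<nu> \<cdot> (A \<lhd> Ident C N)"
      by (rule diagram_eq[OF eqs0, where c = "[]"], (rule depicts typing)+,
        simp add: derivable_simps)
    obtain e where e1: "e = act_arr C ?k (S, \<beta>') ?N ?N AXc (Ident C N)" by blast
    have e [typing]: "e \<in> hom C Sk Ss" and ep: "e \<cdot> pk = ps \<cdot> ((\<theta> \<cdot> d) \<boxtimes> Ident C N)"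
      using act_arr_comp[OF Dr idN idNl bbk(1) bbs(1)] by (simp_all add: e1 D)
    obtain a where a1: "a = act_assoc C A ?k ?K ?N" by blast
    note asc = act_assoc[OF bb0(1) Bk bbs(1) bbv(1) rbN cN, folded a1]
    from asc have a [typing]: "a \<in> hom C Ss Sv" and ap: "a \<cdot> (ps \<cdot> (p \<rhd> N)) = pv \<cdot> (AX \<lhd> pk)" by simp_all
    have wq: "w = \<theta> \<cdot> t \<cdot> v \<cdot> q"
    proof (rule epiD[OF ttk(6) ttk(1) w])
      show "\<theta> \<cdot> t \<cdot> v \<cdot> q \<in> hom C Sk S" by (rule depicts_in, (rule depicts typing)+, simp)
      have "\<theta> \<cdot> t \<cdot> v \<cdot> q \<cdot> pk = \<theta> \<cdot> (t \<cdot> (b \<rhd> X \<otimes> X)) \<cdot> (AX \<lhd> (u \<cdot> L))"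
        by (rule diagram_eq[OF eqs2[OF qp vpv], where c = "[Rw 0 0 0, Rw 1 1 0]"],
          (rule depicts typing)+, simp add: derivable_simps)
      also have "\<dots> = p \<cdot> (Ident C AX \<boxtimes> g)"
        by (rule diagram_eq[OF eqs3[OF tb ff0(4) g1], where c = "[Rw 0 2 0, Rv 2 0 2,
          Rv 1 1 0]"], (rule depicts typing)+, simp add: derivable_simps)
      finally show "w \<cdot> pk = \<theta> \<cdot> t \<cdot> v \<cdot> q \<cdot> pk" by (simp add: wp)
    qed
    have vae: "v \<cdot> a \<cdot> e = (d \<rhd> X) \<cdot> u"
    proof (rule epiD[OF ttk(6) ttk(1)])
      show "v \<cdot> a \<cdot> e \<in> hom C Sk (AXX \<otimes> X)" by (rule depicts_in, (rule depicts typing)+, simp)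
      show "(d \<rhd> X) \<cdot> u \<in> hom C Sk (AXX \<otimes> X)" by (rule depicts_in, (rule depicts typing)+, simp)
      have "v \<cdot> a \<cdot> e \<cdot> pk = v \<cdot> (a \<cdot> (ps \<cdot> (p \<rhd> N))) \<cdot> (AX \<lhd> \<eta> \<rhd> X \<otimes> N) \<cdot> (d \<rhd> N)"
        by (rule diagram_eq[OF eqs2[OF ep ff0(5)], where c = "[Rw 0 0 0, Rw 1 1 0]"],
          (rule depicts typing)+, simp add: derivable_simps)
      also have "\<dots> = (b \<rhd> X \<otimes> X) \<cdot> (AX \<lhd> ((b \<rhd> X) \<cdot> (\<eta> \<rhd> X \<otimes> AX))) \<cdot> (AXX \<lhd> h) \<cdot> (d \<rhd> N)"
        by (rule diagram_eq[OF eqs3[OF ap vpv upk], where c = "[Rw 0 2 0, Rw 1 3 0, Rw 2 2 2,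
          Up 2 1]"], (rule depicts typing)+, simp add: derivable_simps)
      also have "\<dots> = (b \<rhd> X \<otimes> X) \<cdot> (AX \<lhd> \<psi> \<rhd> X) \<cdot> (AXX \<lhd> h) \<cdot> (d \<rhd> N)"
        by (rule diagram_eq[OF eqs2[OF b1 \<eta>l], where c = "[Up 2 1, Rw 0 3 2, Up 2 1, Up 3 1,
          Rw 1 3 2]"], (rule depicts typing)+, simp add: derivable_simps)
      also have "\<dots> = (d \<rhd> X) \<cdot> u \<cdot> pk"
        by (rule diagram_eq[OF eqs2[OF upk b(7)], where c = "[Up 1 1, Rv 1 1 0, Rv 0 0 0]"],
          (rule depicts typing)+, simp add: derivable_simps)
      finally show "v \<cdot> a \<cdot> e \<cdot> pk = (d \<rhd> X) \<cdot> u \<cdot> pk" .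
    qed
    have ae: "a \<cdot> e \<cdot> L = q \<cdot> L" using coassoc by (simp add: a1 e1 q1)
    have "w \<cdot> L = \<theta> \<cdot> t \<cdot> v \<cdot> (q \<cdot> L)"
      by (rule diagram_eq[OF eqs1[OF wq], where c = "[Rw 0 1 0]"], (rule depicts typing)+,
        simp add: derivable_simps)
    also have "\<dots> = \<theta> \<cdot> t \<cdot> v \<cdot> (a \<cdot> e \<cdot> L)" by (simp only: ae)
    also have "\<dots> = \<theta> \<cdot> (t \<cdot> (d \<rhd> X)) \<cdot> u \<cdot> L"
      by (rule diagram_eq[OF eqs1[OF vae], where c = "[Rw 0 1 0]"], (rule depicts typing)+,
        simp add: derivable_simps)
    also have "\<dots> = \<theta> \<cdot> d \<cdot> g"
      by (rule diagram_eq[OF eqs2[OF td g1], where c = "[Rw 0 2 0, Rv 1 0 0]"],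
        (rule depicts typing)+, simp add: derivable_simps)
    finally show ?thesis by (simp add: w1 D)
  qed
  have crK: "crb ?K" using AX_cr by (simp add: K3)
  have "bicolinear \<V> AXb N' lN rN AXb ?D ?D (N', g, AXb)"
    using crN crK g g\<nu> gr GL GR unfolding bicolinear_def N3 eLN eRN K3
    by (simp add: cr_simps bb0(4) bbk(4) bbn(4) left_linear_def)
  moreover have "f' = Comp \<V> (N', g, AXb) i'"
    by (simp add: f3 i3 N3 K3 cr_simps gi)
  ultimately show "\<exists>g. bicolinear \<V> AXb N' lN rN AXb ?D ?D g \<and> f' = Comp \<V> g i'" by blast
qed

end

theorem theorem6p5:
  fixes C :: "('o, 'a) moncat" and A X :: 'o and m \<eta> \<psi> \<delta> \<epsilon> :: 'a
  assumes "strict_monoidal C"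
    and "left_tensor_generator C (tunit C)"
    and "cowreath C A m \<eta> X \<psi> \<delta> \<epsilon>"
  shows "(separable_functor (entwined_modules C A m \<eta> X \<psi> \<delta> \<epsilon>) (right_modules C A m \<eta>)
            forget_obj forget_arr
          \<longleftrightarrow>
          coseparable_coalgebra (Tsharp C A m \<eta>) (X, \<psi>)
            (cowreath_comult C X \<psi> \<delta>) (cowreath_counit C A X \<psi> \<epsilon>))
    \<and>
    (has_coequalizers C \<and> left_coflat C A \<and> left_coflat C X \<longrightarrow>
         (separable_functor (entwined_modules C A m \<eta> X \<psi> \<delta> \<epsilon>) (right_modules C A m \<eta>)
            forget_obj forget_arr
          \<longleftrightarrow>
          coseparable_coring C A m \<eta> (AX_bim C A m X \<psi>)
            (AX_comult C A m X \<psi> \<delta>) (AX_counit C A m \<epsilon>))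
       \<and> (separable_functor (entwined_modules C A m \<eta> X \<psi> \<delta> \<epsilon>) (right_modules C A m \<eta>)
            forget_obj forget_arr
          \<longleftrightarrow>
          separable_functor
            (comodules C A m \<eta> (AX_bim C A m X \<psi>) (AX_comult C A m X \<psi> \<delta>) (AX_counit C A m \<epsilon>))
            (right_modules C A m \<eta>) forget_obj forget_arr))"
proof -
  interpret cowreath_data C A m \<eta> X \<psi> \<delta> \<epsilon>
    using assms(1,3) by unfold_locales (auto simp: cowreath_def)
  have "separable_functor (entwined_modules C A m \<eta> X \<psi> \<delta> \<epsilon>) (right_modules C A m \<eta>) forget_obj forget_arr
      \<longleftrightarrow> (\<exists>B. casimir B)"
    using casimir_separable separable_casimir[OF assms(2)] by blast
  moreover have "coseparable_coring C A m \<eta> (AX_bim C A m X \<psi>) (AX_comult C A m X \<psi> \<delta>) (AX_counit C A m \<epsilon>)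
        \<longleftrightarrow> (\<exists>B. casimir B)"
    "separable_functor (entwined_modules C A m \<eta> X \<psi> \<delta> \<epsilon>) (right_modules C A m \<eta>) forget_obj forget_arr
        \<longleftrightarrow> separable_functor
            (comodules C A m \<eta> (AX_bim C A m X \<psi>) (AX_comult C A m X \<psi> \<delta>) (AX_counit C A m \<epsilon>))
            (right_modules C A m \<eta>) forget_obj forget_arr"
    if "has_coequalizers C" "left_coflat C A" "left_coflat C X"
  proof -
    interpret coflat_cowreath C A m \<eta> X \<psi> \<delta> \<epsilon>
      using that by unfold_locales
    show "coseparable_coring C A m \<eta> (AX_bim C A m X \<psi>) (AX_comult C A m X \<psi> \<delta>) (AX_counit C A m \<epsilon>)
        \<longleftrightarrow> (\<exists>B. casimir B)"
      using casimir_coring coring_casimir by blast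
    show "separable_functor (entwined_modules C A m \<eta> X \<psi> \<delta> \<epsilon>) (right_modules C A m \<eta>) forget_obj forget_arr
        \<longleftrightarrow> separable_functor
            (comodules C A m \<eta> (AX_bim C A m X \<psi>) (AX_comult C A m X \<psi> \<delta>) (AX_counit C A m \<epsilon>))
            (right_modules C A m \<eta>) forget_obj forget_arr"
      by (rule separable_iff_comodules)
  qed
  ultimately show ?thesis
    using coseparable_iff_casimir by simp
qed

end
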